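(* For every $\bar i\in I_\sigma$, the negative prefundamental representation $L^-_{\bar i,1}$ of $\mathcal U_q(\mathfrak b^\sigma)$ is in the category $\mathcal O$.
   Context: Twisted data. $\mathfrak g$ is a simple complex Lie algebra of type $A_m$ ($m\ge2$), $D_m$ ($m\ge4$) or $E_6$ with Dynkin nodes $I$ and Cartan matrix $C$; $\sigma:I\to I$ is a non-trivial diagram automorphism of order $M\in\{2,3\}$; $\omega=e^{2\pi\sqrt{-1}/M}$. $I_\sigma$ is the set of $\sigma$-orbits, $\bar i$ the orbit of $i$; in each orbit a representative is fixed, the smallest node in the standard labelling ($1,\dots,n$ for $A_{2n}^{(2)},A_{2n-1}^{(2)},D_{n+1}^{(2)}$; $1$ and the trivalent node $2$ for $D_4^{(3)}$; in all cases a connected subdiagram); given $\bar i$, $i$ is this representative. $d_{\bar i}=\frac12\sum_{r=1}^MC_{i,\sigma^r(i)}$. $\hat I_\sigma=I_\sigma\sqcup\{\epsilon\}$; $C^\sigma$ is the generalized Cartan matrix of the twisted affine type, $\epsilon$ the affine node (for $A_{2n}^{(2)}$ the end node with longest root), so $d_{\bar i}C^\sigma_{\bar i,\bar j}=\sum_{r=1}^MC_{i,\sigma^r(j)}$ on $I_\sigma$; $d_\epsilon$ makes $(d_iC^\sigma_{i,j})$ symmetric; $(a_i)_{i\in\hat I_\sigma}$ are the positive integers with $\sum_ia_id_iC^\sigma_{i,j}=0$ for all $j$, $a_\epsilon=1$. $q\in\mathbb C^*$ is not a root of unity (with a fixed square root), $q_i=q^{d_i}$, $[m]_p=\frac{p^m-p^{-m}}{p-p^{-1}}$.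 Algebra. $\mathcal U_q(\mathcal L\mathfrak g^\sigma)$ has generators $e_i^\pm,k_i^{\pm1}$ ($i\in\hat I_\sigma$) and relations: the $k_i$ are invertible and commute, $k_ie_j^\pm=q_i^{\pm C^\sigma_{i,j}}e_j^\pm k_i$, $[e_i^+,e_j^-]=\delta_{i,j}\frac{k_i-k_i^{-1}}{q_i-q_i^{-1}}$, the quantum Serre relations of $C^\sigma$, and $\prod_ik_i^{a_i}=1$. It is also generated by the Drinfeld generators $x_{i,m}^\pm$ ($m\in\mathbb Z$), $h_{i,r}$ ($r\neq0$), $k_i^{\pm1}$, $i\in I$, of its Drinfeld presentation (Chari–Pressley, Damiani), where $x_{i,0}^\pm=e_{\bar i}^\pm$, $k_i=k_{\bar i}$ for representatives $i$, $e_\epsilon^\pm$ has degree $\pm1$ for the grading $\deg x_{i,m}^\pm=m,\deg h_{i,r}=r,\deg k_i=0$, and $x_{\sigma(i),m}^\pm=\omega^mx_{i,m}^\pm$, $h_{\sigma(i),r}=\omega^rh_{i,r}$, $k_{\sigma(i)}=k_i$, the $h$'s and $k$'s commute, $k_ix_{j,m}^\pm=q^{\pm\sum_{r=1}^MC_{i,\sigma^r(j)}}x_{j,m}^\pm k_i$, $[h_{i,s},x_{j,l}^\pm]=\pm\frac1s\left(\sum_{r=1}^M[sC_{i,\sigma^r(j)}/d_{\bar i}]_{q_{\bar i}}\omega^{sr}\right)x_{j,s+l}^\pm$, $[x_{i,s}^+,x_{j,l}^-]=\frac{\sum_{r=1}^M\delta_{\sigma^r(i),j}\omega^{rl}}{N_i}\frac{\phi_{i,s+l}^+-\phi_{i,s+l}^-}{q_{\bar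 i}-q_{\bar i}^{-1}}$ with $N_i=M$ if $\sigma(i)=i$, $N_i=1$ otherwise, and $\phi_i^\pm(u)=\sum_{m\ge0}\phi^\pm_{i,\pm m}u^{\pm m}=k_i^{\pm1}\exp(\pm(q_{\bar i}-q_{\bar i}^{-1})\sum_{l\ge1}h_{i,\pm l}u^{\pm l})$ (other $\phi^\pm_{i,m}$ are $0$). Borel subalgebra and category $\mathcal O$. $\mathcal U_q(\mathfrak b^\sigma)$ is the subalgebra generated by $e_i^+,k_i^{\pm1}$ ($i\in\hat I_\sigma$); it contains $x^+_{i,r}$, $\phi^+_{i,r}$ ($r\ge0$). For a tuple $\gamma=(\gamma_i(u))_{i\in I}$ in $\mathbb C[[u]]^I$ with $\gamma_i(0)\ne0$, $\gamma_{\sigma(i)}(u)=\gamma_i(\omega u)$, $L(\gamma)$ is the unique simple $\mathcal U_q(\mathfrak b^\sigma)$-module generated by a vector $v$ with $x^+_{i,r}v=0$ ($i\in I,r\ge0$), $\phi_i^+(u)v=\gamma_i(u)v$. $\mathfrak t$ is the subalgebra generated by the $k_{\bar i}^{\pm1}$, $\bar i\in I_\sigma$; $\mathfrak t^*$ is the group of its algebra characters, written additively; $\alpha_{\bar i}(k_{\bar j})=q_{\bar i}^{C^\sigma_{\bar i,\bar j}}$; $\lambda\le\mu$ iff $\mu-\lambda\in\sum\mathbb N\alpha_{\bar i}$; $D(\lambda)=\{\mu\le\lambda\}$. $\mathcal O$ is the category of $\mathcal U_q(\mathfrak b^\sigma)$-modules that are $\mathfrak t$-diagonalizable with finite-dimensional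 weight spaces and weights in a finite union of sets $D(\lambda_s)$. $L^-_{\bar i,1}=L(\gamma)$ with: if $\sigma(i)\ne i$, $\gamma_{\sigma^k(i)}(u)=(1-\omega^ku)^{-1}$; if $\sigma(i)=i$, $\gamma_i(u)=(1-u^M)^{-1}$; and $\gamma_j(u)=1$ for $j\notin\bar i$. *)

theory Defs
  imports
    "HOL-Analysis.Analysis"
    "HOL-Library.Poly_Mapping"
    "HOL-Computational_Algebra.Formal_Power_Series"
begin

section \<open>Dynkin data\<close>

datatype dynkin = A nat | D nat | E6

fun admissible :: "dynkin \<Rightarrow> bool" where
  "admissible (A m) = (m \<ge> 2)"
| "admissible (D m) = (m \<ge> 4)"
| "admissible E6 = True"

fun nodes :: "dynkin \<Rightarrow> nat set" where
  "nodes (A m) = {1..m}"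
| "nodes (D m) = {1..m}"
| "nodes E6 = {1..6}"

text \<open>Bourbaki labelling: in \<open>D\<^sub>m\<close> the nodes \<open>m - 1\<close> and \<open>m\<close> are attached to \<open>m - 2\<close>;
  in \<open>E\<^sub>6\<close> the long chain is \<open>1 - 3 - 4 - 5 - 6\<close> and \<open>2\<close> is attached to \<open>4\<close>.\<close>

fun edges :: "dynkin \<Rightarrow> (nat \<times> nat) set" where
  "edges (A m) = {(i, i + 1) | i. 1 \<le> i \<and> i + 1 \<le> m}"
| "edges (D m) = {(i, i + 1) | i. 1 \<le> i \<and> i + 1 \<le> m - 1} \<union> {(m - 2, m)}"
| "edges E6 = {(1, 3), (3, 4), (4, 5), (5, 6), (2, 4)}"

definition cartan :: "dynkin \<Rightarrow> nat \<Rightarrow> nat \<Rightarrow> int" where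
  "cartan X i j =
     (if i = j then 2 else if (i, j) \<in> edges X \<or> (j, i) \<in> edges X then - 1 else 0)"

section \<open>Free complex algebras, ideals and subalgebras\<close>

text \<open>The free associative algebra is the monoid algebra of the monoid of words.\<close>

datatype 'g word = Word (letters: "'g list")

instantiation word :: (type) monoid_add
begin
definition "0 = Word []"
definition "u + v = Word (letters u @ letters v)"
instance by standard (auto simp: zero_word_def plus_word_def)
end

type_synonym 'g free_algebra = "'g word \<Rightarrow>\<^sub>0 complex"

definition gen :: "'g \<Rightarrow> 'g free_algebra" where
  "gen g = Poly_Mapping.single (Word [g]) 1"

definition sc :: "complex \<Rightarrow> 'g free_algebra" where
  "sc c = Poly_Mapping.single 0 c"

inductive_set two_sided_ideal :: "'a::ring_1 set \<Rightarrow> 'a set" for R where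
  zero: "0 \<in> two_sided_ideal R"
| gen: "r \<in> R \<Longrightarrow> a * r * b \<in> two_sided_ideal R"
| add: "a \<in> two_sided_ideal R \<Longrightarrow> b \<in> two_sided_ideal R \<Longrightarrow> a + b \<in> two_sided_ideal R"

inductive_set subalgebra :: "'g free_algebra set \<Rightarrow> 'g free_algebra set" for S where
  scalar: "sc c \<in> subalgebra S"
| gen: "s \<in> S \<Longrightarrow> s \<in> subalgebra S"
| add: "a \<in> subalgebra S \<Longrightarrow> b \<in> subalgebra S \<Longrightarrow> a + b \<in> subalgebra S"
| mult: "a \<in> subalgebra S \<Longrightarrow> b \<in> subalgebra S \<Longrightarrow> a * b \<in> subalgebra S"

definition comm :: "'a::ring_1 \<Rightarrow> 'a \<Rightarrow> 'a" where
  "comm a b = a * b - b * a"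

text \<open>Coefficient of \<open>u\<^sup>n\<close> in \<open>exp (\<Sum>l\<ge>1. a l * u\<^sup>l)\<close>; powers of exponent greater than \<open>n\<close> do not
  contribute.\<close>

definition exp_coeff :: "(nat \<Rightarrow> 'g free_algebra) \<Rightarrow> nat \<Rightarrow> 'g free_algebra" where
  "exp_coeff a n =
     (\<Sum>k\<le>n. sc (1 / fact k) * fps_nth (Abs_fps (\<lambda>l. if l = 0 then 0 else a l) ^ k) n)"

section \<open>The twisted quantum loop algebra\<close>

text \<open>\<open>Eps\<close> is the affine node; an orbit is encoded by its smallest element.\<close>

datatype anode = Eps | Nd nat

datatype sign = Pos | Neg

fun sg :: "sign \<Rightarrow> int" where
  "sg Pos = 1"
| "sg Neg = - 1"

text \<open>\<open>GE p i\<close> stands for \<open>e\<^sub>i\<close> with sign \<open>p\<close>; \<open>GK Pos i\<close> for \<open>k\<^sub>i\<close> and \<open>GK Neg i\<close> for its inverse.\<close>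

datatype ugen = GE sign anode | GK sign anode

type_synonym ualg = "ugen free_algebra"

text \<open>\<open>s\<close> is the fixed square root of \<open>q\<close>.\<close>

locale twisted_datum =
  fixes X :: dynkin and \<sigma> :: "nat \<Rightarrow> nat" and M :: nat and q s :: complex
  assumes adm: "admissible X"
    and perm: "\<sigma> permutes nodes X"
    and aut: "\<forall>i\<in>nodes X. \<forall>j\<in>nodes X. cartan X (\<sigma> i) (\<sigma> j) = cartan X i j"
    and M: "M \<in> {2, 3}"
    and order: "\<sigma> ^^ M = id" "\<forall>k. 0 < k \<and> k < M \<longrightarrow> \<sigma> ^^ k \<noteq> id"
    and q: "q \<noteq> 0" "\<forall>n>0. q ^ n \<noteq> 1"
    and s: "s ^ 2 = q"
begin

definition \<omega> :: complex where
  "\<omega> = cis (2 * pi / of_nat M)"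

definition orbit :: "nat \<Rightarrow> nat set" where
  "orbit i = {(\<sigma> ^^ r) i | r. r < M}"

definition rep :: "nat \<Rightarrow> nat" where
  "rep i = Min (orbit i)"

definition Isig :: "nat set" where
  "Isig = rep ` nodes X"

definition Ihat :: "anode set" where
  "Ihat = insert Eps (Nd ` Isig)"

definition csum :: "nat \<Rightarrow> nat \<Rightarrow> int" where
  "csum i j = (\<Sum>r=1..M. cartan X i ((\<sigma> ^^ r) j))"

definition d :: "nat \<Rightarrow> rat" where
  "d i = of_int (csum i i) / 2"

text \<open>The affine node has exactly one neighbour. The triple consists of the representative \<open>j\<close> of
  that neighbour and of the entries \<open>(\<epsilon>, j)\<close> and \<open>(j, \<epsilon>)\<close> of the affine Cartan matrix. The cases
  are, in this order: \<open>A\<^sub>2\<close>, \<open>A\<^sub>2\<^sub>n\<close>, \<open>A\<^sub>3\<close> (the twisted type of \<open>D\<^sub>3\<close>), \<open>A\<^sub>2\<^sub>n\<^sub>-\<^sub>1\<close>;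
  \<open>D\<^sub>4\<close> with \<open>M = 3\<close> and \<open>D\<^sub>m\<close> with \<open>M = 2\<close>; \<open>E\<^sub>6\<close>. For \<open>D\<^sub>m\<close> with \<open>M = 2\<close> the neighbour is
  the fixed end of the diagram; this is node 1 except for the involutions of \<open>D\<^sub>4\<close>
  that move node 1.\<close>

fun affine_link :: "dynkin \<Rightarrow> nat \<times> int \<times> int" where
  "affine_link (A m) =
     (if m = 2 then (1, - 1, - 4) else if even m then (1, - 1, - 2)
      else if m = 3 then (2, - 2, - 1) else (2, - 1, - 1))"
| "affine_link (D m) =
     (if M = 3 then (1, - 1, - 1)
      else (if \<sigma> 1 = 1 then 1 else (THE j. j \<in> nodes (D m) \<and> j \<noteq> 2 \<and> \<sigma> j = j), - 2, - 1))"
| "affine_link E6 = (1, - 1, - 1)"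

definition eps_nbr :: nat where
  "eps_nbr = fst (affine_link X)"

text \<open>The quotient in the last equation is always an integer.\<close>

fun Csig :: "anode \<Rightarrow> anode \<Rightarrow> int" where
  "Csig Eps Eps = 2"
| "Csig Eps (Nd j) = (if j = eps_nbr then fst (snd (affine_link X)) else 0)"
| "Csig (Nd j) Eps = (if j = eps_nbr then snd (snd (affine_link X)) else 0)"
| "Csig (Nd i) (Nd j) = \<lfloor>of_int (csum i j) / d i\<rfloor>"

fun dhat :: "anode \<Rightarrow> rat" where
  "dhat Eps = d eps_nbr * of_int (Csig (Nd eps_nbr) Eps) / of_int (Csig Eps (Nd eps_nbr))"
| "dhat (Nd i) = d i"

text \<open>The conditions determine the labels uniquely on \<open>Ihat\<close>.\<close>

definition label :: "anode \<Rightarrow> nat" where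
  "label = (SOME a. a Eps = 1 \<and> (\<forall>i\<in>Ihat. a i > 0) \<and>
     (\<forall>j\<in>Ihat. (\<Sum>i\<in>Ihat. of_nat (a i) * dhat i * of_int (Csig i j)) = 0))"

text \<open>\<open>qp t\<close> is \<open>q\<close> to the power \<open>t\<close>, for \<open>2 * t\<close> an integer. In \<open>qnum c m\<close>, the quantum number
  \<open>[m]\<close> with parameter \<open>p = qp c\<close>, the number \<open>m\<close> need not be an integer, but \<open>2 * c * m\<close> is
  one wherever it is used.\<close>

definition qp :: "rat \<Rightarrow> complex" where
  "qp t = s powi \<lfloor>2 * t\<rfloor>"

definition qnum :: "rat \<Rightarrow> rat \<Rightarrow> complex" where
  "qnum c m = (qp (c * m) - qp (- (c * m))) / (qp c - qp (- c))"

definition qfact :: "rat \<Rightarrow> nat \<Rightarrow> complex" where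
  "qfact c n = (\<Prod>r=1..n. qnum c (of_nat r))"

definition qbinom :: "rat \<Rightarrow> nat \<Rightarrow> nat \<Rightarrow> complex" where
  "qbinom c n r = qfact c n / (qfact c r * qfact c (n - r))"

definition e :: "sign \<Rightarrow> anode \<Rightarrow> ualg" where
  "e p i = gen (GE p i)"

definition k :: "sign \<Rightarrow> anode \<Rightarrow> ualg" where
  "k p i = gen (GK p i)"

definition serre :: "sign \<Rightarrow> anode \<Rightarrow> anode \<Rightarrow> ualg" where
  "serre p i j = (let n = nat (1 - Csig i j) in
     \<Sum>r\<le>n. sc ((- 1) ^ r * qbinom (dhat i) n r) * e p i ^ (n - r) * e p j * e p i ^ r)"

text \<open>The type \<^typ>\<open>ugen\<close> has letters for all natural numbers; those which are not nodes are set to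
  zero.\<close>

definition relators :: "ualg set" where
  "relators =
     {gen g | g p i. (g = GE p i \<or> g = GK p i) \<and> i \<notin> Ihat}
   \<union> {k Pos i * k Neg i - 1 | i. i \<in> Ihat} \<union> {k Neg i * k Pos i - 1 | i. i \<in> Ihat}
   \<union> {comm (k Pos i) (k Pos j) | i j. i \<in> Ihat \<and> j \<in> Ihat}
   \<union> {k Pos i * e p j - sc (qp (dhat i * of_int (sg p * Csig i j))) * e p j * k Pos i
        | p i j. i \<in> Ihat \<and> j \<in> Ihat}
   \<union> {comm (e Pos i) (e Neg j) -
        (if i = j then sc (1 / (qp (dhat i) - qp (- dhat i))) * (k Pos i - k Neg i) else 0)
        | i j. i \<in> Ihat \<and> j \<in> Ihat}
   \<union> {serre p i j | p i j. i \<in> Ihat \<and> j \<in> Ihat \<and> i \<noteq> j}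
   \<union> {prod_list (map (\<lambda>i. k Pos i ^ label i) (Eps # map Nd (sorted_list_of_set Isig))) - 1}"

text \<open>The twisted quantum loop algebra is the quotient of \<^typ>\<open>ualg\<close> by the ideal \<open>J\<close>. Its elements are
  handled through representatives in \<^typ>\<open>ualg\<close>, and equality in the quotient is \<open>\<approx>\<close>. A
  subalgebra of the quotient is given by its full preimage.\<close>

definition J :: "ualg set" where
  "J = two_sided_ideal relators"

definition eqU :: "ualg \<Rightarrow> ualg \<Rightarrow> bool" (infix "\<approx>" 50) where
  "a \<approx> b \<longleftrightarrow> a - b \<in> J"

definition generated :: "ualg set \<Rightarrow> ualg set" where
  "generated S = {a. \<exists>b\<in>subalgebra S. a \<approx> b}"

definition borel :: "ualg set" where
  "borel = generated ({e Pos i | i. i \<in> Ihat} \<union> {k p i | p i. i \<in> Ihat})"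

definition cartan_part :: "ualg set" where
  "cartan_part = generated {k p (Nd i) | p i. i \<in> Isig}"

section \<open>Drinfeld generators\<close>

definition kI :: "sign \<Rightarrow> nat \<Rightarrow> ualg" where
  "kI p i = k p (Nd (rep i))"

definition phi :: "(nat \<Rightarrow> int \<Rightarrow> ualg) \<Rightarrow> sign \<Rightarrow> nat \<Rightarrow> int \<Rightarrow> ualg" where
  "phi h p i m =
     (if sg p * m < 0 then 0
      else kI p i * exp_coeff
        (\<lambda>l. sc (of_int (sg p) * (qp (d i) - qp (- d i))) * h i (sg p * int l)) (nat (sg p * m)))"

definition grading :: "(int \<Rightarrow> ualg set) \<Rightarrow> bool" where
  "grading G \<longleftrightarrow>
     1 \<in> G 0
   \<and> (\<forall>n. J \<subseteq> G n)
   \<and> (\<forall>n. \<forall>a\<in>G n. \<forall>b\<in>G n. \<forall>c. a + sc c * b \<in> G n)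
   \<and> (\<forall>m n. \<forall>a\<in>G m. \<forall>b\<in>G n. a * b \<in> G (m + n))
   \<and> (\<forall>a. \<exists>S f. finite S \<and> (\<forall>n\<in>S. f n \<in> G n) \<and> a = sum f S)
   \<and> (\<forall>S f. finite S \<and> (\<forall>n\<in>S. f n \<in> G n) \<and> sum f S \<in> J \<longrightarrow> (\<forall>n\<in>S. f n \<in> J))"

definition dorder :: "nat \<Rightarrow> complex" where
  "dorder i = (if \<sigma> i = i then of_nat M else 1)"

text \<open>\<open>x p i m\<close> and \<open>h i r\<close> (\<open>r \<noteq> 0\<close>) are families of Drinfeld generators. They are characterised by their
  relations and by their position relative to the generators \<open>e\<close>, \<open>k\<close>; this leaves the freedom to
  rescale \<open>x p i m\<close> by \<open>c\<^sup>m\<close> and \<open>h i r\<close> by \<open>c\<^sup>r\<close>. The quadratic relations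
  between \<open>x\<close>'s of the same sign and the Drinfeld-Serre relations are not imposed separately.\<close>

definition drinfeld_generators ::
    "(sign \<Rightarrow> nat \<Rightarrow> int \<Rightarrow> ualg) \<Rightarrow> (nat \<Rightarrow> int \<Rightarrow> ualg) \<Rightarrow> bool" where
  "drinfeld_generators x h \<longleftrightarrow> (let I = nodes X in
     generated ({x p i m | p i m. i \<in> I} \<union> {h i r | i r. i \<in> I \<and> r \<noteq> 0} \<union> {kI p i | p i. i \<in> I}) = UNIV
   \<and> (\<forall>p. \<forall>i\<in>Isig. x p i 0 \<approx> e p (Nd i))
   \<and> (\<exists>G. grading G \<and> (\<forall>p m. \<forall>i\<in>I. x p i m \<in> G m) \<and> (\<forall>i\<in>I. \<forall>r. r \<noteq> 0 \<longrightarrow> h i r \<in> G r)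
        \<and> (\<forall>p. \<forall>i\<in>I. kI p i \<in> G 0) \<and> (\<forall>p. e p Eps \<in> G (sg p)))
   \<and> (\<forall>i\<in>I. \<forall>r\<ge>0. x Pos i r \<in> borel \<and> phi h Pos i r \<in> borel)
   \<and> (\<forall>p m. \<forall>i\<in>I. x p (\<sigma> i) m \<approx> sc (\<omega> powi m) * x p i m)
   \<and> (\<forall>r. r \<noteq> 0 \<longrightarrow> (\<forall>i\<in>I. h (\<sigma> i) r \<approx> sc (\<omega> powi r) * h i r))
   \<and> (\<forall>r t. r \<noteq> 0 \<and> t \<noteq> 0 \<longrightarrow> (\<forall>i\<in>I. \<forall>j\<in>I. comm (h i r) (h j t) \<approx> 0))
   \<and> (\<forall>p r. r \<noteq> 0 \<longrightarrow> (\<forall>i\<in>I. \<forall>j\<in>I. comm (kI p i) (h j r) \<approx> 0))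
   \<and> (\<forall>p m. \<forall>i\<in>I. \<forall>j\<in>I.
        kI Pos i * x p j m \<approx> sc (q powi (sg p * csum i j)) * x p j m * kI Pos i)
   \<and> (\<forall>p r l. r \<noteq> 0 \<longrightarrow> (\<forall>i\<in>I. \<forall>j\<in>I.
        comm (h i r) (x p j l) \<approx>
          sc (of_int (sg p) / of_int r *
              (\<Sum>t=1..M. qnum (d i) (of_int (r * cartan X i ((\<sigma> ^^ t) j)) / d i)
                          * \<omega> powi (r * int t)))
            * x p j (r + l)))
   \<and> (\<forall>m l. \<forall>i\<in>I. \<forall>j\<in>I.
        comm (x Pos i m) (x Neg j l) \<approx>
          sc ((\<Sum>t=1..M. if (\<sigma> ^^ t) i = j then \<omega> powi (int t * l) else 0)
                / (dorder i * (qp (d i) - qp (- d i))))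
            * (phi h Pos i (m + l) - phi h Neg i (m + l))))"

section \<open>Modules over the Borel subalgebra and the category \<open>\<O>\<close>\<close>

text \<open>A module lives on a whole type \<open>'v\<close> with scalar multiplication \<open>scl\<close>; the values \<open>act a\<close> for \<open>a\<close>
  outside \<^term>\<open>borel\<close> are irrelevant.\<close>

definition borel_module ::
    "(complex \<Rightarrow> 'v \<Rightarrow> 'v) \<Rightarrow> (ualg \<Rightarrow> 'v \<Rightarrow> 'v::ab_group_add) \<Rightarrow> bool" where
  "borel_module scl act \<longleftrightarrow> vector_space scl
   \<and> (\<forall>a\<in>borel. Vector_Spaces.linear scl scl (act a))
   \<and> (\<forall>c v. act (sc c) v = scl c v)
   \<and> (\<forall>a\<in>borel. \<forall>b\<in>borel. \<forall>v. act (a + b) v = act a v + act b v)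
   \<and> (\<forall>a\<in>borel. \<forall>b\<in>borel. \<forall>v. act (a * b) v = act a (act b v))
   \<and> (\<forall>a\<in>J. \<forall>v. act a v = 0)"

definition simple_module ::
    "(complex \<Rightarrow> 'v \<Rightarrow> 'v) \<Rightarrow> (ualg \<Rightarrow> 'v \<Rightarrow> 'v::ab_group_add) \<Rightarrow> bool" where
  "simple_module scl act \<longleftrightarrow> borel_module scl act \<and> (UNIV :: 'v set) \<noteq> {0}
   \<and> (\<forall>W. module.subspace scl W \<and> (\<forall>a\<in>borel. \<forall>w\<in>W. act a w \<in> W) \<longrightarrow> W = {0} \<or> W = UNIV)"

text \<open>The module is (isomorphic to) the simple module \<open>L(\<gamma>)\<close>.\<close>

definition is_L ::
    "(sign \<Rightarrow> nat \<Rightarrow> int \<Rightarrow> ualg) \<Rightarrow> (nat \<Rightarrow> int \<Rightarrow> ualg) \<Rightarrow> (nat \<Rightarrow> complex fps)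
      \<Rightarrow> (complex \<Rightarrow> 'v \<Rightarrow> 'v) \<Rightarrow> (ualg \<Rightarrow> 'v \<Rightarrow> 'v::ab_group_add) \<Rightarrow> bool" where
  "is_L x h \<gamma> scl act \<longleftrightarrow> simple_module scl act
   \<and> (\<exists>v. {act a v | a. a \<in> borel} = UNIV
        \<and> (\<forall>i\<in>nodes X. \<forall>r\<ge>0. act (x Pos i r) v = 0)
        \<and> (\<forall>i\<in>nodes X. \<forall>m. act (phi h Pos i (int m)) v = scl (fps_nth (\<gamma> i) m) v))"

text \<open>Elements of the dual of \<^term>\<open>cartan_part\<close>: its algebra characters.\<close>

definition tstar :: "(ualg \<Rightarrow> complex) set" where
  "tstar = {\<nu>.
     (\<forall>c. \<nu> (sc c) = c)
   \<and> (\<forall>a\<in>cartan_part. \<forall>b\<in>cartan_part. \<nu> (a + b) = \<nu> a + \<nu> b \<and> \<nu> (a * b) = \<nu> a * \<nu> b)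
   \<and> (\<forall>a\<in>J. \<nu> a = 0)}"

text \<open>The difference \<open>\<mu> - \<nu>\<close> is \<open>\<Sum>i. n i * \<alpha>\<^sub>i\<close>, where \<open>\<alpha>\<^sub>i\<close> sends \<open>k\<^sub>j\<close> to \<open>q\<^sub>i\<close> to the power of the
  \<open>(i, j)\<close> entry of \<^term>\<open>Csig\<close>. The group of characters is written additively but its law is the
  product of values, and a character is determined by its values on the \<open>k\<^sub>j\<close>.\<close>

definition wle :: "(ualg \<Rightarrow> complex) \<Rightarrow> (ualg \<Rightarrow> complex) \<Rightarrow> bool" where
  "wle \<nu> \<mu> \<longleftrightarrow> (\<exists>n :: nat \<Rightarrow> nat. \<forall>j\<in>Isig.
     \<mu> (k Pos (Nd j)) =
       \<nu> (k Pos (Nd j)) * (\<Prod>i\<in>Isig. qp (d i * of_int (Csig (Nd i) (Nd j))) ^ n i))"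

definition Dcone :: "(ualg \<Rightarrow> complex) \<Rightarrow> (ualg \<Rightarrow> complex) set" where
  "Dcone \<nu> = {\<mu> \<in> tstar. wle \<mu> \<nu>}"

definition weight_space ::
    "(complex \<Rightarrow> 'v \<Rightarrow> 'v) \<Rightarrow> (ualg \<Rightarrow> 'v \<Rightarrow> 'v) \<Rightarrow> (ualg \<Rightarrow> complex) \<Rightarrow> 'v::ab_group_add set" where
  "weight_space scl act \<nu> = {v. \<forall>a\<in>cartan_part. act a v = scl (\<nu> a) v}"

definition in_category_O ::
    "(complex \<Rightarrow> 'v \<Rightarrow> 'v) \<Rightarrow> (ualg \<Rightarrow> 'v \<Rightarrow> 'v::ab_group_add) \<Rightarrow> bool" where
  "in_category_O scl act \<longleftrightarrow> borel_module scl act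
   \<and> module.span scl (\<Union>\<nu>\<in>tstar. weight_space scl act \<nu>) = UNIV
   \<and> (\<forall>\<nu>\<in>tstar. \<exists>B. finite B \<and> weight_space scl act \<nu> \<subseteq> module.span scl B)
   \<and> (\<exists>S\<subseteq>tstar. finite S \<and>
        (\<forall>\<nu>\<in>tstar. weight_space scl act \<nu> \<noteq> {0} \<longrightarrow> (\<exists>\<mu>\<in>S. \<nu> \<in> Dcone \<mu>)))"

text \<open>The highest \<open>\<ell>\<close>-weight of the negative prefundamental representation of spectral parameter 1
  attached to the orbit with representative \<open>i\<close>. If \<open>\<sigma> i \<noteq> i\<close>, the exponent \<open>t\<close> with
  \<open>j = \<sigma>\<^sup>t i\<close> is unique modulo \<open>M\<close>.\<close>

definition neg_prefund :: "nat \<Rightarrow> nat \<Rightarrow> complex fps" where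
  "neg_prefund i j =
     (if j \<notin> orbit i then 1
      else if \<sigma> i = i then inverse (1 - fps_X ^ M)
      else inverse (1 - fps_const (\<omega> ^ (LEAST t. (\<sigma> ^^ t) i = j)) * fps_X))"

end

end

theory Submission
 imports Defs "HOL-Library.Multiset"
begin

text \<open>Commutators with the negative generators act on words in the \<open>e\<^sub>i\<close> through skew derivations. These show that
 the positive and the Cartan part of the Borel subalgebra are independent modulo the relations. Degree,
 weight and the null root then force the affine generator \<open>e\<^sub>\<epsilon>\<close> into the algebra generated by the \<open>k\<^sub>i\<close>, the
 currents \<open>x\<^sub>i\<^sub>,\<^sub>r\<close> of both signs with \<open>r \<ge> 0\<close>, and \<open>h\<^sub>i\<^sub>,\<^sub>r\<close> with \<open>r > 0\<close>. Consequently \<open>L(\<gamma>)\<close> embeds into the induced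
 module modulo its radical, and its image lies in the span of the products of lowering currents applied to the
 top vector. As each \<open>\<gamma>\<^sub>i\<close> is rational, its coefficients satisfy a linear recurrence. The exchange relations
 between \<open>\<phi>\<^sub>i\<close> and the lowering currents propagate recurrences from one graded piece to the next (an
 induction of Mukhin-Young type), so that modulo the radical finitely many of the lowering currents
 suffice on each graded piece and all weight spaces are finite-dimensional.\<close>

text \<open>The lowering modes \<open>x Neg i r\<close> with r \<ge> 0 need not act on L(\<gamma>):
  already \<open>x Neg i 0\<close>, which equals \<open>e Neg (Nd i)\<close>, is not among the
  generators of the Borel subalgebra. Hence the passage to an induced module. L(\<gamma>) survives
  it because negative Serre elements have word length at least 2, so lengths 0 and 1 remain
  untouched; this low-degree piece of the triangular decomposition is all that the proof uses. The
  second obstacle is \<open>e Pos Eps\<close>: Drinfeld generators are known through their relations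
  only, without a formula for the affine generator. It is located by expanding \<open>h j 1\<close>
  over the Borel subalgebra, identifying its content with the null root and stripping letters by
  skew derivations until one affine letter is left. The start must be a node moved by \<sigma>,
  since \<open>h j 1\<close> vanishes at a fixed node. Modes are kept nonnegative because
  commutators of currents then involve only \<phi>^+ and one inverse Cartan factor, so that the
  recurrence of \<gamma> governs everything.\<close>

lemma sc_0 [simp]: "sc 0 = 0" by (simp add: sc_def)
lemma sc_1 [simp]: "sc 1 = 1" by (simp add: sc_def)
lemma sc_add: "sc (a + b) = sc a + sc b" by (simp add: sc_def single_add)
lemma sc_minus: "sc (- a) = - sc a" by (simp add: sc_def single_uminus)
lemma sc_diff: "sc (a - b) = sc a - sc b" by (simp add: sc_def single_diff)
lemma sc_mult: "sc (a * b) = sc a * sc b" by (simp add: sc_def mult_single)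

abbreviation "sgl \<equiv> Poly_Mapping.single"

lemma single_induct [case_names single add]:
 fixes a :: "'k \<Rightarrow>\<^sub>0 'c::comm_monoid_add"
 assumes "!!w c. P (sgl w c)" and "!!a b. P a ==> P b ==> P (a + b)"
 shows "P a"
proof (induction a rule: update_induct)
 case const
 show ?case using assms(1)[of undefined 0] by simp
next
 case (update f w c)
 have "Poly_Mapping.update w c f = f + sgl w c"
 proof (rule poly_mapping_eqI)
  fix k
  have "Poly_Mapping.lookup f w = 0" using update(1) by (simp add: in_keys_iff)
  thus "Poly_Mapping.lookup (Poly_Mapping.update w c f) k = Poly_Mapping.lookup (f + sgl w c) k"
   by (auto simp: lookup_update lookup_add lookup_single when_def)
 qed
 thus ?case using assms(2)[OF update(3) assms(1)] by simp
qed

lemma sc_commute: "a * sc c = sc c * (a :: 'g free_algebra)"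
 by (induction a rule: single_induct)
   (simp_all add: sc_def mult_single distrib_left distrib_right mult.commute)

lemma sc_left_commute: "a * (sc c * b) = sc c * (a * (b :: 'g free_algebra))"
 by (metis mult.assoc sc_commute)

lemma gen_mult_single: "gen g * sgl w c = sgl (Word (g # letters w)) c"
 by (simp add: gen_def mult_single plus_word_def)

lemma single_word_Cons:
 "sgl (Word (g # gs)) c = gen g * (sgl (Word gs) c :: 'g free_algebra)"
 by (simp add: gen_mult_single)

text \<open>Words are built by prefixing letters, so scalars, sums and left multiplication by a
  generator suffice. Multiplicativity of actions and the commutation rules of the skew derivations
  are checked in these three cases.\<close>

lemma free_induct [case_names sc add gen]:
 fixes a :: "'g free_algebra"
 assumes "!!c. P (sc c)" and "!!a b. P a ==> P b ==> P (a + b)" and "!!g a. P a ==> P (gen g * a)"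
 shows "P a"
proof (induction a rule: single_induct)
 case (single w c)
 have "P (sgl (Word gs) c)" for gs
  by (induction gs) (use assms(1)[of c] assms(3) in "simp_all add: single_word_Cons sc_def zero_word_def")
 from this[of "letters w"] show ?case by simp
qed (use assms(2) in auto)

lemma subalgebra_1: "1 \<in> subalgebra S" using subalgebra.scalar[of 1 S] by simp
lemma subalgebra_0: "0 \<in> subalgebra S" using subalgebra.scalar[of 0 S] by simp
lemma subalgebra_sc: "a \<in> subalgebra S ==> sc c * a \<in> subalgebra S"
 by (intro subalgebra.mult subalgebra.scalar)
lemma subalgebra_minus: "a \<in> subalgebra S ==> - a \<in> subalgebra S"
 using subalgebra_sc[of a S "- 1"] by (simp add: sc_minus)
lemma subalgebra_diff: "a \<in> subalgebra S ==> b \<in> subalgebra S ==> a - b \<in> subalgebra S"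
 using subalgebra.add[OF _ subalgebra_minus, of a S b] by simp
lemma subalgebra_sum: "(!!i. i \<in> F ==> f i \<in> subalgebra S) ==> sum f F \<in> subalgebra S"
 by (induction F rule: infinite_finite_induct) (auto intro: subalgebra_0 subalgebra.add)
lemma subalgebra_power: "a \<in> subalgebra S ==> a ^ n \<in> subalgebra S"
 by (induction n) (auto intro: subalgebra_1 subalgebra.mult)
lemma subalgebra_prod_list: "(!!a. a \<in> set as ==> a \<in> subalgebra S) ==> prod_list as \<in> subalgebra S"
 by (induction as) (auto intro: subalgebra_1 subalgebra.mult)

lemma two_sided_ideal_mult:
 assumes "a \<in> two_sided_ideal R" shows "x * a * y \<in> two_sided_ideal R"
 using assms
proof induction
 case (gen r a b)
 thus ?case using two_sided_ideal.gen[of r R "x * a" "b * y"] by (simp add: mult.assoc)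
qed (auto simp: distrib_left distrib_right intro: two_sided_ideal.intros)

lemma two_sided_ideal_left: "a \<in> two_sided_ideal R ==> x * a \<in> two_sided_ideal R"
 using two_sided_ideal_mult[of a R x 1] by simp
lemma two_sided_ideal_right: "a \<in> two_sided_ideal R ==> a * y \<in> two_sided_ideal R"
 using two_sided_ideal_mult[of a R 1 y] by simp
lemma two_sided_ideal_minus: "a \<in> two_sided_ideal R ==> - a \<in> two_sided_ideal R"
 using two_sided_ideal_left[of a R "- 1"] by simp
lemma two_sided_ideal_diff:
 "a \<in> two_sided_ideal R ==> b \<in> two_sided_ideal R ==> a - b \<in> two_sided_ideal R"
 using two_sided_ideal.add[OF _ two_sided_ideal_minus, of a R b] by simp
lemma two_sided_ideal_gen: "r \<in> R ==> r \<in> two_sided_ideal R"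
 using two_sided_ideal.gen[of r R 1 1] by simp
lemma two_sided_ideal_mono: assumes "R \<subseteq> S" shows "two_sided_ideal R \<subseteq> two_sided_ideal S"
proof
 fix a assume "a \<in> two_sided_ideal R"
 thus "a \<in> two_sided_ideal S"
  by induction (use assms in "auto intro: two_sided_ideal.intros")
qed

section \<open>Actions of free algebras\<close>

text \<open>The leftmost letter acts last, which makes the extension multiplicative
  (\<open>act_mult\<close>). No relations enter: a module over a quotient appears as an action of
  the free algebra together with a subspace modulo which one computes.\<close>

definition lift ::
  "(complex => 'm => 'm) => ('g => 'm => 'm) => 'g free_algebra => 'm => 'm::ab_group_add" where
 "lift scl op a m = (\<Sum>w\<in>Poly_Mapping.keys a. scl (Poly_Mapping.lookup a w) (foldr op (letters w) m))"

locale lin_ops = vector_space scl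
 for scl :: "complex => 'm => 'm::ab_group_add" +
 fixes op :: "'g => 'm => 'm"
 assumes op_add: "op g (x + y) = op g x + op g y"
  and op_scl: "op g (scl c x) = scl c (op g x)"
begin

abbreviation "act \<equiv> lift scl op"

lemma op_0: "op g 0 = 0" using op_scl[of g 0 0] by simp

lemma foldr_op_add: "foldr op gs (x + y) = foldr op gs x + foldr op gs y"
 by (induction gs) (auto simp: op_add)
lemma foldr_op_scl: "foldr op gs (scl c x) = scl c (foldr op gs x)"
 by (induction gs) (auto simp: op_scl)

lemma act_add_right: "act a (x + y) = act a x + act a y"
 by (simp add: lift_def foldr_op_add scale_right_distrib sum.distrib)
lemma act_scl: "act a (scl c x) = scl c (act a x)"
 by (simp add: lift_def foldr_op_scl scale_sum_right mult.commute)
lemma act_single: "act (sgl w c) m = scl c (foldr op (letters w) m)"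
 by (cases "c = 0") (simp_all add: lift_def)
lemma act_add: "act (a + b) m = act a m + act b m"
 unfolding lift_def
 by (rule setsum_keys_plus_distrib) (simp_all add: scale_left_distrib)
lemma act_sc: "act (sc c) m = scl c m"
 by (simp add: sc_def act_single zero_word_def)
lemma act_0: "act 0 m = 0" by (simp add: lift_def)
lemma act_1: "act 1 m = m" using act_sc[of 1 m] by simp
lemma act_minus: "act (- a) m = - act a m"
 using act_add[of a "- a" m] by (simp add: act_0 eq_neg_iff_add_eq_0 add.commute)
lemma act_diff: "act (a - b) m = act a m - act b m"
 using act_add[of a "- b" m] by (simp add: act_minus)
lemma act_sum: "act (sum f F) m = (\<Sum>i\<in>F. act (f i) m)"
 by (induction F rule: infinite_finite_induct) (auto simp: act_0 act_add)
lemma act_0_right: "act a 0 = 0" using act_scl[of a 0 0] by simp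
lemma act_minus_right: "act a (- x) = - act a x" using act_scl[of a "- 1" x] by simp
lemma act_diff_right: "act a (x - y) = act a x - act a y"
 using act_add_right[of a x "- y"] by (simp add: act_minus_right)
lemma act_sum_right: "act a (sum f F) = (\<Sum>i\<in>F. act a (f i))"
 by (induction F rule: infinite_finite_induct) (auto simp: act_0_right act_add_right)

lemma act_gen_mult: "act (gen g * a) m = op g (act a m)"
proof (induction a rule: single_induct)
 case (single w c)
 show ?case by (simp add: gen_mult_single act_single op_scl)
qed (simp add: distrib_left act_add op_add)

lemma act_gen: "act (gen g) m = op g m" using act_gen_mult[of g 1 m] by (simp add: act_1)

lemma act_mult: "act (a * b) m = act a (act b m)"
proof (induction a rule: free_induct)
 case (sc c)
 show ?case
 proof (induction b rule: free_induct)
  case (gen g b)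
  thus ?case by (simp add: sc_left_commute[symmetric] act_gen_mult act_sc op_scl)
 qed (auto simp: distrib_left act_add act_sc sc_mult[symmetric] scale_right_distrib)
next
 case (add a b)
 thus ?case by (simp add: distrib_right act_add)
next
 case (gen g a)
 thus ?case by (simp add: mult.assoc act_gen_mult)
qed


end

lemma vector_space_sc: "vector_space (%c a. sc c * (a :: 'g free_algebra))"
 by unfold_locales (simp_all add: distrib_left distrib_right sc_add sc_mult mult.assoc)

lemma sc_sc_mult: "sc a * (sc b * x) = sc (a * b) * (x :: 'g free_algebra)"
 by (simp add: sc_mult mult.assoc)

text \<open>Linear extension of a function on words; it yields both the skew derivations
  \<open>R\<close> and the substitution \<open>emb\<close>.\<close>

definition word_ext :: "('g list => 'h free_algebra) => 'g free_algebra => 'h free_algebra" where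
 "word_ext f y = (\<Sum>w\<in>Poly_Mapping.keys y. sc (Poly_Mapping.lookup y w) * f (letters w))"

lemma word_ext_single: "word_ext f (sgl w c) = sc c * f (letters w)"
 by (cases "c = 0") (simp_all add: word_ext_def)
lemma word_ext_add: "word_ext f (x + y) = word_ext f x + word_ext f y"
 unfolding word_ext_def by (rule setsum_keys_plus_distrib) (simp_all add: sc_add distrib_right)
lemma word_ext_sc: "word_ext f (sc c * y) = sc c * word_ext f y"
proof (induction y rule: single_induct)
 case (single w b)
 show ?case
  by (simp add: sc_def mult_single word_ext_single) (simp add: sc_def[symmetric] sc_mult mult.assoc)
qed (simp add: distrib_left word_ext_add)
lemma word_ext_0 [simp]: "word_ext f 0 = 0" by (simp add: word_ext_def)
lemma word_ext_const [simp]: "word_ext f (sc c) = sc c * f []"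
 by (simp add: sc_def word_ext_single zero_word_def)

text \<open>Homogeneity is expressed through the support, so that zero is homogeneous of every kind.
  Weight (\<open>hom\<close>) and multidegree (\<open>content\<close>) are instances.\<close>

definition words_in :: "('g list => bool) => 'g free_algebra => bool" where
 "words_in P y \<longleftrightarrow> (\<forall>w\<in>Poly_Mapping.keys y. P (letters w))"

abbreviation "words_on S \<equiv> words_in (%w. set w \<subseteq> S)"

lemma words_in_0 [simp]: "words_in P 0" by (simp add: words_in_def)
lemma words_in_single: "P (letters w) ==> words_in P (sgl w c)"
 by (auto simp: words_in_def)
lemma words_in_add: "words_in P x ==> words_in P y ==> words_in P (x + y)"
 unfolding words_in_def using keys_add[of x y] by blast
lemma words_in_mult:
 assumes "words_in P x" "words_in Q y" "!!u v. P u ==> Q v ==> S (u @ v)"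
 shows "words_in S (x * y)"
 unfolding words_in_def
proof
 fix w assume "w \<in> Poly_Mapping.keys (x * y)"
 then obtain u v where "w = u + v" "u \<in> Poly_Mapping.keys x" "v \<in> Poly_Mapping.keys y"
  using keys_mult[of x y] by blast
 thus "S (letters w)" using assms by (auto simp: words_in_def plus_word_def)
qed
lemma words_in_gen: "P [l] ==> words_in P (gen l)"
 by (simp add: gen_def words_in_single)
lemma words_in_const: "P [] ==> words_in P (sc c)"
 by (simp add: sc_def words_in_single zero_word_def)
lemma words_in_sc: "words_in P y ==> words_in P (sc c * y)"
 by (rule words_in_mult[where P = "%u. u = []" and Q = P]) (auto intro: words_in_const)
lemma words_in_sum: "(!!i. i \<in> F ==> words_in P (f i)) ==> words_in P (sum f F)"
 by (induction F rule: infinite_finite_induct) (auto intro: words_in_add)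

lemma words_in_word_ext:
 assumes "words_in P y" "!!w. P w ==> words_in Q (f w)"
 shows "words_in Q (word_ext f y)"
 unfolding word_ext_def
 by (intro words_in_sum words_in_sc) (use assms in "auto simp: words_in_def")

lemma words_in_induct [consumes 1, case_names zero single add]:
 assumes "words_in P y" and "Q 0" and "!!w c. P w ==> Q (sgl (Word w) c)"
  and "!!x y. Q x ==> Q y ==> Q (x + y)"
 shows "Q y"
proof -
 have y: "y = (\<Sum>w\<in>Poly_Mapping.keys y. sgl w (Poly_Mapping.lookup y w))"
 proof (rule poly_mapping_eqI)
  fix v
  show "Poly_Mapping.lookup y v
   = Poly_Mapping.lookup (\<Sum>w\<in>Poly_Mapping.keys y. sgl w (Poly_Mapping.lookup y w)) v"
   by (simp add: lookup_sum lookup_single when_def in_keys_iff)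
 qed
 have "Q (\<Sum>w\<in>F. sgl w (Poly_Mapping.lookup y w))"
  if "finite F" "F \<subseteq> Poly_Mapping.keys y" for F
  using that
 proof (induction F rule: finite_induct)
  case (insert w F)
  have "Q (sgl (Word (letters w)) (Poly_Mapping.lookup y w))"
   using assms(1,3) insert.prems unfolding words_in_def by blast
  thus ?case using insert assms(4) by simp
 qed (simp add: assms(2))
 from this[of "Poly_Mapping.keys y"] show ?thesis using y by simp
qed

section \<open>Skew derivations of a free algebra\<close>

text \<open>Exponents are counted in powers of the square root \<open>s\<close>, which keeps them
  integral although d_i may be 1/2: \<open>D i\<close> becomes 2 d_i, \<open>B\<close> the doubled
  symmetrised Cartan form, and q_i is \<open>s powi D i\<close>.\<close>

locale cartan_form =
 fixes s :: complex and I :: "'g set" and B C :: "'g => 'g => int" and D :: "'g => int"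
 assumes s_nz: "s ~= 0" and s_gen: "!!n. n > 0 ==> s ^ n ~= 1"
  and fin_I: "finite I"
  and B_eq: "!!i j. i \<in> I ==> j \<in> I ==> B i j = D i * C i j"
  and B_sym: "!!i j. i \<in> I ==> j \<in> I ==> B i j = B j i"
  and D_pos: "!!i. i \<in> I ==> D i > 0"
  and C_diag: "!!i. i \<in> I ==> C i i = 2"
  and C_nonpos: "!!i j. i \<in> I ==> j \<in> I ==> i ~= j ==> C i j \<le> 0"
begin

lemma s_powi_eq_1: "s powi n = 1 \<longleftrightarrow> n = 0"
proof
 assume h: "s powi n = 1"
 show "n = 0"
 proof (rule ccontr)
  assume "n ~= 0"
  consider "n > 0" | "n < 0" using \<open>n ~= 0\<close> by linarith
  thus False
  proof cases
   case 1
   thus False using h s_gen[of "nat n"] by (simp add: power_int_def)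
  next
   case 2
   hence "s ^ nat (- n) = 1" using h by (simp add: power_int_def power_inverse)
   thus False using s_gen[of "nat (- n)"] 2 by simp
  qed
 qed
qed simp

lemma s_powi_add: "s powi (m + n) = s powi m * s powi n"
 by (simp add: power_int_add s_nz)
lemma s_powi_nz: "s powi n ~= 0" using s_nz by simp
lemma s_powi_cancel: "s powi m = s powi n \<longleftrightarrow> m = n"
 using s_powi_eq_1[of "m - n"] s_powi_nz by (simp add: power_int_diff s_nz)

lemma B_diag: "i \<in> I ==> B i i = 2 * D i" by (simp add: B_eq C_diag)

definition wt :: "'g => 'g list => int" where
 "wt j w = (\<Sum>l\<leftarrow>w. B j l)"

lemma wt_simps [simp]: "wt j [] = 0" "wt j (l # w) = B j l + wt j w" "wt j (u @ v) = wt j u + wt j v"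
 by (simp_all add: wt_def)

abbreviation hom :: "'g => int => 'g free_algebra => bool" where
 "hom j u \<equiv> words_in (%w. wt j w = u)"

text \<open>For t = 1 and t = -1 these are the two skew derivations of Kashiwara and Lusztig,
  normalised so that in a commutator with a negative generator both Cartan elements stand on the
  left; see \<open>emb_commutator\<close>.\<close>

primrec Rw :: "int => 'g => 'g list => 'g free_algebra" where
 "Rw t i [] = 0"
| "Rw t i (l # w) = (if l = i then sgl (Word w) 1 else 0)
   + sc (s powi (t * B i l)) * (gen l * Rw t i w)"

definition R :: "int => 'g => 'g free_algebra => 'g free_algebra" where
 "R t i = word_ext (Rw t i)"

lemma R_add: "R t i (x + y) = R t i x + R t i y" by (simp add: R_def word_ext_add)
lemma R_sc: "R t i (sc c * y) = sc c * R t i y" by (simp add: R_def word_ext_sc)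
lemma R_const [simp]: "R t i (sc c) = 0" by (simp add: R_def)
lemma R_0 [simp]: "R t i 0 = 0" by (simp add: R_def)
lemma R_1 [simp]: "R t i 1 = 0" using R_const[of t i 1] by simp
lemma R_minus: "R t i (- x) = - R t i x" using R_sc[of t i "- 1" x] by (simp add: sc_minus)
lemma R_diff: "R t i (x - y) = R t i x - R t i y" using R_add[of t i x "- y"] by (simp add: R_minus)
lemma R_gen_mult:
 "R t i (gen l * y) = (if l = i then y else 0) + sc (s powi (t * B i l)) * (gen l * R t i y)"
proof (induction y rule: single_induct)
 case (single w c)
 have "sc c * sgl (Word (letters w)) 1 = sgl w c"
  by (simp add: sc_def mult_single zero_word_def plus_word_def)
 thus ?case
  by (simp add: gen_mult_single R_def word_ext_single distrib_left sc_left_commute[of "gen l"] sc_sc_mult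
    mult.commute)
qed (simp add: distrib_left R_add)
lemma R_gen: "R t i (gen l) = (if l = i then 1 else 0)"
 using R_gen_mult[of t i l 1] by simp

lemma hom_R:
 assumes "hom j u y" shows "hom j (u - B j i) (R t i y)"
proof -
 have "words_in (%v. wt j v = wt j w - B j i) (Rw t i w)" for w
 proof (induction w)
  case (Cons l w)
  show ?case unfolding Rw.simps
  proof (intro words_in_add words_in_sc)
   show "words_in (%v. wt j v = wt j (l # w) - B j i) (if l = i then sgl (Word w) 1 else 0)"
    by (auto intro: words_in_single)
   show "words_in (%v. wt j v = wt j (l # w) - B j i) (gen l * Rw t i w)"
    by (rule words_in_mult[where P = "%u. u = [l]", OF words_in_gen Cons.IH]) auto
  qed
 qed simp
 thus ?thesis unfolding R_def using words_in_word_ext[OF assms] by metis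
qed

lemma hom_gen_mult: "hom j u y ==> hom j (u + B j l) (gen l * y)"
 by (rule words_in_mult[where P = "%u. u = [l]", OF words_in_gen]) auto
lemma hom_mult_gen: "hom j u y ==> hom j (u + B j l) (y * gen l)"
 by (rule words_in_mult[where Q = "%u. u = [l]", OF _ words_in_gen]) auto

lemma R_mult:
 assumes "hom i u x"
 shows "R t i (x * y) = R t i x * y + sc (s powi (t * u)) * (x * R t i y)"
proof -
 have sw: "R t i (sgl (Word w) c * y)
   = R t i (sgl (Word w) c) * y
    + sc (s powi (t * wt i w)) * (sgl (Word w) c * R t i y)" for w c
 proof (induction w)
  case Nil
  show ?case by (simp add: zero_word_def[symmetric] sc_def[symmetric] R_sc)
 next
  case (Cons l w)
  show ?case
   unfolding single_word_Cons mult.assoc R_gen_mult Cons.IH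
   by (simp add: distrib_left distrib_right sc_left_commute[of "gen l"] sc_sc_mult s_powi_add mult.assoc)
 qed
 show ?thesis using assms
 proof (induction rule: words_in_induct)
  case (single w c)
  thus ?case using sw[of w c] by simp
 qed (simp_all add: distrib_left distrib_right R_add)
qed

text \<open>The two twists correspond to the two terms of \<open>k - k\<^sup>-\<^sup>1\<close>, hence commute up to a scalar.\<close>

lemma R_commute:
 assumes "i \<in> I" "l \<in> I"
 shows "R (- 1) i (R 1 l y) = sc (s powi (B i l)) * R 1 l (R (- 1) i y)"
proof (induction y rule: free_induct)
 case (sc c)
 show ?case by simp
next
 case (add a b)
 thus ?case by (simp add: R_add distrib_left)
next
 case (gen g a)
 have "R (- 1) i (R 1 l (gen g * a)) = (if g = l then R (- 1) i a else 0)
   + sc (s powi B l g) * ((if g = i then R 1 l a else 0)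
    + sc (s powi (- B i g)) * (gen g * R (- 1) i (R 1 l a)))"
  by (simp add: R_gen_mult R_add R_sc)
 moreover have "R 1 l (R (- 1) i (gen g * a)) = (if g = i then R 1 l a else 0)
   + sc (s powi (- B i g)) * ((if g = l then R (- 1) i a else 0)
    + sc (s powi (B l g)) * (gen g * R 1 l (R (- 1) i a)))"
  by (simp add: R_gen_mult R_add R_sc)
 ultimately show ?case unfolding gen.IH using B_sym[OF assms]
  by (simp add: distrib_left sc_left_commute[of "gen g"] sc_sc_mult s_powi_add[symmetric]
    power_int_minus s_nz ac_simps)
qed

section \<open>Iterated skew commutators\<close>

text \<open>\<open>u\<close> is the weight of \<open>y\<close>, and each commutator with
  \<open>gen i\<close> raises it by \<open>2 * D i\<close>, hence the exponent. This is the n-th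
  power of the q-adjoint action of \<open>gen i\<close>, written without a coproduct.\<close>

primrec ads :: "'g => int => nat => 'g free_algebra => 'g free_algebra" where
 "ads i u 0 y = y"
| "ads i u (Suc n) y = gen i * ads i u n y - sc (s powi (u + 2 * D i * int n)) * (ads i u n y * gen i)"

lemma ads_Suc_shift: "ads i u (Suc n) y = ads i (u + 2 * D i) n (ads i u 1 y)"
proof (induction n)
 case (Suc n)
 have e: "u + 2 * D i * int (Suc n) = u + 2 * D i + 2 * D i * int n" by (simp add: algebra_simps)
 show ?case using Suc unfolding ads.simps(2)[of i u "Suc n"] ads.simps(2)[of i "u + 2 * D i" n] e by simp
qed simp

lemma hom_diff: "hom j u x ==> hom j u y ==> hom j u (x - y)"
 using words_in_add[OF _ words_in_sc[of _ y "- 1"]] by (fastforce simp: sc_minus)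

lemma hom_ads:
 assumes "i \<in> I" "hom i u y" shows "hom i (u + 2 * D i * int n) (ads i u n y)"
proof (induction n)
 case (Suc n)
 have e: "u + 2 * D i * int (Suc n) = u + 2 * D i * int n + B i i"
  using B_diag[OF assms(1)] by (simp add: algebra_simps)
 show ?case unfolding ads.simps e
  by (intro hom_diff words_in_sc hom_gen_mult hom_mult_gen Suc)
qed (use assms in simp)

lemma ads_add: "ads i u n (x + y) = ads i u n x + ads i u n y"
 by (induction n) (simp_all add: algebra_simps)
lemma ads_sc: "ads i u n (sc c * y) = sc c * ads i u n y"
 by (induction n) (simp_all add: algebra_simps sc_left_commute[of "gen i"] sc_sc_mult)
lemma ads_0: "ads i u n 0 = 0" by (induction n) simp_all

definition is_ideal :: "'g free_algebra set => bool" where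
 "is_ideal N \<longleftrightarrow> 0 \<in> N \<and> (\<forall>a\<in>N. \<forall>b\<in>N. a + b \<in> N) \<and> (\<forall>a\<in>N. \<forall>x y. x * a * y \<in> N)"

lemma ideal_0: "is_ideal N ==> 0 \<in> N" by (simp add: is_ideal_def)
lemma ideal_add: "is_ideal N ==> a \<in> N ==> b \<in> N ==> a + b \<in> N" by (simp add: is_ideal_def)
lemma ideal_left: "is_ideal N ==> a \<in> N ==> x * a \<in> N"
 unfolding is_ideal_def by (metis mult.right_neutral)
lemma ideal_right: "is_ideal N ==> a \<in> N ==> a * x \<in> N"
 unfolding is_ideal_def by (metis mult.left_neutral)
lemma ideal_minus: "is_ideal N ==> a \<in> N ==> - a \<in> N"
 using ideal_left[of N a "- 1"] by simp
lemma ideal_diff: "is_ideal N ==> a \<in> N ==> b \<in> N ==> a - b \<in> N"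
 using ideal_add[of N a "- b"] ideal_minus by simp
lemma ideal_cancel_sc: "is_ideal N ==> sc c * a \<in> N ==> c ~= 0 ==> a \<in> N"
 using ideal_left[of N "sc c * a" "sc (1 / c)"] by (simp add: sc_sc_mult)
lemma ideal_cong: "is_ideal N ==> a - b \<in> N ==> a \<in> N \<longleftrightarrow> b \<in> N"
 using ideal_add[of N "a - b" b] ideal_diff[of N a "a - b"] by auto
lemma ideal_zero: "is_ideal {0}" by (simp add: is_ideal_def)

lemma ideal_ads: "is_ideal N ==> y \<in> N ==> ads i u n y \<in> N"
 by (induction n) (auto intro: ideal_diff ideal_left ideal_right)

text \<open>\<open>R (- 1) i\<close> turns \<open>y * gen i\<close> into \<open>y\<close> times the
  inverse of the power of \<open>s\<close> used in the commutator, so the two copies of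
  \<open>y\<close> cancel. The kernel of this derivation is therefore stable under the q-adjoint
  action; for \<open>R 1 i\<close> there is a correction, namely \<open>gc\<close>.\<close>

lemma R_minus_ads:
 assumes "i \<in> I" "hom i u y" "R (- 1) i y = 0"
 shows "R (- 1) i (ads i u n y) = 0"
proof (induction n)
 case (Suc n)
 have "R (- 1) i (ads i u n y * gen i) = sc (s powi (- (u + 2 * D i * int n))) * ads i u n y"
  using R_mult[OF hom_ads[OF assms(1,2)], of "- 1" n "gen i"] Suc by (simp add: R_gen)
 thus ?case using Suc
  by (simp add: R_diff R_gen_mult R_sc sc_sc_mult s_powi_add[symmetric])
qed (use assms in simp)

text \<open>Up to the factor \<open>Q\<^sup>2 - 1\<close>, with \<open>Q = s\<^sup>D\<close>, this is \<open>(1 - Q\<^sup>2\<^sup>n) (\<theta>\<^sup>2 Q\<^sup>2\<^sup>n\<^sup>-\<^sup>2 - 1)\<close> for \<open>\<theta> = s\<^sup>u\<close>.\<close>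

primrec gc :: "'g => int => nat => complex" where
 "gc i u 0 = 0"
| "gc i u (Suc n) = 1 - s powi (2 * (u + 2 * D i * int n)) + s powi (2 * D i) * gc i u n"

lemma gc_closed:
 "gc i u n * (s powi (2 * D i) - 1)
  = (1 - s powi (2 * D i * int n)) * (s powi (2 * u + 2 * D i * (int n - 1)) - 1)"
proof (induction n)
 case (Suc n)
 define X Y Z where "X = s powi (2 * D i)" and "Y = s powi (2 * D i * int n)"
  and "Z = s powi (2 * u + 2 * D i * (int n - 1))"
 have "s powi (2 * (u + 2 * D i * int n)) = X * Y * Z"
  by (simp add: X_def Y_def Z_def s_powi_add[symmetric] algebra_simps)
 moreover have "s powi (2 * D i * int (Suc n)) = X * Y"
  "s powi (2 * u + 2 * D i * (int (Suc n) - 1)) = X * Z"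
  by (simp_all add: X_def Y_def Z_def s_powi_add[symmetric] algebra_simps)
 moreover have "gc i u n * (X - 1) = (1 - Y) * (Z - 1)"
  using Suc by (simp add: X_def Y_def Z_def)
 hence "X * gc i u n * (X - 1) = X * ((1 - Y) * (Z - 1))" by simp
 moreover have gS: "gc i u (Suc n) = 1 - X * Y * Z + X * gc i u n"
  using \<open>s powi (2 * (u + 2 * D i * int n)) = X * Y * Z\<close> by (simp add: X_def)
 ultimately have "gc i u (Suc n) * (X - 1) = (1 - X * Y) * (X * Z - 1)"
  unfolding gS by (simp add: algebra_simps del: gc.simps)
 also have "... = (1 - s powi (2 * D i * int (Suc n))) * (s powi (2 * u + 2 * D i * (int (Suc n) - 1)) - 1)"
  using \<open>s powi (2 * D i * int (Suc n)) = X * Y\<close>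
   \<open>s powi (2 * u + 2 * D i * (int (Suc n) - 1)) = X * Z\<close> by simp
 finally show ?case by (simp only: X_def)
qed simp

text \<open>As for the coefficient in e f^n v = c f^(n-1) v in rank one, vanishing happens at a
  single weight. For \<open>u = B i j\<close> it happens at n = 1 - C i j, the exponent of the Serre
  relation.\<close>

lemma gc_eq_0:
 assumes "i \<in> I" "n > 0" shows "gc i u n = 0 \<longleftrightarrow> u = D i * (1 - int n)"
proof -
 have "s powi (2 * D i) - 1 ~= 0" using s_powi_eq_1[of "2 * D i"] D_pos[OF assms(1)] by auto
 hence "gc i u n = 0 \<longleftrightarrow> (1 - s powi (2 * D i * int n)) * (s powi (2 * u + 2 * D i * (int n - 1)) - 1) = 0"
  using gc_closed[of i u n] by (metis mult_eq_0_iff)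
 also have "... \<longleftrightarrow> 2 * u + 2 * D i * (int n - 1) = 0"
  using s_powi_eq_1[of "2 * D i * int n"] s_powi_eq_1[of "2 * u + 2 * D i * (int n - 1)"] D_pos[OF assms(1)]
   assms(2) by auto
 also have "... \<longleftrightarrow> u = D i * (1 - int n)" by (auto simp: algebra_simps)
 finally show ?thesis .
qed

lemma R_plus_ads:
 assumes "i \<in> I" "is_ideal N" "hom i u y" "R 1 i y \<in> N"
 shows "R 1 i (ads i u n y) - sc (gc i u n) * ads i u (n - 1) y \<in> N"
proof (induction n)
 case (Suc n)
 define m where "m = u + 2 * D i * int n"
 let ?y = "ads i u n y" and ?z = "ads i u (n - 1) y" and ?Q = "sc (s powi (2 * D i))"
 have h: "hom i m ?y" unfolding m_def by (rule hom_ads[OF assms(1,3)])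
 define r where "r = R 1 i ?y - sc (gc i u n) * ?z"
 have r: "r \<in> N" using Suc by (simp add: r_def)
 have R1: "R 1 i (ads i u (Suc n) y)
   = sc (1 - s powi (2 * m)) * ?y + ?Q * (gen i * R 1 i ?y)
    - sc (s powi m) * (R 1 i ?y * gen i)"
  using R_mult[OF h, of 1 "gen i"]
  by (simp add: R_diff R_gen_mult R_sc R_gen B_diag[OF assms(1)] m_def[symmetric] sc_sc_mult sc_diff
    distrib_left left_diff_distrib s_powi_add[symmetric])
 have R2: "R 1 i ?y = r + sc (gc i u n) * ?z" by (simp add: r_def)
 \<comment> \<open>One more commutator on \<open>ads i u (n - 1) y\<close> gives back
   \<open>ads i u n y\<close>, which is why the coefficients obey the recursion of
   \<open>gc\<close>; at n = 0 the coefficient is zero.\<close>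
 have st: "gc i u n = 0 \<or> ?Q * (gen i * ?z)
    - sc (s powi m) * (?z * gen i) = ?Q * ?y"
 proof (cases n)
  case (Suc n')
  have "m = 2 * D i + (u + 2 * D i * int n')" by (simp add: m_def Suc algebra_simps)
  thus ?thesis by (simp add: Suc right_diff_distrib sc_sc_mult s_powi_add[symmetric])
 qed simp
 hence st': "?Q * (gen i * (sc (gc i u n) * ?z))
    - sc (s powi m) * (sc (gc i u n) * ?z * gen i)
   = sc (s powi (2 * D i) * gc i u n) * ?y"
 proof
  assume "?Q * (gen i * ?z)
    - sc (s powi m) * (?z * gen i) = ?Q * ?y"
  hence "sc (gc i u n) * (?Q * (gen i * ?z)
    - sc (s powi m) * (?z * gen i)) = sc (gc i u n) * (?Q * ?y)"
   by simp
  thus ?thesis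
   by (simp add: right_diff_distrib sc_left_commute[of "gen i"] sc_sc_mult mult.assoc mult.commute)
 qed simp
 have gS: "gc i u (Suc n) = 1 - s powi (2 * m) + s powi (2 * D i) * gc i u n" by (simp add: m_def)
 have "R 1 i (ads i u (Suc n) y) - sc (gc i u (Suc n)) * ads i u (Suc n - 1) y
   = ?Q * (gen i * r) - sc (s powi m) * (r * gen i)"
  unfolding R1 R2 gS using st'
  by (simp add: sc_add sc_diff distrib_right distrib_left algebra_simps del: gc.simps)
 also have "... \<in> N" by (intro ideal_diff ideal_left ideal_right assms r)
 finally show ?case .
qed (use assms in simp)

definition serre_elt :: "'g => 'g => 'g free_algebra" where
 "serre_elt i j = ads i (B i j) (nat (1 - C i j)) (gen j)"

text \<open>For l = i the coefficient \<open>gc\<close> vanishes at the Serre exponent. For l = j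
  the derivative is a multiple of a power of \<open>gen i\<close>, whose coefficient dies at the
  first commutator if t = 1 and at the last one if t = -1. For other l nothing is left at
  all.\<close>

lemma R_serre:
 assumes ij: "i \<in> I" "j \<in> I" "i ~= j" and l: "l \<in> I"
 shows "R (- 1) l (serre_elt i j) = 0" "R 1 l (serre_elt i j) = 0"
proof -
 define n where "n = nat (1 - C i j)"
 have n: "n > 0" "int n = 1 - C i j" using C_nonpos[OF ij] by (auto simp: n_def)
 have h: "hom i (B i j) (gen j)" by (auto intro: words_in_gen)
 have hl: "hom l (B l j + int m * B l i) (ads i (B i j) m (gen j))" for m
 proof (induction m)
  case (Suc m)
  have e: "B l j + int (Suc m) * B l i = B l j + int m * B l i + B l i" by (simp add: algebra_simps)
  show ?case unfolding ads.simps e by (intro hom_diff words_in_sc hom_gen_mult hom_mult_gen Suc)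
 qed (auto intro: words_in_gen)
 have "R (- 1) l (serre_elt i j) = 0 \<and> R 1 l (serre_elt i j) = 0"
 proof (cases "l = i")
  case True
  have "gc i (B i j) n = 0" using gc_eq_0[OF ij(1) n(1)] n(2) B_eq[OF ij(1,2)] by simp
  thus ?thesis
   using R_minus_ads[OF ij(1) h] R_plus_ads[OF ij(1) ideal_zero h, of n] ij(3) True
   by (simp add: serre_elt_def n_def[symmetric] R_gen)
 next
  case False
  show ?thesis
  proof (cases "l = j")
   case False
   have "R t l (ads i (B i j) m (gen j)) = 0" for t m
    using R_mult[OF hl] \<open>l ~= i\<close> False
    by (induction m) (simp_all add: R_diff R_gen_mult R_sc R_gen)
   thus ?thesis by (simp add: serre_elt_def)
  next
   case True
   have st: "R t l (ads i (B i j) (Suc m) (gen j))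
     = sc (s powi (t * B i j)) * (gen i * R t l (ads i (B i j) m (gen j)))
      - sc (s powi (B i j + 2 * D i * int m)) * (R t l (ads i (B i j) m (gen j)) * gen i)" for t m
    using R_mult[OF hl[of m], of t "gen i"] \<open>l ~= i\<close> True B_sym[OF ij(1,2)]
    by (simp add: R_diff R_gen_mult R_sc R_gen)
   have p: "R 1 l (ads i (B i j) (Suc m) (gen j)) = 0" for m
   proof (induction m)
    case 0
    show ?case unfolding st using True by (simp add: R_gen)
   next
    case (Suc m)
    show ?case unfolding st[of 1 "Suc m"] Suc by simp
   qed
   have "\<exists>c. R (- 1) l (ads i (B i j) m (gen j)) = sc c * gen i ^ m \<and> (int m > - C i j --> c = 0)" for m
   proof (induction m)
    case 0
    show ?case using True C_nonpos[OF ij] by (intro exI[of _ 1]) (auto simp: R_gen)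
   next
    case (Suc m)
    then obtain c where c: "R (- 1) l (ads i (B i j) m (gen j)) = sc c * gen i ^ m"
     "int m > - C i j --> c = 0" by blast
    have "R (- 1) l (ads i (B i j) (Suc m) (gen j))
     = sc (c * (s powi (- B i j) - s powi (B i j + 2 * D i * int m))) * gen i ^ Suc m"
     unfolding st c
     by (simp add: power_commutes sc_left_commute[of "gen i"] sc_sc_mult sc_diff left_diff_distrib
       right_diff_distrib mult.assoc mult.commute)
    moreover have "c * (s powi (- B i j) - s powi (B i j + 2 * D i * int m)) = 0" if "int (Suc m) > - C i j"
    proof (cases "int m > - C i j")
     case False
     hence "int m = - C i j" using that by simp
     hence e: "B i j + 2 * D i * int m = - B i j" by (simp add: B_eq[OF ij(1,2)])
     show ?thesis unfolding e by simp
    qed (use c in simp)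
    ultimately show ?case by blast
   qed
   from this[of n] n(2) have "R (- 1) l (serre_elt i j) = 0" by (auto simp: serre_elt_def n_def)
   moreover have "R 1 l (serre_elt i j) = 0"
    using p[of "n - 1"] n(1) by (simp add: serre_elt_def n_def[symmetric] del: ads.simps)
   ultimately show ?thesis by simp
  qed
 qed
 thus "R (- 1) l (serre_elt i j) = 0" "R 1 l (serre_elt i j) = 0" by auto
qed

text \<open>Each application shortens all words by one letter.\<close>

lemma R_nilpotent: "\<exists>n. (R t i ^^ n) y = 0"
proof -
 have len: "words_in (%v. length v < n) (R t i y)" if "words_in (%v. length v < Suc n) y" for n y
 proof -
  have "words_in (%v. Suc (length v) = length w) (Rw t i w)" for w
  proof (induction w)
   case (Cons l w)
   thus ?case unfolding Rw.simps
    by (intro words_in_add words_in_sc)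
     (auto intro: words_in_single words_in_mult[where P = "%u. u = [l]", OF words_in_gen])
  qed simp
  hence "words_in (%v. length v < n) (Rw t i w)" if "length w < Suc n" for w
   using that unfolding words_in_def by fastforce
  thus ?thesis unfolding R_def using words_in_word_ext[OF that] by blast
 qed
 have "words_in (%v. length v < n) y ==> (R t i ^^ n) y = 0" for n
 proof (induction n arbitrary: y)
  case 0
  hence "Poly_Mapping.keys y = {}" by (auto simp: words_in_def)
  thus ?case by simp
 next
  case (Suc n)
  show ?case unfolding funpow_Suc_right comp_def by (rule Suc.IH[OF len[OF Suc.prems]])
 qed
 moreover have "\<exists>n. words_in (%v. length v < n) y"
 proof -
  have "words_in (%v. length v < Suc (\<Sum>w\<in>Poly_Mapping.keys y. length (letters w))) y"
   unfolding words_in_def by (auto simp: less_Suc_eq_le intro: member_le_sum)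
  thus ?thesis by blast
 qed
 ultimately show ?thesis by blast
qed

end

text \<open>Later \<open>N\<close> is the set \<open>Ipos\<close> of positive elements that vanish
  in the loop algebra. Membership in \<open>N\<close> plays the role of equality in the positive
  part, and it is never asked whether the Serre relations generate \<open>N\<close>.\<close>

locale cartan_ideal = cartan_form +
 fixes N :: "'a free_algebra set"
 assumes N_ideal: "is_ideal N"
  and N_R: "!!i t y. i \<in> I ==> t = 1 \<or> t = - 1 ==> y \<in> N ==> R t i y \<in> N"
  and N_serre: "!!i j. i \<in> I ==> j \<in> I ==> i ~= j ==> serre_elt i j \<in> N"
  and N_out: "!!j. j \<notin> I ==> gen j \<in> N"
begin

lemmas N_add = ideal_add[OF N_ideal] and N_0 = ideal_0[OF N_ideal] and N_left = ideal_left[OF N_ideal]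
 and N_right = ideal_right[OF N_ideal] and N_diff = ideal_diff[OF N_ideal]
 and N_minus = ideal_minus[OF N_ideal] and N_cancel_sc = ideal_cancel_sc[OF N_ideal]
 and N_cong = ideal_cong[OF N_ideal]

lemma N_descent:
 assumes "!!n. (R t i ^^ Suc n) x \<in> N ==> (R t i ^^ n) x \<in> N"
 shows "x \<in> N"
proof -
 obtain T where "(R t i ^^ T) x = 0" using R_nilpotent by blast
 hence "(R t i ^^ T) x \<in> N" by (simp only: N_0)
 hence "(R t i ^^ 0) x \<in> N" by (induction T) (blast intro: assms)+
 thus ?thesis by simp
qed

text \<open>Applying \<open>R t j\<close> n times to the hypothesis expresses a multiple of the
  (n-1)-st derivative of \<open>x\<close> through the n-th one. The derivatives vanish eventually,
  so descent reaches \<open>x\<close> unless one of the multiples is zero; by the closed form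
  \<open>cl\<close> this is what \<open>nz\<close> excludes.\<close>

lemma skew_commutator_in_ideal:
 assumes j: "j \<in> I" and t: "t = 1 \<or> t = - 1" and x: "hom j u x"
  and ax: "gen j * x - sc \<theta> * (x * gen j) \<in> N"
  and nz: "!!a::nat. \<theta> * s powi (t * u) ~= s powi (2 * t * D j * int a)"
 shows "x \<in> N"
proof -
 let ?w = "2 * t * D j"
 let ?W = "%x. s powi (- ?w * x)"
 define xs where "xs n = (R t j ^^ n) x" for n
 define Y P where "Y = s powi (- ?w)" and "P = \<theta> * s powi (t * u)"
 define A where "A n = gen j * xs n - sc (\<theta> * ?W (int n)) * (xs n * gen j)" for n
 \<comment> \<open>The multiples in question. The recursion is read off from \<open>RA\<close> after
   division by \<open>s powi ?w\<close>, which is multiplication by \<open>Y\<close>.\<close>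
 define c where "c = rec_nat 0 (%n a. Y * (a - 1 + P * ?W (2 * int n)))"
 have c0: "c 0 = 0" and cS: "c (Suc n) = Y * (c n - 1 + P * ?W (2 * int n))" for n
  by (simp_all add: c_def)
 have xS: "xs (Suc n) = R t j (xs n)" for n by (simp add: xs_def)
 have h: "hom j (u - 2 * D j * int n) (xs n)" for n
 proof (induction n)
  case (Suc n)
  thus ?case using hom_R[OF Suc, of j t] B_diag[OF j] by (simp add: xS algebra_simps)
 qed (use x in "simp add: xs_def")
 have RA: "R t j (A n) = sc (1 - P * ?W (2 * int n)) * xs n
   + sc (s powi ?w) * A (Suc n)" for n
 proof -
  have e1: "\<theta> * ?W (int n) * s powi (t * (u - 2 * D j * int n))
    = P * ?W (2 * int n)"
   by (simp add: P_def s_powi_add[symmetric] algebra_simps)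
  have e2: "\<theta> * ?W (int n)
    = s powi ?w * (\<theta> * ?W (int (Suc n)))"
   by (simp add: s_powi_add[symmetric] algebra_simps)
  have "R t j (A n) = xs n + sc (s powi (t * B j j)) * (gen j * xs (Suc n))
    - sc (\<theta> * ?W (int n)) * (xs (Suc n) * gen j
     + sc (s powi (t * (u - 2 * D j * int n))) * xs n)"
   unfolding A_def R_diff R_sc R_mult[OF h] by (simp add: R_gen_mult R_gen xS)
  also have "... = xs n + sc (s powi ?w) * (gen j * xs (Suc n))
    - sc (s powi ?w * (\<theta> * ?W (int (Suc n)))) * (xs (Suc n) * gen j)
    - sc (P * ?W (2 * int n)) * xs n"
   unfolding e1[symmetric] e2[symmetric]
   by (simp add: distrib_left sc_sc_mult B_diag[OF j] mult.commute mult.left_commute)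
  also have "... = sc (1 - P * ?W (2 * int n)) * xs n
   + sc (s powi ?w) * A (Suc n)"
   unfolding A_def by (simp add: sc_diff left_diff_distrib right_diff_distrib sc_sc_mult)
  finally show ?thesis .
 qed
 have YI: "sc (Y * s powi ?w) * z = z" for z by (simp add: Y_def s_powi_add[symmetric])
 have YI': "sc (Y * s powi (t * (D j * 2))) * z = z" for z using YI[of z] by (simp add: ac_simps)
 have inN: "A n - sc (c n) * xs (n - 1) \<in> N" for n
 proof (induction n)
  case 0
  show ?case using ax by (simp add: A_def c0 xs_def)
 next
  case (Suc n)
  define r where "r = A n - sc (c n) * xs (n - 1)"
  have "R t j r \<in> N" using N_R[OF j t Suc] by (simp add: r_def)
  hence "sc Y * R t j r \<in> N" by (rule N_left)
  moreover have "sc Y * R t j r = A (Suc n) - sc (c (Suc n)) * xs (Suc n - 1)"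
  proof -
   have "sc (c n) * R t j (xs (n - 1)) = sc (c n) * xs n"
    by (cases n) (simp_all add: c0 xS)
   hence Rr: "R t j r = sc (1 - P * ?W (2 * int n)) * xs n
     + sc (s powi ?w) * A (Suc n) - sc (c n) * xs n"
    by (simp add: r_def R_diff R_sc RA)
   show ?thesis
    by (simp add: Rr cS distrib_left right_diff_distrib sc_sc_mult YI' sc_diff sc_add left_diff_distrib
      distrib_right algebra_simps)
  qed
  ultimately show ?case by simp
 qed
 have cl: "c n * (1 - Y) = - Y * (1 - ?W (int n))
   * (1 - P * ?W (int n - 1))" for n
 proof (induction n)
  case (Suc n)
  define U V where "U = ?W (int n)" and "V = ?W (int n - 1)"
  have 1: "?W (int (Suc n)) = Y * U"
   "?W (int (Suc n) - 1) = Y * V"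
   "?W (2 * int n) = Y * U * V"
   by (simp_all add: U_def V_def Y_def s_powi_add[symmetric] algebra_simps)
  have "c (Suc n) * (1 - Y) = Y * (c n * (1 - Y) + (P * (Y * U * V) - 1) * (1 - Y))"
   unfolding cS 1 by (simp add: algebra_simps)
  also have "... = Y * (- Y * (1 - U) * (1 - P * V) + (P * (Y * U * V) - 1) * (1 - Y))"
   using Suc by (simp add: U_def V_def)
  also have "... = - Y * (1 - Y * U) * (1 - P * (Y * V))"
  proof -
   have "U = Y * V" by (simp add: U_def V_def Y_def s_powi_add[symmetric] algebra_simps)
   thus ?thesis by (simp add: algebra_simps)
  qed
  finally show ?case unfolding 1 .
 qed (simp add: c0)
 have c_nz: "c (Suc n) ~= 0" for n
 proof
  assume "c (Suc n) = 0"
  hence "Y = 0 \<or> 1 = ?W (int (Suc n))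
    \<or> 1 = P * ?W (int n)" using cl[of "Suc n"] by auto
  moreover have "Y ~= 0" unfolding Y_def by (rule s_powi_nz)
  moreover have "1 ~= ?W (int (Suc n))"
   using s_powi_eq_1[of "- ?w * int (Suc n)"] D_pos[OF j] t by auto
  moreover have "1 ~= P * ?W (int n)"
  proof
   assume a: "1 = P * ?W (int n)"
   have "s powi (?w * int n) = P * (?W (int n) * s powi (?w * int n))"
    using a by (metis mult.assoc mult_1)
   thus False using nz[of n] by (simp add: P_def s_powi_add[symmetric])
  qed
  ultimately show False by blast
 qed
 show ?thesis
 proof (rule N_descent[of t j])
  fix n assume "(R t j ^^ Suc n) x \<in> N"
  hence "xs (Suc n) \<in> N" by (simp only: xs_def)
  hence "A (Suc n) \<in> N" unfolding A_def by (intro N_diff N_left N_right)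
  hence "sc (c (Suc n)) * xs n \<in> N" using inN[of "Suc n"] N_cong by simp
  thus "(R t j ^^ n) x \<in> N" using N_cancel_sc c_nz by (simp add: xs_def)
 qed
qed

text \<open>\<open>kerR i u\<close> is the part of weight \<open>u\<close> of the subalgebra generated by the elements
 \<open>ads i (B i j) n (gen j)\<close> with \<open>j \<noteq> i\<close>; it is killed by \<open>R (- 1) i\<close>, and iterated skew commutators with
 \<open>gen i\<close> are nilpotent on it modulo the Serre relations.\<close>

inductive kerR :: "'a => int => 'a free_algebra => bool" for i where
 one: "kerR i 0 1"
| gen: "kerR i u y ==> j ~= i ==> kerR i (u + B i j) (gen j * y)"
| ad: "kerR i u y ==> kerR i (u + B i i) (gen i * y - sc (s powi u) * (y * gen i))"
| add: "kerR i u x ==> kerR i u y ==> kerR i u (x + y)"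
| scale: "kerR i u y ==> kerR i u (sc c * y)"

lemma kerR_hom: "kerR i u y ==> hom i u y"
 by (induction rule: kerR.induct)
  (auto intro: words_in_const[where c = 1, simplified] words_in_add words_in_sc hom_gen_mult hom_mult_gen hom_diff)

lemma kerR_R:
 assumes "i \<in> I" "kerR i u y" shows "R (- 1) i y = 0"
 using assms(2)
proof (induction rule: kerR.induct)
 case (ad u y)
 thus ?case using R_minus_ads[OF assms(1) kerR_hom[OF ad(1)], of 1] by simp
qed (simp_all add: R_gen_mult R_add R_sc)

text \<open>Skew Leibniz rule for the q-adjoint action, with induction on m + n: each commutator
  falls on one of the two factors, so after m + n of them one factor has been hit often
  enough.\<close>

lemma ads_mult_in_ideal:
 assumes i: "i \<in> I"
  and "hom i u x" "ads i u m x \<in> N" "hom i v y" "ads i v n y \<in> N"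
 shows "ads i (u + v) (m + n) (x * y) \<in> N"
 using assms(2-)
proof (induction "m + n" arbitrary: u v m n x y)
 case 0
 thus ?case by (auto intro: N_right)
next
 case (Suc k)
 show ?case
 proof (cases "m = 0 \<or> n = 0")
  case True
  hence "x * y \<in> N" using Suc.prems N_left N_right by auto
  thus ?thesis by (rule ideal_ads[OF N_ideal])
 next
  case False
  then obtain m' n' where mn: "m = Suc m'" "n = Suc n'" by (metis not0_implies_Suc)
  have split: "ads i (u + v) 1 (x * y) = ads i u 1 x * y + sc (s powi u) * (x * ads i v 1 y)"
   by (simp add: algebra_simps s_powi_add sc_sc_mult sc_left_commute[of x])
  have hx: "hom i (u + 2 * D i) (ads i u 1 x)" "hom i (v + 2 * D i) (ads i v 1 y)"
   using hom_ads[OF i Suc.prems(1), of 1] hom_ads[OF i Suc.prems(3), of 1] by simp_all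
  have "ads i (u + 2 * D i + v) (m' + n) (ads i u 1 x * y) \<in> N"
  proof (intro Suc.hyps(1) hx Suc.prems)
   show "k = m' + n" using Suc.hyps(2) mn by simp
   show "ads i (u + 2 * D i) m' (ads i u 1 x) \<in> N"
    using Suc.prems(2) unfolding mn ads_Suc_shift .
  qed
  moreover have "ads i (u + (v + 2 * D i)) (m + n') (x * ads i v 1 y) \<in> N"
  proof (intro Suc.hyps(1) hx Suc.prems)
   show "k = m + n'" using Suc.hyps(2) mn by simp
   show "ads i (v + 2 * D i) n' (ads i v 1 y) \<in> N"
    using Suc.prems(4) unfolding mn ads_Suc_shift .
  qed
  moreover have "m + n = Suc (m' + n)" "m' + n = m + n'" "u + 2 * D i + v = u + v + 2 * D i"
   "u + (v + 2 * D i) = u + v + 2 * D i" using mn by simp_all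
  ultimately show ?thesis
   unfolding \<open>m + n = Suc (m' + n)\<close> ads_Suc_shift split ads_add ads_sc
   by (metis N_add N_left)
 qed
qed

text \<open>Local nilpotency of the q-adjoint action: on the letters it is the Serre relation, and
  \<open>ads_mult_in_ideal\<close> carries it through products.\<close>

lemma kerR_nilpotent:
 assumes "i \<in> I" "kerR i u y" shows "\<exists>n. ads i u n y \<in> N"
 using assms(2)
proof (induction rule: kerR.induct)
 case one
 have "ads i 0 1 1 \<in> N" by (simp add: N_0)
 thus ?case by blast
next
 case (gen u y j)
 have "\<exists>m. ads i (B i j) m (gen j) \<in> N"
 proof (cases "j \<in> I")
  case True
  thus ?thesis using N_serre[OF assms(1) True] gen.hyps by (auto simp: serre_elt_def)
 next
  case False
  thus ?thesis using N_out[of j] by (intro exI[of _ 0]) simp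
 qed
 then obtain m where "ads i (B i j) m (gen j) \<in> N" by blast
 moreover obtain n where "ads i u n y \<in> N" using gen.IH by blast
 ultimately have "ads i (B i j + u) (m + n) (gen j * y) \<in> N"
  by (intro ads_mult_in_ideal[OF assms(1) _ _ kerR_hom[OF gen.hyps(1)]]) (auto intro: words_in_gen)
 thus ?case by (auto simp: add.commute)
next
 case (ad u y)
 then obtain n where "ads i u n y \<in> N" by blast
 hence "ads i u (Suc n) y \<in> N" by (auto intro: N_diff N_left N_right)
 thus ?case unfolding ads_Suc_shift B_diag[OF assms(1)] by auto
next
 case (add u x y)
 then obtain m n where "ads i u m x \<in> N" "ads i u n y \<in> N" by blast
 moreover have "ads i u k z \<in> N ==> ads i u (k + l) z \<in> N" for k l z
  by (induction l) (auto intro: N_diff N_left N_right)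
 ultimately have "ads i u (m + n) (x + y) \<in> N"
  by (metis N_add add.commute ads_add)
 thus ?case by blast
next
 case (scale u y c)
 thus ?case by (auto simp: ads_sc intro: N_left)
qed


text \<open>A letter \<open>gen i\<close> in front of \<open>y\<close> is traded for a commutator,
  which stays in \<open>kerR\<close>, and a copy of \<open>y\<close> followed by
  \<open>gen i\<close>, which joins the second summand. All other letters are simply
  prefixed.\<close>

lemma word_kerR_decomp:
 assumes i: "i \<in> I"
 shows "\<exists>y x. kerR i (wt i w) y \<and> hom i (wt i w - B i i) x
   \<and> sgl (Word w) 1 = y + x * gen i"
proof (induction w)
 case Nil
 show ?case by (intro exI[of _ 1] exI[of _ 0]) (auto intro: kerR.one simp: zero_word_def[symmetric])
next
 case (Cons l w)
 then obtain y x where yx: "kerR i (wt i w) y" "hom i (wt i w - B i i) x"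
  "sgl (Word w) 1 = y + x * gen i" by blast
 have h: "hom i (wt i (l # w) - B i i) (gen l * x)"
  using hom_gen_mult[OF yx(2), of l] by (simp add: algebra_simps)
 have e: "sgl (Word (l # w)) 1 = gen l * y + gen l * x * gen i"
  unfolding single_word_Cons yx by (simp add: distrib_left mult.assoc)
 show ?case
 proof (cases "l = i")
  case False
  thus ?thesis using kerR.gen[OF yx(1) False] h e by (auto simp: add.commute)
 next
  case True
  have "sgl (Word (l # w)) 1 = (gen i * y - sc (s powi wt i w) * (y * gen i))
    + (sc (s powi wt i w) * y + gen l * x) * gen i"
   unfolding e unfolding True by (simp add: distrib_right mult.assoc)
  moreover have "hom i (wt i (l # w) - B i i) (sc (s powi wt i w) * y + gen l * x)"
   using kerR_hom[OF yx(1)] True by (intro words_in_add[OF words_in_sc h]) simp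
  ultimately show ?thesis using kerR.ad[OF yx(1)] True by (metis add.commute wt_simps(2))
 qed
qed

lemma kerR_decomp:
 assumes i: "i \<in> I" and z: "hom i u z"
 shows "\<exists>y x. (kerR i u y \<or> y = 0) \<and> hom i (u - B i i) x \<and> z = y + x * gen i"
 using z
proof (induction rule: words_in_induct)
 case zero
 show ?case by (intro exI[of _ 0]) auto
next
 case (single w c)
 obtain y x where yx: "kerR i (wt i w) y" "hom i (wt i w - B i i) x"
  "sgl (Word w) 1 = y + x * gen i" using word_kerR_decomp[OF i] by blast
 have "sgl (Word w) c = sc c * sgl (Word w) 1"
  by (simp add: sc_def mult_single)
 hence "sgl (Word w) c = sc c * y + (sc c * x) * gen i"
  by (simp add: yx(3) distrib_left mult.assoc)
 thus ?case using kerR.scale[OF yx(1), of c] words_in_sc[OF yx(2), of c] single by blast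
next
 case (add z z')
 then obtain y x y' x' where "kerR i u y \<or> y = 0" "hom i (u - B i i) x" "z = y + x * gen i"
   "kerR i u y' \<or> y' = 0" "hom i (u - B i i) x'" "z' = y' + x' * gen i" by metis
 moreover from this have "kerR i u (y + y') \<or> y + y' = 0" by (auto intro: kerR.add)
 ultimately show ?case
  by (intro exI[of _ "y + y'"] exI[of _ "x + x'"]) (auto intro: words_in_add simp: algebra_simps)
qed

text \<open>On the last derivative of \<open>x\<close> outside \<open>N\<close>, right
  multiplication by \<open>gen i\<close> followed by \<open>R (- 1) i\<close> is a power of
  \<open>s\<close> times a geometric sum, which is nonzero since \<open>s\<close> is not a root of
  unity. Descent through the derivatives then gives the claim for \<open>x\<close>.\<close>

lemma right_multiple_in_ideal:
 assumes i: "i \<in> I" and x: "hom i u x" and h: "R (- 1) i (x * gen i) \<in> N"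
 shows "x \<in> N"
proof -
 define xs where "xs n = (R (- 1) i ^^ n) x" for n
 have xS: "xs (Suc n) = R (- 1) i (xs n)" for n by (simp add: xs_def)
 have hx: "hom i (u - 2 * D i * int n) (xs n)" for n
 proof (induction n)
  case (Suc n)
  thus ?case using hom_R[OF Suc, of i "- 1"] B_diag[OF i] by (simp add: xS algebra_simps)
 qed (use x in "simp add: xs_def")
 define c where "c n = s powi (- u) * (\<Sum>k\<le>n. s powi (2 * D i * int k))" for n
 have c: "c n ~= 0" for n
 proof
  define X where "X = s powi (2 * D i)"
  have X: "s powi (2 * D i * int k) = X ^ k" for k by (simp add: X_def power_int_mult)
  have "X ~= 1" using s_powi_eq_1[of "2 * D i"] D_pos[OF i] by (simp add: X_def)
  moreover have "X ^ Suc n ~= 1" using s_powi_eq_1[of "2 * D i * int (Suc n)"] D_pos[OF i] X[of "Suc n"] by auto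
  moreover assume "c n = 0"
  hence "(\<Sum>k\<le>n. X ^ k) = 0" unfolding c_def X using s_powi_nz mult_eq_0_iff by metis
  ultimately show False using geometric_sum[of X "Suc n"] by (simp add: lessThan_Suc_atMost)
 qed
 have inN: "xs (Suc n) * gen i + sc (c n) * xs n \<in> N" for n
 proof (induction n)
  case 0
  show ?case using h R_mult[OF x, of "- 1" "gen i"] by (simp add: R_gen xs_def c_def)
 next
  case (Suc n)
  have e: "s powi (- u) * s powi (2 * D i * int (Suc n)) = s powi (- (u - 2 * D i * int (Suc n)))"
   by (simp add: s_powi_add[symmetric] algebra_simps)
  have "R (- 1) i (xs (Suc n) * gen i + sc (c n) * xs n)
    = xs (Suc (Suc n)) * gen i + sc (s powi (- (u - 2 * D i * int (Suc n))) + c n) * xs (Suc n)"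
   unfolding R_add R_sc R_mult[OF hx] by (simp add: R_gen xS sc_add distrib_right add.assoc)
  also have "s powi (- (u - 2 * D i * int (Suc n))) + c n = c (Suc n)"
   unfolding e[symmetric] by (simp add: c_def distrib_left)
  finally show ?case using N_R[OF i _ Suc, of "- 1"] by simp
 qed
 show ?thesis
 proof (rule N_descent[of "- 1" i])
  fix n assume "(R (- 1) i ^^ Suc n) x \<in> N"
  hence "xs (Suc n) \<in> N" by (simp only: xs_def)
  hence "(xs (Suc n) * gen i + sc (c n) * xs n) - xs (Suc n) * gen i \<in> N" by (intro N_diff inN N_right)
  hence "sc (c n) * xs n \<in> N" by simp
  thus "(R (- 1) i ^^ n) x \<in> N" using N_cancel_sc c by (simp add: xs_def)
 qed
qed

text \<open>Analogue of the vanishing of lowest weight vectors of positive weight in an integrable module.\<close>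

lemma positive_weight_in_ideal:
 assumes i: "i \<in> I" and z: "hom i u z" and u: "u > 0"
  and Rz: "R (- 1) i z \<in> N" "R 1 i z \<in> N"
 shows "z \<in> N"
proof -
 obtain y x where yx: "kerR i u y \<or> y = 0" "hom i (u - B i i) x" "z = y + x * gen i"
  using kerR_decomp[OF i z] by blast
 \<comment> \<open>\<open>R (- 1) i\<close> kills the \<open>kerR\<close> part \<open>y\<close>, so
   the second summand is annihilated on its own and drops out. What is left of \<open>z\<close> is
   nilpotent for the q-adjoint action.\<close>
 have "R (- 1) i (x * gen i) \<in> N"
  using Rz(1) yx kerR_R[OF i] by (auto simp: R_add)
 hence "x * gen i \<in> N" by (intro N_right right_multiple_in_ideal[OF i yx(2)])
 moreover have "\<exists>n. ads i u n y \<in> N"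
  using yx(1) kerR_nilpotent[OF i] N_0 by (auto simp: ads_0)
 ultimately obtain n where "ads i u n z \<in> N"
  unfolding yx(3) ads_add using ideal_ads[OF N_ideal] N_add by blast
 thus ?thesis
 \<comment> \<open>Nilpotency is undone one commutator at a time by \<open>R 1 i\<close>: the
   coefficient \<open>gc i u (Suc n)\<close> could vanish only at a weight that is not
   positive.\<close>
 proof (induction n)
  case (Suc n)
  have "R 1 i (ads i u (Suc n) z) \<in> N" by (rule N_R[OF i _ Suc.prems]) simp
  hence "sc (gc i u (Suc n)) * ads i u n z \<in> N"
   using R_plus_ads[OF i N_ideal z Rz(2), of "Suc n"] N_cong by auto
  moreover have "gc i u (Suc n) ~= 0"
  proof
   assume "gc i u (Suc n) = 0"
   hence "u = - (D i * int n)" using gc_eq_0[OF i, of "Suc n" u] by simp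
   moreover have "D i * int n \<ge> 0" using D_pos[OF i] by simp
   ultimately show False using u by simp
  qed
  ultimately have "ads i u n z \<in> N" by (rule N_cancel_sc)
  thus ?case by (rule Suc.IH)
 qed simp
qed

end

section \<open>Quantum binomials and the coefficients of the Serre relations\<close>

definition q_int :: "complex => int => nat => complex" where
 "q_int s c n = (s powi (c * int n) - s powi (- (c * int n))) / (s powi c - s powi (- c))"

definition q_fact :: "complex => int => nat => complex" where
 "q_fact s c n = (\<Prod>r=1..n. q_int s c r)"

definition q_binom :: "complex => int => nat => nat => complex" where
 "q_binom s c n r = q_fact s c n / (q_fact s c r * q_fact s c (n - r))"

context cartan_form begin

lemma q_int_nz: assumes "c > 0" "n > 0" shows "q_int s c n ~= 0"
proof -
 have "s powi (c * int n) ~= s powi (- (c * int n))" "s powi c ~= s powi (- c)"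
  using assms by (simp_all add: s_powi_cancel)
 thus ?thesis by (simp add: q_int_def)
qed

lemma q_fact_nz: "c > 0 ==> q_fact s c n ~= 0"
 by (auto simp: q_fact_def q_int_nz)
lemma q_fact_Suc: "q_fact s c (Suc n) = q_int s c (Suc n) * q_fact s c n"
 by (simp add: q_fact_def mult.commute)
lemma q_fact_0 [simp]: "q_fact s c 0 = 1" by (simp add: q_fact_def)

lemma q_int_add:
 "q_int s c (m + n) = s powi (- (c * int n)) * q_int s c m + s powi (c * int m) * q_int s c n"
proof -
 have "s powi (- (c * int n)) * (s powi (c * int m) - s powi (- (c * int m)))
   + s powi (c * int m) * (s powi (c * int n) - s powi (- (c * int n)))
  = s powi (c * int (m + n)) - s powi (- (c * int (m + n)))"
  by (simp add: algebra_simps s_powi_add[symmetric])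
 thus ?thesis by (simp add: q_int_def add_divide_distrib[symmetric])
qed

lemma q_pascal:
 assumes "c > 0" "r < n"
 shows "q_binom s c (Suc n) (Suc r)
  = s powi (- (c * int (Suc r))) * q_binom s c n (Suc r) + s powi (c * int (n - r)) * q_binom s c n r"
proof -
 obtain m where n: "n = Suc (r + m)" using assms(2) less_iff_Suc_add by blast
 have "q_int s c (Suc n) = s powi (- (c * int (Suc r))) * q_int s c (Suc m) + s powi (c * int (Suc m)) * q_int s c (Suc r)"
  using q_int_add[of c "Suc m" "Suc r"] n by (simp add: ac_simps)
 thus ?thesis
  using q_fact_nz[OF assms(1)] q_int_nz[OF assms(1)]
  by (simp add: q_binom_def n q_fact_Suc field_simps)
qed

lemma q_binom_0: "c > 0 ==> q_binom s c n 0 = 1" and q_binom_n: "c > 0 ==> q_binom s c n n = 1"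
 using q_fact_nz by (simp_all add: q_binom_def)

text \<open>The q-binomial formula for left and right multiplication by \<open>gen i\<close>; the
  two terms of the Pascal rule correspond to the two terms of a commutator.\<close>

lemma ads_expand:
 assumes i: "i \<in> I"
 shows "ads i u n y = (\<Sum>r\<le>n. sc ((- 1) ^ r * s powi (int r * (u + D i * (int n - 1))) * q_binom s (D i) n r)
  * (gen i ^ (n - r) * y * gen i ^ r))"
proof (induction n)
 case 0
 show ?case using q_binom_0[OF D_pos[OF i]] by simp
next
 case (Suc n)
 define cf where "cf m r = (- 1) ^ r * s powi (int r * (u + D i * (int m - 1))) * q_binom s (D i) m r" for m r
 define z where "z a r = gen i ^ a * y * gen i ^ r" for a r
 let ?v = "u + 2 * D i * int n"
 let ?t = "%r. sc (s powi ?v * cf n r) * z (n - r) (Suc r)"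
 have c1: "cf (Suc n) 0 = 1" "cf n 0 = 1" using q_binom_0[OF D_pos[OF i]] by (simp_all add: cf_def)
 have c2: "cf (Suc n) (Suc n) = - (s powi ?v * cf n n)"
  using q_binom_n[OF D_pos[OF i]] by (simp add: cf_def s_powi_add[symmetric] algebra_simps)
 have c3: "cf (Suc n) (Suc r) = cf n (Suc r) - s powi ?v * cf n r" if "r < n" for r
 proof -
  have 1: "s powi (int (Suc r) * (u + D i * (int (Suc n) - 1))) * s powi (- (D i * int (Suc r)))
    = s powi (int (Suc r) * (u + D i * (int n - 1)))"
   by (simp add: s_powi_add[symmetric] algebra_simps)
  have 2: "s powi (int (Suc r) * (u + D i * (int (Suc n) - 1))) * s powi (D i * int (n - r))
    = s powi ?v * s powi (int r * (u + D i * (int n - 1)))"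
   using that by (simp add: s_powi_add[symmetric] algebra_simps of_nat_diff)
  have "cf (Suc n) (Suc r) = (- 1) ^ Suc r * ((s powi (int (Suc r) * (u + D i * (int (Suc n) - 1)))
     * s powi (- (D i * int (Suc r)))) * q_binom s (D i) n (Suc r)
    + (s powi (int (Suc r) * (u + D i * (int (Suc n) - 1))) * s powi (D i * int (n - r))) * q_binom s (D i) n r)"
   unfolding cf_def q_pascal[OF D_pos[OF i] that] by (simp add: algebra_simps)
  also have "... = cf n (Suc r) - s powi ?v * cf n r"
   unfolding 1 2 by (simp add: cf_def algebra_simps)
  finally show ?thesis .
 qed
 have "ads i u (Suc n) y = (\<Sum>r\<le>n. sc (cf n r) * z (Suc n - r) r)
   - (\<Sum>r\<le>n. ?t r)"
 proof -
  have "gen i * (sc (cf n r) * z (n - r) r) = sc (cf n r) * z (Suc n - r) r" if "r \<le> n" for r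
   using that by (simp add: z_def sc_left_commute[of "gen i"] Suc_diff_le mult.assoc)
  moreover have "sc (s powi ?v) * (sc (cf n r) * z (n - r) r * gen i)
   = ?t r" for r
   by (simp add: z_def sc_sc_mult mult.assoc power_commutes)
  ultimately show ?thesis
   unfolding ads.simps Suc cf_def[symmetric] z_def[symmetric]
   by (simp add: sum_distrib_left sum_distrib_right)
 qed
 also have "(\<Sum>r\<le>n. sc (cf n r) * z (Suc n - r) r)
   = z (Suc n) 0 + (\<Sum>r<n. sc (cf n (Suc r)) * z (n - r) (Suc r))"
  by (simp add: lessThan_Suc_atMost[symmetric] sum.lessThan_Suc_shift c1 del: sum.lessThan_Suc)
 also have "(\<Sum>r\<le>n. ?t r)
   = (\<Sum>r<n. ?t r)
    - sc (cf (Suc n) (Suc n)) * z 0 (Suc n)"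
  by (simp add: lessThan_Suc_atMost[symmetric] c2 sc_minus)
 also have "z (Suc n) 0 + (\<Sum>r<n. sc (cf n (Suc r)) * z (n - r) (Suc r))
   - ((\<Sum>r<n. ?t r)
    - sc (cf (Suc n) (Suc n)) * z 0 (Suc n))
   = z (Suc n) 0 + (\<Sum>r<n. sc (cf (Suc n) (Suc r)) * z (n - r) (Suc r))
    + sc (cf (Suc n) (Suc n)) * z 0 (Suc n)"
 proof -
  have "(\<Sum>r<n. sc (cf (Suc n) (Suc r)) * z (n - r) (Suc r))
    = (\<Sum>r<n. sc (cf n (Suc r)) * z (n - r) (Suc r))
     - (\<Sum>r<n. ?t r)"
   by (simp add: sum_subtractf[symmetric] c3 sc_diff left_diff_distrib)
  thus ?thesis by (simp add: algebra_simps)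
 qed
 also have "... = (\<Sum>r\<le>Suc n. sc (cf (Suc n) r) * z (Suc n - r) r)"
  by (simp add: sum.atMost_Suc_shift c1 del: sum.atMost_Suc)
    (simp add: lessThan_Suc_atMost[symmetric])
 finally show ?case by (simp add: cf_def z_def)
qed

text \<open>At n = 1 - C i j and \<open>u = B i j\<close> the exponent
  \<open>u + D i * (n - 1)\<close> of \<open>ads_expand\<close> vanishes, so the iterated commutator
  has exactly the coefficients of the quantum Serre relation.\<close>

lemma serre_elt_expand:
 assumes "i \<in> I" "j \<in> I" "i ~= j"
 shows "serre_elt i j = (\<Sum>r\<le>nat (1 - C i j). sc ((- 1) ^ r * q_binom s (D i) (nat (1 - C i j)) r)
  * (gen i ^ (nat (1 - C i j) - r) * gen j * gen i ^ r))"
proof -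
 have "B i j + D i * (int (nat (1 - C i j)) - 1) = 0"
  using C_nonpos[OF assms] B_eq[OF assms(1,2)] by simp
 thus ?thesis
  unfolding serre_elt_def ads_expand[OF assms(1)] by simp
qed

end

section \<open>Twisted Dynkin data\<close>

lemma cartan_A: "i \<in> {1..m} ==> j \<in> {1..m} ==>
  cartan (A m) i j = (if i = j then 2 else if j = i + 1 \<or> i = j + 1 then - 1 else 0)"
 by (auto simp: cartan_def)

lemma cartan_D: "m \<ge> 4 ==> i \<in> {1..m} ==> j \<in> {1..m} ==>
  cartan (D m) i j = (if i = j then 2
   else if (j = i + 1 \<and> j \<le> m - 1) \<or> (i = j + 1 \<and> i \<le> m - 1) \<or> (i = m - 2 \<and> j = m) \<or> (i = m \<and> j = m - 2)
   then - 1 else 0)"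
 by (auto simp: cartan_def)

lemma cartan_sym: "cartan X i j = cartan X j i" by (auto simp: cartan_def)
lemma cartan_values: "cartan X i j \<in> {2, - 1, 0}" "i ~= j ==> cartan X i j \<in> {- 1, 0}"
 by (auto simp: cartan_def)
lemma cartan_diag: "cartan X i i = 2" by (simp add: cartan_def)

lemma finite_nodes: "finite (nodes X)" by (cases X) auto

context twisted_datum begin

lemma s_nz: "s ~= 0" using s q(1) by auto
lemma s_gen: "n > 0 ==> s ^ n ~= 1"
 by (metis q(2) s power_mult power_one mult.commute)

lemma M_pos: "M > 1" using M by auto

lemma \<sigma>_nodes: "\<sigma> i \<in> nodes X \<longleftrightarrow> i \<in> nodes X"
 using perm permutes_in_image by metis
lemma \<sigma>_inj: "\<sigma> i = \<sigma> j \<longleftrightarrow> i = j"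
 using perm permutes_inj by (metis injD)
lemma \<sigma>_pow_nodes: "(\<sigma> ^^ r) i \<in> nodes X \<longleftrightarrow> i \<in> nodes X"
 by (induction r) (auto simp: \<sigma>_nodes)
lemma \<sigma>_pow_M: "(\<sigma> ^^ (M * a)) i = i"
 by (induction a) (simp_all add: funpow_add order)
lemma \<sigma>_pow_mod: "(\<sigma> ^^ r) i = (\<sigma> ^^ (r mod M)) i"
proof -
 have "(\<sigma> ^^ r) i = (\<sigma> ^^ (r mod M + M * (r div M))) i" by simp
 also have "... = (\<sigma> ^^ (r mod M)) i" unfolding funpow_add by (simp add: \<sigma>_pow_M)
 finally show ?thesis .
qed
lemma \<sigma>_surj: "\<exists>i. j = \<sigma> i"
 using permutes_surj[OF perm] by (metis surjD)
lemma \<sigma>_preimage: assumes "j \<in> nodes X" obtains i where "i \<in> nodes X" "j = \<sigma> i"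
 using \<sigma>_surj[of j] assms \<sigma>_nodes by metis

lemma aut_\<sigma>: "i \<in> nodes X ==> j \<in> nodes X ==> cartan X (\<sigma> i) (\<sigma> j) = cartan X i j"
 using aut by blast

lemma aut_pow: "i \<in> nodes X ==> j \<in> nodes X ==> cartan X ((\<sigma> ^^ r) i) ((\<sigma> ^^ r) j) = cartan X i j"
 by (induction r) (auto simp: aut_\<sigma> \<sigma>_pow_nodes)

lemma orbit_alt: "orbit i = range (%r. (\<sigma> ^^ r) i)"
proof -
 have "(\<sigma> ^^ r) i \<in> orbit i" for r
  unfolding orbit_def using \<sigma>_pow_mod[of r i] M_pos mod_less_divisor[of M r] by auto
 thus ?thesis by (auto simp: orbit_def)
qed
lemma finite_orbit: "finite (orbit i)" by (simp add: orbit_def)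
lemma orbit_self: "i \<in> orbit i" unfolding orbit_alt by (rule range_eqI[of _ _ 0]) simp
lemma orbit_pow: "(\<sigma> ^^ r) i \<in> orbit i" by (simp add: orbit_alt)
lemma orbit_eq: assumes "j \<in> orbit i" shows "orbit j = orbit i"
proof -
 obtain r where r: "j = (\<sigma> ^^ r) i" using assms by (auto simp: orbit_alt)
 have 1: "(\<sigma> ^^ a) j = (\<sigma> ^^ (a + r)) i" for a by (simp add: r funpow_add)
 have 2: "(\<sigma> ^^ a) i = (\<sigma> ^^ (a + (M - 1) * r)) j" for a
 proof -
  have "a + (M - 1) * r + r = a + M * r" using M_pos by (cases M) auto
  hence "(\<sigma> ^^ (a + (M - 1) * r)) j = (\<sigma> ^^ (a + M * r)) i" unfolding 1 by (rule arg_cong)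
  thus ?thesis by (simp add: funpow_add \<sigma>_pow_M)
 qed
 show ?thesis unfolding orbit_alt
 proof (intro equalityI subsetI)
  fix x assume "x \<in> range (%r. (\<sigma> ^^ r) j)" thus "x \<in> range (%r. (\<sigma> ^^ r) i)" by (auto simp: 1)
 next
  fix x assume "x \<in> range (%r. (\<sigma> ^^ r) i)"
  then obtain a where "x = (\<sigma> ^^ a) i" by blast
  thus "x \<in> range (%r. (\<sigma> ^^ r) j)" unfolding 2 by blast
 qed
qed
lemma rep_in_orbit: "rep i \<in> orbit i"
 unfolding rep_def using finite_orbit orbit_self by (metis Min_in empty_iff)
lemma rep_eq_iff: "rep i = rep j \<longleftrightarrow> j \<in> orbit i"
proof
 assume "rep i = rep j"
 hence "orbit i = orbit j" using rep_in_orbit orbit_eq by metis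
 thus "j \<in> orbit i" using orbit_self by simp
next
 assume "j \<in> orbit i" thus "rep i = rep j" by (simp add: rep_def orbit_eq)
qed
lemma rep_pow: "rep ((\<sigma> ^^ r) i) = rep i" by (metis rep_eq_iff orbit_pow)
lemma orbit_nodes: "i \<in> nodes X ==> orbit i \<subseteq> nodes X" by (auto simp: orbit_alt \<sigma>_pow_nodes)
lemma rep_nodes: "i \<in> nodes X ==> rep i \<in> nodes X" using rep_in_orbit orbit_nodes by blast
lemma rep_rep: "rep (rep i) = rep i" using rep_in_orbit rep_eq_iff by metis
lemma Isig_iff: "i \<in> Isig \<longleftrightarrow> i \<in> nodes X \<and> rep i = i"
 unfolding Isig_def using rep_nodes rep_rep by (metis image_iff)
lemma finite_Isig: "finite Isig" unfolding Isig_def using finite_nodes by blast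
lemma finite_Ihat: "finite Ihat" unfolding Ihat_def using finite_Isig by blast

lemma pow_fixed: "\<sigma> i = i ==> (\<sigma> ^^ r) i = i" by (induction r) auto
lemma orbit_fixed: "\<sigma> i = i ==> orbit i = {i}" by (auto simp: orbit_alt pow_fixed)

text \<open>\<open>M\<close> is prime, so the orbit of a moved node has full length.\<close>

lemma pow_neq: assumes "\<sigma> i ~= i" "0 < r" "r < M" shows "(\<sigma> ^^ r) i ~= i"
proof
 assume h: "(\<sigma> ^^ r) i = i"
 have o3: "M = 3 ==> \<sigma> (\<sigma> (\<sigma> i)) = i"
  using order(1) by (metis comp_apply eq_id_iff funpow.simps(2) funpow_0 numeral_3_eq_3)
 consider "M = 2" "r = 1" | "M = 3" "r = 1" | "M = 3" "r = 2" using M assms by force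
 thus False
 proof cases
  case 1
  thus False using h assms(1) by (metis funpow_simps_right(2) funpow_0 comp_apply One_nat_def)
 next
  case 2
  thus False using h assms(1) by (metis funpow_simps_right(2) funpow_0 comp_apply One_nat_def)
 next
  case 3
  hence "\<sigma> (\<sigma> i) = i" using h by (simp add: numeral_2_eq_2)
  thus False using o3 3 assms by simp
 qed
qed

lemma pow_inj: assumes "\<sigma> i ~= i" shows "inj_on (%r. (\<sigma> ^^ r) i) {..<M}"
proof -
 have F: False if "(\<sigma> ^^ a) i = (\<sigma> ^^ b) i" "a < b" "b < M" for a b
 proof -
  have "(\<sigma> ^^ a) ((\<sigma> ^^ (b - a)) i) = (\<sigma> ^^ a) i"
   using that by (metis funpow_add comp_apply le_add_diff_inverse less_imp_le)
  moreover have "(\<sigma> ^^ a) x = (\<sigma> ^^ a) y ==> x = y" for x y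
   by (induction a) (auto simp: \<sigma>_inj)
  ultimately have "(\<sigma> ^^ (b - a)) i = i" by blast
  thus False using pow_neq[OF assms, of "b - a"] that by simp
 qed
 show ?thesis
 proof (rule inj_onI)
  fix a b assume ab: "a \<in> {..<M}" "b \<in> {..<M}" "(\<sigma> ^^ a) i = (\<sigma> ^^ b) i"
  show "a = b"
   using F[OF ab(3)] F[OF ab(3)[symmetric]] ab(1,2) by (cases a b rule: linorder_cases) auto
 qed
qed

lemma csum_pow: assumes "i \<in> nodes X" "j \<in> nodes X"
 shows "csum i j = (\<Sum>r<M. cartan X ((\<sigma> ^^ r) i) j)"
proof -
 have "csum i j = (\<Sum>r<M. cartan X i ((\<sigma> ^^ (M - r)) j))"
  unfolding csum_def
  by (rule sum.reindex_bij_witness[of _ "%r. M - r" "%r. M - r"]) auto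
 also have "... = (\<Sum>r<M. cartan X ((\<sigma> ^^ r) i) j)"
 proof (rule sum.cong)
  fix r assume r: "r \<in> {..<M}"
  have "cartan X i ((\<sigma> ^^ (M - r)) j) = cartan X ((\<sigma> ^^ r) i) ((\<sigma> ^^ r) ((\<sigma> ^^ (M - r)) j))"
   using assms by (simp add: aut_pow \<sigma>_pow_nodes)
  also have "(\<sigma> ^^ r) ((\<sigma> ^^ (M - r)) j) = j"
   using r \<sigma>_pow_M[of 1 j] by (simp add: funpow_add[symmetric, THEN fun_cong, simplified])
  finally show "cartan X i ((\<sigma> ^^ (M - r)) j) = cartan X ((\<sigma> ^^ r) i) j" .
 qed simp
 finally show ?thesis .
qed

lemma sum_pow_shift: "(\<Sum>r=1..M. f ((\<sigma> ^^ r) i)) = (\<Sum>r<M. f ((\<sigma> ^^ r) i))"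
proof -
 have "(\<Sum>r=1..M. f ((\<sigma> ^^ r) i)) = (\<Sum>r\<in>{1..<M}. f ((\<sigma> ^^ r) i)) + f ((\<sigma> ^^ M) i)"
  using M_pos by (simp add: sum.last_plus add.commute)
 also have "(\<sigma> ^^ M) i = (\<sigma> ^^ 0) i" using \<sigma>_pow_M[of 1 i] by simp
 also have "(\<Sum>r\<in>{1..<M}. f ((\<sigma> ^^ r) i)) + f ((\<sigma> ^^ 0) i) = (\<Sum>r<M. f ((\<sigma> ^^ r) i))"
  using M_pos by (simp add: lessThan_atLeast0 sum.atLeast_Suc_lessThan add.commute)
 finally show ?thesis .
qed

lemma csum_sym: assumes "i \<in> nodes X" "j \<in> nodes X" shows "csum i j = csum j i"
proof -
 have "csum i j = (\<Sum>r<M. cartan X i ((\<sigma> ^^ r) j))"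
  unfolding csum_def by (rule sum_pow_shift)
 also have "... = csum j i" using assms by (simp add: csum_pow cartan_sym[of X i])
 finally show ?thesis .
qed

lemma csum_fixed_left: "i \<in> nodes X ==> j \<in> nodes X ==> \<sigma> i = i ==> csum i j = int M * cartan X i j"
 by (simp add: csum_pow pow_fixed)

lemma csum_orbit: assumes "i \<in> nodes X" "j \<in> nodes X" "\<sigma> i ~= i"
 shows "csum i j = (\<Sum>u\<in>orbit i. cartan X u j)"
proof -
 have "orbit i = (%r. (\<sigma> ^^ r) i) ` {..<M}" by (auto simp: orbit_def)
 thus ?thesis using pow_inj[OF assms(3)] by (simp add: csum_pow assms sum.reindex)
qed

lemma \<sigma>_neighbours:
 assumes "p \<in> nodes X" "u \<in> nodes X" "cartan X (\<sigma> p) u = - 1"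
 obtains v where "v \<in> nodes X" "u = \<sigma> v" "cartan X p v = - 1"
 using assms \<sigma>_preimage[OF assms(2)] aut_\<sigma> by metis

lemma not_id: "\<exists>i\<in>nodes X. \<sigma> i ~= i"
proof (rule ccontr)
 assume "\<not> ?thesis"
 hence "\<sigma> i = i" for i using perm permutes_not_in by metis
 thus False using order(2) M_pos by (metis eq_id_iff funpow_0 funpow_simps_right(2) comp_apply One_nat_def zero_less_one)
qed

lemma M_eq_2: assumes "!!i. i \<in> nodes X ==> \<sigma> (\<sigma> i) = i" shows "M = 2"
proof (rule ccontr)
 assume "M ~= 2"
 hence m: "M = 3" using M by auto
 obtain i where i: "i \<in> nodes X" "\<sigma> i ~= i" using not_id by blast
 have "(\<sigma> ^^ 2) i ~= i" using pow_neq[OF i(2), of 2] m by simp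
 thus False using assms[OF i(1)] by (simp add: numeral_2_eq_2)
qed

text \<open>The image of node 1 must be an end of the chain: an interior image would have two
  neighbours, both equal to the image of 2. Once this image is known, the remaining nodes are forced
  one after the other.\<close>

lemma type_A:
 assumes X: "X = A m"
 shows "!!i. i \<in> {1..m} ==> \<sigma> i = m + 1 - i" and "M = 2"
proof -
 have m: "m \<ge> 2" using adm X by simp
 have N: "nodes X = {1..m}" by (simp add: X)
 have adj: "cartan X i j = (if i = j then 2 else if j = i + 1 \<or> i = j + 1 then - 1 else 0)"
  if "i \<in> {1..m}" "j \<in> {1..m}" for i j using cartan_A[OF that] X by simp
 have sN: "\<sigma> i \<in> {1..m}" if "i \<in> {1..m}" for i using \<sigma>_nodes[of i] N that by simp
 have step: "\<sigma> (i + 1) = \<sigma> i + 1 \<or> \<sigma> i = \<sigma> (i + 1) + 1" if "i \<in> {1..m}" "i + 1 \<in> {1..m}" for i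
  using aut_\<sigma>[of i "i + 1"] adj[OF that] adj[OF sN sN, OF that] that N
  by (auto split: if_splits)
 have one: "1 \<in> {1..m}" using m by simp
 have "\<sigma> 1 = 1 \<or> \<sigma> 1 = m"
 proof (rule ccontr)
  assume "\<not> ?thesis"
  hence p: "1 < \<sigma> 1" "\<sigma> 1 < m" using sN[OF one] by auto
  have "u = \<sigma> 2" if u: "u = \<sigma> 1 - 1 \<or> u = \<sigma> 1 + 1" for u
  proof -
   have uN: "u \<in> {1..m}" using p u by auto
   have "cartan X (\<sigma> 1) u = - 1" using adj[OF sN[OF one] uN] p u by auto
   then obtain v where v: "v \<in> {1..m}" "u = \<sigma> v" "cartan X 1 v = - 1"
    using \<sigma>_neighbours[of 1 u] one uN N by metis
   hence "v = 2" using adj[OF one v(1)] by (auto split: if_splits)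
   thus ?thesis using v by blast
  qed
  from this[of "\<sigma> 1 - 1"] this[of "\<sigma> 1 + 1"] p show False by auto
 qed
 have rigid: "\<sigma> i = g i" if g1: "\<sigma> 1 = g 1" and g: "g = (%i. i) \<or> g = (%i. m + 1 - i)" and i: "i \<in> {1..m}" for g i
  using i
 proof (induction i rule: less_induct)
  case (less i)
  show ?case
  proof (rule ccontr)
   assume n: "\<sigma> i ~= g i"
   hence "i ~= 1" using g1 by metis
   then obtain k where k: "i = k + 1" "k \<in> {1..m}" using less.prems by (cases i) auto
   have "\<sigma> k = g k" using less k by auto
   hence k2: "k \<ge> 2 \<and> \<sigma> i = g (k - 1)" using step[of k] k less.prems g n sN[OF less.prems] by auto
   moreover have "\<sigma> (k - 1) = g (k - 1)" by (rule less.IH) (use k k2 in auto)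
   ultimately show False using \<sigma>_inj[of i "k - 1"] k by auto
  qed
 qed
 have "\<sigma> 1 ~= 1"
 proof
  assume "\<sigma> 1 = 1"
  thus False using rigid[of "%i. i"] not_id N by auto
 qed
 hence s1: "\<sigma> 1 = m" using \<open>\<sigma> 1 = 1 \<or> \<sigma> 1 = m\<close> by blast
 thus sig: "\<sigma> i = m + 1 - i" if "i \<in> {1..m}" for i using rigid[of "%i. m + 1 - i"] that by simp
 show "M = 2"
 proof (rule M_eq_2)
  fix i assume "i \<in> nodes X"
  hence "i \<in> {1..m}" "m + 1 - i \<in> {1..m}" "m + 1 - (m + 1 - i) = i" using N by auto
  thus "\<sigma> (\<sigma> i) = i" using sig[of i] sig[of "m + 1 - i"] by simp
 qed
qed

text \<open>This node is the only one with three neighbours.\<close>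

lemma type_D_centre:
 assumes X: "X = D m"
 shows "\<sigma> (m - 2) = m - 2"
proof -
 have m: "m \<ge> 4" using adm X by simp
 have N: "nodes X = {1..m}" by (simp add: X)
 define c where "c = m - 2"
 have adj: "cartan X i j = - 1 \<longleftrightarrow> (j = i + 1 \<and> j \<le> m - 1) \<or> (i = j + 1 \<and> i \<le> m - 1) \<or> (i = c \<and> j = m) \<or> (i = m \<and> j = c)"
  if "i \<in> {1..m}" "j \<in> {1..m}" for i j using cartan_D[OF m that] m X by (auto simp: c_def)
 have sN: "\<sigma> i \<in> {1..m}" if "i \<in> {1..m}" for i using \<sigma>_nodes[of i] N that by simp
 have cN: "c \<in> {1..m}" "m - 3 \<in> {1..m}" "m - 1 \<in> {1..m}" "m \<in> {1..m}" using m by (auto simp: c_def)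
 have "cartan X (\<sigma> c) (\<sigma> u) = - 1" if "u = m - 3 \<or> u = m - 1 \<or> u = m" for u
 proof -
  have uN: "u \<in> {1..m}" using that m by auto
  have "cartan X c u = - 1" unfolding adj[OF cN(1) uN] using that m by (auto simp: c_def)
  thus ?thesis using aut_\<sigma>[of c u] cN uN N by simp
 qed
 hence "cartan X (\<sigma> c) (\<sigma> (m - 3)) = - 1" "cartan X (\<sigma> c) (\<sigma> (m - 1)) = - 1" "cartan X (\<sigma> c) (\<sigma> m) = - 1"
  by auto
 moreover have "\<sigma> (m - 3) ~= \<sigma> (m - 1)" "\<sigma> (m - 3) ~= \<sigma> m" "\<sigma> (m - 1) ~= \<sigma> m"
  using m by (auto simp: \<sigma>_inj)
 ultimately show "\<sigma> (m - 2) = m - 2"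
  using m unfolding adj[OF sN sN, OF cN(1) cN(2)] adj[OF sN sN, OF cN(1) cN(3)] adj[OF sN sN, OF cN(1) cN(4)]
  by (auto simp: c_def)
qed

text \<open>For \<open>m\<close> at least 5 the long arm is distinguished from the two short ones,
  so only the latter can be exchanged.\<close>

lemma type_D5:
 assumes X: "X = D m" and m: "m \<ge> 5"
 shows "!!i. i \<in> {1..m - 2} ==> \<sigma> i = i" and "\<sigma> (m - 1) = m" and "\<sigma> m = m - 1" and "M = 2"
proof -
 have N: "nodes X = {1..m}" by (simp add: X)
 define c where "c = m - 2"
 have adj: "cartan X i j = - 1 \<longleftrightarrow> (j = i + 1 \<and> j \<le> m - 1) \<or> (i = j + 1 \<and> i \<le> m - 1) \<or> (i = c \<and> j = m) \<or> (i = m \<and> j = c)"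
  if "i \<in> {1..m}" "j \<in> {1..m}" for i j using cartan_D[OF _ that] m X by (auto simp: c_def)
 have sN: "\<sigma> i \<in> {1..m}" if "i \<in> {1..m}" for i using \<sigma>_nodes[of i] N that by simp
 have cN: "c \<in> {1..m}" "m - 3 \<in> {1..m}" "m - 1 \<in> {1..m}" "m \<in> {1..m}" "m - 4 \<in> {1..m}"
  using m by (auto simp: c_def)
 have sc: "\<sigma> c = c" using type_D_centre[OF X] by (simp add: c_def)
 have adj\<sigma>: "cartan X (\<sigma> u) (\<sigma> v) = - 1" if "u \<in> {1..m}" "v \<in> {1..m}" "cartan X u v = - 1" for u v
  using aut_\<sigma>[of u v] that N by simp
 have n: "\<sigma> u \<in> {m - 3, m - 1, m}" if "u \<in> {m - 3, m - 1, m}" for u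
 proof -
  have uN: "u \<in> {1..m}" using that m by auto
  have "cartan X c u = - 1" unfolding adj[OF cN(1) uN] using that m by (auto simp: c_def)
  hence "cartan X c (\<sigma> u) = - 1" using adj\<sigma>[OF cN(1) uN] sc by simp
  thus ?thesis using sN[OF uN] m unfolding adj[OF cN(1) sN[OF uN]] by (auto simp: c_def)
 qed
 \<comment> \<open>If the long arm went to a short one, its next node \<open>m - 4\<close> would
   have to go to the centre, the only neighbour of a short arm; but the centre is already
   taken.\<close>
 have s3: "\<sigma> (m - 3) = m - 3"
 proof (rule ccontr)
  assume "\<sigma> (m - 3) ~= m - 3"
  hence l: "\<sigma> (m - 3) = m - 1 \<or> \<sigma> (m - 3) = m" using n[of "m - 3"] by auto
  have "cartan X (m - 3) (m - 4) = - 1" unfolding adj[OF cN(2,5)] using m by auto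
  hence "cartan X (\<sigma> (m - 3)) (\<sigma> (m - 4)) = - 1" using adj\<sigma> cN by blast
  hence "\<sigma> (m - 4) = c" using l m sN[OF cN(5)] unfolding adj[OF sN sN, OF cN(2,5)] by (auto simp: c_def)
  thus False using \<sigma>_inj[of "m - 4" c] sc m by (auto simp: c_def)
 qed
 have low: "\<sigma> (m - 3 - a) = m - 3 - a" if "a < m - 3" for a using that
 proof (induction a rule: less_induct)
  case (less a)
  show ?case
  proof (cases a)
   case (Suc b)
   define v where "v = m - 3 - a"
   have v: "m - 3 - b = v + 1" "v \<in> {1..m}" "v + 1 \<in> {1..m}" "v + 1 \<le> m - 3"
    using less.prems Suc by (auto simp: v_def)
   have s1: "\<sigma> (v + 1) = v + 1" using less.IH[of b] less.prems Suc v by auto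
   have s2: "\<sigma> (v + 2) = v + 2"
   proof (cases b)
    case 0
    hence "v + 2 = c" using v m by (simp add: c_def)
    thus ?thesis using sc by simp
   next
    case (Suc b')
    hence "\<sigma> (m - 3 - b') = m - 3 - b'" using less.IH[of b'] less.prems \<open>a = Suc b\<close> by auto
    moreover have "m - 3 - b' = v + 2" using Suc v less.prems \<open>a = Suc b\<close> by simp
    ultimately show ?thesis by simp
   qed
   have "cartan X (v + 1) v = - 1" unfolding adj[OF v(3,2)] using v by auto
   hence "cartan X (v + 1) (\<sigma> v) = - 1" using adj\<sigma>[OF v(3,2)] s1 by simp
   hence "\<sigma> v = v \<or> \<sigma> v = v + 2"
    using v m unfolding adj[OF v(3) sN[OF v(2)]] by (auto simp: c_def)
   thus ?thesis using s2 \<sigma>_inj[of v "v + 2"] by (auto simp: v_def)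
  qed (use s3 in simp)
 qed
 show fixd: "\<sigma> i = i" if "i \<in> {1..m - 2}" for i
 proof (cases "i = m - 2")
  case False
  thus ?thesis using low[of "m - 3 - i"] that m by auto
 qed (use sc in "simp add: c_def")
 have "\<sigma> (m - 1) ~= m - 3" "\<sigma> m ~= m - 3" "\<sigma> (m - 1) ~= \<sigma> m"
  using s3 \<sigma>_inj[of "m - 1" "m - 3"] \<sigma>_inj[of m "m - 3"] \<sigma>_inj[of "m - 1" m] m by auto
 hence alt: "\<sigma> (m - 1) = m - 1 \<and> \<sigma> m = m \<or> \<sigma> (m - 1) = m \<and> \<sigma> m = m - 1"
  using n[of "m - 1"] n[of m] by auto
 have cases: "i \<in> {1..m - 2} \<or> i = m - 1 \<or> i = m" if "i \<in> {1..m}" for i using that by auto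
 have "\<not> (\<sigma> (m - 1) = m - 1 \<and> \<sigma> m = m)"
 proof
  assume h: "\<sigma> (m - 1) = m - 1 \<and> \<sigma> m = m"
  obtain i where i: "i \<in> {1..m}" "\<sigma> i ~= i" using not_id N by auto
  show False using cases[OF i(1)] fixd[of i] h i(2) by blast
 qed
 thus sw: "\<sigma> (m - 1) = m" "\<sigma> m = m - 1" using alt by auto
 show "M = 2"
 proof (rule M_eq_2)
  fix i assume "i \<in> nodes X"
  thus "\<sigma> (\<sigma> i) = i" using cases[of i] fixd sw N by auto
 qed
qed

text \<open>The three outer nodes are equivalent in the diagram, so an involution is determined only
  up to the choice of the outer node \<open>p\<close> that it fixes.\<close>

lemma type_D4:
 assumes X: "X = D 4"
 shows "\<sigma> 2 = 2" and "(M = 2 \<and> (\<exists>p\<in>{1,3,4}. \<sigma> p = p \<and> (\<forall>i\<in>{1,3,4} - {p}. \<sigma> i ~= i))) \<or> (M = 3 \<and> (\<forall>i\<in>{1,3,4}. \<sigma> i ~= i))"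
  and "\<sigma> ` {1,3,4} = {1,3,4}"
proof -
 have N: "nodes X = {1,2,3,4}" by (auto simp: X)
 show s2: "\<sigma> 2 = 2" using type_D_centre[OF X] by simp
 have im: "\<sigma> i \<in> {1,3,4}" if "i \<in> {1,3,4}" for i
  using \<sigma>_nodes[of i] \<sigma>_inj[of i 2] s2 N that by auto
 hence v: "\<sigma> 1 \<in> {1,3,4}" "\<sigma> 3 \<in> {1,3,4}" "\<sigma> 4 \<in> {1,3,4}" by auto
 have d: "\<sigma> 1 ~= \<sigma> 3" "\<sigma> 1 ~= \<sigma> 4" "\<sigma> 3 ~= \<sigma> 4" by (auto simp: \<sigma>_inj)
 show "\<sigma> ` {1,3,4} = {1,3,4}" using v d by auto
 have nid: "\<not> (\<sigma> 1 = 1 \<and> \<sigma> 3 = 3 \<and> \<sigma> 4 = 4)" using not_id s2 N by auto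
 show "(M = 2 \<and> (\<exists>p\<in>{1,3,4}. \<sigma> p = p \<and> (\<forall>i\<in>{1,3,4} - {p}. \<sigma> i ~= i))) \<or> (M = 3 \<and> (\<forall>i\<in>{1,3,4}. \<sigma> i ~= i))"
 proof (cases "\<exists>p\<in>{1,3,4}. \<sigma> p = p")
  case True
  hence e: "\<exists>p\<in>{1,3,4}. \<sigma> p = p \<and> (\<forall>i\<in>{1,3,4} - {p}. \<sigma> i ~= i)" using v d nid by auto
  have "M = 2"
  proof (rule M_eq_2)
   fix i assume "i \<in> nodes X"
   thus "\<sigma> (\<sigma> i) = i" using True v d nid s2 N by auto
  qed
  thus ?thesis using e by blast
 next
  case False
  have "M ~= 2"
  proof
   assume m: "M = 2"
   have "\<sigma> (\<sigma> 1) = 1" "\<sigma> (\<sigma> 3) = 3"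
    using \<sigma>_pow_M[of 1 1] \<sigma>_pow_M[of 1 3] m by (simp_all add: numeral_2_eq_2)
   thus False using False v d by auto
  qed
  thus ?thesis using False M by auto
 qed
qed

lemma type_E6:
 assumes X: "X = E6"
 shows "\<sigma> 1 = 6" "\<sigma> 2 = 2" "\<sigma> 3 = 5" "\<sigma> 4 = 4" "\<sigma> 5 = 3" "\<sigma> 6 = 1" "M = 2"
proof -
 have N: "nodes X = {1,2,3,4,5,6}" by (auto simp: X)
 have adj: "cartan X i j = - 1 \<longleftrightarrow> (i, j) \<in> {(1, 3), (3, 4), (4, 5), (5, 6), (2, 4), (3, 1), (4, 3), (5, 4), (6, 5), (4, 2)}" for i j
  by (auto simp: X cartan_def)
 have sN: "\<sigma> i \<in> {1,2,3,4,5,6}" if "i \<in> {1,2,3,4,5,6}" for i using \<sigma>_nodes[of i] N that by simp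
 have a: "cartan X (\<sigma> i) (\<sigma> j) = - 1" if "(i, j) \<in> {(1, 3), (3, 4), (4, 5), (5, 6), (2, 4)}" for i j
 proof -
  have "cartan X i j = - 1" using that unfolding adj by auto
  thus ?thesis using aut_\<sigma>[of i j] that N by auto
 qed
 have a': "cartan X (\<sigma> 1) (\<sigma> 3) = - 1" "cartan X (\<sigma> 3) (\<sigma> 4) = - 1" "cartan X (\<sigma> 4) (\<sigma> 5) = - 1"
  "cartan X (\<sigma> 5) (\<sigma> 6) = - 1" "cartan X (\<sigma> 2) (\<sigma> 4) = - 1" by (auto intro: a)
 have d': "\<sigma> 2 ~= \<sigma> 3" "\<sigma> 2 ~= \<sigma> 5" "\<sigma> 3 ~= \<sigma> 5" "\<sigma> 1 ~= \<sigma> 4" "\<sigma> 6 ~= \<sigma> 4" by (simp_all add: \<sigma>_inj)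
 have nb: "cartan X p v = - 1 \<longleftrightarrow> v \<in> (if p = 1 then {3} else if p = 2 then {4} else if p = 3 then {1,4}
   else if p = 4 then {2,3,5} else if p = 5 then {4,6} else if p = 6 then {5} else {})" for p v
  unfolding adj by auto
 have n4: "cartan X (\<sigma> 4) (\<sigma> 3) = - 1" "cartan X (\<sigma> 4) (\<sigma> 5) = - 1" "cartan X (\<sigma> 4) (\<sigma> 2) = - 1"
  using a'(2,3,5) cartan_sym by metis+
 have "\<sigma> 4 = 1 \<or> \<sigma> 4 = 2 \<or> \<sigma> 4 = 3 \<or> \<sigma> 4 = 4 \<or> \<sigma> 4 = 5 \<or> \<sigma> 4 = 6" using sN[of 4] by simp
 hence s4: "\<sigma> 4 = 4"
 proof (elim disjE)
  assume "\<sigma> 4 = 1" thus ?thesis using n4 d' unfolding nb by simp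
 next assume "\<sigma> 4 = 2" thus ?thesis using n4 d' unfolding nb by simp
 next assume "\<sigma> 4 = 3" thus ?thesis using n4 d' unfolding nb by simp metis
 next assume "\<sigma> 4 = 5" thus ?thesis using n4 d' unfolding nb by simp metis
 next assume "\<sigma> 4 = 6" thus ?thesis using n4 d' unfolding nb by simp
 qed
 have v: "\<sigma> 2 \<in> {2,3,5}" "\<sigma> 3 \<in> {2,3,5}" "\<sigma> 5 \<in> {2,3,5}" using n4 unfolding s4 nb by simp_all
 have n1: "cartan X (\<sigma> 3) (\<sigma> 1) = - 1" using a'(1) cartan_sym by metis
 have "\<sigma> 3 ~= 2" using n1 d'(4) s4 unfolding nb by auto
 moreover have "\<sigma> 5 ~= 2" using a'(4) d'(5) s4 unfolding nb by auto
 ultimately have s2: "\<sigma> 2 = 2" "\<sigma> 3 \<in> {3,5}" "\<sigma> 5 \<in> {3,5}" using v d' by auto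
 have s1: "\<sigma> 1 = (if \<sigma> 3 = 3 then 1 else 6)" using n1 d'(4) s4 s2 unfolding nb by auto
 have s6: "\<sigma> 6 = (if \<sigma> 5 = 3 then 1 else 6)" using a'(4) d'(5) s4 s2 unfolding nb by auto
 have s: "(\<sigma> 1 = 6 \<and> \<sigma> 2 = 2 \<and> \<sigma> 3 = 5 \<and> \<sigma> 5 = 3 \<and> \<sigma> 6 = 1) \<or> (\<sigma> 1 = 1 \<and> \<sigma> 2 = 2 \<and> \<sigma> 3 = 3 \<and> \<sigma> 5 = 5 \<and> \<sigma> 6 = 6)"
  using s1 s2 s6 d'(3) by auto
 thus *: "\<sigma> 1 = 6" "\<sigma> 2 = 2" "\<sigma> 3 = 5" "\<sigma> 4 = 4" "\<sigma> 5 = 3" "\<sigma> 6 = 1" using not_id s4 N by auto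
 show "M = 2" by (rule M_eq_2) (use * N in auto)
qed

end

text \<open>Connectedness in the form used later: a set that respects adjacency contains all nodes
  or none. In types A and D every node other than 1 has a smaller neighbour; E6 is followed edge by
  edge.\<close>

lemma dynkin_connected:
 assumes adm: "admissible X"
  and Z: "!!u v. u \<in> nodes X ==> v \<in> nodes X ==> cartan X u v = - 1 ==> u \<in> Z \<longleftrightarrow> v \<in> Z"
  and v: "v \<in> nodes X"
 shows "v \<in> Z \<longleftrightarrow> 1 \<in> Z"
proof (cases X)
 case (A m)
 show ?thesis using v
 proof (induction v rule: less_induct)
  case (less v)
  show ?case
  proof (cases "v = 1")
   case False
   have "cartan X (v - 1) v = - 1" using less.prems False A by (auto simp: cartan_def)
   moreover have "v - 1 \<in> nodes X" "v - 1 < v" using less.prems False A by auto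
   ultimately show ?thesis using less.IH[of "v - 1"] Z less.prems by blast
  qed simp
 qed
next
 case (D m)
 hence m: "m \<ge> 4" using adm by simp
 show ?thesis using v
 proof (induction v rule: less_induct)
  case (less v)
  show ?case
  proof (cases "v = 1")
   case False
   define u where "u = (if v = m then m - 2 else v - 1)"
   have u: "u \<in> nodes X" "u < v" using less.prems False D m by (auto simp: u_def)
   have "cartan X u v = - 1" using less.prems False D m by (auto simp: cartan_def u_def)
   thus ?thesis using less.IH[of u] Z less.prems u by blast
  qed simp
 qed
next
 case E6
 have Z': "u \<in> Z \<longleftrightarrow> v \<in> Z" if "(u, v) \<in> edges E6" for u v
  using Z[of u v] that E6 by (auto simp: cartan_def)
 have "1 \<in> Z \<longleftrightarrow> 3 \<in> Z" "3 \<in> Z \<longleftrightarrow> 4 \<in> Z" "4 \<in> Z \<longleftrightarrow> 5 \<in> Z" "5 \<in> Z \<longleftrightarrow> 6 \<in> Z" "2 \<in> Z \<longleftrightarrow> 4 \<in> Z"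
  by (auto intro!: Z')
 moreover have "v \<in> {1,2,3,4,5,6}" using v E6 by auto
 ultimately show ?thesis by auto
qed

lemma sum_cartan:
 fixes f :: "nat => int"
 assumes j: "j \<in> nodes X"
 shows "(\<Sum>u\<in>nodes X. f u * cartan X u j) = 2 * f j - sum f {u \<in> nodes X. cartan X u j = - 1}"
proof -
 have "(\<Sum>u\<in>nodes X. f u * cartan X u j)
  = (\<Sum>u\<in>nodes X. (if u = j then 2 * f u else 0) - (if cartan X u j = - 1 then f u else 0))"
  by (intro sum.cong refl) (auto simp: cartan_def)
 thus ?thesis using j by (simp add: sum_subtractf finite_nodes sum.inter_filter)
qed

lemma sum_cartan_A:
 fixes f :: "nat => int"
 assumes j: "j \<in> {1..m}"
 shows "(\<Sum>u\<in>{1..m}. f u * cartan (A m) u j)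
  = 2 * f j - (if 1 < j then f (j - 1) else 0) - (if j < m then f (j + 1) else 0)"
proof -
 have "{u \<in> nodes (A m). cartan (A m) u j = - 1} = (if 1 < j then {j - 1} else {}) \<union> (if j < m then {j + 1} else {})"
  using j by (auto simp: cartan_def)
 thus ?thesis using sum_cartan[of j "A m" f] j by simp
qed

lemma sum_cartan_D:
 fixes f :: "nat => int"
 assumes m: "m \<ge> 4" and j: "j \<in> {1..m}"
 shows "(\<Sum>u\<in>{1..m}. f u * cartan (D m) u j)
  = 2 * f j - (if j = m then f (m - 2) else if 1 < j then f (j - 1) else 0)
   - (if j = m - 2 then f (m - 1) + f m else if j < m - 1 then f (j + 1) else 0)"
proof -
 let ?P = "if j = m then {m - 2} else if 1 < j then {j - 1} else {}"
 let ?Q = "if j = m - 2 then {m - 1, m} else if j < m - 1 then {j + 1} else {}"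
 have "{u \<in> nodes (D m). cartan (D m) u j = - 1} = ?P \<union> ?Q"
 proof (intro equalityI subsetI)
  fix u assume "u \<in> {u \<in> nodes (D m). cartan (D m) u j = - 1}"
  hence "u \<in> {1..m}" "j = u + 1 \<and> j \<le> m - 1 \<or> u = j + 1 \<and> u \<le> m - 1 \<or> u = m - 2 \<and> j = m \<or> u = m \<and> j = m - 2"
   using cartan_D[OF m _ j, of u] by (auto split: if_splits)
  thus "u \<in> ?P \<union> ?Q" by (auto split: if_splits; linarith)
 next
  fix u assume "u \<in> ?P \<union> ?Q"
  thus "u \<in> {u \<in> nodes (D m). cartan (D m) u j = - 1}" using m j by (auto simp: cartan_def split: if_splits)
 qed
 moreover have "?P \<inter> ?Q = {}" "m - 1 ~= m" "m - 2 ~= m" using m j by auto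
 ultimately show ?thesis using sum_cartan[of j "D m" f] j by (simp add: sum.union_disjoint)
qed

context twisted_datum begin

lemma M_3: assumes "M = 3" shows "X = D 4"
proof (cases X)
 case (D m)
 hence "m \<ge> 4" using adm by simp
 moreover have "\<not> m \<ge> 5" using type_D5(4)[OF D] assms by auto
 ultimately show ?thesis using D by simp
qed (use type_A(2) type_E6(7) assms in auto)

lemma orbit_M2: assumes "M = 2" shows "orbit i = {i, \<sigma> i}"
proof -
 have "{r. r < M} = {0, 1}" using assms by auto
 hence "orbit i = (%r. (\<sigma> ^^ r) i) ` {0, 1}" unfolding orbit_def by blast
 thus ?thesis by simp
qed
lemma rep_M2: assumes "M = 2" shows "rep i = min i (\<sigma> i)"
 unfolding rep_def orbit_M2[OF assms] by simp

text \<open>An orbit of length 3 consists of the outer nodes of D4, no two of which are adjacent. An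
  orbit of length 2 may contain an edge, which lowers \<open>d\<close> from 1 to 1/2.\<close>

lemma csum_diag:
 assumes "i \<in> nodes X"
 shows "\<sigma> i = i ==> csum i i = 2 * int M"
  and "\<sigma> i ~= i ==> M = 2 ==> csum i i = 2 + cartan X i (\<sigma> i)"
  and "\<sigma> i ~= i ==> M = 3 ==> csum i i = 2"
  and "\<sigma> i ~= i ==> M = 3 ==> 0 < r ==> r < M ==> cartan X i ((\<sigma> ^^ r) i) = 0"
proof -
 show "\<sigma> i = i ==> csum i i = 2 * int M" using csum_fixed_left[OF assms assms] by (simp add: cartan_diag)
 show "csum i i = 2 + cartan X i (\<sigma> i)" if "\<sigma> i ~= i" "M = 2"
 proof -
  have "orbit i = {i, \<sigma> i}" by (rule orbit_M2[OF that(2)])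
  thus ?thesis using csum_orbit[OF assms assms that(1)] that(1) by (simp add: cartan_diag cartan_sym)
 qed
 show z: "cartan X i ((\<sigma> ^^ r) i) = 0" if M3: "\<sigma> i ~= i" "M = 3" "0 < r" "r < M" for r
 proof -
  have X: "X = D 4" by (rule M_3[OF M3(2)])
  have "i ~= 2" "(\<sigma> ^^ r) i ~= 2"
  proof -
   show "i ~= 2" using type_D4(1)[OF X] M3(1) by metis
   have "(\<sigma> ^^ a) i ~= 2" for a
   proof (induction a)
    case (Suc a)
    thus ?case using \<sigma>_inj[of "(\<sigma> ^^ a) i" 2] type_D4(1)[OF X] by simp
   qed (use \<open>i ~= 2\<close> in simp)
   thus "(\<sigma> ^^ r) i ~= 2" .
  qed
  moreover have "nodes X = {1..4}" by (simp add: X)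
  hence "(\<sigma> ^^ r) i \<in> {1..4}" "i \<in> {1..4}" using assms \<sigma>_pow_nodes[of r i] by simp_all
  moreover have "(\<sigma> ^^ r) i ~= i" using pow_neq[OF M3(1,3,4)] .
  ultimately show ?thesis unfolding X by (subst cartan_D) auto
 qed
 show "csum i i = 2" if "\<sigma> i ~= i" "M = 3"
 proof -
  have "csum i i = (\<Sum>r<3. cartan X i ((\<sigma> ^^ r) i))"
   using csum_pow[OF assms assms] cartan_sym that by simp
  also have "{..<3::nat} = {0, 1, 2}" by auto
  finally show ?thesis using z[OF that, of 1] z[OF that, of 2] that by (simp add: cartan_diag)
 qed
qed

lemma d_fixed: "i \<in> nodes X ==> \<sigma> i = i ==> M = 2 ==> d i = 2"
 unfolding d_def by (subst csum_diag(1)) simp_all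

lemma csum_diag_cases:
 assumes "i \<in> nodes X"
 shows "\<sigma> i = i \<and> csum i i = 2 * int M \<or> \<sigma> i ~= i \<and> csum i i = 2 \<or> \<sigma> i ~= i \<and> csum i i = 1"
 using csum_diag(1-3)[OF assms] cartan_values(2)[of i "\<sigma> i" X] M by fastforce

lemma d_pos: "i \<in> nodes X ==> d i > 0"
 using csum_diag_cases[of i] M_pos by (auto simp: d_def)

text \<open>The floor in \<open>Csig\<close> is exact: \<open>d i\<close> is M, 1 or 1/2, and for
  the value M, at a fixed node, the numerator is divisible by M.\<close>

lemma d_Csig: assumes "i \<in> nodes X" "j \<in> nodes X"
 shows "d i * of_int (Csig (Nd i) (Nd j)) = of_int (csum i j)"
proof -
 have "\<exists>z::int. of_int (csum i j) / d i = of_int z"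
  using csum_diag_cases[OF assms(1)]
 proof (elim disjE conjE)
  assume "\<sigma> i = i" "csum i i = 2 * int M"
  thus ?thesis using csum_fixed_left[OF assms] M_pos
   by (intro exI[of _ "cartan X i j"]) (simp add: d_def)
 next
  assume "csum i i = 2"
  thus ?thesis by (intro exI[of _ "csum i j"]) (simp add: d_def)
 next
  assume "csum i i = 1"
  thus ?thesis by (intro exI[of _ "2 * csum i j"]) (simp add: d_def)
 qed
 then obtain z :: int where z: "of_int (csum i j) / d i = of_int z" by blast
 hence "Csig (Nd i) (Nd j) = z" by simp
 thus ?thesis using z d_pos[OF assms(1)] by (simp add: field_simps)
qed

lemma csum_\<sigma>_left: assumes "i \<in> nodes X" "j \<in> nodes X" shows "csum (\<sigma> i) j = csum i j"
proof -
 have "csum (\<sigma> i) j = (\<Sum>r<M. cartan X ((\<sigma> ^^ Suc r) i) j)"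
  using assms by (simp add: csum_pow \<sigma>_nodes funpow_swap1)
 also have "... = (\<Sum>r=1..M. cartan X ((\<sigma> ^^ r) i) j)"
  by (rule sum.reindex_bij_witness[of _ "%r. r - 1" Suc]) auto
 also have "... = csum i j"
  using sum_pow_shift[of "%u. cartan X u j" i] assms by (simp add: csum_pow)
 finally show ?thesis .
qed

lemma csum_rep: assumes "i \<in> nodes X" "j \<in> nodes X" shows "csum (rep i) (rep j) = csum i j"
proof -
 have P: "csum ((\<sigma> ^^ r) u) v = csum u v" if "u \<in> nodes X" "v \<in> nodes X" for r u v
  using that by (induction r) (auto simp: csum_\<sigma>_left \<sigma>_pow_nodes)
 have Q: "csum (rep u) v = csum u v" if "u \<in> nodes X" "v \<in> nodes X" for u v
 proof -
  obtain r where "rep u = (\<sigma> ^^ r) u" using rep_in_orbit[of u] unfolding orbit_alt by blast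
  thus ?thesis using P[OF that] by simp
 qed
 show ?thesis using assms Q[of i "rep j"] Q[of j i] csum_sym[of i "rep j"] csum_sym[of j i] rep_nodes by simp
qed

lemma csum_neg:
 assumes "u \<in> nodes X" "v \<in> nodes X" "rep u ~= rep v"
 shows "csum u v \<le> 0" "cartan X u v = - 1 ==> csum u v < 0"
proof -
 have nz: "cartan X ((\<sigma> ^^ r) u) v \<le> 0" for r
 proof -
  have "(\<sigma> ^^ r) u ~= v" using rep_pow[of r u] assms(3) by metis
  thus ?thesis using cartan_values(2)[of "(\<sigma> ^^ r) u" v X] by auto
 qed
 show "csum u v \<le> 0" unfolding csum_pow[OF assms(1,2)] by (rule sum_nonpos) (use nz in auto)
 assume h: "cartan X u v = - 1"
 have "csum u v = cartan X ((\<sigma> ^^ 0) u) v + (\<Sum>r\<in>{..<M} - {0}. cartan X ((\<sigma> ^^ r) u) v)"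
  unfolding csum_pow[OF assms(1,2)] using M_pos by (subst sum.remove[of _ 0]) auto
 moreover have "(\<Sum>r\<in>{..<M} - {0}. cartan X ((\<sigma> ^^ r) u) v) \<le> 0" by (rule sum_nonpos) (use nz in auto)
 ultimately show "csum u v < 0" using h by simp
qed

text \<open>Passage from nodes to orbits. A moved orbit contributes its column sum once, whereas
  \<open>csum i j\<close> is already \<open>M\<close> times the Cartan entry at a fixed node; this
  is why the value there is divided by \<open>M\<close>.\<close>

lemma sum_nodes_orbits:
 fixes f :: "nat => int"
 assumes f: "!!u. u \<in> nodes X ==> f (\<sigma> u) = f u" and M: "!!u. u \<in> nodes X ==> \<sigma> u = u ==> int M dvd f u"
  and j: "j \<in> nodes X"
 shows "(\<Sum>u\<in>nodes X. f u * cartan X u j) = (\<Sum>i\<in>Isig. (if \<sigma> i = i then f i div int M else f i) * csum i j)"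
proof -
 have fp: "f ((\<sigma> ^^ r) u) = f u" if "u \<in> nodes X" for r u
  by (induction r) (use f that \<sigma>_pow_nodes in auto)
 have "(\<Sum>u\<in>nodes X. f u * cartan X u j) = (\<Sum>i\<in>Isig. \<Sum>u\<in>{u \<in> nodes X. rep u = i}. f u * cartan X u j)"
  by (rule sum.group[symmetric]) (auto simp: finite_nodes finite_Isig Isig_def)
 also have "... = (\<Sum>i\<in>Isig. (if \<sigma> i = i then f i div int M else f i) * csum i j)"
 proof (rule sum.cong[OF refl])
  fix i assume "i \<in> Isig"
  hence i: "i \<in> nodes X" "rep i = i" by (auto simp: Isig_iff)
  have o: "{u \<in> nodes X. rep u = i} = orbit i"
   using rep_eq_iff[of i] i orbit_nodes by (auto simp: eq_commute)
  have "(\<Sum>u\<in>orbit i. f u * cartan X u j) = f i * (\<Sum>u\<in>orbit i. cartan X u j)"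
   unfolding sum_distrib_left by (rule sum.cong) (use fp i in "auto simp: orbit_alt")
  also have "... = (if \<sigma> i = i then f i div int M else f i) * csum i j"
  proof (cases "\<sigma> i = i")
   case True
   then obtain z where "f i = int M * z" using M[OF i(1)] by blast
   thus ?thesis using True M_pos csum_fixed_left[OF i(1) j] by (simp add: orbit_fixed)
  next
   case False
   thus ?thesis using csum_orbit[OF i(1) j] by simp
  qed
  finally show "(\<Sum>u\<in>{u \<in> nodes X. rep u = i}. f u * cartan X u j)
   = (if \<sigma> i = i then f i div int M else f i) * csum i j" unfolding o .
 qed
 finally show ?thesis .
qed

text \<open>A certificate for the labels, lifted to the finite diagram: \<open>f\<close> is constant
  on orbits, equal to the label on a moved orbit and to \<open>M\<close> times the label on a fixed
  node. The sums say that the finite part of the null vector pairs nontrivially only with the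
  neighbour of \<epsilon>; the last equation is the null condition at \<epsilon>.\<close>

definition affine_solution :: "(nat => int) => int => bool" where
 "affine_solution f c \<longleftrightarrow> eps_nbr \<in> Isig \<and> Csig Eps (Nd eps_nbr) < 0 \<and> Csig (Nd eps_nbr) Eps < 0
  \<and> (\<exists>z. 2 * dhat Eps = of_int z)
  \<and> (\<forall>u\<in>nodes X. f u > 0 \<and> f (\<sigma> u) = f u \<and> (\<sigma> u = u --> int M dvd f u))
  \<and> (\<forall>j\<in>nodes X. (\<Sum>u\<in>nodes X. f u * cartan X u j) = (if rep j = eps_nbr then c else 0))
  \<and> of_int c = - d eps_nbr * of_int (Csig (Nd eps_nbr) Eps)
  \<and> 2 * dhat Eps = - of_int (if \<sigma> eps_nbr = eps_nbr then f eps_nbr div int M else f eps_nbr)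
    * d eps_nbr * of_int (Csig (Nd eps_nbr) Eps)"

lemma affine_solutionI:
 assumes link: "affine_link X = (p, c1, c2)" and p: "p \<in> Isig" and neg: "c1 < 0" "c2 < 0"
  and dp: "d p = \<delta>" and z: "2 * \<delta> * of_int c2 / of_int c1 = of_int z"
  and f: "!!u. u \<in> nodes X ==> f u > 0" "!!u. u \<in> nodes X ==> f (\<sigma> u) = f u"
   "!!u. u \<in> nodes X ==> \<sigma> u = u ==> int M dvd f u"
  and sum: "!!j. j \<in> nodes X ==> (\<Sum>u\<in>nodes X. f u * cartan X u j) = (if rep j = p then c else 0)"
  and c: "of_int c = - \<delta> * of_int c2"
  and ap: "2 / of_int c1 = (- of_int (if \<sigma> p = p then f p div int M else f p) :: rat)"
 shows "affine_solution f c"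
proof -
 have nb: "eps_nbr = p" by (simp add: eps_nbr_def link)
 have C: "Csig Eps (Nd p) = c1" "Csig (Nd p) Eps = c2" by (simp_all add: nb link)
 have dE: "dhat Eps = \<delta> * of_int c2 / of_int c1" unfolding dhat.simps nb C dp ..
 have "2 * dhat Eps = (2 / of_int c1) * \<delta> * of_int c2" unfolding dE by simp
 also have "... = - of_int (if \<sigma> p = p then f p div int M else f p) * \<delta> * of_int c2" unfolding ap ..
 finally have E: "2 * dhat Eps = - of_int (if \<sigma> p = p then f p div int M else f p) * \<delta> * of_int c2" .
 have "2 * dhat Eps = of_int z" unfolding dE using z by simp
 thus ?thesis unfolding affine_solution_def nb C dp
  using p neg f sum c E by blast
qed

text \<open>The functions \<open>f\<close> come from the tables of labels. For even \<open>m\<close>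
  no node is fixed and all finite labels are 2. For odd \<open>m\<close> the two ends carry 1 and
  the other nodes 2; the middle node is fixed, so its label is 1. In each case \<open>z\<close> is
  twice \<open>dhat Eps\<close>.\<close>

lemma affine_solution_A:
 assumes X: "X = A m" shows "\<exists>f c. affine_solution f c"
proof -
 have sig: "\<sigma> i = m + 1 - i" if "i \<in> {1..m}" for i using type_A(1)[OF X that] .
 have M2: "M = 2" using type_A(2)[OF X] .
 have iM: "int M = 2" using M2 by simp
 have m: "m \<ge> 2" using adm X by simp
 have N: "nodes X = {1..m}" by (simp add: X)
 have rp: "rep i = min i (m + 1 - i)" if "i \<in> {1..m}" for i using rep_M2[OF M2, of i] sig[OF that] by simp
 have adj: "cartan X i j = (if i = j then 2 else if j = i + 1 \<or> i = j + 1 then - 1 else 0)"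
  if "i \<in> {1..m}" "j \<in> {1..m}" for i j using cartan_A[OF that] X by simp
 have sumC: "(\<Sum>u\<in>nodes X. f u * cartan X u j) = 2 * f j - (if 1 < j then f (j - 1) else 0) - (if j < m then f (j + 1) else 0)"
  if "j \<in> {1..m}" for f :: "nat => int" and j using sum_cartan_A[OF that] by (simp add: X)
 have s1: "\<sigma> 1 = m" using sig[of 1] m by simp
 have dn: "d i = (2 + of_int (cartan X i (\<sigma> i))) / 2" if "i \<in> {1..m}" "\<sigma> i ~= i" for i
  using csum_diag(2)[OF _ that(2) M2] N that(1) by (simp add: d_def)
 have d1: "d 1 = (if m = 2 then 1 / 2 else 1)"
  using dn[of 1] s1 m adj[of 1 m] by (auto split: if_splits)
 have rep1: "rep j = 1 \<longleftrightarrow> j = 1 \<or> j = m" if "j \<in> {1..m}" for j using rp[OF that] that m by auto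
 have I1: "1 \<in> Isig" using rep1[of 1] N m by (simp add: Isig_iff)
 have "even m \<and> m > 2 \<or> m = 2 \<or> m = 3 \<or> odd m \<and> m \<ge> 5" using m by presburger
 then consider "m = 2" | "even m" "m > 2" | "m = 3" | "odd m" "m \<ge> 5" by blast
 thus ?thesis
 proof cases
  case 1
  have link: "affine_link X = (1, - 1, - 4)" by (simp add: X 1)
  have "affine_solution (%_. 2) 2"
  proof (rule affine_solutionI[OF link I1, where z = 4 and \<delta> = "1 / 2"])
   fix j assume j: "j \<in> nodes X"
   hence "j = 1 \<or> j = 2" using N 1 by auto
   thus "(\<Sum>u\<in>nodes X. 2 * cartan X u j) = (if rep j = 1 then 2 else 0)"
    using sumC[of j "%_. 2"] rep1[of j] j N 1 by auto
  qed (use d1 1 iM s1 in simp_all)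
  thus ?thesis by blast
 next
  case 2
  have link: "affine_link X = (1, - 1, - 2)" using 2 by (simp add: X)
  have "affine_solution (%_. 2) 2"
  proof (rule affine_solutionI[OF link I1, where z = 4 and \<delta> = 1])
   fix j assume j: "j \<in> nodes X"
   thus "(\<Sum>u\<in>nodes X. 2 * cartan X u j) = (if rep j = 1 then 2 else 0)"
    using sumC[of j "%_. 2"] rep1[of j] j N 2 by auto
  qed (use d1 2 iM s1 in simp_all)
  thus ?thesis by blast
 next
  case 3
  have link: "affine_link X = (2, - 2, - 1)" by (simp add: X 3)
  have s2: "\<sigma> 2 = 2" "\<sigma> 1 = 3" "\<sigma> 3 = 1" using sig[of 2] sig[of 1] sig[of 3] 3 by auto
  have r: "rep 1 = 1" "rep 2 = 2" "rep 3 = 1" using rp[of 1] rp[of 2] rp[of 3] 3 by auto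
  have d2: "d 2 = 2" by (rule d_fixed[OF _ s2(1) M2]) (use N 3 in simp)
  have N3: "j = 1 \<or> j = 2 \<or> j = 3" if "j \<in> nodes X" for j using that N 3 by auto
  define f :: "nat => int" where "f u = (if u = 2 then 2 else 1)" for u
  have "affine_solution f 2"
  proof (rule affine_solutionI[OF link, where z = 2 and \<delta> = 2])
   show "2 \<in> Isig" using r N 3 by (simp add: Isig_iff)
   fix j assume j: "j \<in> nodes X"
   show "(\<Sum>u\<in>nodes X. f u * cartan X u j) = (if rep j = 2 then 2 else 0)"
    using N3[OF j] sumC[of j f] j N 3 r by (auto simp: f_def)
  next
   fix u assume u: "u \<in> nodes X"
   show "f (\<sigma> u) = f u" using N3[OF u] s2 by (auto simp: f_def)
   show "\<sigma> u = u ==> int M dvd f u" using N3[OF u] s2 iM by (auto simp: f_def)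
  qed (use d2 s2 iM in "simp_all add: f_def")
  thus ?thesis by blast
 next
  case 4
  have link: "affine_link X = (2, - 1, - 1)" using 4 by (auto simp: X)
  have s2: "\<sigma> 2 = m - 1" using sig[of 2] 4 by auto
  have d2: "d 2 = 1"
  proof -
   have "m - 1 \<in> {1..m}" "2 \<in> {1..m}" "m - 1 ~= 2" "m - 1 ~= 2 + 1" "2 ~= m - 1 + 1" using 4 by auto
   thus ?thesis using dn[of 2] s2 adj[of 2 "m - 1"] by simp
  qed
  define f :: "nat => int" where "f u = (if u = 1 \<or> u = m then 1 else 2)" for u
  have "affine_solution f 1"
  proof (rule affine_solutionI[OF link, where z = 2 and \<delta> = 1])
   show "2 \<in> Isig" using rp[of 2] 4 N by (auto simp: Isig_iff)
   fix j assume j: "j \<in> nodes X"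
   have "rep j = 2 \<longleftrightarrow> j = 2 \<or> j = m - 1" using rp[of j] j N 4 by auto
   moreover have "(\<Sum>u\<in>nodes X. f u * cartan X u j) = (if j = 2 \<or> j = m - 1 then 1 else 0)"
    using sumC[of j f] j N 4 by (auto simp: f_def)
   ultimately show "(\<Sum>u\<in>nodes X. f u * cartan X u j) = (if rep j = 2 then 1 else 0)" by simp
  next
   fix u assume u: "u \<in> nodes X"
   thus "f (\<sigma> u) = f u" using sig[of u] N 4 by (auto simp: f_def)
   show "\<sigma> u = u ==> int M dvd f u" using sig[of u] u N 4 iM by (auto simp: f_def)
  qed (use d2 s2 4 in "auto simp: f_def")
  thus ?thesis by blast
 qed
qed

lemma affine_solution_E6:
 assumes X: "X = E6" shows "\<exists>f c. affine_solution f c"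
proof -
 note t = type_E6[OF X]
 have N: "nodes X = {1,2,3,4,5,6}" by (auto simp: X)
 have iM: "int M = 2" using t by simp
 have link: "affine_link X = (1, - 1, - 1)" by (simp add: X)
 have rp: "rep 1 = 1" "rep 2 = 2" "rep 3 = 3" "rep 4 = 4" "rep 5 = 3" "rep 6 = 1"
  by (simp_all add: rep_M2[OF t(7)] t(1-6) del: One_nat_def)
 have "cartan X 1 6 = 0" by (simp add: X cartan_def)
 hence d1: "d 1 = 1" using csum_diag(2)[of 1, OF _ _ t(7)] t(1) N by (simp add: d_def)
 have N6: "j = 1 \<or> j = 2 \<or> j = 3 \<or> j = 4 \<or> j = 5 \<or> j = 6" if "j \<in> nodes X" for j using N that by auto
 \<comment> \<open>The labels of the orbits of 1, 3, 4, 2 are 2, 3, 2, 1, and the fixed nodes 4 and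
   2 carry twice their label.\<close>
 define f :: "nat => int" where "f u = (if u = 4 then 4 else if u = 3 \<or> u = 5 then 3 else 2)" for u
 have sumC: "(\<Sum>u\<in>nodes X. f u * cartan X u j) = (if j = 1 \<or> j = 6 then 1 else 0)"
  if "j = 1 \<or> j = 2 \<or> j = 3 \<or> j = 4 \<or> j = 5 \<or> j = 6" for j
  unfolding N using that by (elim disjE) (simp_all add: f_def X cartan_def del: One_nat_def)
 have "affine_solution f 1"
 proof (rule affine_solutionI[OF link, where z = 2 and \<delta> = 1])
  show "1 \<in> Isig" using rp N by (auto simp: Isig_iff)
  fix j assume j: "j \<in> nodes X"
  show "(\<Sum>u\<in>nodes X. f u * cartan X u j) = (if rep j = 1 then 1 else 0)"
   unfolding sumC[OF N6[OF j]] using N6[OF j] rp by (elim disjE) (simp_all del: One_nat_def)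
 next
  fix u assume u: "u \<in> nodes X"
  show "f (\<sigma> u) = f u" using N6[OF u] by (elim disjE) (simp_all add: t(1-6) f_def del: One_nat_def)
  show "\<sigma> u = u ==> int M dvd f u" using N6[OF u] iM by (elim disjE) (simp_all add: t(1-6) f_def del: One_nat_def)
 qed (use d1 t(1) in "simp_all add: f_def del: One_nat_def")
 thus ?thesis by blast
qed

end

context twisted_datum begin

text \<open>For order 3 the outer orbit has label 2 and the centre label 1, whence the value 3 at
  the centre. For order 2 all labels are 1, and the two fixed nodes, 2 and \<open>p\<close>, carry
  the value 2.\<close>

lemma affine_solution_D4:
 assumes X: "X = D 4" shows "\<exists>f c. affine_solution f c"
proof -
 note t = type_D4[OF X]
 have N: "nodes X = {1,2,3,4}" by (auto simp: X)
 have sumC: "(\<Sum>u\<in>nodes X. f u * cartan X u j) = (if j = 2 then 2 * f 2 - f 1 - f 3 - f 4 else 2 * f j - f 2)"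
  if "j \<in> nodes X" for f :: "nat => int" and j
 proof -
  have "j = 1 \<or> j = 2 \<or> j = 3 \<or> j = 4" using that N by auto
  thus ?thesis unfolding N by (elim disjE) (simp_all add: X cartan_def del: One_nat_def)
 qed
 have s134: "\<sigma> i \<in> {1,3,4}" if "i \<in> {1,3,4}" for i using t(3) that by blast
 show ?thesis
 proof (cases "M = 3")
  case True
  hence iM: "int M = 3" by simp
  have link: "affine_link X = (1, - 1, - 1)" unfolding X affine_link.simps if_P[OF True] ..
  have nf: "\<sigma> i ~= i" if "i \<in> {1,3,4}" for i using t(2) True that by auto
  have r1: "rep j = 1" if "j \<in> {1,3,4}" for j
  proof -
   have "inj_on (%r. (\<sigma> ^^ r) j) {..<M}" by (rule pow_inj[OF nf[OF that]])
   moreover have "orbit j = (%r. (\<sigma> ^^ r) j) ` {..<M}" by (auto simp: orbit_def)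
   ultimately have "card (orbit j) = M" by (simp add: card_image)
   hence "card (orbit j) = 3" using iM by simp
   moreover have "orbit j \<subseteq> {1,3,4}"
   proof -
    have "(\<sigma> ^^ r) j \<in> {1,3,4}" for r by (induction r) (use that s134 in auto)
    thus ?thesis unfolding orbit_alt by blast
   qed
   ultimately have "orbit j = {1,3,4}" by (intro card_subset_eq) auto
   thus ?thesis by (simp add: rep_def)
  qed
  have r2: "rep 2 = 2" using t(1) by (simp add: rep_def orbit_fixed)
  have d1: "d 1 = 1" using csum_diag(3)[of 1, OF _ _ True] nf[of 1] N by (simp add: d_def)
  define f :: "nat => int" where "f u = (if u = 2 then 3 else 2)" for u
  have "affine_solution f 1"
  proof (rule affine_solutionI[OF link, where z = 2 and \<delta> = 1])
   show "1 \<in> Isig" using r1[of 1] N by (auto simp: Isig_iff)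
   fix j assume j: "j \<in> nodes X"
   show "(\<Sum>u\<in>nodes X. f u * cartan X u j) = (if rep j = 1 then 1 else 0)"
    using sumC[OF j, of f] j r1[of j] r2 unfolding N by (auto simp: f_def)
  next
   fix u assume u: "u \<in> nodes X"
   show "f (\<sigma> u) = f u" using u t(1) s134[of u] unfolding N by (auto simp: f_def)
   show "\<sigma> u = u ==> int M dvd f u" using u nf[of u] iM unfolding N by (auto simp: f_def)
  qed (use d1 nf[of 1] in "simp_all add: f_def")
  thus ?thesis by blast
 next
  case False
  hence M2: "M = 2" using M by auto
  hence iM: "int M = 2" by simp
  obtain p where p: "p \<in> {1,3,4}" "\<sigma> p = p" "!!i. i \<in> {1,3,4} ==> i ~= p ==> \<sigma> i ~= i"
   using t(2) False by auto
  have link: "affine_link X = (p, - 2, - 1)"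
  proof (cases "\<sigma> 1 = 1")
   case True
   hence "p = 1" using p(3)[of 1] by auto
   thus ?thesis using True False by (simp add: X)
  next
   case n1: False
   have "(THE j. j \<in> nodes (D 4) \<and> j ~= 2 \<and> \<sigma> j = j) = p"
   proof (rule the_equality)
    show "p \<in> nodes (D 4) \<and> p ~= 2 \<and> \<sigma> p = p" using p(1,2) by auto
    fix j assume j: "j \<in> nodes (D 4) \<and> j ~= 2 \<and> \<sigma> j = j"
    hence "j \<in> {1,3,4}" by auto
    thus "j = p" using p(3)[of j] j by blast
   qed
   thus ?thesis using n1 False by (simp add: X)
  qed
  have rp: "rep j = p \<longleftrightarrow> j = p" for j
   using rep_eq_iff[of p j] p(2) by (auto simp: rep_def orbit_fixed)
  have rpp: "rep p = p" using rp[of p] by simp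
  have pN: "p \<in> nodes X" using p(1) N by auto
  have dp: "d p = 2" by (rule d_fixed[OF pN p(2) M2])
  define f :: "nat => int" where "f u = (if u = 2 \<or> u = p then 2 else 1)" for u
  have "affine_solution f 2"
  proof (rule affine_solutionI[OF link, where z = 2 and \<delta> = 2])
   show "p \<in> Isig" using rpp pN by (simp add: Isig_iff)
   fix j assume j: "j \<in> nodes X"
   show "(\<Sum>u\<in>nodes X. f u * cartan X u j) = (if rep j = p then 2 else 0)"
    unfolding rp sumC[OF j] using j p(1) unfolding N f_def by auto
  next
   fix u assume u: "u \<in> nodes X"
   have "\<sigma> u = p \<longleftrightarrow> u = p" "\<sigma> u = 2 \<longleftrightarrow> u = 2"
    using \<sigma>_inj[of u p] \<sigma>_inj[of u 2] p(2) t(1) by auto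
   thus "f (\<sigma> u) = f u" by (simp add: f_def)
   show "\<sigma> u = u ==> int M dvd f u" using u p(3)[of u] iM unfolding N by (auto simp: f_def)
  qed (use dp p(2) iM in "simp_all add: f_def")
  thus ?thesis by blast
 qed
qed

lemma affine_solution_D5:
 assumes X: "X = D m" and m: "m \<ge> 5" shows "\<exists>f c. affine_solution f c"
proof -
 note t = type_D5[OF X m]
 have N: "nodes X = {1..m}" by (simp add: X)
 have iM: "int M = 2" using t(4) by simp
 obtain n where n: "m = n + 5" using m by (metis add.commute le_Suc_ex)
 have s1: "\<sigma> 1 = 1" using t(1)[of 1] m by simp
 have "M ~= 3" using t(4) by simp
 hence link: "affine_link X = (1, - 2, - 1)" using s1 by (simp add: X)
 have rp: "rep j = 1 \<longleftrightarrow> j = 1" for j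
  using rep_eq_iff[of 1 j] s1 by (auto simp: rep_def orbit_fixed)
 have N1: "1 \<in> nodes X" using N m by simp
 have d1: "d 1 = 2" by (rule d_fixed[OF N1 s1 t(4)])
 define f :: "nat => int" where "f u = (if u = m - 1 \<or> u = m then 1 else 2)" for u
 have "affine_solution f 2"
 proof (rule affine_solutionI[OF link, where z = 2 and \<delta> = 2])
  show "1 \<in> Isig" using rp[of 1] N1 by (simp add: Isig_iff)
  fix j assume "j \<in> nodes X"
  hence j: "j \<in> {1..m}" by (simp add: N)
  have "(\<Sum>u\<in>nodes X. f u * cartan X u j)
   = 2 * f j - (if j = m then f (m - 2) else if 1 < j then f (j - 1) else 0)
    - (if j = m - 2 then f (m - 1) + f m else if j < m - 1 then f (j + 1) else 0)"
   using sum_cartan_D[OF _ j, of f] m by (simp add: X)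
  also have "... = (if rep j = 1 then 2 else 0)" using j unfolding rp f_def n by auto
  finally show "(\<Sum>u\<in>nodes X. f u * cartan X u j) = (if rep j = 1 then 2 else 0)" .
 next
  fix u assume u: "u \<in> nodes X"
  hence "u \<in> {1..m - 2} \<or> u = m - 1 \<or> u = m" using N by auto
  thus "f (\<sigma> u) = f u" using t(1)[of u] t(2,3) by (auto simp: f_def)
  show "\<sigma> u = u ==> int M dvd f u" using u t(2,3) iM m by (auto simp: f_def)
 qed (use d1 s1 iM m in "auto simp: f_def")
 thus ?thesis by blast
qed

lemma affine_solution_exists: "\<exists>f c. affine_solution f c"
proof (cases X)
 case (D m)
 hence "m = 4 \<or> m \<ge> 5" using adm by auto
 thus ?thesis using affine_solution_D4 affine_solution_D5 D by auto
qed (use affine_solution_A affine_solution_E6 in auto)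

section \<open>The symmetrised affine Cartan form and its radical\<close>

definition Dh :: "anode => int" where "Dh i = \<lfloor>2 * dhat i\<rfloor>"
definition Bh :: "anode => anode => int" where "Bh i j = Dh i * Csig i j"

lemma nbr: "eps_nbr \<in> Isig" "Csig Eps (Nd eps_nbr) < 0" "Csig (Nd eps_nbr) Eps < 0"
 using affine_solution_exists by (auto simp: affine_solution_def)

lemma Isig_nodes: "i \<in> Isig ==> i \<in> nodes X" by (simp add: Isig_iff)

lemma Ihat_cases: "i \<in> Ihat ==> (i = Eps ==> P) ==> (!!u. i = Nd u ==> u \<in> Isig ==> P) ==> P"
 by (auto simp: Ihat_def)
lemma Eps_Ihat [simp]: "Eps \<in> Ihat" by (simp add: Ihat_def)
lemma Nd_Ihat [simp]: "Nd u \<in> Ihat \<longleftrightarrow> u \<in> Isig" by (auto simp: Ihat_def)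

lemma dhat_pos: "i \<in> Ihat ==> dhat i > 0"
proof (erule Ihat_cases)
 assume "i = Eps"
 moreover have "d eps_nbr > 0" using nbr(1) d_pos Isig_nodes by blast
 moreover have "(of_int (Csig (Nd eps_nbr) Eps) :: rat) < 0" "(of_int (Csig Eps (Nd eps_nbr)) :: rat) < 0"
  using nbr(2,3) by (simp_all only: of_int_less_0_iff)
 ultimately show ?thesis unfolding \<open>i = Eps\<close> dhat.simps by (intro divide_neg_neg mult_pos_neg)
qed (use d_pos Isig_nodes in auto)

lemma of_int_Dh: "i \<in> Ihat ==> of_int (Dh i) = 2 * dhat i"
proof (erule Ihat_cases)
 assume "i = Eps"
 obtain z where "2 * dhat Eps = of_int z" using affine_solution_exists unfolding affine_solution_def by blast
 thus ?thesis unfolding Dh_def \<open>i = Eps\<close> by simp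
next
 fix u assume "i = Nd u"
 thus ?thesis by (simp add: Dh_def d_def)
qed

lemma Dh_pos: "i \<in> Ihat ==> Dh i > 0"
 using of_int_Dh[of i] dhat_pos[of i] by (metis of_int_0_less_iff mult_pos_pos zero_less_numeral)

lemma Csig_diag: "i \<in> Ihat ==> Csig i i = 2"
proof (erule Ihat_cases)
 fix u assume u: "i = Nd u" "u \<in> Isig"
 have "d u * of_int (Csig (Nd u) (Nd u)) = d u * 2" using d_Csig[of u u] Isig_nodes[OF u(2)] by (simp add: d_def)
 hence "(of_int (Csig (Nd u) (Nd u)) :: rat) = of_int 2"
  using d_pos[OF Isig_nodes[OF u(2)]] by simp
 thus ?thesis unfolding u(1) of_int_eq_iff .
qed simp

lemma Bh_Nd: assumes "i \<in> Isig" "j \<in> Isig" shows "Bh (Nd i) (Nd j) = 2 * csum i j"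
proof -
 have "(of_int (Bh (Nd i) (Nd j)) :: rat) = 2 * (d i * of_int (Csig (Nd i) (Nd j)))"
  using of_int_Dh[of "Nd i"] assms by (simp add: Bh_def)
 also have "... = of_int (2 * csum i j)" using d_Csig[of i j] assms Isig_nodes by simp
 finally show ?thesis using of_int_eq_iff by blast
qed

lemma Bh_Eps: "Bh Eps (Nd j) = Bh (Nd j) Eps"
proof (cases "j = eps_nbr")
 case True
 have "(of_int (Bh Eps (Nd eps_nbr)) :: rat) = of_int (Bh (Nd eps_nbr) Eps)"
  using of_int_Dh[of Eps] of_int_Dh[of "Nd eps_nbr"] nbr by (simp add: Bh_def del: Csig.simps)
 thus ?thesis unfolding of_int_eq_iff True .
qed (simp add: Bh_def)

lemma Bh_sym: assumes "i \<in> Ihat" "j \<in> Ihat" shows "Bh i j = Bh j i"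
 using assms Bh_Eps csum_sym Bh_Nd Isig_nodes by (elim Ihat_cases) auto

lemma Csig_nonpos: assumes "i \<in> Ihat" "j \<in> Ihat" "i ~= j" shows "Csig i j \<le> 0"
 using assms(1,2)
proof (elim Ihat_cases)
 fix u v assume uv: "i = Nd u" "u \<in> Isig" "j = Nd v" "v \<in> Isig"
 hence "rep u ~= rep v" using assms(3) by (simp add: Isig_iff)
 hence "csum u v \<le> 0" using csum_neg(1)[of u v] uv Isig_nodes by auto
 hence "Dh i * Csig i j \<le> 0" using Bh_Nd[OF uv(2,4)] uv by (simp add: Bh_def del: Csig.simps)
 thus ?thesis using Dh_pos[OF assms(1)] by (simp add: mult_le_0_iff del: Csig.simps)
qed (use assms(3) nbr(2,3) in "auto split: if_splits")

lemma s_cartan_form: "cartan_form s Ihat Bh Csig Dh"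
 using s_nz s_gen finite_Ihat Bh_sym Dh_pos Csig_diag Csig_nonpos
 unfolding cartan_form_def Bh_def by blast

text \<open>\<open>label\<close> is an arbitrary choice, so its properties follow once a candidate
  exists; \<open>a\<close> is read off from a certificate \<open>f\<close>.\<close>

lemma label_props: "label Eps = 1" "!!i. i \<in> Ihat ==> label i > 0"
  "!!j. j \<in> Ihat ==> (\<Sum>i\<in>Ihat. of_nat (label i) * dhat i * of_int (Csig i j)) = 0"
proof -
 obtain f c where "affine_solution f c" using affine_solution_exists by blast
 hence f: "!!u. u \<in> nodes X ==> f u > 0" "!!u. u \<in> nodes X ==> f (\<sigma> u) = f u"
   "!!u. u \<in> nodes X ==> \<sigma> u = u --> int M dvd f u"
  and sm: "!!j. j \<in> nodes X ==> (\<Sum>u\<in>nodes X. f u * cartan X u j) = (if rep j = eps_nbr then c else 0)"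
  and c: "of_int c = - d eps_nbr * of_int (Csig (Nd eps_nbr) Eps)"
  and e: "2 * dhat Eps = - of_int (if \<sigma> eps_nbr = eps_nbr then f eps_nbr div int M else f eps_nbr)
    * d eps_nbr * of_int (Csig (Nd eps_nbr) Eps)"
  unfolding affine_solution_def by blast+
 have f3: "!!u. u \<in> nodes X ==> \<sigma> u = u ==> int M dvd f u" using f(3) by blast
 define g where "g i = (if \<sigma> i = i then f i div int M else f i)" for i
 define a where "a i = (case i of Eps => 1 | Nd u => nat (g u))" for i
 have gpos: "g i > 0" if i: "i \<in> Isig" for i
 proof (cases "\<sigma> i = i")
  case True
  obtain z where "f i = int M * z" using f3[OF Isig_nodes[OF i] True] unfolding dvd_def by blast
  thus ?thesis using f(1)[OF Isig_nodes[OF i]] True M_pos by (simp add: g_def zero_less_mult_iff)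
 qed (use f(1)[OF Isig_nodes[OF i]] in "simp add: g_def")
 have split: "(\<Sum>i\<in>Ihat. F i) = F Eps + (\<Sum>u\<in>Isig. F (Nd u))" for F :: "anode => rat"
  unfolding Ihat_def by (subst sum.insert) (auto simp: finite_Isig sum.reindex inj_on_def)
 have "a Eps = 1 \<and> (\<forall>i\<in>Ihat. a i > 0) \<and> (\<forall>j\<in>Ihat. (\<Sum>i\<in>Ihat. of_nat (a i) * dhat i * of_int (Csig i j)) = 0)"
 proof (intro conjI ballI)
  show "a Eps = 1" by (simp add: a_def)
  show "a i > 0" if "i \<in> Ihat" for i using that gpos by (elim Ihat_cases) (auto simp: a_def)
  have ag: "(of_nat (a (Nd u)) :: rat) = of_int (g u)" if "u \<in> Isig" for u using gpos[OF that] by (simp add: a_def)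
  fix j assume "j \<in> Ihat"
  thus "(\<Sum>i\<in>Ihat. of_nat (a i) * dhat i * of_int (Csig i j)) = 0"
  proof (rule Ihat_cases)
   assume j: "j = Eps"
   have "(\<Sum>u\<in>Isig. of_nat (a (Nd u)) * dhat (Nd u) * of_int (Csig (Nd u) Eps))
    = (\<Sum>u\<in>Isig. if u = eps_nbr then of_int (g u) * d u * of_int (Csig (Nd u) Eps) else 0)"
    by (rule sum.cong) (auto simp: ag)
   also have "... = of_int (g eps_nbr) * d eps_nbr * of_int (Csig (Nd eps_nbr) Eps)"
    using nbr(1) finite_Isig by (simp add: sum.delta del: Csig.simps)
   also have "... = - 2 * dhat Eps" using e by (simp add: g_def del: Csig.simps dhat.simps)
   finally show ?thesis unfolding j split by (simp add: a_def del: Csig.simps(2-) dhat.simps)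
  next
   fix v assume j: "j = Nd v" "v \<in> Isig"
   have vN: "v \<in> nodes X" "rep v = v" using j by (auto simp: Isig_iff)
   have "(\<Sum>u\<in>Isig. of_nat (a (Nd u)) * dhat (Nd u) * of_int (Csig (Nd u) (Nd v)))
    = (\<Sum>u\<in>Isig. of_int (g u * csum u v))"
    using d_Csig vN Isig_nodes by (intro sum.cong) (auto simp: ag mult.assoc simp del: Csig.simps)
   also have "... = of_int (\<Sum>u\<in>Isig. g u * csum u v)" by simp
   also have "(\<Sum>u\<in>Isig. g u * csum u v) = (if v = eps_nbr then c else 0)"
    unfolding g_def using trans[OF sum_nodes_orbits[where f = f and j = v, OF f(2) f3 vN(1), symmetric] sm[OF vN(1)]]
    unfolding vN(2) .
   finally have 1: "(\<Sum>u\<in>Isig. of_nat (a (Nd u)) * dhat (Nd u) * of_int (Csig (Nd u) (Nd v)))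
    = of_int (if v = eps_nbr then c else 0)" .
   have "dhat Eps * of_int (Csig Eps (Nd v)) = - of_int (if v = eps_nbr then c else 0)"
   proof (cases "v = eps_nbr")
    case True
    have "(of_int (Csig Eps (Nd eps_nbr)) :: rat) ~= 0" using nbr(2) by (simp del: Csig.simps)
    thus ?thesis using True c by (simp del: Csig.simps)
   qed simp
   thus ?thesis unfolding j split 1 by (simp add: a_def del: Csig.simps dhat.simps)
  qed
 qed
 hence "label Eps = 1 \<and> (\<forall>i\<in>Ihat. label i > 0)
   \<and> (\<forall>j\<in>Ihat. (\<Sum>i\<in>Ihat. of_nat (label i) * dhat i * of_int (Csig i j)) = 0)"
  unfolding label_def
  by (rule someI[where P = "%a. a Eps = 1 \<and> (\<forall>i\<in>Ihat. a i > 0)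
   \<and> (\<forall>j\<in>Ihat. (\<Sum>i\<in>Ihat. of_nat (a i) * dhat i * of_int (Csig i j)) = 0)"])
 thus "label Eps = 1" "!!i. i \<in> Ihat ==> label i > 0"
  "!!j. j \<in> Ihat ==> (\<Sum>i\<in>Ihat. of_nat (label i) * dhat i * of_int (Csig i j)) = 0" by auto
qed

lemma label_null: assumes "j \<in> Ihat" shows "(\<Sum>i\<in>Ihat. int (label i) * Bh i j) = 0"
proof -
 have "(of_int (\<Sum>i\<in>Ihat. int (label i) * Bh i j) :: rat) = (\<Sum>i\<in>Ihat. of_nat (label i) * (2 * dhat i) * of_int (Csig i j))"
  by (simp add: Bh_def of_int_Dh[symmetric] mult.assoc del: Csig.simps)
 also have "... = 2 * (\<Sum>i\<in>Ihat. of_nat (label i) * dhat i * of_int (Csig i j))"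
  by (simp add: sum_distrib_left algebra_simps del: Csig.simps dhat.simps)
 also have "... = 0" using label_props(3)[OF assms] by simp
 finally show ?thesis using of_int_eq_0_iff by blast
qed

lemma Bh_nbr_neg: "Bh Eps (Nd eps_nbr) < 0"
 unfolding Bh_def using nbr(2) Dh_pos[of Eps] by (simp add: mult_pos_neg del: Csig.simps)

lemma Bh_adjacent: assumes "u \<in> nodes X" "v \<in> nodes X" "cartan X u v = - 1" "rep u ~= rep v"
 shows "Bh (Nd (rep u)) (Nd (rep v)) < 0"
 using csum_neg(2)[OF assms(1,2,4,3)] csum_rep[OF assms(1,2)] assms(1,2)
 by (simp add: Bh_Nd Isig_def)

text \<open>The form is a sum of squares: with u = n / label, twice its value is the sum of the
  terms \<open>T l m\<close>, the pure squares being cancelled by the null vector. Each term is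
  nonnegative since off-diagonal entries are nonpositive. If the sum vanishes, the zeros of
  \<open>n\<close> propagate along edges, and they start at \<epsilon>.\<close>

lemma form_definite:
 fixes n :: "anode => int"
 assumes n0: "n Eps = 0" and Q: "(\<Sum>l\<in>Ihat. \<Sum>m\<in>Ihat. n l * n m * Bh l m) \<le> 0" and l: "l \<in> Ihat"
 shows "n l = 0"
proof -
 define a :: "anode => rat" where "a l = of_nat (label l)" for l
 define u :: "anode => rat" where "u l = of_int (n l) / a l" for l
 define b :: "anode => anode => rat" where "b l m = of_int (Bh l m)" for l m
 have a: "a l > 0" if "l \<in> Ihat" for l using label_props(2)[OF that] by (simp add: a_def)
 have nu: "of_int (n l) = a l * u l" if "l \<in> Ihat" for l using a[OF that] by (simp add: u_def)
 have bs: "b l m = b m l" if "l \<in> Ihat" "m \<in> Ihat" for l m using Bh_sym[OF that] by (simp add: b_def)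
 have null: "(\<Sum>l\<in>Ihat. a l * b l m) = 0" if "m \<in> Ihat" for m
 proof -
  have "(\<Sum>l\<in>Ihat. a l * b l m) = of_int (\<Sum>l\<in>Ihat. int (label l) * Bh l m)" by (simp add: a_def b_def)
  thus ?thesis using label_null[OF that] by simp
 qed
 define T where "T l m = - b l m * a l * a m * (u l - u m)\<^sup>2" for l m
 have T0: "T l m \<ge> 0" if "l \<in> Ihat" "m \<in> Ihat" for l m
 proof (cases "l = m")
  case False
  have "Bh l m \<le> 0" using Csig_nonpos[OF that False] Dh_pos[OF that(1)]
   by (simp add: Bh_def mult_nonneg_nonpos del: Csig.simps)
  hence "- b l m \<ge> 0" by (simp add: b_def)
  thus ?thesis unfolding T_def using a[OF that(1)] a[OF that(2)] by (intro mult_nonneg_nonneg) auto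
 qed (simp add: T_def)
 have "(\<Sum>l\<in>Ihat. \<Sum>m\<in>Ihat. T l m) = (\<Sum>l\<in>Ihat. \<Sum>m\<in>Ihat. 2 * (b l m * (a l * u l) * (a m * u m)))
   - (\<Sum>l\<in>Ihat. \<Sum>m\<in>Ihat. b l m * a l * a m * (u l)\<^sup>2) - (\<Sum>l\<in>Ihat. \<Sum>m\<in>Ihat. b l m * a l * a m * (u m)\<^sup>2)"
  unfolding sum_subtractf[symmetric] T_def by (intro sum.cong refl) (simp add: power2_eq_square algebra_simps)
 also have "(\<Sum>l\<in>Ihat. \<Sum>m\<in>Ihat. b l m * a l * a m * (u m)\<^sup>2) = (\<Sum>m\<in>Ihat. \<Sum>l\<in>Ihat. b l m * a l * a m * (u m)\<^sup>2)"
  by (rule sum.swap)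
 also have "... = (\<Sum>m\<in>Ihat. a m * (u m)\<^sup>2 * (\<Sum>l\<in>Ihat. a l * b l m))"
  unfolding sum_distrib_left by (intro sum.cong refl) (simp add: algebra_simps)
 also have "... = 0" by (simp add: null)
 also have "(\<Sum>l\<in>Ihat. \<Sum>m\<in>Ihat. b l m * a l * a m * (u l)\<^sup>2) = (\<Sum>l\<in>Ihat. a l * (u l)\<^sup>2 * (\<Sum>m\<in>Ihat. a m * b m l))"
  unfolding sum_distrib_left by (intro sum.cong refl) (simp add: bs algebra_simps)
 also have "... = 0" by (simp add: null)
 also have "(\<Sum>l\<in>Ihat. \<Sum>m\<in>Ihat. 2 * (b l m * (a l * u l) * (a m * u m))) = 2 * of_int (\<Sum>l\<in>Ihat. \<Sum>m\<in>Ihat. n l * n m * Bh l m)"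
  unfolding of_int_sum sum_distrib_left
  by (intro sum.cong refl) (simp add: nu[symmetric] b_def)
 also have "... - 0 - 0 \<le> 0" using Q by (simp only: diff_zero mult_le_0_iff of_int_le_0_iff) simp
 finally have "(\<Sum>l\<in>Ihat. \<Sum>m\<in>Ihat. T l m) \<le> 0" by simp
 hence "(\<Sum>l\<in>Ihat. \<Sum>m\<in>Ihat. T l m) = 0"
  using sum_nonneg[of Ihat "%l. \<Sum>m\<in>Ihat. T l m"] sum_nonneg[of Ihat "T l" for l] T0
  by (metis (no_types, lifting) antisym)
 hence "\<forall>l\<in>Ihat. (\<Sum>m\<in>Ihat. T l m) = 0"
  using sum_nonneg_eq_0_iff[OF finite_Ihat, of "%l. \<Sum>m\<in>Ihat. T l m"] T0 by (simp add: sum_nonneg)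
 hence T00: "T l m = 0" if "l \<in> Ihat" "m \<in> Ihat" for l m
  using sum_nonneg_eq_0_iff[OF finite_Ihat, of "T l"] T0 that by blast
 have eq: "n l = 0 \<longleftrightarrow> n m = 0" if "l \<in> Ihat" "m \<in> Ihat" "Bh l m < 0" for l m
 proof -
  have "u l = u m" using T00[OF that(1,2)] that(3) a[OF that(1)] a[OF that(2)] by (auto simp: T_def b_def)
  thus ?thesis using nu[OF that(1)] nu[OF that(2)] a[OF that(1)] a[OF that(2)] by (metis mult_eq_0_iff less_irrefl of_int_eq_0_iff)
 qed
 define Z where "Z = {v. n (Nd (rep v)) = 0}"
 have cl: "v \<in> Z \<longleftrightarrow> w \<in> Z" if "v \<in> nodes X" "w \<in> nodes X" "cartan X v w = - 1" for v w
 proof (cases "rep v = rep w")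
  case False
  thus ?thesis
   using eq[of "Nd (rep v)" "Nd (rep w)"] Bh_adjacent[OF that False] that by (auto simp: Z_def Isig_def)
 qed (simp add: Z_def)
 have all: "v \<in> Z \<longleftrightarrow> 1 \<in> Z" if "v \<in> nodes X" for v
  using dynkin_connected[OF adm cl that] .
 have "eps_nbr \<in> Z" using eq[of Eps "Nd eps_nbr"] n0 Bh_nbr_neg nbr(1) by (simp add: Z_def Isig_iff)
 hence "1 \<in> Z" using all[of eps_nbr] nbr(1) by (simp add: Isig_iff)
 hence "n (Nd (rep v)) = 0" if "v \<in> nodes X" for v using all[OF that] by (simp add: Z_def)
 hence "n (Nd v) = 0" if "v \<in> Isig" for v using that Isig_iff by metis
 thus ?thesis using l by (elim Ihat_cases) (use n0 in auto)
qed

lemma form_nondegenerate: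
 fixes n :: "anode => int"
 assumes "n Eps = 0" "!!j. j \<in> Isig ==> (\<Sum>l\<in>Ihat. n l * Bh (Nd j) l) = 0" "l \<in> Ihat"
 shows "n l = 0"
proof -
 have "(\<Sum>m\<in>Ihat. n l * n m * Bh l m) = 0" if "l \<in> Ihat" for l
  using that assms(1,2) by (elim Ihat_cases) (auto simp: mult.assoc sum_distrib_left[symmetric])
 hence "(\<Sum>l\<in>Ihat. \<Sum>m\<in>Ihat. n l * n m * Bh l m) \<le> 0" by simp
 thus ?thesis using form_definite[of n l] assms by blast
qed

text \<open>The positivity of finite type: otherwise every term of the quadratic form of
  \<open>n\<close> would be nonpositive, against \<open>form_definite\<close>.\<close>

lemma form_positive:
 fixes n :: "anode => int"
 assumes "n Eps = 0" "!!l. l \<in> Ihat ==> n l \<ge> 0" "l \<in> Ihat" "n l ~= 0"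
 shows "\<exists>j\<in>Isig. (\<Sum>l\<in>Ihat. n l * Bh (Nd j) l) > 0"
proof (rule ccontr)
 assume "\<not> ?thesis"
 hence "(\<Sum>m\<in>Ihat. n m * Bh l m) \<le> 0" if "l \<in> Ihat" "l ~= Eps" for l
  using that by (elim Ihat_cases) (auto simp: not_less)
 hence "(\<Sum>m\<in>Ihat. n l * n m * Bh l m) \<le> 0" if "l \<in> Ihat" for l
  using assms(1) assms(2)[OF that] that by (cases "l = Eps") (auto simp: mult.assoc sum_distrib_left[symmetric] mult_nonneg_nonpos)
 hence "(\<Sum>l\<in>Ihat. \<Sum>m\<in>Ihat. n l * n m * Bh l m) \<le> 0" by (rule sum_nonpos)
 thus False using form_definite[of n l] assms by blast
qed

end

section \<open>Induced modules\<close>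

text \<open>One notion of congruence for several sets of relators: for all of them, and for the part
  without Serre relators in which the behaviour of the Serre elements is computed.\<close>

definition ideq :: "'a::ring_1 set => 'a => 'a => bool" where
 "ideq R a b \<longleftrightarrow> a - b \<in> two_sided_ideal R"

lemma ideq_refl [simp, intro]: "ideq R a a" by (simp add: ideq_def two_sided_ideal.zero)
lemma ideq_sym: "ideq R a b ==> ideq R b a"
 unfolding ideq_def using two_sided_ideal_minus[of "a - b" R] by simp
lemma ideq_trans [trans]: "ideq R a b ==> ideq R b c ==> ideq R a c"
 unfolding ideq_def using two_sided_ideal.add[of "a - b" R "b - c"] by simp
lemma ideq_add: "ideq R a b ==> ideq R c d ==> ideq R (a + c) (b + d)"
 unfolding ideq_def using two_sided_ideal.add[of "a - b" R "c - d"] by (simp add: algebra_simps)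
lemma ideq_minus: "ideq R a b ==> ideq R (- a) (- b)"
 unfolding ideq_def using two_sided_ideal_minus[of "a - b" R] by simp
lemma ideq_diff: "ideq R a b ==> ideq R c d ==> ideq R (a - c) (b - d)"
 using ideq_add[OF _ ideq_minus, of R a b c d] by simp
lemma ideq_left: "ideq R a b ==> ideq R (c * a) (c * b)"
 unfolding ideq_def using two_sided_ideal_left[of "a - b" R c] by (simp add: right_diff_distrib)
lemma ideq_right: "ideq R a b ==> ideq R (a * c) (b * c)"
 unfolding ideq_def using two_sided_ideal_right[of "a - b" R c] by (simp add: left_diff_distrib)
lemma ideq_mult: "ideq R a b ==> ideq R c d ==> ideq R (a * c) (b * d)"
 using ideq_left ideq_right ideq_trans by blast
lemma ideq_sum: "(!!i. i \<in> F ==> ideq R (f i) (g i)) ==> ideq R (sum f F) (sum g F)"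
 by (induction F rule: infinite_finite_induct) (auto intro: ideq_add)
lemma ideq_0_iff: "ideq R a 0 \<longleftrightarrow> a \<in> two_sided_ideal R" by (simp add: ideq_def)

fun opp :: "sign => sign" where "opp Pos = Neg" | "opp Neg = Pos"

lemma sg_opp [simp]: "sg (opp p) = - sg p" by (cases p) auto

context twisted_datum begin

sublocale cf: cartan_form s Ihat Bh Csig Dh by (rule s_cartan_form)

definition cc :: "anode => complex" where "cc i = 1 / (s powi Dh i - s powi (- Dh i))"

lemma cc_nz: "i \<in> Ihat ==> cc i ~= 0"
 using cf.s_powi_cancel[of "Dh i" "- Dh i"] Dh_pos[of i] by (simp add: cc_def)

lemma qp_int: "2 * t = of_int z ==> qp t = s powi z" by (simp add: qp_def)
lemma qp_Bh: "i \<in> Ihat ==> qp (dhat i * of_int (sg p * Csig i j)) = s powi (sg p * Bh i j)"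
 by (rule qp_int) (simp add: of_int_Dh Bh_def algebra_simps del: Csig.simps dhat.simps)
lemma qp_Dh: "i \<in> Ihat ==> qp (dhat i) = s powi Dh i" "i \<in> Ihat ==> qp (- dhat i) = s powi (- Dh i)"
 by (rule qp_int; simp add: of_int_Dh del: dhat.simps)+

lemma qnum_dhat: "i \<in> Ihat ==> qnum (dhat i) (of_nat r) = q_int s (Dh i) r"
proof -
 assume i: "i \<in> Ihat"
 have "qp (dhat i * of_nat r) = s powi (Dh i * int r)" "qp (- (dhat i * of_nat r)) = s powi (- (Dh i * int r))"
  by (rule qp_int; simp add: of_int_Dh[OF i] del: dhat.simps)+
 thus ?thesis by (simp add: qnum_def q_int_def qp_Dh[OF i] del: dhat.simps)
qed
lemma qbinom_dhat: "i \<in> Ihat ==> qbinom (dhat i) n r = q_binom s (Dh i) n r"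
 by (simp add: qbinom_def q_binom_def qfact_def q_fact_def qnum_dhat del: dhat.simps)

text \<open>Substitution of \<open>e p i\<close> for the letters. Positive and negative elements are
  handled in the free algebra on the nodes, where the skew derivations live, and transported by this
  map.\<close>

definition emb :: "sign => anode free_algebra => ualg" where
 "emb p = word_ext (%w. prod_list (map (e p) w))"

lemma emb_add: "emb p (x + y) = emb p x + emb p y" by (simp add: emb_def word_ext_add)
lemma emb_sc: "emb p (sc c * y) = sc c * emb p y" by (simp add: emb_def word_ext_sc)
lemma emb_const [simp]: "emb p (sc c) = sc c" by (simp add: emb_def)
lemma emb_0 [simp]: "emb p 0 = 0" by (simp add: emb_def)
lemma emb_1 [simp]: "emb p 1 = 1" using emb_const[of p 1] by simp
lemma emb_minus: "emb p (- x) = - emb p x" using emb_sc[of p "- 1" x] by (simp add: sc_minus)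
lemma emb_diff: "emb p (x - y) = emb p x - emb p y" using emb_add[of p x "- y"] by (simp add: emb_minus)
lemma emb_gen_mult: "emb p (gen l * y) = e p l * emb p y"
proof (induction y rule: single_induct)
 case (single w c)
 show ?case by (simp add: gen_mult_single emb_def word_ext_single sc_left_commute[of "e p l"])
qed (simp add: distrib_left emb_add)
lemma emb_gen: "emb p (gen l) = e p l" using emb_gen_mult[of p l 1] by simp
lemma emb_mult: "emb p (x * y) = emb p x * emb p y"
proof (induction x rule: free_induct)
 case (sc c) thus ?case by (simp add: emb_sc)
next
 case (add a b) thus ?case by (simp add: distrib_right emb_add)
next
 case (gen g a) thus ?case by (simp add: mult.assoc emb_gen_mult)
qed
lemma emb_power: "emb p (x ^ n) = emb p x ^ n" by (induction n) (simp_all add: emb_mult)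
lemma emb_sum: "emb p (sum f F) = (\<Sum>i\<in>F. emb p (f i))"
 by (induction F rule: infinite_finite_induct) (simp_all add: emb_add)

lemma serre_emb:
 assumes "i \<in> Ihat" "j \<in> Ihat" "i ~= j"
 shows "serre p i j = emb p (cf.serre_elt i j)"
 unfolding serre_def Let_def cf.serre_elt_expand[OF assms]
 by (simp add: emb_sum emb_sc emb_mult emb_power emb_gen qbinom_dhat[OF assms(1)] mult.assoc del: dhat.simps Csig.simps)

definition k_relators :: "ualg set" where
 "k_relators = {k Pos i * k Neg i - 1 | i. i \<in> Ihat} \<union> {k Neg i * k Pos i - 1 | i. i \<in> Ihat}
  \<union> {comm (k Pos i) (k Pos j) | i j. i \<in> Ihat \<and> j \<in> Ihat}"

definition out_relators :: "ualg set" where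
 "out_relators = {gen g | g p i. (g = GE p i \<or> g = GK p i) \<and> i \<notin> Ihat}"

definition ke_relators :: "ualg set" where
 "ke_relators = {k Pos i * e p j - sc (qp (dhat i * of_int (sg p * Csig i j))) * e p j * k Pos i
    | p i j. i \<in> Ihat \<and> j \<in> Ihat}"

definition ef_relators :: "ualg set" where
 "ef_relators = {comm (e Pos i) (e Neg j) -
    (if i = j then sc (1 / (qp (dhat i) - qp (- dhat i))) * (k Pos i - k Neg i) else 0)
    | i j. i \<in> Ihat \<and> j \<in> Ihat}"

definition central_relator :: ualg where
 "central_relator = prod_list (map (%i. k Pos i ^ label i) (Eps # map Nd (sorted_list_of_set Isig))) - 1"

text \<open>The Serre relators are kept apart. Commutators with generators of the opposite sign are
  computed without them, so that the negative Serre relations can be imposed on the induced module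
  afterwards.\<close>

definition base_relators :: "ualg set" where
 "base_relators = out_relators \<union> k_relators \<union> ke_relators \<union> ef_relators \<union> {central_relator}"

lemma relators_eq: "relators = base_relators \<union> {serre p i j | p i j. i \<in> Ihat \<and> j \<in> Ihat \<and> i ~= j}"
 unfolding relators_def base_relators_def out_relators_def k_relators_def ke_relators_def ef_relators_def
  central_relator_def by blast

abbreviation beq (infix "\<simeq>" 50) where "beq \<equiv> ideq base_relators"

lemma beq_eqU: "a \<simeq> b ==> a \<approx> b"
 unfolding eqU_def J_def ideq_def using two_sided_ideal_mono[of base_relators relators] relators_eq by blast

lemma eqU_ideq: "a \<approx> b \<longleftrightarrow> ideq relators a b" by (simp add: eqU_def J_def ideq_def)

lemma k_inverse: "i \<in> Ihat ==> k p i * k (opp p) i \<simeq> 1"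
 unfolding ideq_def by (rule two_sided_ideal_gen, cases p) (auto simp: base_relators_def k_relators_def)

lemma out_zero: "i \<notin> Ihat ==> e p i \<simeq> 0" "i \<notin> Ihat ==> k p i \<simeq> 0"
 unfolding ideq_0_iff e_def k_def
 by (rule two_sided_ideal_gen, auto simp: base_relators_def out_relators_def)+

lemma ideq_inverse_commute:
 fixes a b x :: "'g free_algebra"
 assumes h: "ideq R (a * x) (sc c * (x * a))" "ideq R (a * b) 1" "ideq R (b * a) 1" and c: "c ~= 0"
 shows "ideq R (b * x) (sc (inverse c) * (x * b))"
proof -
 have "ideq R (b * x) (b * x * (a * b))" using ideq_left[OF ideq_sym[OF h(2)], of "b * x"] by simp
 also have "b * x * (a * b) = b * (x * a) * b" by (simp add: mult.assoc)
 also have "ideq R (b * (x * a) * b) (b * (sc (inverse c) * (a * x)) * b)"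
 proof (rule ideq_right, rule ideq_left)
  have "ideq R (sc (inverse c) * (a * x)) (sc (inverse c) * (sc c * (x * a)))" by (rule ideq_left[OF h(1)])
  thus "ideq R (x * a) (sc (inverse c) * (a * x))" using c by (simp add: sc_sc_mult ideq_sym)
 qed
 also have "b * (sc (inverse c) * (a * x)) * b = sc (inverse c) * ((b * a) * (x * b))"
  by (simp add: sc_left_commute[of b] mult.assoc)
 also have "ideq R ... (sc (inverse c) * (1 * (x * b)))" by (intro ideq_left ideq_right h)
 finally show ?thesis by simp
qed

lemma k_comm_ideal:
 assumes "k_relators \<subseteq> R" "i \<in> Ihat" "j \<in> Ihat" shows "ideq R (k p i * k p' j) (k p' j * k p i)"
proof -
 have inv: "ideq R (k Pos i * k Neg i) 1" "ideq R (k Neg i * k Pos i) 1" if "i \<in> Ihat" for i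
  unfolding ideq_def using that assms(1) by (auto intro!: two_sided_ideal_gen simp: k_relators_def)
 have c: "ideq R (k Pos i * k Pos j) (k Pos j * k Pos i)" if "i \<in> Ihat" "j \<in> Ihat" for i j
 proof -
  have "comm (k Pos i) (k Pos j) \<in> R" using that assms(1) unfolding k_relators_def by blast
  thus ?thesis unfolding ideq_def comm_def by (rule two_sided_ideal_gen)
 qed
 have c1: "ideq R (k p i * k Pos j) (k Pos j * k p i)" if "i \<in> Ihat" "j \<in> Ihat" for p i j
  using ideq_inverse_commute[of R "k Pos i" "k Pos j" 1 "k Neg i"] c[OF that] inv[OF that(1)]
  by (cases p) simp_all
 have c2: "ideq R (k p' j * k p i) (k p i * k p' j)"
  using ideq_inverse_commute[of R "k Pos j" "k p i" 1 "k Neg j"] inv[OF assms(3)]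
   ideq_sym[OF c1[OF assms(2,3)]] by (cases p') simp_all
 thus ?thesis by (rule ideq_sym)
qed

lemma k_comm: "i \<in> Ihat ==> j \<in> Ihat ==> k p i * k p' j \<simeq> k p' j * k p i"
 by (rule k_comm_ideal) (auto simp: base_relators_def)

lemma k_e:
 assumes "i \<in> Ihat" shows "k p i * e p' j \<simeq> sc (s powi (sg p * sg p' * Bh i j)) * (e p' j * k p i)"
proof (cases "j \<in> Ihat")
 case True
 have "k Pos i * e p' j - sc (s powi (sg p' * Bh i j)) * e p' j * k Pos i \<in> ke_relators"
  unfolding ke_relators_def qp_Bh[OF assms, symmetric] using assms True by blast
 hence 1: "k Pos i * e p' j \<simeq> sc (s powi (sg p' * Bh i j)) * (e p' j * k Pos i)"
  unfolding ideq_def by (intro two_sided_ideal_gen) (simp add: base_relators_def mult.assoc)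
 show ?thesis
 proof (cases p)
  case Neg
  have "s powi (- (sg p' * Bh i j)) = inverse (s powi (sg p' * Bh i j))" by (simp add: power_int_minus)
  thus ?thesis using ideq_inverse_commute[OF 1 _ _ cf.s_powi_nz, of "k Neg i"]
    k_inverse[OF assms, of Pos] k_inverse[OF assms, of Neg] Neg by simp
 qed (use 1 in simp)
next
 case False
 have "k p i * e p' j \<simeq> 0" using ideq_left[OF out_zero(1)[OF False], where c = "k p i"] by simp
 moreover have "sc (s powi (sg p * sg p' * Bh i j)) * (e p' j * k p i) \<simeq> 0"
  using ideq_left[OF ideq_right[OF out_zero(1)[OF False], where c = "k p i"]] by simp
 ultimately show ?thesis using ideq_sym ideq_trans by blast
qed

lemma e_k:
 assumes "i \<in> Ihat" shows "e p' j * k p i \<simeq> sc (s powi (- (sg p * sg p' * Bh i j))) * (k p i * e p' j)"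
proof -
 have "sc (s powi (- (sg p * sg p' * Bh i j))) * (k p i * e p' j)
  \<simeq> sc (s powi (- (sg p * sg p' * Bh i j))) * (sc (s powi (sg p * sg p' * Bh i j)) * (e p' j * k p i))"
  by (rule ideq_left[OF k_e[OF assms]])
 thus ?thesis by (simp add: sc_sc_mult cf.s_powi_add[symmetric] ideq_sym)
qed

lemma e_e: assumes "i \<in> Ihat" "j \<in> Ihat"
 shows "e p i * e (opp p) j \<simeq> e (opp p) j * e p i + (if i = j then sc (cc i) * (k p i - k (opp p) i) else 0)"
proof -
 have "comm (e Pos i) (e Neg j) - (if i = j then sc (1 / (qp (dhat i) - qp (- dhat i))) * (k Pos i - k Neg i) else 0)
  \<in> ef_relators" if "i \<in> Ihat" "j \<in> Ihat" for i j using that unfolding ef_relators_def by blast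
 note ef = this
 have "comm (e Pos i) (e Neg j) - (if i = j then sc (cc i) * (k Pos i - k Neg i) else 0) \<in> ef_relators"
  if "i \<in> Ihat" "j \<in> Ihat" for i j
  using ef[OF that] by (simp only: qp_Dh[OF that(1)] cc_def)
 hence 1: "comm (e Pos i) (e Neg j) \<simeq> (if i = j then sc (cc i) * (k Pos i - k Neg i) else 0)"
  if "i \<in> Ihat" "j \<in> Ihat" for i j unfolding ideq_def using that
  by (intro two_sided_ideal_gen) (simp add: base_relators_def)
 show ?thesis
 proof (cases p)
  case Pos
  have "e Pos i * e Neg j = e Neg j * e Pos i + comm (e Pos i) (e Neg j)" by (simp add: comm_def)
  thus ?thesis unfolding Pos opp.simps using ideq_add[OF ideq_refl 1[OF assms], of "e Neg j * e Pos i"] by metis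
 next
  case Neg
  have "e Pos j * e Neg i - comm (e Pos j) (e Neg i)
    \<simeq> e Pos j * e Neg i - (if j = i then sc (cc j) * (k Pos j - k Neg j) else 0)"
   by (rule ideq_diff[OF ideq_refl 1[OF assms(2,1)]])
  moreover have "e Pos j * e Neg i - (if j = i then sc (cc j) * (k Pos j - k Neg j) else 0)
   = e Pos j * e Neg i + (if i = j then sc (cc i) * (k Neg i - k Pos i) else 0)"
   by (simp add: right_diff_distrib)
  moreover have "e Pos j * e Neg i - comm (e Pos j) (e Neg i) = e Neg i * e Pos j" by (simp add: comm_def)
  ultimately show ?thesis unfolding Neg opp.simps by metis
 qed
qed

text \<open>The opposite generator is moved through the letters one at a time, and each Cartan
  element that arises is carried to the left end past the preceding letters. The powers of
  \<open>s\<close> collected on the way are those of \<open>Rw\<close>, with opposite signs of t for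
  k and its inverse.\<close>

lemma emb_commutator:
 assumes i: "i \<in> Ihat"
 shows "emb p y * e (opp p) i \<simeq> e (opp p) i * emb p y
   + sc (cc i) * (k p i * emb p (cf.R (- 1) i y) - k (opp p) i * emb p (cf.R 1 i y))"
proof (induction y rule: free_induct)
 case (sc c)
 show ?case by (simp add: sc_commute)
next
 case (add a b)
 have "emb p (a + b) * e (opp p) i = emb p a * e (opp p) i + emb p b * e (opp p) i"
  by (simp add: emb_add distrib_right)
 also have "... \<simeq> (e (opp p) i * emb p a
   + sc (cc i) * (k p i * emb p (cf.R (- 1) i a) - k (opp p) i * emb p (cf.R 1 i a))) + (e (opp p) i * emb p b
   + sc (cc i) * (k p i * emb p (cf.R (- 1) i b) - k (opp p) i * emb p (cf.R 1 i b)))"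
  by (rule ideq_add[OF add])
 finally show ?case by (simp add: emb_add cf.R_add algebra_simps)
next
 case (gen g a)
 define f where "f = e (opp p) i"
 define Y where "Y t = emb p (cf.R t i a)" for t
 show ?case
 proof (cases "g \<in> Ihat")
  case True
  have "emb p (gen g * a) * f = e p g * (emb p a * f)" by (simp add: emb_gen_mult mult.assoc)
  also have "... \<simeq> e p g * (f * emb p a + sc (cc i) * (k p i * Y (- 1) - k (opp p) i * Y 1))"
   using gen by (intro ideq_left) (simp add: f_def Y_def)
  also have "... = (e p g * f) * emb p a + sc (cc i) * ((e p g * k p i) * Y (- 1) - (e p g * k (opp p) i) * Y 1)"
   by (simp add: distrib_left right_diff_distrib sc_left_commute[of "e p g"] mult.assoc)
  also have "... \<simeq> (f * e p g + (if g = i then sc (cc g) * (k p g - k (opp p) g) else 0)) * emb p a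
   + sc (cc i) * ((sc (s powi (- (sg p * sg p * Bh i g))) * (k p i * e p g)) * Y (- 1)
     - (sc (s powi (- (sg (opp p) * sg p * Bh i g))) * (k (opp p) i * e p g)) * Y 1)"
   unfolding f_def by (intro ideq_add ideq_right ideq_left ideq_diff e_e e_k True i)
  also have "sg p * sg p = 1" by (cases p) auto
  also have "sg (opp p) * sg p = - 1" by (cases p) auto
  also have "(f * e p g + (if g = i then sc (cc g) * (k p g - k (opp p) g) else 0)) * emb p a
   + sc (cc i) * ((sc (s powi (- (1 * Bh i g))) * (k p i * e p g)) * Y (- 1)
     - (sc (s powi (- (- 1 * Bh i g))) * (k (opp p) i * e p g)) * Y 1)
   = f * emb p (gen g * a)
   + sc (cc i) * (k p i * emb p (cf.R (- 1) i (gen g * a)) - k (opp p) i * emb p (cf.R 1 i (gen g * a)))"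
   by (simp add: cf.R_gen_mult emb_add emb_sc emb_gen_mult Y_def[symmetric] sc_left_commute[of "k p i"]
     sc_left_commute[of "k (opp p) i"] algebra_simps)
  finally show ?thesis by (simp add: f_def)
 next
  case False
  hence gi: "g ~= i" using i by auto
  have z: "x * (e p g * y) \<simeq> 0" for x y
   using ideq_left[OF ideq_right[OF out_zero(1)[OF False], where c = y], where c = x] by simp
  have "emb p (gen g * a) * f \<simeq> 0"
   using z[of 1 "emb p a * f"] by (simp add: emb_gen_mult mult.assoc)
  moreover have "f * emb p (gen g * a)
   + sc (cc i) * (k p i * emb p (cf.R (- 1) i (gen g * a)) - k (opp p) i * emb p (cf.R 1 i (gen g * a))) \<simeq> 0"
  proof -
   have "f * (e p g * emb p a) + sc (cc i) * (sc (s powi (- 1 * Bh i g)) * (k p i * (e p g * emb p (cf.R (- 1) i a)))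
     - sc (s powi (1 * Bh i g)) * (k (opp p) i * (e p g * emb p (cf.R 1 i a))))
     \<in> two_sided_ideal base_relators"
    using z unfolding ideq_0_iff
    by (blast intro: two_sided_ideal.add two_sided_ideal_left two_sided_ideal_diff)
   thus ?thesis
    unfolding ideq_0_iff using gi
    by (simp only: cf.R_gen_mult emb_sc emb_gen_mult if_False add_0 sc_left_commute[of "k p i"]
     sc_left_commute[of "k (opp p) i"])
  qed
  ultimately show ?thesis unfolding f_def[symmetric] by (blast intro: ideq_trans ideq_sym)
 qed
qed

text \<open>By \<open>R_serre\<close> both Cartan terms of the commutator vanish already in the free
  algebra, so the base relators suffice.\<close>

lemma serre_commutes:
 assumes "i \<in> Ihat" "j \<in> Ihat" "i ~= j" "l \<in> Ihat"
 shows "serre p i j * e (opp p) l \<simeq> e (opp p) l * serre p i j"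
 using emb_commutator[OF assms(4), of p "cf.serre_elt i j"] cf.R_serre[OF assms] serre_emb[OF assms(1-3)] by simp

lemma k_emb:
 assumes "i \<in> Ihat" "cf.hom i u y" shows "k p i * emb p' y \<simeq> sc (s powi (sg p * sg p' * u)) * (emb p' y * k p i)"
 using assms(2)
proof (induction rule: words_in_induct)
 case (single w c)
 have "k p i * emb p' (sgl (Word w) c)
   \<simeq> sc (s powi (sg p * sg p' * cf.wt i w)) * (emb p' (sgl (Word w) c) * k p i)"
 proof (induction w)
  case Nil
  show ?case by (simp add: zero_word_def[symmetric] sc_def[symmetric] sc_commute)
 next
  case (Cons l w)
  let ?x = "sgl (Word w) c"
  have "k p i * emb p' (gen l * ?x) = (k p i * e p' l) * emb p' ?x" by (simp add: emb_gen_mult mult.assoc)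
  also have "... \<simeq> (sc (s powi (sg p * sg p' * Bh i l)) * (e p' l * k p i)) * emb p' ?x"
   by (intro ideq_right k_e assms)
  also have "... = sc (s powi (sg p * sg p' * Bh i l)) * (e p' l * (k p i * emb p' ?x))" by (simp add: mult.assoc)
  also have "... \<simeq> sc (s powi (sg p * sg p' * Bh i l)) * (e p' l * (sc (s powi (sg p * sg p' * cf.wt i w)) * (emb p' ?x * k p i)))"
   by (intro ideq_left Cons.IH)
  also have "... = sc (s powi (sg p * sg p' * cf.wt i (l # w))) * (emb p' (gen l * ?x) * k p i)"
   by (simp add: sc_left_commute[of "e p' l"] sc_sc_mult emb_gen_mult mult.assoc cf.s_powi_add[symmetric] distrib_left)
  finally show ?case by (simp only: single_word_Cons)
 qed
 thus ?case using single by simp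
next
 case (add x y)
 thus ?case using ideq_add[OF add] by (simp add: emb_add distrib_left distrib_right)
qed simp

end

context twisted_datum begin

text \<open>The relators that involve generators of the Borel subalgebra only. A module over it
  satisfies them, and nothing more is asked of the module from which one induces.\<close>

definition borel_relators :: "ualg set" where
 "borel_relators = k_relators
  \<union> {k Pos i * e Pos j - sc (qp (dhat i * of_int (sg Pos * Csig i j))) * e Pos j * k Pos i | i j. i \<in> Ihat \<and> j \<in> Ihat}
  \<union> {serre Pos i j | i j. i \<in> Ihat \<and> j \<in> Ihat \<and> i ~= j} \<union> {central_relator}"

lemma borel_relators_subset: "borel_relators \<subseteq> relators"
 unfolding borel_relators_def relators_eq base_relators_def ke_relators_def by blast

definition borel_gens :: "ualg set" where
 "borel_gens = {e Pos i | i. i \<in> Ihat} \<union> {k p i | p i. i \<in> Ihat}"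

abbreviation SB :: "ualg set" where "SB \<equiv> subalgebra borel_gens"

lemma SB_e: "i \<in> Ihat ==> e Pos i \<in> SB" and SB_k: "i \<in> Ihat ==> k p i \<in> SB"
 by (rule subalgebra.gen, auto simp: borel_gens_def)+

lemma SB_central: "central_relator \<in> SB"
 unfolding central_relator_def
 by (intro subalgebra_diff subalgebra_prod_list subalgebra_1) (auto intro!: subalgebra_power SB_k simp: finite_Isig)

end

section \<open>Functions on words as a model of the induced module\<close>

datatype 'v wfun = Wfun (app: "anode list => 'v")

instantiation wfun :: (ab_group_add) ab_group_add
begin
definition "0 = Wfun (%_. 0)"
definition "m + m' = Wfun (%w. app m w + app m' w)"
definition "- m = Wfun (%w. - app m w)"
definition "m - m' = Wfun (%w. app m w - app m' w)"
instance
 by standard (auto simp: zero_wfun_def plus_wfun_def minus_wfun_def uminus_wfun_def algebra_simps)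
end

lemma app_simps [simp]: "app 0 w = 0" "app (m + m') w = app m w + app m' w" "app (- m) w = - app m w"
  "app (m - m') w = app m w - app m' w"
 by (simp_all add: zero_wfun_def plus_wfun_def minus_wfun_def uminus_wfun_def)

lemma wfun_eqI: "(!!w. app m w = app m' w) ==> m = m'"
 by (cases m; cases m') auto

text \<open>The analogue of a Verma module: the functions on words in the letters of the negative part with values in a
 module over the Borel subalgebra. Relations of the given module only hold modulo \<open>V0\<close>, so that regular
 representations of quotient algebras are covered.\<close>

locale borel_rep = twisted_datum X \<sigma> M q s + V: lin_ops scl opV
 for X \<sigma> M q s and scl :: "complex => 'v => 'v::ab_group_add" and opV :: "ugen => 'v => 'v" +
 fixes V0 :: "'v set"
 assumes V0_0: "0 \<in> V0" and V0_add: "v \<in> V0 ==> v' \<in> V0 ==> v + v' \<in> V0"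
  and V0_op: "v \<in> V0 ==> opV g v \<in> V0" and V0_scl: "v \<in> V0 ==> scl c v \<in> V0"
  and rel: "r \<in> borel_relators ==> lift scl opV r v \<in> V0"
begin

definition sclM :: "complex => 'v wfun => 'v wfun" where
 "sclM c m = Wfun (%w. scl c (app m w))"

definition Fop :: "anode => 'v wfun => 'v wfun" where
 "Fop j m = Wfun (%w. case w of [] => 0 | l # u => if l = j then app m u else 0)"

definition Kw :: "sign => anode => (anode list => 'v) => anode list => 'v" where
 "Kw p i f w = scl (s powi (- sg p * cf.wt i w)) (opV (GK p i) (f w))"

definition Kop :: "sign => anode => 'v wfun => 'v wfun" where
 "Kop p i m = Wfun (Kw p i (app m))"

definition Kd :: "anode => 'v wfun => 'v wfun" where
 "Kd i m = sclM (cc i) (Kop Pos i m - Kop Neg i m)"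

text \<open>Think of \<open>m\<close> as its value at the empty word plus the sum of
  \<open>Fop l\<close> applied to its branches. Moving e_i past a first letter f_l gives the
  recursive term, and the commutator of e_i with f_i gives \<open>Kd\<close> on the branch of
  \<open>i\<close>. In this way \<open>E_F\<close> holds by construction.\<close>

primrec Ew :: "anode => anode list => (anode list => 'v) => 'v" where
 "Ew i [] f = opV (GE Pos i) (f []) + app (Kd i (Wfun (%u. f (i # u)))) []"
| "Ew i (l # w) f = Ew i w (%u. f (l # u)) + app (Kd i (Wfun (%u. f (i # u)))) (l # w)"

definition Eop :: "anode => 'v wfun => 'v wfun" where
 "Eop i m = Wfun (%w. Ew i w (app m))"

fun opM :: "ugen => 'v wfun => 'v wfun" where
 "opM (GE Pos i) m = (if i \<in> Ihat then Eop i m else 0)"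
| "opM (GE Neg i) m = (if i \<in> Ihat then Fop i m else 0)"
| "opM (GK p i) m = (if i \<in> Ihat then Kop p i m else 0)"

definition \<delta> :: "'v => 'v wfun" where
 "\<delta> v = Wfun (%w. if w = [] then v else 0)"

lemmas V_lin = V.op_add V.op_scl V.op_0


lemma Kop_add: "Kop p i (m + m') = Kop p i m + Kop p i m'"
 by (rule wfun_eqI) (simp add: Kop_def Kw_def V_lin V.scale_right_distrib)
lemma Kop_scl: "Kop p i (sclM c m) = sclM c (Kop p i m)"
 by (rule wfun_eqI) (simp add: Kop_def Kw_def sclM_def V_lin mult.commute)
lemma sclM_add: "sclM c (m + m') = sclM c m + sclM c m'"
 by (rule wfun_eqI) (simp add: sclM_def V.scale_right_distrib)
lemma sclM_diff: "sclM c (m - m') = sclM c m - sclM c m'"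
 by (rule wfun_eqI) (simp add: sclM_def V.scale_right_diff_distrib)
lemma sclM_scl: "sclM c (sclM c' m) = sclM (c * c') m"
 by (rule wfun_eqI) (simp add: sclM_def)
lemma sclM_0: "sclM c 0 = 0" "sclM 0 m = 0"
 by (rule wfun_eqI, simp add: sclM_def)+
lemma app_sclM: "app (sclM c m) w = scl c (app m w)" by (simp add: sclM_def)
lemma Kd_add: "Kd i (m + m') = Kd i m + Kd i m'"
 by (simp add: Kd_def Kop_add sclM_add[symmetric] algebra_simps)
lemma Kd_scl: "Kd i (sclM c m) = sclM c (Kd i m)"
 by (simp add: Kd_def Kop_scl sclM_diff[symmetric] sclM_scl mult.commute)
lemma Kd_0: "Kd i 0 = 0"
 using Kd_scl[of i 0 0] by (simp add: sclM_0)
lemma Fop_add: "Fop i (m + m') = Fop i m + Fop i m'"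
 by (rule wfun_eqI) (auto simp: Fop_def split: list.split)
lemma Fop_scl: "Fop i (sclM c m) = sclM c (Fop i m)"
 by (rule wfun_eqI) (auto simp: Fop_def sclM_def split: list.split)
lemma Ew_add: "Ew i w (%u. f u + g u) = Ew i w f + Ew i w g"
proof (induction w arbitrary: f g)
 have Wf: "Wfun (%u. f (i # u) + g (i # u)) = Wfun (%u. f (i # u)) + Wfun (%u. g (i # u))"
  for f g :: "anode list => 'v" by (simp add: plus_wfun_def)
 {
  case Nil
  show ?case by (simp add: Wf V_lin Kd_add algebra_simps)
 next
  case (Cons l w)
  show ?case by (simp add: Wf Cons Kd_add algebra_simps)
 }
qed
lemma Ew_scl: "Ew i w (%u. scl c (f u)) = scl c (Ew i w f)"
proof (induction w arbitrary: f)
 have Wf: "Wfun (%u. scl c (f (i # u))) = sclM c (Wfun (%u. f (i # u)))"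
  for f :: "anode list => 'v" by (simp add: sclM_def)
 {
  case Nil
  show ?case by (simp add: Wf V_lin Kd_scl app_sclM V.scale_right_distrib)
 next
  case (Cons l w)
  show ?case by (simp add: Wf Cons Kd_scl app_sclM V.scale_right_distrib)
 }
qed
lemma Ew_0: "Ew i w (%_. 0) = 0"
 using Ew_scl[of i w 0 "%_. 0"] by simp

lemma E_add: "Eop i (m + m') = Eop i m + Eop i m'"
 by (rule wfun_eqI) (simp add: Eop_def Ew_add plus_wfun_def)
lemma E_scl: "Eop i (sclM c m) = sclM c (Eop i m)"
 by (rule wfun_eqI) (simp add: Eop_def Ew_scl sclM_def)

sublocale M: lin_ops sclM opM
proof
 show "opM g (x + y) = opM g x + opM g y" for g x y
  by (cases "(g, x + y)" rule: opM.cases) (auto simp: Kop_add Fop_add E_add)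
 show "opM g (sclM c x) = sclM c (opM g x)" for g c x
  by (cases "(g, x)" rule: opM.cases) (auto simp: Kop_scl Fop_scl E_scl sclM_0)
qed (simp_all add: sclM_add sclM_scl, (rule wfun_eqI, simp add: sclM_def V.scale_left_distrib)+)

lemma Kop_F: "Kop p i (Fop j m) = sclM (s powi (- sg p * Bh i j)) (Fop j (Kop p i m))"
 by (rule wfun_eqI)
  (auto simp: Kop_def Kw_def Fop_def sclM_def V_lin cf.s_powi_add[symmetric] algebra_simps split: list.split)

lemma E_F: "Eop i (Fop j m) = Fop j (Eop i m) + (if i = j then Kd i m else 0)"
proof (rule wfun_eqI)
 fix w
 have sub1: "Wfun (%u. app (Fop j m) (l # u)) = (if l = j then m else 0)" for l
  by (rule wfun_eqI) (auto simp: Fop_def)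
 have sub2: "(%u. app (Fop j m) (l # u)) = (if l = j then app m else (%_. 0))" for l
  by (auto simp: Fop_def)
 show "app (Eop i (Fop j m)) w = app (Fop j (Eop i m) + (if i = j then Kd i m else 0)) w"
  by (cases w) (auto simp: Eop_def sub1 sub2 Kd_0 Ew_0 zero_wfun_def[symmetric], auto simp: Fop_def V_lin)
qed

lemma E_\<delta>: "Eop i (\<delta> v) = \<delta> (opV (GE Pos i) v)"
proof (rule wfun_eqI)
 fix w
 have "Wfun (%u. app (\<delta> v) (l # u)) = 0" "(%u. app (\<delta> v) (l # u)) = (%_. 0)" for l
  by (simp_all add: \<delta>_def zero_wfun_def)
 thus "app (Eop i (\<delta> v)) w = app (\<delta> (opV (GE Pos i) v)) w"
  by (cases w) (simp_all add: Eop_def Kd_0 Ew_0, simp_all add: \<delta>_def)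
qed

lemma K_\<delta>: "Kop p i (\<delta> v) = \<delta> (opV (GK p i) v)"
 by (rule wfun_eqI) (auto simp: Kop_def Kw_def \<delta>_def V_lin)

lemma \<delta>_add: "\<delta> (v + v') = \<delta> v + \<delta> v'" and \<delta>_scl: "\<delta> (scl c v) = sclM c (\<delta> v)"
 by (rule wfun_eqI, auto simp: \<delta>_def sclM_def)+

lemma M_act_\<delta>: "b \<in> SB ==> M.act b (\<delta> v) = \<delta> (V.act b v)"
proof (induction b arbitrary: v rule: subalgebra.induct)
 case (scalar c)
 show ?case by (simp add: M.act_sc V.act_sc \<delta>_scl)
next
 case (gen b)
 thus ?case unfolding borel_gens_def e_def k_def
  by (auto simp: M.act_gen V.act_gen E_\<delta> K_\<delta>)
next
 case (add a b)
 thus ?case by (simp add: M.act_add V.act_add \<delta>_add)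
next
 case (mult a b)
 thus ?case by (simp add: M.act_mult V.act_mult)
qed

text \<open>Closure under negative generators alone. Stability under the other generators is checked
  on the generating set, by \<open>Fspan_K\<close> and \<open>Fspan_E\<close>.\<close>

inductive_set Fspan :: "'v wfun set => 'v wfun set" for G where
 zero: "0 \<in> Fspan G"
| gen: "m \<in> G ==> sclM c m \<in> Fspan G"
| add: "m \<in> Fspan G ==> m' \<in> Fspan G ==> m + m' \<in> Fspan G"
| F: "m \<in> Fspan G ==> j \<in> Ihat ==> Fop j m \<in> Fspan G"

lemma Fspan_gen: "m \<in> G ==> m \<in> Fspan G" using Fspan.gen[of m G 1] by simp
lemma Fspan_scl: "m \<in> Fspan G ==> sclM c m \<in> Fspan G"
proof (induction rule: Fspan.induct)
 case zero
 show ?case by (simp add: Fspan.zero)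
next
 case (gen m c')
 thus ?case by (simp add: sclM_scl Fspan.gen)
next
 case (add m m')
 thus ?case by (simp add: sclM_add Fspan.add)
next
 case (F m j)
 thus ?case using Fspan.F[OF F.IH F.hyps(2)] by (simp add: Fop_scl)
qed
lemma Fspan_minus: "m \<in> Fspan G ==> - m \<in> Fspan G"
 using Fspan_scl[of m G "- 1"] by simp
lemma Fspan_diff: "m \<in> Fspan G ==> m' \<in> Fspan G ==> m - m' \<in> Fspan G"
 using Fspan.add[OF _ Fspan_minus, of m G m'] by simp

text \<open>Three layers: \<open>Mt\<close> is generated by the given module; modulo
  \<open>N0\<close> all relations except the negative Serre relations hold on it; \<open>NN\<close>
  adds the latter. From here on, equality means congruence modulo \<open>NN\<close>.\<close>

definition Mt :: "'v wfun set" where "Mt = Fspan (range \<delta>)"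
definition N0 :: "'v wfun set" where "N0 = Fspan (\<delta> ` V0)"
definition NN :: "'v wfun set" where
 "NN = Fspan (\<delta> ` V0 \<union> {M.act (serre Neg i j) m | i j m. i \<in> Ihat \<and> j \<in> Ihat \<and> i ~= j \<and> m \<in> Mt})"

lemma Fspan_mono: assumes "G \<subseteq> H" shows "Fspan G \<subseteq> Fspan H"
proof
 fix m assume "m \<in> Fspan G"
 thus "m \<in> Fspan H" by induction (use assms in "auto intro: Fspan.intros")
qed

lemma N0_NN: "N0 \<subseteq> NN" unfolding N0_def NN_def by (rule Fspan_mono) auto

lemma Fspan_K:
 assumes "!!m. m \<in> G ==> Kop p i m \<in> Fspan G" "m \<in> Fspan G" shows "Kop p i m \<in> Fspan G"
 using assms(2)
proof induction
 case zero
 have "Kop p i 0 = 0" using Kop_scl[of p i 0 0] by (simp add: sclM_0)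
 thus ?case by (simp add: Fspan.zero)
qed (auto simp: Kop_scl Kop_add Kop_F intro: Fspan.intros Fspan_scl assms)

lemma Fspan_E:
 assumes "!!p m. m \<in> G ==> Kop p i m \<in> Fspan G" "!!m. m \<in> G ==> Eop i m \<in> Fspan G" "m \<in> Fspan G"
 shows "Eop i m \<in> Fspan G"
 using assms(3)
proof induction
 case zero
 have "Eop i 0 = 0" using E_scl[of i 0 0] by (simp add: sclM_0)
 thus ?case by (simp add: Fspan.zero)
next
 case (gen m c)
 show ?case using Fspan_scl assms(2) gen by (simp add: E_scl)
next
 case (add m m')
 show ?case using add by (simp add: Fspan.add E_add)
next
 case (F m j)
 have "Kd i m \<in> Fspan G"
  unfolding Kd_def by (intro Fspan_scl Fspan_diff Fspan_K[OF assms(1) F.hyps(1)])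
 thus ?case using Fspan.add[OF Fspan.F[OF F.IH F.hyps(2)]] Fspan.F[OF F.IH F.hyps(2)]
  by (cases "i = j") (simp_all add: E_F)
qed

lemma Mt_op: "m \<in> Mt ==> opM g m \<in> Mt"
proof -
 assume m: "m \<in> Mt"
 have K: "!!p i m. m \<in> range \<delta> ==> Kop p i m \<in> Fspan (range \<delta>)" by (auto simp: K_\<delta> intro: Fspan_gen)
 have E: "!!i m. m \<in> range \<delta> ==> Eop i m \<in> Fspan (range \<delta>)" by (auto simp: E_\<delta> intro: Fspan_gen)
 show ?thesis using m
  by (cases "(g, m)" rule: opM.cases)
   (use Fspan_K[OF K] Fspan_E[OF K E] in "simp_all add: Mt_def Fspan.zero Fspan.F")
qed

lemma N0_op: "m \<in> N0 ==> opM g m \<in> N0"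
proof -
 assume m: "m \<in> N0"
 have K: "!!p i m. m \<in> \<delta> ` V0 ==> Kop p i m \<in> Fspan (\<delta> ` V0)" by (auto simp: K_\<delta> intro!: Fspan_gen imageI V0_op)
 have E: "!!i m. m \<in> \<delta> ` V0 ==> Eop i m \<in> Fspan (\<delta> ` V0)" by (auto simp: E_\<delta> intro!: Fspan_gen imageI V0_op)
 show ?thesis using m
  by (cases "(g, m)" rule: opM.cases)
   (use Fspan_K[OF K] Fspan_E[OF K E] in "simp_all add: N0_def Fspan.zero Fspan.F")
qed

lemma act_closed:
 assumes "!!g m. m \<in> S ==> opM g m \<in> S" "!!m m'. m \<in> S ==> m' \<in> S ==> m + m' \<in> S"
  "!!c m. m \<in> S ==> sclM c m \<in> S" "m \<in> S"
 shows "M.act a m \<in> S"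
 by (induction a rule: free_induct) (auto simp: M.act_sc M.act_add M.act_gen_mult assms)

lemma Mt_act: "m \<in> Mt ==> M.act a m \<in> Mt"
 by (rule act_closed[OF Mt_op]) (auto simp: Mt_def intro: Fspan.add Fspan_scl)
lemma N0_act: "m \<in> N0 ==> M.act a m \<in> N0"
 by (rule act_closed[OF N0_op]) (auto simp: N0_def intro: Fspan.add Fspan_scl)

lemma ideal_acts:
 assumes S: "!!m a. m \<in> Fspan G ==> M.act a m \<in> Fspan G"
  and R: "!!r m. r \<in> R ==> m \<in> Mt ==> M.act r m \<in> Fspan G"
  and a: "a \<in> two_sided_ideal R" and m: "m \<in> Mt"
 shows "M.act a m \<in> Fspan G"
 using a
proof induction
 case (gen r a b)
 thus ?case using R[OF gen Mt_act[OF m, of b]] S by (simp add: M.act_mult)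
qed (auto simp: M.act_0 M.act_add intro: Fspan.intros)

lemma ideq_acts:
 assumes S: "!!m a. m \<in> Fspan G ==> M.act a m \<in> Fspan G"
  and R: "!!r m. r \<in> R ==> m \<in> Mt ==> M.act r m \<in> Fspan G"
  and a: "ideq R a b" and m: "m \<in> Mt"
 shows "M.act a m - M.act b m \<in> Fspan G"
 using ideal_acts[OF S R a[unfolded ideq_def] m] by (simp add: M.act_diff)

text \<open>A relator that vanishes on the image of the given module and passes through the negative
  generators vanishes on all of \<open>Mt\<close>.\<close>

lemma zeroI:
 assumes base: "!!v. M.act r (\<delta> v) \<in> N0"
  and step: "!!j m. j \<in> Ihat ==> m \<in> Mt ==> M.act r m \<in> N0 ==> M.act r (Fop j m) \<in> N0"
  and m: "m \<in> Mt"
 shows "M.act r m \<in> N0"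
 using m[unfolded Mt_def]
proof induction
 case zero
 show ?case by (simp add: M.act_0_right N0_def Fspan.zero)
next
 case (gen m c)
 then obtain v where "m = \<delta> v" by blast
 thus ?case using base by (simp add: M.act_scl N0_def Fspan_scl)
next
 case (add m m')
 thus ?case by (simp add: M.act_add_right N0_def Fspan.add)
next
 case (F m j)
 thus ?case using step by (simp add: Mt_def)
qed

lemma N0_\<delta>: "v \<in> V0 ==> \<delta> v \<in> N0" by (auto simp: N0_def intro: Fspan_gen)
lemma N0_sclF: "m \<in> N0 ==> j \<in> Ihat ==> sclM c (Fop j m) \<in> N0"
 by (auto simp: N0_def intro: Fspan.F Fspan_scl)

lemma act_e: "i \<in> Ihat ==> M.act (e Pos i) m = Eop i m" "i \<in> Ihat ==> M.act (e Neg i) m = Fop i m"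
 and act_k: "i \<in> Ihat ==> M.act (k p i) m = Kop p i m"
 by (simp_all add: e_def k_def M.act_gen)

lemma k_relators_act:
 assumes "r \<in> k_relators" "m \<in> Mt" shows "M.act r m \<in> N0"
proof -
 have base: "M.act r (\<delta> v) \<in> N0" for v
 proof -
  have "r \<in> SB" using assms(1) unfolding k_relators_def comm_def
   by (elim UnE CollectE exE conjE) (hypsubst, intro subalgebra_diff subalgebra.mult SB_k subalgebra_1, assumption+)+
  moreover have "r \<in> borel_relators" using assms(1) by (simp add: borel_relators_def)
  ultimately show ?thesis using rel[of r v] by (simp add: M_act_\<delta> N0_\<delta>)
 qed
 have F_diff: "Fop j (x - y) = Fop j x - Fop j y" for j x y
  using Fop_add[of j x "- y"] Fop_scl[of j "- 1" y] by simp
 have "\<exists>c. M.act r (Fop j m) = sclM c (Fop j (M.act r m))" if "j \<in> Ihat" for j m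
  using assms(1) unfolding k_relators_def
 proof (elim UnE CollectE exE conjE)
  fix i assume i: "r = k Pos i * k Neg i - 1" "i \<in> Ihat"
  have "M.act r (Fop j m) = Fop j (M.act r m)"
   unfolding i(1) M.act_diff M.act_mult M.act_1 act_k[OF i(2)] Kop_F Kop_scl sclM_scl F_diff
   by (simp add: cf.s_powi_add[symmetric])
  thus ?thesis by (intro exI[of _ 1]) simp
 next
  fix i assume i: "r = k Neg i * k Pos i - 1" "i \<in> Ihat"
  have "M.act r (Fop j m) = Fop j (M.act r m)"
   unfolding i(1) M.act_diff M.act_mult M.act_1 act_k[OF i(2)] Kop_F Kop_scl sclM_scl F_diff
   by (simp add: cf.s_powi_add[symmetric])
  thus ?thesis by (intro exI[of _ 1]) simp
 next
  fix i i' assume i: "r = comm (k Pos i) (k Pos i')" "i \<in> Ihat" "i' \<in> Ihat"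
  have "M.act r (Fop j m) = sclM (s powi (- sg Pos * Bh i j) * s powi (- sg Pos * Bh i' j)) (Fop j (M.act r m))"
   unfolding i(1) comm_def M.act_diff M.act_mult act_k[OF i(2)] act_k[OF i(3)] Kop_F Kop_scl sclM_scl F_diff sclM_diff
   by (simp only: mult.commute[of "s powi (- sg Pos * Bh i j)"])
  thus ?thesis by blast
 qed
 thus ?thesis using zeroI[OF base _ assms(2)] N0_sclF by metis
qed

lemma N0_scl: "m \<in> N0 ==> sclM c m \<in> N0" and N0_add: "m \<in> N0 ==> m' \<in> N0 ==> m + m' \<in> N0"
 and N0_diff: "m \<in> N0 ==> m' \<in> N0 ==> m - m' \<in> N0" and N0_0: "0 \<in> N0"
 by (auto simp: N0_def intro: Fspan_scl Fspan.add Fspan_diff Fspan.zero)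

lemma F_diff: "Fop j (x - y) = Fop j x - Fop j y"
 using Fop_add[of j x "- y"] Fop_scl[of j "- 1" y] by simp

lemma K_commute_N0:
 assumes "m \<in> Mt" "i \<in> Ihat" "j \<in> Ihat"
 shows "Kop p i (Kop p' j m) - Kop p' j (Kop p i m) \<in> N0"
 using ideq_acts[of "\<delta> ` V0" k_relators, OF _ _ k_comm_ideal[OF subset_refl assms(2,3)] assms(1), of p p']
  N0_act k_relators_act assms(2,3)
 by (simp add: N0_def M.act_mult act_k)

lemma base_relators_act:
 assumes r: "r \<in> base_relators" and m: "m \<in> Mt" shows "M.act r m \<in> N0"
 using r unfolding base_relators_def
proof (elim UnE)
 assume "r \<in> out_relators"
 then obtain g p i where g: "r = gen g" "g = GE p i \<or> g = GK p i" "i \<notin> Ihat"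
  unfolding out_relators_def by blast
 hence "M.act r m = 0" by (cases p) (auto simp: M.act_gen)
 thus ?thesis using N0_0 by simp
next
 assume "r \<in> k_relators" thus ?thesis by (rule k_relators_act[OF _ m])
next
 assume "r \<in> ef_relators"
 then obtain i j where ij: "i \<in> Ihat" "j \<in> Ihat" and r: "r = comm (e Pos i) (e Neg j) -
    (if i = j then sc (1 / (qp (dhat i) - qp (- dhat i))) * (k Pos i - k Neg i) else 0)"
  unfolding ef_relators_def by blast
 have "M.act r m = 0"
  unfolding r qp_Dh[OF ij(1)] cc_def[symmetric]
  by (cases "i = j") (use ij in "simp_all add: comm_def M.act_diff M.act_mult M.act_sc M.act_0 act_e act_k E_F Kd_def")
 thus ?thesis using N0_0 by simp
next
 assume "r \<in> ke_relators"
 then obtain i j p where ij: "i \<in> Ihat" "j \<in> Ihat"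
  and r: "r = k Pos i * e p j - sc (s powi (sg p * Bh i j)) * (e p j * k Pos i)"
  unfolding ke_relators_def using qp_Bh by (auto simp: mult.assoc simp del: Csig.simps dhat.simps)
 show ?thesis
 proof (cases p)
  case Neg
  hence "M.act r m = 0" unfolding r
   using ij by (simp add: M.act_diff M.act_mult M.act_sc act_e act_k Kop_F)
  thus ?thesis using N0_0 by simp
 next
  case Pos
  have act_r: "M.act r m = Kop Pos i (Eop j m) - sclM (s powi Bh i j) (Eop j (Kop Pos i m))" for m
   unfolding r Pos using ij by (simp add: M.act_diff M.act_mult M.act_sc act_e act_k)
  show ?thesis
  proof (rule zeroI[OF _ _ m])
   fix v
   have rb: "r \<in> borel_relators"
    unfolding borel_relators_def r Pos qp_Bh[OF ij(1), symmetric] mult.assoc[symmetric] using ij by blast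
   have "r \<in> SB" unfolding r Pos using ij by (intro subalgebra_diff subalgebra.mult subalgebra.scalar SB_e SB_k)
   thus "M.act r (\<delta> v) \<in> N0" using rel[OF rb, of v] by (simp add: M_act_\<delta> N0_\<delta>)
  next
   fix l m assume l: "l \<in> Ihat" and m: "m \<in> Mt" and IH: "M.act r m \<in> N0"
   have A: "M.act r (Fop l m) = sclM (s powi (- Bh i l)) (Fop l (M.act r m))
     + (if j = l then Kop Pos i (Kd j m) - Kd j (Kop Pos i m) else 0)"
   proof (cases "j = l")
    case True
    have "s powi Bh i l * s powi (- Bh i l) = 1" by (simp add: cf.s_powi_add[symmetric])
    thus ?thesis unfolding act_r
     by (simp add: True E_F Kop_F Kop_add Kop_scl E_scl E_add Kd_scl Fop_scl F_diff sclM_scl sclM_add sclM_diff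
       mult.commute)
   next
    case False
    thus ?thesis unfolding act_r
     by (simp add: E_F Kop_F E_scl Fop_scl F_diff sclM_scl sclM_diff mult.commute)
   qed
   have K_diff: "Kop p i (x - y) = Kop p i x - Kop p i y" for p i x y
    using Kop_add[of p i x "- y"] Kop_scl[of p i "- 1" y] by simp
   have "Kop Pos i (Kd j m) - Kd j (Kop Pos i m)
    = sclM (cc j) ((Kop Pos i (Kop Pos j m) - Kop Pos j (Kop Pos i m)) - (Kop Pos i (Kop Neg j m) - Kop Neg j (Kop Pos i m)))"
    unfolding Kd_def Kop_scl K_diff sclM_diff by simp
   also have "... \<in> N0" by (intro N0_scl N0_diff K_commute_N0 m ij)
   finally show "M.act r (Fop l m) \<in> N0" unfolding A using N0_add[OF N0_sclF[OF IH l]] N0_sclF[OF IH l] by (cases "j = l") simp_all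
  qed
 qed
next
 \<comment> \<open>Because the labels form a null vector, the product of the \<open>k\<close>'s
   passes every negative generator without a scalar; its action is then decided on the given
   module.\<close>
 assume r: "r \<in> {central_relator}"
 define L where "L = Eps # map Nd (sorted_list_of_set Isig)"
 have L_set: "set L = Ihat" "distinct L" by (auto simp: L_def Ihat_def finite_Isig distinct_map inj_on_def)
 have P: "M.act (prod_list (map (%i. k Pos i ^ label i) js)) (Fop l m)
   = sclM (s powi (- (\<Sum>i\<leftarrow>js. int (label i) * Bh i l))) (Fop l (M.act (prod_list (map (%i. k Pos i ^ label i) js)) m))"
  if "set js \<subseteq> Ihat" for js l m using that
 proof (induction js arbitrary: m)
  case (Cons i js)
  have i: "i \<in> Ihat" using Cons.prems by simp
  have Kn: "M.act (k Pos i ^ n) (Fop l m) = sclM (s powi (- (int n * Bh i l))) (Fop l (M.act (k Pos i ^ n) m))" for n m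
  proof (induction n)
   case (Suc n)
   have "s powi (- (int (Suc n) * Bh i l)) = s powi (- (int n * Bh i l)) * s powi (- Bh i l)"
    by (simp add: cf.s_powi_add[symmetric] algebra_simps)
   thus ?case using Suc by (simp add: M.act_mult act_k[OF i] Kop_scl Kop_F sclM_scl)
  qed (simp add: M.act_1)
  show ?case using Cons.IH Cons.prems
   by (simp add: M.act_mult M.act_scl Kn sclM_scl cf.s_powi_add[symmetric] algebra_simps)
 qed (simp add: M.act_1)
 have sum0: "(\<Sum>i\<leftarrow>L. int (label i) * Bh i l) = 0" if "l \<in> Ihat" for l
  using label_null[OF that] sum_list_distinct_conv_sum_set[OF L_set(2), of "%i. int (label i) * Bh i l"] L_set(1) by simp
 have r': "r = prod_list (map (%i. k Pos i ^ label i) L) - 1" using r by (simp add: central_relator_def L_def)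
 show ?thesis
 proof (rule zeroI[OF _ _ m])
  fix v
  have rb: "r \<in> borel_relators" using r by (simp add: borel_relators_def)
  have "r \<in> SB" using r SB_central by simp
  thus "M.act r (\<delta> v) \<in> N0" using rel[OF rb, of v] by (simp add: M_act_\<delta> N0_\<delta>)
 next
  fix l m assume l: "l \<in> Ihat" and IH: "M.act r m \<in> N0"
  have "M.act r (Fop l m) = Fop l (M.act r m)"
   unfolding r' M.act_diff M.act_1 P[OF equalityD1[OF L_set(1)]] sum0[OF l] F_diff by simp
  thus "M.act r (Fop l m) \<in> N0" using N0_sclF[OF IH l, of 1] by simp
 qed
qed

lemma beq_act: "a \<simeq> b ==> m \<in> Mt ==> M.act a m - M.act b m \<in> N0"
 using ideq_acts[of "\<delta> ` V0" base_relators a b m] N0_act base_relators_act unfolding N0_def by blast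

lemma serre_Pos_act:
 assumes ij: "i \<in> Ihat" "j \<in> Ihat" "i ~= j" and m: "m \<in> Mt"
 shows "M.act (serre Pos i j) m \<in> N0"
proof (rule zeroI[OF _ _ m])
 fix v
 have rb: "serre Pos i j \<in> borel_relators" using ij by (auto simp: borel_relators_def)
 have "serre Pos i j \<in> SB" unfolding serre_def Let_def using ij
  by (intro subalgebra_sum subalgebra.mult subalgebra.scalar subalgebra_power SB_e)
 thus "M.act (serre Pos i j) (\<delta> v) \<in> N0" using rel[OF rb, of v] by (simp add: M_act_\<delta> N0_\<delta>)
next
 fix l m assume l: "l \<in> Ihat" and m: "m \<in> Mt" and IH: "M.act (serre Pos i j) m \<in> N0"
 have "M.act (serre Pos i j) (Fop l m) - Fop l (M.act (serre Pos i j) m) \<in> N0"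
  using beq_act[OF serre_commutes[OF ij l, of Pos] m] l by (simp add: M.act_mult act_e)
 from N0_add[OF this N0_sclF[OF IH l, of 1]] show "M.act (serre Pos i j) (Fop l m) \<in> N0" by simp
qed

text \<open>Closing the negative Serre elements under negative generators alone already gives a
  submodule: modulo the base relators they commute with \<open>e Pos l\<close>, and up to a scalar
  with \<open>k p l\<close>.\<close>

lemma NN_op: assumes "m \<in> NN" shows "opM g m \<in> NN"
proof -
 define G where "G = \<delta> ` V0 \<union> {M.act (serre Neg i j) m | i j m. i \<in> Ihat \<and> j \<in> Ihat \<and> i ~= j \<and> m \<in> Mt}"
 have NN: "NN = Fspan G" by (simp add: NN_def G_def)
 have sub: "N0 \<subseteq> Fspan G" using N0_NN NN by simp
 have S: "M.act a (M.act (serre Neg i j) m) \<in> Fspan G"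
  if "a * serre Neg i j \<simeq> sc c * (serre Neg i j * a)" "i \<in> Ihat" "j \<in> Ihat" "i ~= j" "m \<in> Mt" for a c i j m
 proof -
  have "M.act a (M.act (serre Neg i j) m) - sclM c (M.act (serre Neg i j) (M.act a m)) \<in> Fspan G"
   using beq_act[OF that(1,5)] sub by (auto simp: M.act_mult M.act_sc)
  moreover have "M.act (serre Neg i j) (M.act a m) \<in> G"
   unfolding G_def using that(2-4) Mt_act[OF that(5)] by blast
  hence "sclM c (M.act (serre Neg i j) (M.act a m)) \<in> Fspan G" by (rule Fspan.gen)
  ultimately show ?thesis using Fspan.add by fastforce
 qed
 have K: "Kop p l m \<in> Fspan G" if "m \<in> G" "l \<in> Ihat" for p l m
  using that(1)[unfolded G_def]
 proof (elim UnE CollectE exE conjE imageE)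
  fix v assume "m = \<delta> v" "v \<in> V0"
  thus ?thesis using sub N0_\<delta>[OF V0_op] by (auto simp: K_\<delta>)
 next
  fix i j m' assume ij: "m = M.act (serre Neg i j) m'" "i \<in> Ihat" "j \<in> Ihat" "i ~= j" "m' \<in> Mt"
  have "cf.hom l (Bh l j + int n * Bh l i) (cf.ads i u n (gen j))" for n u
  proof (induction n)
   case (Suc n)
   have e: "Bh l j + int (Suc n) * Bh l i = Bh l j + int n * Bh l i + Bh l i" by (simp add: algebra_simps)
   show ?case unfolding cf.ads.simps e
    by (intro cf.hom_diff words_in_sc cf.hom_gen_mult cf.hom_mult_gen Suc)
  qed (auto intro: words_in_gen)
  hence "cf.hom l (Bh l j + int (nat (1 - Csig i j)) * Bh l i) (cf.serre_elt i j)"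
   unfolding cf.serre_elt_def .
  from k_emb[OF that(2) this, of p Neg] obtain c where
   "k p l * serre Neg i j \<simeq> sc c * (serre Neg i j * k p l)" using serre_emb[OF ij(2-4)] by metis
  from S[OF this ij(2-5)] show ?thesis using that(2) ij(1) by (simp add: act_k)
 qed
 have E: "Eop l m \<in> Fspan G" if "m \<in> G" "l \<in> Ihat" for l m
  using that(1)[unfolded G_def]
 proof (elim UnE CollectE exE conjE imageE)
  fix v assume "m = \<delta> v" "v \<in> V0"
  thus ?thesis using sub N0_\<delta>[OF V0_op] by (auto simp: E_\<delta>)
 next
  fix i j m' assume ij: "m = M.act (serre Neg i j) m'" "i \<in> Ihat" "j \<in> Ihat" "i ~= j" "m' \<in> Mt"
  have "e Pos l * serre Neg i j \<simeq> sc 1 * (serre Neg i j * e Pos l)"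
   using ideq_sym[OF serre_commutes[OF ij(2-4) that(2), of Neg]] by simp
  from S[OF this ij(2-5)] show ?thesis using that(2) ij(1) by (simp add: act_e)
 qed
 show ?thesis using assms unfolding NN
  by (cases "(g, m)" rule: opM.cases)
   (use Fspan_K[OF K] Fspan_E[OF K E] in "auto simp: Fspan.zero Fspan.F")
qed

lemma NN_act: "m \<in> NN ==> M.act a m \<in> NN"
 by (rule act_closed[OF NN_op]) (auto simp: NN_def intro: Fspan.add Fspan_scl)

lemma J_act: assumes "a \<in> J" "m \<in> Mt" shows "M.act a m \<in> NN"
proof -
 have "M.act r m \<in> NN" if "r \<in> relators" "m \<in> Mt" for r m
  using that(1) unfolding relators_eq
 proof (elim UnE CollectE exE conjE)
  assume "r \<in> base_relators" thus ?thesis using base_relators_act that(2) N0_NN by blast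
 next
  fix p i j assume ij: "r = serre p i j" "i \<in> Ihat" "j \<in> Ihat" "i ~= j"
  show ?thesis
  proof (cases p)
   case Pos
   thus ?thesis using serre_Pos_act[OF ij(2-4) that(2)] N0_NN ij(1) by blast
  next
   case Neg
   thus ?thesis unfolding NN_def ij(1) using ij(2-4) that(2) by (intro Fspan_gen) blast
  qed
 qed
 thus ?thesis using ideal_acts[of _ relators a m] NN_act assms unfolding NN_def J_def by blast
qed

text \<open>A negative Serre element consists of words of length at least 2, so whatever it produces
  is zero at shorter words. The lowest two layers of the induced module are thus as large as they
  can be.\<close>

lemma NN_low: assumes "m \<in> NN" shows "app m [] \<in> V0" "app m [l] \<in> V0"
proof -
 have FF: "app (M.act (emb Neg y) m) w = 0" if "words_in (%u. length u \<ge> 2) y" "length w \<le> 1" for y m w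
  using that(1)
 proof (induction rule: words_in_induct)
  case (single u c)
  then obtain a b u' where u: "u = a # b # u'" by (metis One_nat_def Suc_le_length_iff numeral_2_eq_2)
  define x where "x = M.act (emb Neg (sgl (Word u') c)) m"
  have "M.act (emb Neg (sgl (Word u) c)) m = M.act (e Neg a) (M.act (e Neg b) x)"
   unfolding u single_word_Cons emb_gen_mult M.act_mult x_def ..
  also have "app ... w = 0"
   using that(2) by (cases w) (auto simp: e_def M.act_gen Fop_def)
  finally show ?case .
 qed (simp_all add: M.act_0 emb_add M.act_add)
 have len: "words_in (%u. length u = Suc n) (cf.ads i u n (gen j))" for i u n j
 proof (induction n)
  case (Suc n)
  have "words_in (%v. length v = Suc (Suc n)) (gen i * cf.ads i u n (gen j))"
   by (rule words_in_mult[where P = "%v. length v = 1", OF words_in_gen Suc]) auto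
  moreover have "words_in (%v. length v = Suc (Suc n)) (cf.ads i u n (gen j) * gen i)"
   by (rule words_in_mult[where Q = "%v. length v = 1", OF Suc words_in_gen]) auto
  ultimately show ?case
   using words_in_add[OF _ words_in_sc[of _ _ "- c" for c]] by (fastforce simp: sc_minus)
 qed (auto intro: words_in_gen)
 have "app m w \<in> V0" if "length w \<le> 1" for w
  using assms that unfolding NN_def
 proof (induction arbitrary: w rule: Fspan.induct)
  case (gen m c)
  thus ?case
  proof (elim UnE CollectE exE conjE imageE)
   fix v assume "m = \<delta> v" "v \<in> V0"
   thus ?thesis using V0_0 V0_scl by (auto simp: \<delta>_def sclM_def)
  next
   fix i j m' assume ij: "m = M.act (serre Neg i j) m'" "i \<in> Ihat" "j \<in> Ihat" "i ~= j" "m' \<in> Mt"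
   have "nat (1 - Csig i j) \<ge> 1" using Csig_nonpos[OF ij(2-4)] by simp
   hence "words_in (%u. length u \<ge> 2) (cf.serre_elt i j)"
    using len[of "nat (1 - Csig i j)" i "Bh i j" j] unfolding cf.serre_elt_def words_in_def by auto
   from FF[OF this gen(2)] show ?thesis using V0_0 unfolding ij(1) serre_emb[OF ij(2-4)] by (simp add: app_sclM)
  qed
 next
  case (F m j)
  thus ?case by (cases w) (auto simp: Fop_def V0_0)
 qed (auto simp: V0_0 intro: V0_add)
 thus "app m [] \<in> V0" "app m [l] \<in> V0" by auto
qed

lemma \<delta>_Mt: "\<delta> v \<in> Mt" unfolding Mt_def by (rule Fspan_gen) simp

end

text \<open>Independence of joint eigenvectors, modulo a subspace: an operator that separates
  \<open>a0\<close> from \<open>b\<close>, minus its eigenvalue at \<open>a0\<close>, removes the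
  term at \<open>a0\<close>, and the induction hypothesis applies to the rescaled remainder.\<close>

lemma (in vector_space) eigen_independent:
 fixes T :: "'p => 'b => 'b" and x :: "'i => 'b"
 assumes N: "0 \<in> N" "!!a b. a \<in> N ==> b \<in> N ==> a + b \<in> N" "!!c a. a \<in> N ==> scale c a \<in> N"
  and T: "!!p a b. T p (a + b) = T p a + T p b" "!!p c a. T p (scale c a) = scale c (T p a)"
   "!!p a. p \<in> P ==> a \<in> N ==> T p a \<in> N"
  and fin: "finite S"
  and eig: "!!p a. p \<in> P ==> a \<in> S ==> T p (x a) - scale (c p a) (x a) \<in> N"
  and sep: "!!a b. a \<in> S ==> b \<in> S ==> a ~= b ==> \<exists>p\<in>P. c p a ~= c p b"
  and sum: "(\<Sum>a\<in>S. x a) \<in> N"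
 shows "\<forall>a\<in>S. x a \<in> N"
 using fin eig sep sum
proof (induction S arbitrary: x rule: finite_induct)
 case (insert a0 S)
 have Nm: "- a \<in> N" if "a \<in> N" for a using N(3)[OF that, of "- 1"] by simp
 have Nd: "a - b \<in> N" if "a \<in> N" "b \<in> N" for a b using N(2)[OF that(1) Nm[OF that(2)]] by simp
 have Ns: "(\<Sum>a\<in>F. g a) \<in> N" if "!!a. a \<in> F ==> g a \<in> N" for F :: "'i set" and g
  using that by (induction F rule: infinite_finite_induct) (auto intro: N)
 have T0: "T p 0 = 0" for p using T(2)[of p 0 0] by simp
 have Ts: "T p (sum g F) = (\<Sum>a\<in>F. T p (g a))" for p F and g :: "'i => 'b"
  by (induction F rule: infinite_finite_induct) (auto simp: T0 T(1))
 have S: "x b \<in> N" if b: "b \<in> S" for b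
 proof -
  obtain p where p: "p \<in> P" "c p a0 ~= c p b" using insert.prems(2)[of a0 b] b insert.hyps by auto
  define y where "y a = scale (c p a - c p a0) (x a)" for a
  have "\<forall>a\<in>S. y a \<in> N"
  proof (rule insert.IH)
   fix p' a assume a: "p' \<in> P" "a \<in> S"
   have "T p' (y a) - scale (c p' a) (y a) = scale (c p a - c p a0) (T p' (x a) - scale (c p' a) (x a))"
    by (simp add: y_def T(2) scale_right_diff_distrib mult.commute)
   also have "... \<in> N" using insert.prems(1)[OF a(1), of a] a by (intro N(3)) simp
   finally show "T p' (y a) - scale (c p' a) (y a) \<in> N" .
  next
   show "\<exists>p\<in>P. c p a ~= c p b" if "a \<in> S" "b \<in> S" "a ~= b" for a b using insert.prems(2) that by blast
   have "(\<Sum>a\<in>S. y a) = (T p (\<Sum>a\<in>insert a0 S. x a) - scale (c p a0) (\<Sum>a\<in>insert a0 S. x a))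
     - (\<Sum>a\<in>insert a0 S. T p (x a) - scale (c p a) (x a))"
    using insert.hyps
    by (simp add: Ts scale_sum_right sum_subtractf y_def scale_left_diff_distrib scale_right_distrib T(1) algebra_simps)
   also have "... \<in> N"
    using insert.prems(1)[OF p(1)] by (intro Nd N(3) Ns T(3) p insert.prems) auto
   finally show "(\<Sum>a\<in>S. y a) \<in> N" .
  qed
  hence "scale (1 / (c p b - c p a0)) (y b) \<in> N" using b N(3) by blast
  thus ?thesis using p(2) by (simp add: y_def)
 qed
 hence "(\<Sum>a\<in>S. x a) \<in> N" by (rule Ns)
 from Nd[OF insert.prems(3) this] have "x a0 \<in> N" using insert.hyps by simp
 thus ?case using S by simp
qed simp

section \<open>Monomials of the Borel subalgebra\<close>

context twisted_datum begin

text \<open>The regular representation composed with the rescaling that sends e_i to H_i e_i and k_i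
  to u_i k_i. Such rescalings tell monomials of different multidegree apart without a PBW
  basis.\<close>

definition opT :: "(anode => complex) => (anode => complex) => ugen => ualg => ualg" where
 "opT H u g w = (case g of GE p i => sc (H i) * (e p i * w)
   | GK Pos i => sc (u i) * (k Pos i * w) | GK Neg i => sc (inverse (u i)) * (k Neg i * w))"

definition twist :: "(anode => complex) => (anode => complex) => ualg => ualg => ualg" where
 "twist H u = lift (%c a. sc c * a) (opT H u)"

text \<open>The \<open>e\<close>'s can be rescaled freely, the \<open>k\<close>'s only so that the
  central relation is preserved.\<close>

definition admissible_twist :: "(anode => complex) => bool" where
 "admissible_twist u \<longleftrightarrow> (\<forall>i\<in>Ihat. u i ~= 0) \<and> (\<Prod>i\<in>Ihat. u i ^ label i) = 1"

lemma twist_lin_ops: "lin_ops (%c a. sc c * a) (opT H u)"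
proof -
 interpret V: vector_space "%c a. sc c * (a :: ualg)" by (rule vector_space_sc)
 show ?thesis
  by unfold_locales
   (auto simp: opT_def distrib_left sc_sc_mult sc_left_commute[of "e p i" for p i] sc_left_commute[of "k p i" for p i]
    mult.commute split: ugen.split sign.split)
qed

lemmas twist_simps =
 lin_ops.act_sc[OF twist_lin_ops, folded twist_def] lin_ops.act_add[OF twist_lin_ops, folded twist_def]
 lin_ops.act_diff[OF twist_lin_ops, folded twist_def] lin_ops.act_mult[OF twist_lin_ops, folded twist_def]
 lin_ops.act_1[OF twist_lin_ops, folded twist_def] lin_ops.act_0[OF twist_lin_ops, folded twist_def]
 lin_ops.act_gen[OF twist_lin_ops, folded twist_def] lin_ops.act_sum[OF twist_lin_ops, folded twist_def]
lemmas twist_scl = lin_ops.act_scl[OF twist_lin_ops, folded twist_def]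

definition eig :: "(anode => complex) => (anode => complex) => complex => ualg => bool" where
 "eig H u c x \<longleftrightarrow> (\<forall>w. twist H u x w = sc c * (x * w))"

lemma eig_twist: "eig H u c x ==> twist H u x w = sc c * (x * w)" by (simp add: eig_def)

lemma eig_sc: "eig H u 1 (sc c)" by (simp add: eig_def twist_simps)
lemma eig_1: "eig H u 1 1" by (simp add: eig_def twist_simps)
lemma eig_0: "eig H u c 0" by (simp add: eig_def twist_simps)
lemma eig_add: "eig H u c x ==> eig H u c y ==> eig H u c (x + y)"
 by (simp add: eig_def twist_simps distrib_left distrib_right)
lemma eig_mult: "eig H u c x ==> eig H u c' y ==> eig H u (c * c') (x * y)"
 by (simp add: eig_def twist_simps twist_scl sc_left_commute[of x] sc_sc_mult mult.assoc mult.commute)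
lemma eig_smult: "eig H u c x ==> eig H u c (sc a * x)"
 using eig_mult[OF eig_sc, of H u c x a] by simp
lemma eig_diff: "eig H u c x ==> eig H u c y ==> eig H u c (x - y)"
 by (simp add: eig_def twist_simps right_diff_distrib left_diff_distrib)
lemma eig_sum: "(!!i. i \<in> F ==> eig H u c (f i)) ==> eig H u c (sum f F)"
 by (induction F rule: infinite_finite_induct) (auto intro: eig_add eig_0)
lemma eig_power: "eig H u c x ==> eig H u (c ^ n) (x ^ n)"
 by (induction n) (auto intro: eig_mult eig_1)
lemma eig_e: "eig H u (H i) (e p i)"
 by (simp add: eig_def twist_simps opT_def e_def)
lemma eig_k: "eig H u (case p of Pos => u i | Neg => inverse (u i)) (k p i)"
 by (cases p) (simp_all add: eig_def twist_simps opT_def k_def)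
lemma eig_prod_list: "(!!a. a \<in> set L ==> eig H u (c a) (f a)) ==> eig H u (\<Prod>a\<leftarrow>L. c a) (\<Prod>a\<leftarrow>L. f a)"
 by (induction L) (auto intro: eig_mult eig_1)

lemma J_left: "a \<in> J ==> x * a \<in> J" and J_right: "a \<in> J ==> a * x \<in> J"
 and J_add: "a \<in> J ==> b \<in> J ==> a + b \<in> J" and J_diff: "a \<in> J ==> b \<in> J ==> a - b \<in> J"
 and J_0: "0 \<in> J" and J_minus: "a \<in> J ==> - a \<in> J"
 unfolding J_def
 by (auto intro: two_sided_ideal_left two_sided_ideal_right two_sided_ideal.add two_sided_ideal_diff
   two_sided_ideal.zero two_sided_ideal_minus)
lemma J_sum: "(!!i. i \<in> F ==> f i \<in> J) ==> sum f F \<in> J"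
 by (induction F rule: infinite_finite_induct) (auto intro: J_0 J_add)
lemma J_cancel_sc: "sc c * a \<in> J ==> c ~= 0 ==> a \<in> J"
 using J_left[of "sc c * a" "sc (1 / c)"] by (simp add: sc_sc_mult)
lemma eqU_J: "a \<approx> b ==> a \<in> J \<longleftrightarrow> b \<in> J"
 unfolding eqU_def using J_add[of "a - b" b] J_diff[of a "a - b"] by auto
lemma eqU_0: "a \<approx> 0 \<longleftrightarrow> a \<in> J" by (simp add: eqU_def)

text \<open>Every relator of the Borel subalgebra is homogeneous for these rescalings, hence the
  rescaled action still satisfies it modulo \<open>J\<close>.\<close>

lemma eig_rel:
 assumes "admissible_twist u" "r \<in> borel_relators" shows "\<exists>c. eig H u c r"
proof -
 have nz: "u i ~= 0" if "i \<in> Ihat" for i using assms(1) that by (simp add: admissible_twist_def)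
 show ?thesis using assms(2) unfolding borel_relators_def k_relators_def
 proof (elim UnE CollectE exE conjE)
  fix i assume "r = k Pos i * k Neg i - 1" "i \<in> Ihat"
  thus ?thesis using eig_diff[OF eig_mult[OF eig_k[of H u i Pos] eig_k[of H u i Neg]] , of 1] eig_1 nz by auto
 next
  fix i assume "r = k Neg i * k Pos i - 1" "i \<in> Ihat"
  thus ?thesis using eig_diff[OF eig_mult[OF eig_k[of H u i Neg] eig_k[of H u i Pos]] , of 1] eig_1 nz by auto
 next
  fix i j assume "r = comm (k Pos i) (k Pos j)"
  thus ?thesis unfolding comm_def
   using eig_diff[OF eig_mult[OF eig_k[of H u i Pos] eig_k[of H u j Pos]]
    eig_mult[OF eig_k[of H u j Pos] eig_k[of H u i Pos], unfolded mult.commute[of "case Pos of Pos => u j | Neg => inverse (u j)"]]]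
   by blast
 next
  fix i j assume "r = k Pos i * e Pos j - sc (qp (dhat i * of_int (sg Pos * Csig i j))) * e Pos j * k Pos i"
  thus ?thesis unfolding mult.assoc
   using eig_diff[OF eig_mult[OF eig_k[of H u i Pos] eig_e[of H u j Pos]]
    eig_smult[OF eig_mult[OF eig_e[of H u j Pos] eig_k[of H u i Pos]], unfolded mult.commute[of "H j"]]]
   by blast
 next
  fix i j assume r: "r = serre Pos i j"
  define n where "n = nat (1 - Csig i j)"
  have "eig H u (H i ^ n * H j) (sc c * e Pos i ^ (n - t) * e Pos j * e Pos i ^ t)" if "t \<le> n" for t c
  proof -
   have "eig H u (H i ^ (n - t) * (H j * H i ^ t)) (sc c * (e Pos i ^ (n - t) * (e Pos j * e Pos i ^ t)))"
    by (intro eig_smult eig_mult eig_power eig_e)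
   moreover have "H i ^ (n - t) * (H j * H i ^ t) = H i ^ n * H j"
    using that by (simp add: power_add[symmetric] mult.commute mult.left_commute)
   ultimately show ?thesis by (simp add: mult.assoc)
  qed
  thus ?thesis unfolding r serre_def Let_def n_def[symmetric] by (blast intro: eig_sum)
 next
  assume r: "r \<in> {central_relator}"
  define L where "L = Eps # map Nd (sorted_list_of_set Isig)"
  have L: "set L = Ihat" "distinct L" by (auto simp: L_def Ihat_def finite_Isig distinct_map inj_on_def)
  have "eig H u (\<Prod>i\<leftarrow>L. u i ^ label i) (\<Prod>i\<leftarrow>L. k Pos i ^ label i)"
   using eig_power[OF eig_k[of H u _ Pos]] by (intro eig_prod_list) simp
  also have "(\<Prod>i\<leftarrow>L. u i ^ label i) = (\<Prod>i\<in>Ihat. u i ^ label i)"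
   using prod.distinct_set_conv_list[OF L(2), of "%i. u i ^ label i"] L(1) by simp
  also have "... = 1" using assms(1) by (simp add: admissible_twist_def)
  finally have "eig H u 1 ((\<Prod>i\<leftarrow>L. k Pos i ^ label i) - 1)" by (intro eig_diff eig_1)
  thus ?thesis using r by (auto simp: central_relator_def L_def)
 qed
qed

lemma borel_rep_regular:
 assumes "admissible_twist u" shows "borel_rep X \<sigma> M q s (%c a. sc c * a) (opT H u) J"
proof -
 interpret V: lin_ops "%c a. sc c * (a :: ualg)" "opT H u" by (rule twist_lin_ops)
 show ?thesis
 proof
  show "lift (%c a. sc c * a) (opT H u) r v \<in> J" if r: "r \<in> borel_relators" for r v
  proof -
   obtain c where "eig H u c r" using eig_rel[OF assms r] by blast
   hence "lift (%c a. sc c * a) (opT H u) r v = sc c * (r * v)" by (simp add: eig_def twist_def)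
   moreover have "r \<in> J" using r borel_relators_subset unfolding J_def by (auto intro: two_sided_ideal_gen)
   ultimately show ?thesis by (simp add: J_left J_right)
  qed
  show "opT H u g v \<in> J" if "v \<in> J" for g v
   using that by (auto simp: opT_def intro!: J_left split: ugen.split sign.split)
 qed (auto intro: J_0 J_add J_left)
qed

text \<open>Triangular decomposition in lowest degree, together with the invariance of \<open>J\<close> under rescaling automorphisms.\<close>

lemma twist_in_J:
 assumes adm: "admissible_twist u" and j: "j \<in> Ihat" and z: "z \<in> SB" and b: "b \<in> SB"
  and h: "e Neg j * z + b \<in> J"
 shows "twist H u z 1 \<in> J" "twist H u b 1 \<in> J"
proof -
 interpret W: borel_rep X \<sigma> M q s "%c a. sc c * a" "opT H u" J by (rule borel_rep_regular[OF adm])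
 have "W.M.act (e Neg j * z + b) (W.\<delta> 1) \<in> W.NN" by (rule W.J_act[OF h W.\<delta>_Mt])
 hence N: "W.Fop j (W.\<delta> (twist H u z 1)) + W.\<delta> (twist H u b 1) \<in> W.NN"
  by (simp add: W.M.act_add W.M.act_mult W.act_e[OF j] W.M_act_\<delta> z b twist_def)
 show "twist H u z 1 \<in> J" using W.NN_low(2)[OF N, of j] by (simp add: W.Fop_def W.\<delta>_def)
 show "twist H u b 1 \<in> J" using W.NN_low(1)[OF N] by (simp add: W.Fop_def W.\<delta>_def)
qed

lemma twist_in_J': "admissible_twist u ==> b \<in> SB ==> b \<in> J ==> twist H u b 1 \<in> J"
 using twist_in_J(2)[of u Eps 0 b H] by (simp add: subalgebra_0)

lemma twist_trivial: "b \<in> SB ==> twist (%_. 1) (%_. 1) b w = b * w"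
proof (induction b arbitrary: w rule: subalgebra.induct)
 case (gen b)
 thus ?case unfolding borel_gens_def e_def k_def
  by (auto simp: twist_simps opT_def e_def k_def split: sign.split)
qed (simp_all add: twist_simps distrib_right mult.assoc)

text \<open>The case of the trivial rescaling: applied to 1, the regular representation returns the
  element itself.\<close>

lemma triangular_low:
 assumes "j \<in> Ihat" "z \<in> SB" "b \<in> SB" "e Neg j * z + b \<in> J" shows "z \<in> J" "b \<in> J"
proof -
 have "admissible_twist (%_. 1)" by (simp add: admissible_twist_def)
 note t = twist_in_J[OF this assms, where H = "%_. 1"]
 from t(1) show "z \<in> J" using assms by (simp add: twist_trivial)
 from t(2) show "b \<in> J" using assms by (simp add: twist_trivial)
qed

lemma twist_SB: "b \<in> SB ==> w \<in> SB ==> twist H u b w \<in> SB"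
proof (induction b arbitrary: w rule: subalgebra.induct)
 case (gen b)
 have op: "opT H u g w \<in> SB" if "gen g \<in> SB" for g
  using that gen.prems by (auto simp: opT_def e_def k_def intro!: subalgebra_sc subalgebra.mult split: ugen.split sign.split)
 from gen(1) have "b \<in> SB" by (rule subalgebra.gen)
 with gen(1) op show ?case unfolding borel_gens_def e_def k_def by (auto simp: twist_simps)
qed (simp_all add: twist_simps subalgebra_sc subalgebra.add)

lemma eig_independent:
 assumes fin: "finite S" and x: "!!a. a \<in> S ==> x a \<in> SB"
  and eig: "!!p a. p \<in> P ==> a \<in> S ==> eig (fst p) (snd p) (c p a) (x a)"
  and adm: "!!p. p \<in> P ==> admissible_twist (snd p)"
  and sep: "!!a b. a \<in> S ==> b \<in> S ==> a ~= b ==> \<exists>p\<in>P. c p a ~= c p b"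
  and sum: "(\<Sum>a\<in>S. x a) \<in> J"
 shows "\<forall>a\<in>S. x a \<in> J"
proof -
 have "\<forall>a\<in>S. x a \<in> J \<inter> SB"
 proof (rule vector_space.eigen_independent[OF vector_space_sc, where T = "%p a. twist (fst p) (snd p) a 1" and c = c and P = P and S = S])
  show "twist (fst p) (snd p) a 1 \<in> J \<inter> SB" if "p \<in> P" "a \<in> J \<inter> SB" for p a
   using that twist_in_J'[OF adm] twist_SB[OF _ subalgebra_1] by auto
  show "twist (fst p) (snd p) (x a) 1 - sc (c p a) * x a \<in> J \<inter> SB" if "p \<in> P" "a \<in> S" for p a
   using eig_twist[OF eig[OF that], of 1] by (simp add: J_0 subalgebra_0)
  show "(\<Sum>a\<in>S. x a) \<in> J \<inter> SB" using sum x by (auto intro: subalgebra_sum)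
  show "twist (fst p) (snd p) (sc c * a) 1 = sc c * twist (fst p) (snd p) a 1" for p c a
   by (simp add: twist_simps)
 qed (use fin sep in "auto simp: twist_simps intro: J_0 J_add J_left subalgebra_0 subalgebra.add subalgebra_sc")
 thus ?thesis by blast
qed

end

abbreviation content :: "'g multiset => 'g free_algebra => bool" where
 "content T \<equiv> words_in (%w. mset w = T)"

lemma words_in_impD: "words_in P y ==> (!!w. P w ==> Q w) ==> words_in Q y"
 by (auto simp: words_in_def)

lemma words_in_word: "P w ==> words_in P (sgl (Word w) c)"
 by (auto simp: words_in_def)

context cartan_form begin

lemma words_in_R:
 assumes "words_on S y" shows "words_on S (R t i y)"
proof -
 have "words_in (%v. set v \<subseteq> S) (Rw t i w)" if "set w \<subseteq> S" for w
  using that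
 proof (induction w)
  case (Cons l w)
  show ?case unfolding Rw.simps
   using Cons by (intro words_in_add words_in_sc words_in_mult[where P = "%u. u = [l]", OF words_in_gen Cons.IH])
    (auto intro: words_in_word)
 qed simp
 thus ?thesis unfolding R_def by (rule words_in_word_ext[OF assms])
qed

lemma content_R:
 assumes "content T y" shows "content (T - {#i#}) (R t i y)"
proof -
 have n: "Rw t i w = 0" if "i \<notin> set w" for w using that by (induction w) auto
 have "words_in (%v. mset v = mset w - {#i#}) (Rw t i w)" for w
 proof (induction w)
  case (Cons l w)
  show ?case
  proof (cases "l = i \<and> i \<notin> set w")
   case True
   thus ?thesis by (auto simp: n intro: words_in_single)
  next
   case False
   have "words_in (%v. mset v = mset (l # w) - {#i#}) (gen l * Rw t i w)"
   proof (cases "i \<in> set w")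
    case True
    hence e: "mset (l # w) - {#i#} = add_mset l (mset w - {#i#})" by (cases "l = i") auto
    show ?thesis unfolding e
     by (rule words_in_mult[where P = "%u. u = [l]", OF words_in_gen Cons.IH]) auto
   qed (simp add: n)
   thus ?thesis unfolding Rw.simps
    by (intro words_in_add words_in_sc) (auto intro: words_in_single)
  qed
 qed simp
 thus ?thesis unfolding R_def using words_in_word_ext[OF assms] by metis
qed

lemma content_hom: "content T y ==> hom j (\<Sum>l\<in>#T. B j l) y"
proof (erule words_in_impD)
 have "wt j w = (\<Sum>l\<in>#mset w. B j l)" for w by (induction w) auto
 thus "mset w = T ==> wt j w = (\<Sum>l\<in>#T. B j l)" for w by auto
qed

end


lemma content_single_gen:
 assumes "content {#l#} y" obtains c where "y = sc c * gen l"
proof -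
 have "\<exists>c. y = sc c * gen l" using assms
 proof (induction rule: words_in_induct)
  case zero
  have "0 = sc 0 * gen l" by (simp add: sc_0)
  thus ?case by blast
 next
  case (single w c)
  hence "w = [l]" by simp
  hence "sgl (Word w) c = sc c * gen l"
   by (simp add: sc_def gen_def mult_single zero_word_def plus_word_def)
  thus ?case by blast
 next
  case (add x y)
  then obtain c c' where "x = sc c * gen l" "y = sc c' * gen l" by blast
  hence "x + y = sc (c + c') * gen l" by (simp add: sc_add distrib_right)
  thus ?case by blast
 qed
 thus thesis using that by blast
qed

lemma content_gen_mult: "content T y ==> content (add_mset l T) (gen l * y)"
 by (rule words_in_mult[where P = "%u. u = [l]", OF words_in_gen]) auto

context twisted_datum begin

lemma emb_SB: "words_on Ihat y ==> emb Pos y \<in> SB"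
proof (induction rule: words_in_induct)
 case (single w c)
 have "emb Pos (sgl (Word w) c) = sc c * prod_list (map (e Pos) w)"
  by (simp add: emb_def word_ext_single)
 thus ?case using single by (auto intro!: subalgebra_sc subalgebra_prod_list SB_e)
qed (simp_all add: emb_add subalgebra.add subalgebra_0)

lemma content_SB: "content T y ==> set_mset T \<subseteq> Ihat ==> emb Pos y \<in> SB"
 by (rule emb_SB, erule words_in_impD) auto

lemma eig_emb: "content T y ==> eig H u (\<Prod>l\<in>#T. H l) (emb Pos y)"
proof (induction rule: words_in_induct)
 case (single w c)
 have "eig H u (prod_list (map H w)) (prod_list (map (e Pos) w))"
  by (rule eig_prod_list) (rule eig_e)
 moreover have "prod_list (map H w) = (\<Prod>l\<in>#T. H l)" unfolding single[symmetric] by (induction w) simp_all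
 ultimately show ?case by (simp add: emb_def word_ext_single eig_smult)
qed (simp_all add: emb_add eig_add eig_0)

lemma eqU_refl: "(a :: ualg) \<approx> a" by (simp add: eqU_ideq)
lemma eqU_sym: "(a :: ualg) \<approx> b ==> b \<approx> a" by (simp add: eqU_ideq ideq_sym)
lemma eqU_trans [trans]: "(a :: ualg) \<approx> b ==> b \<approx> c ==> a \<approx> c" unfolding eqU_ideq by (rule ideq_trans)
lemma eqU_add: "(a :: ualg) \<approx> b ==> c \<approx> c' ==> a + c \<approx> b + c'" unfolding eqU_ideq by (rule ideq_add)
lemma eqU_diff: "(a :: ualg) \<approx> b ==> c \<approx> c' ==> a - c \<approx> b - c'" unfolding eqU_ideq by (rule ideq_diff)
lemma eqU_left: "(a :: ualg) \<approx> b ==> c * a \<approx> c * b" unfolding eqU_ideq by (rule ideq_left)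
lemma eqU_right: "(a :: ualg) \<approx> b ==> a * c \<approx> b * c" unfolding eqU_ideq by (rule ideq_right)
lemma eqU_mult: "(a :: ualg) \<approx> b ==> c \<approx> c' ==> a * c \<approx> b * c'" unfolding eqU_ideq by (rule ideq_mult)
lemma eqU_sum: "(!!i. i \<in> F ==> (f i :: ualg) \<approx> g i) ==> sum f F \<approx> sum g F" unfolding eqU_ideq by (rule ideq_sum)

text \<open>Letters that are not nodes vanish in the quotient, so they can be dropped.\<close>

lemma drop_out_letters:
 obtains y' where "words_on Ihat y'" "emb Pos y \<approx> emb Pos y'"
  "!!t i. i \<in> Ihat ==> emb Pos (cf.R t i y) \<approx> emb Pos (cf.R t i y')"
proof -
 have "\<exists>y'. words_on Ihat y' \<and> emb Pos y \<approx> emb Pos y' \<and>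
  (\<forall>t. \<forall>i\<in>Ihat. emb Pos (cf.R t i y) \<approx> emb Pos (cf.R t i y'))"
 proof (induction y rule: free_induct)
  case (sc c)
  show ?case by (rule exI[of _ "sc c"]) (auto intro: words_in_const eqU_refl)
 next
  case (add a b)
  then obtain a' b' where "words_on Ihat a'" "emb Pos a \<approx> emb Pos a'"
   "\<forall>t. \<forall>i\<in>Ihat. emb Pos (cf.R t i a) \<approx> emb Pos (cf.R t i a')"
   "words_on Ihat b'" "emb Pos b \<approx> emb Pos b'"
   "\<forall>t. \<forall>i\<in>Ihat. emb Pos (cf.R t i b) \<approx> emb Pos (cf.R t i b')" by blast
  thus ?case by (intro exI[of _ "a' + b'"]) (auto intro: words_in_add eqU_add simp: emb_add cf.R_add)
 next
  case (gen g a)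
  then obtain a' where a': "words_on Ihat a'" "emb Pos a \<approx> emb Pos a'"
   "!!t i. i\<in>Ihat ==> emb Pos (cf.R t i a) \<approx> emb Pos (cf.R t i a')" by blast
  show ?case
  proof (cases "g \<in> Ihat")
   case True
   show ?thesis
   proof (intro exI conjI allI ballI)
    show "words_on Ihat (gen g * a')"
     using True by (intro words_in_mult[where P = "%u. u = [g]", OF words_in_gen a'(1)]) auto
    show "emb Pos (gen g * a) \<approx> emb Pos (gen g * a')"
     by (simp add: emb_gen_mult eqU_left a')
    show "emb Pos (cf.R t i (gen g * a)) \<approx> emb Pos (cf.R t i (gen g * a'))" if "i \<in> Ihat" for t i
     unfolding cf.R_gen_mult emb_add emb_sc emb_gen_mult
     by (intro eqU_add eqU_left) (use a' that in "auto intro: eqU_refl")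
   qed
  next
   case False
   have z: "e Pos g * y \<in> J" for y
    using J_right[of "e Pos g" y] beq_eqU[OF out_zero(1)[OF False, of Pos]] by (simp add: eqU_0)
   show ?thesis
   proof (intro exI[of _ 0] conjI allI ballI)
    show "emb Pos (gen g * a) \<approx> emb Pos 0" using z by (simp add: emb_gen_mult eqU_0)
    show "emb Pos (cf.R t i (gen g * a)) \<approx> emb Pos (cf.R t i 0)" if "i \<in> Ihat" for t i
    proof -
     have "g ~= i" using False that by auto
     thus ?thesis by (simp add: cf.R_gen_mult emb_sc emb_gen_mult eqU_0 J_left z)
    qed
   qed simp
  qed
 qed
 thus thesis using that by blast
qed

definition Ipos :: "anode free_algebra set" where "Ipos = {y. emb Pos y \<in> J}"

text \<open>The two parts of a commutator are separated by a rescaling of the \<open>k\<close>'s.\<close>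

lemma k_parts_in_J:
 assumes i: "i \<in> Ihat" and a: "a \<in> SB" "eig (%_. 1) (%l. s powi Bh l i) 1 a"
  and b: "b \<in> SB" "eig (%_. 1) (%l. s powi Bh l i) 1 b"
  and h: "k Pos i * a - k Neg i * b \<in> J"
 shows "a \<in> J" "b \<in> J"
proof -
 \<comment> \<open>This rescaling is admissible because the labels form a null vector, and it
   multiplies k_i and its inverse by different scalars because \<open>Bh i i\<close> is
   positive.\<close>
 define u where "u l = s powi Bh l i" for l
 have kk: "k (opp p) i * (k p i * x) \<approx> x" for p x
  using eqU_right[OF beq_eqU[OF k_inverse[OF i, of "opp p"]], of x] by (cases p) (simp_all add: mult.assoc)
 have ko: "x \<in> J" if "k p i * x \<in> J" for p x
  using J_left[OF that, of "k (opp p) i"] eqU_J[OF kk[of p x]] by simp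
 have adm: "admissible_twist u"
 proof -
  have "(\<Prod>l\<in>Ihat. u l ^ label l) = s powi (\<Sum>l\<in>Ihat. int (label l) * Bh l i)"
  proof -
   have "(\<Prod>l\<in>F. u l ^ label l) = s powi (\<Sum>l\<in>F. int (label l) * Bh l i)" for F
    by (induction F rule: infinite_finite_induct)
     (simp_all add: u_def cf.s_powi_add power_int_power' mult.commute)
   thus ?thesis .
  qed
  thus ?thesis using label_null[OF i] by (simp add: admissible_twist_def u_def cf.s_nz)
 qed
 have eigs: "eig (%_. 1) u (if p then s powi Bh i i else s powi (- Bh i i)) (if p then k Pos i * a else - (k Neg i * b))" for p
  using eig_mult[OF eig_k[where p = Pos and i = i] a(2)] eig_smult[OF eig_mult[OF eig_k[where p = Neg and i = i] b(2)], of "- 1"]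
  by (auto simp: u_def[abs_def] power_int_minus sc_minus)
 have "s powi (Bh i i) ~= s powi (- Bh i i)"
  using cf.B_diag[OF i] cf.D_pos[OF i] by (simp add: cf.s_powi_cancel)
 hence "\<forall>p\<in>UNIV. (if p then k Pos i * a else - (k Neg i * b)) \<in> J"
  using h eigs adm by (intro eig_independent[where P = "{(%_. 1, u)}" and c = "%_ p. if p then s powi Bh i i else s powi (- Bh i i)"])
   (auto simp: UNIV_bool intro!: subalgebra.mult subalgebra_minus SB_k i a b)
 from this[THEN bspec, of True] this[THEN bspec, of False] have "k Pos i * a \<in> J" "k Neg i * b \<in> J"
  using J_minus by fastforce+
 thus "a \<in> J" "b \<in> J" using ko by auto
qed

lemma eig_emb_1: "words_in P y ==> eig (%_. 1) u 1 (emb Pos y)"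
proof (induction rule: words_in_induct)
 case (single w c)
 have "eig (%_. 1) u (prod_list (map (%_. 1) w)) (prod_list (map (e Pos) w))"
  by (rule eig_prod_list) (rule eig_e)
 moreover have "(\<Prod>l\<leftarrow>w. (%_. 1 :: complex) l) = 1" by (induction w) simp_all
 ultimately show ?case by (simp add: emb_def word_ext_single eig_smult)
qed (simp_all add: emb_add eig_add eig_0)

text \<open>If a positive element vanishes, so does its commutator with \<open>e Neg i\<close>. That
  commutator has a part with k_i and a part with its inverse, each containing one skew derivative,
  and \<open>k_parts_in_J\<close> makes both vanish. This is how stability under \<open>R\<close> is
  obtained.\<close>

sublocale ci: cartan_ideal s Ihat Bh Csig Dh Ipos
proof
 show "cf.is_ideal Ipos"
  unfolding cf.is_ideal_def
  by (auto simp: Ipos_def emb_add emb_mult intro: J_0 J_add J_left J_right)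
 show "cf.serre_elt i j \<in> Ipos" if "i \<in> Ihat" "j \<in> Ihat" "i ~= j" for i j
 proof -
  have "serre Pos i j \<in> relators" unfolding relators_def using that by blast
  thus ?thesis using serre_emb[OF that, of Pos] by (simp add: Ipos_def J_def two_sided_ideal_gen)
 qed
 show "gen j \<in> Ipos" if "j \<notin> Ihat" for j
  using beq_eqU[OF out_zero(1)[OF that]] by (simp add: Ipos_def emb_gen eqU_0)
 show "cf.R t i y \<in> Ipos" if i: "i \<in> Ihat" and t: "t = 1 \<or> t = - 1" and y: "y \<in> Ipos" for t i y
 proof -
  obtain y' where y': "words_on Ihat y'" "emb Pos y \<approx> emb Pos y'"
   "!!t i. i \<in> Ihat ==> emb Pos (cf.R t i y) \<approx> emb Pos (cf.R t i y')" by (rule drop_out_letters[of y]) blast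
  have "emb Pos y' \<in> J" using y y'(2) by (simp add: Ipos_def eqU_J)
  hence "(emb Pos y' * e Neg i - e Neg i * emb Pos y') \<in> J" by (simp add: J_left J_right J_diff)
  moreover have "emb Pos y' * e Neg i - e Neg i * emb Pos y' \<approx>
   sc (cc i) * (k Pos i * emb Pos (cf.R (- 1) i y') - k Neg i * emb Pos (cf.R 1 i y'))"
   using eqU_diff[OF beq_eqU[OF emb_commutator[OF i, of Pos y']] eqU_refl[of "e Neg i * emb Pos y'"]] by simp
  ultimately have "k Pos i * emb Pos (cf.R (- 1) i y') - k Neg i * emb Pos (cf.R 1 i y') \<in> J"
   using J_cancel_sc cc_nz[OF i] eqU_J by blast
  note kp = k_parts_in_J[OF i emb_SB[OF cf.words_in_R[OF y'(1)]] eig_emb_1[OF cf.words_in_R[OF y'(1)]]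
   emb_SB[OF cf.words_in_R[OF y'(1)]] eig_emb_1[OF cf.words_in_R[OF y'(1)]] this]
  have "emb Pos (cf.R t i y') \<in> J" using t kp by auto
  thus ?thesis using eqU_J[OF y'(3)[OF i, of t]] by (simp add: Ipos_def)
 qed
qed

end

section \<open>Cartan monomials and the independence of monomials in the Borel subalgebra\<close>

context twisted_datum begin

definition kpow :: "anode => int => ualg" where
 "kpow j n = (if n \<ge> 0 then k Pos j ^ nat n else k Neg j ^ nat (- n))"

definition Kmon :: "(nat => int) => ualg" where
 "Kmon U = prod_list (map (%j. kpow (Nd j) (U j)) (sorted_list_of_set Isig))"

lemma k_inv: "i \<in> Ihat ==> k p i * k (opp p) i \<approx> 1" using beq_eqU[OF k_inverse] .
lemma k_inv_left: "i \<in> Ihat ==> k p i * (k (opp p) i * x) \<approx> x"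
 using eqU_right[OF k_inv, of i p x] by (simp add: mult.assoc)
lemma k_com: "i \<in> Ihat ==> j \<in> Ihat ==> k p i * k p' j \<approx> k p' j * k p i" using beq_eqU[OF k_comm] .

lemma kpow_0 [simp]: "kpow j 0 = 1" by (simp add: kpow_def)

lemma kpow_nat: "kpow j (int n) = k Pos j ^ n" by (simp add: kpow_def)

lemma k_kpow: assumes j: "j \<in> Ihat" shows "k p j * kpow j n \<approx> kpow j (n + sg p)"
proof (cases p)
 case Pos
 show ?thesis
 proof (cases "n \<ge> 0")
  case True
  hence "nat (n + 1) = Suc (nat n)" by simp
  thus ?thesis using True Pos by (simp add: kpow_def eqU_refl)
 next
  case False
  hence "nat (- n) = Suc (nat (- (n + 1)))" by simp
  hence "kpow j n = k Neg j * kpow j (n + 1)" using False by (auto simp: kpow_def)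
  thus ?thesis using Pos k_inv_left[OF j, of Pos] by simp
 qed
next
 case Neg
 show ?thesis
 proof (cases "n \<le> 0")
  case True
  hence "nat (- (n - 1)) = Suc (nat (- n))" by simp
  thus ?thesis using True Neg by (auto simp: kpow_def eqU_refl)
 next
  case False
  hence "nat n = Suc (nat (n - 1))" by simp
  hence "kpow j n = k Pos j * kpow j (n - 1)" using False by (auto simp: kpow_def)
  thus ?thesis using Neg k_inv_left[OF j, of Neg] by simp
 qed
qed

lemma power_commutes_eqU: "a * b \<approx> b * (a :: ualg) ==> a ^ n * b \<approx> b * a ^ n"
proof (induction n)
 case (Suc n)
 have "a ^ Suc n * b = a * (a ^ n * b)" by (simp add: mult.assoc)
 also have "... \<approx> a * (b * a ^ n)" using Suc by (intro eqU_left) simp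
 also have "... = a * b * a ^ n" by (simp add: mult.assoc)
 also have "... \<approx> b * a * a ^ n" by (intro eqU_right Suc.prems)
 finally show ?case by (simp add: mult.assoc)
qed (simp add: eqU_refl)

lemma kpow_commute:
 assumes "i \<in> Ihat" "!!p. k p i * (b :: ualg) \<approx> b * k p i" shows "kpow i m * b \<approx> b * kpow i m"
 using assms(2) by (auto simp: kpow_def intro: power_commutes_eqU)

lemma kpow_add: assumes "j \<in> Ihat" shows "kpow j m * kpow j n \<approx> kpow j (m + n)"
proof -
 have "k p j ^ r * kpow j n \<approx> kpow j (n + sg p * int r)" for p r
 proof (induction r)
  case (Suc r)
  have "k p j ^ Suc r * kpow j n = k p j * (k p j ^ r * kpow j n)" by (simp add: mult.assoc)
  also have "... \<approx> k p j * kpow j (n + sg p * int r)" by (intro eqU_left Suc)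
  also have "... \<approx> kpow j (n + sg p * int r + sg p)" by (rule k_kpow[OF assms])
  finally show ?case by (simp add: algebra_simps)
 qed (simp add: eqU_refl)
 from this[of Pos "nat m"] this[of Neg "nat (- m)"] show ?thesis
  by (cases "m \<ge> 0") (auto simp: kpow_def[of j m] add.commute)
qed

lemma prod_list_commute_eqU:
 "(!!x. x \<in> set L ==> f x * b \<approx> b * (f x :: ualg)) ==> prod_list (map f L) * b \<approx> b * prod_list (map f L)"
proof (induction L)
 case (Cons x L)
 have "prod_list (map f (x # L)) * b = f x * (prod_list (map f L) * b)" by (simp add: mult.assoc)
 also have "... \<approx> f x * (b * prod_list (map f L))" using Cons by (intro eqU_left) simp
 also have "... = f x * b * prod_list (map f L)" by (simp add: mult.assoc)
 also have "... \<approx> b * f x * prod_list (map f L)" using Cons by (intro eqU_right) simp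
 finally show ?case by (simp add: mult.assoc)
qed (simp add: eqU_refl)

lemma kpow_kpow_commute: "i \<in> Ihat ==> j \<in> Ihat ==> kpow i m * kpow j n \<approx> kpow j n * kpow i m"
 by (intro kpow_commute eqU_sym[OF kpow_commute[of j]] k_com)

lemma Kmon_add: "Kmon U * Kmon W \<approx> Kmon (%j. U j + W j)"
proof -
 have "prod_list (map (%j. kpow (Nd j) (U j)) L) * prod_list (map (%j. kpow (Nd j) (W j)) L)
   \<approx> prod_list (map (%j. kpow (Nd j) (U j + W j)) L)" if "set L \<subseteq> Isig" for L using that
 proof (induction L)
  case (Cons x L)
  define P Q where "P = prod_list (map (%j. kpow (Nd j) (U j)) L)" and "Q = prod_list (map (%j. kpow (Nd j) (W j)) L)"
  have c: "P * kpow (Nd x) (W x) \<approx> kpow (Nd x) (W x) * P"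
   unfolding P_def using Cons.prems by (intro prod_list_commute_eqU kpow_kpow_commute) auto
  have "kpow (Nd x) (U x) * P * (kpow (Nd x) (W x) * Q) = kpow (Nd x) (U x) * (P * kpow (Nd x) (W x)) * Q"
   by (simp add: mult.assoc)
  also have "... \<approx> kpow (Nd x) (U x) * (kpow (Nd x) (W x) * P) * Q" by (intro eqU_right eqU_left c)
  also have "... = (kpow (Nd x) (U x) * kpow (Nd x) (W x)) * (P * Q)" by (simp add: mult.assoc)
  also have "... \<approx> kpow (Nd x) (U x + W x) * prod_list (map (%j. kpow (Nd j) (U j + W j)) L)"
   unfolding P_def Q_def using Cons by (intro eqU_mult kpow_add) auto
  finally show ?case by (simp add: P_def Q_def)
 qed (simp add: eqU_refl)
 thus ?thesis by (simp add: Kmon_def finite_Isig)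
qed

lemma Kmon_0: "Kmon (%_. 0) = 1"
proof -
 have "prod_list (map (%j. kpow (Nd j) 0) L) = 1" for L by (induction L) auto
 thus ?thesis by (simp add: Kmon_def)
qed
lemma Kmon_inv: "Kmon U * Kmon (%j. - U j) \<approx> 1" using Kmon_add[of U "%j. - U j"] by (simp add: Kmon_0)
lemma Kmon_cong: "(!!j. j \<in> Isig ==> U j = W j) ==> Kmon U = Kmon W"
 unfolding Kmon_def by (intro arg_cong[where f = prod_list] map_cong) (auto simp: finite_Isig)

lemma Kmon_cancel: assumes "a * Kmon U \<in> J" shows "a \<in> J"
proof -
 have "a * Kmon U * Kmon (%j. - U j) \<approx> a" using eqU_left[OF Kmon_inv, of a U] by (simp add: mult.assoc)
 thus ?thesis using eqU_J J_right[OF assms] by blast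
qed

lemma Kmon_single: assumes "i \<in> Isig" shows "k p (Nd i) \<approx> Kmon (%j. if j = i then sg p else 0)"
proof -
 have "kpow (Nd i) (sg p) = k p (Nd i)" by (cases p) (simp_all add: kpow_def)
 moreover have "prod_list (map (%j. kpow (Nd j) (if j = i then sg p else 0)) L)
   = (if i \<in> set L then kpow (Nd i) (sg p) else 1)" if "distinct L" for L using that
  by (induction L) auto
 ultimately show ?thesis using assms by (simp add: Kmon_def finite_Isig eqU_refl)
qed

text \<open>Since \<epsilon> has label 1, the central relation makes its \<open>k\<close> the
  inverse of a monomial in the others. So Cartan monomials over \<open>Isig\<close> are
  enough.\<close>

lemma k_Kmon: assumes "i \<in> Ihat" shows "\<exists>W. k p i \<approx> Kmon W"
 using assms
proof (rule Ihat_cases)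
 assume e: "i = Eps"
 define l where "l j = int (label (Nd j))" for j
 have "map (%i. k Pos i ^ label i) (map Nd L) = map (%j. kpow (Nd j) (l j)) L" for L
  by (simp add: l_def kpow_nat)
 hence c: "central_relator = k Pos Eps * Kmon l - 1"
  by (simp only: central_relator_def Kmon_def list.map prod_list.Cons label_props(1) power_one_right)
 have "central_relator \<in> J" unfolding J_def relators_eq base_relators_def by (intro two_sided_ideal_gen) auto
 hence 1: "k Pos Eps * Kmon l \<approx> 1" unfolding eqU_def c .
 show ?thesis
 proof (cases p)
  case Pos
  have "k Pos Eps \<approx> k Pos Eps * (Kmon l * Kmon (%j. - l j))" using eqU_sym[OF eqU_left[OF Kmon_inv]] by simp
  also have "... = k Pos Eps * Kmon l * Kmon (%j. - l j)" by (simp add: mult.assoc)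
  also have "... \<approx> 1 * Kmon (%j. - l j)" by (intro eqU_right 1)
  finally show ?thesis using Pos e by auto
 next
  case Neg
  have "k Neg Eps \<approx> k Neg Eps * (k Pos Eps * Kmon l)" using eqU_sym[OF eqU_left[OF 1], of "k Neg Eps"] by simp
  also have "... \<approx> Kmon l" using k_inv_left[of Eps Neg] by simp
  finally show ?thesis using Neg e by auto
 qed
qed (use Kmon_single in auto)

definition pairing :: "(nat => int) => anode => int" where
 "pairing U l = (\<Sum>i\<in>Isig. U i * Bh (Nd i) l)"

lemma kpow_e: assumes "i \<in> Ihat" shows "kpow i m * e p j \<approx> sc (s powi (sg p * m * Bh i j)) * (e p j * kpow i m)"
proof -
 have 1: "k p' i ^ n * e p j \<approx> sc (s powi (sg p * (sg p' * int n) * Bh i j)) * (e p j * k p' i ^ n)" for p' n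
 proof (induction n)
  case (Suc n)
  have "k p' i ^ Suc n * e p j = k p' i * (k p' i ^ n * e p j)" by (simp add: mult.assoc)
  also have "... \<approx> k p' i * (sc (s powi (sg p * (sg p' * int n) * Bh i j)) * (e p j * k p' i ^ n))" by (intro eqU_left Suc)
  also have "... = sc (s powi (sg p * (sg p' * int n) * Bh i j)) * ((k p' i * e p j) * k p' i ^ n)"
   by (simp add: sc_left_commute[of "k p' i"] mult.assoc)
  also have "... \<approx> sc (s powi (sg p * (sg p' * int n) * Bh i j)) * ((sc (s powi (sg p' * sg p * Bh i j)) * (e p j * k p' i)) * k p' i ^ n)"
   by (intro eqU_left eqU_right beq_eqU[OF k_e[OF assms]])
  also have "... = sc (s powi (sg p * (sg p' * int (Suc n)) * Bh i j)) * (e p j * k p' i ^ Suc n)"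
   by (simp add: sc_sc_mult mult.assoc cf.s_powi_add[symmetric] algebra_simps)
  finally show ?case .
 qed (simp add: eqU_refl)
 from 1[of Pos "nat m"] 1[of Neg "nat (- m)"] show ?thesis by (cases "m \<ge> 0") (auto simp: kpow_def)
qed

lemma Kmon_e: "Kmon U * e p j \<approx> sc (s powi (sg p * pairing U j)) * (e p j * Kmon U)"
proof -
 have "prod_list (map (%i. kpow (Nd i) (U i)) L) * e p j
   \<approx> sc (s powi (sg p * (\<Sum>i\<leftarrow>L. U i * Bh (Nd i) j))) * (e p j * prod_list (map (%i. kpow (Nd i) (U i)) L))"
  if "set L \<subseteq> Isig" for L using that
 proof (induction L)
  case (Cons x L)
  define P where "P = prod_list (map (%i. kpow (Nd i) (U i)) L)"
  define u where "u = (\<Sum>i\<leftarrow>L. U i * Bh (Nd i) j)"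
  have "kpow (Nd x) (U x) * P * e p j = kpow (Nd x) (U x) * (P * e p j)" by (simp add: mult.assoc)
  also have "... \<approx> kpow (Nd x) (U x) * (sc (s powi (sg p * u)) * (e p j * P))"
   unfolding P_def u_def using Cons by (intro eqU_left) auto
  also have "... = sc (s powi (sg p * u)) * ((kpow (Nd x) (U x) * e p j) * P)"
   by (simp add: sc_left_commute[of "kpow (Nd x) (U x)"] mult.assoc)
  also have "... \<approx> sc (s powi (sg p * u)) * ((sc (s powi (sg p * U x * Bh (Nd x) j)) * (e p j * kpow (Nd x) (U x))) * P)"
   using Cons.prems by (intro eqU_left eqU_right kpow_e) auto
  also have "... = sc (s powi (sg p * (U x * Bh (Nd x) j + u))) * (e p j * (kpow (Nd x) (U x) * P))"
   by (simp add: sc_sc_mult mult.assoc cf.s_powi_add[symmetric] algebra_simps)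
  finally show ?case by (simp add: P_def u_def)
 qed (simp add: eqU_refl)
 from this[of "sorted_list_of_set Isig"] show ?thesis
  by (simp add: Kmon_def pairing_def finite_Isig sum_list_distinct_conv_sum_set)
qed

lemma Kmon_emb: assumes "content T y"
 shows "Kmon U * emb p y \<approx> sc (s powi (sg p * (\<Sum>l\<in>#T. pairing U l))) * (emb p y * Kmon U)"
 using assms
proof (induction rule: words_in_induct)
 case (single w c)
 have "Kmon U * emb p (sgl (Word w) c)
   \<approx> sc (s powi (sg p * (\<Sum>l\<in>#mset w. pairing U l))) * (emb p (sgl (Word w) c) * Kmon U)"
 proof (induction w)
  case Nil
  show ?case by (simp add: zero_word_def[symmetric] sc_def[symmetric] sc_commute eqU_refl)
 next
  case (Cons l w)
  let ?x = "sgl (Word w) c" and ?u = "\<Sum>l\<in>#mset w. pairing U l"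
  have "Kmon U * emb p (gen l * ?x) = (Kmon U * e p l) * emb p ?x" by (simp add: emb_gen_mult mult.assoc)
  also have "... \<approx> (sc (s powi (sg p * pairing U l)) * (e p l * Kmon U)) * emb p ?x"
   by (intro eqU_right Kmon_e)
  also have "... = sc (s powi (sg p * pairing U l)) * (e p l * (Kmon U * emb p ?x))" by (simp add: mult.assoc)
  also have "... \<approx> sc (s powi (sg p * pairing U l)) * (e p l * (sc (s powi (sg p * ?u)) * (emb p ?x * Kmon U)))"
   by (intro eqU_left Cons.IH)
  also have "... = sc (s powi (sg p * (\<Sum>l\<in>#mset (l # w). pairing U l))) * (emb p (gen l * ?x) * Kmon U)"
   by (simp add: sc_left_commute[of "e p l"] sc_sc_mult emb_gen_mult mult.assoc cf.s_powi_add[symmetric] distrib_left)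
  finally show ?case by (simp only: single_word_Cons)
 qed
 thus ?case using single by simp
next
 case (add x y)
 thus ?case using eqU_add[OF add] by (simp add: emb_add distrib_left distrib_right)
qed (simp add: eqU_refl)

text \<open>A key of a monomial consists of the content of its positive part and of the exponents of its Cartan part.\<close>

definition valid_key :: "anode multiset \<times> (nat => int) => bool" where
 "valid_key p \<longleftrightarrow> set_mset (fst p) \<subseteq> Ihat \<and> (\<forall>j. j \<notin> Isig --> snd p j = 0)"

inductive_set PB :: "ualg set" where
 zero: "0 \<in> PB"
| add: "a \<in> PB ==> b \<in> PB ==> a + b \<in> PB"
| mono: "valid_key p ==> content (fst p) y ==> emb Pos y * Kmon (snd p) \<in> PB"

lemma mono_PB: assumes "set_mset T \<subseteq> Ihat" "content T y" shows "emb Pos y * Kmon U \<in> PB"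
proof -
 define W where "W j = (if j \<in> Isig then U j else 0)" for j
 have "Kmon U = Kmon W" by (rule Kmon_cong) (simp add: W_def)
 thus ?thesis using PB.mono[of "(T, W)" y] assms by (simp add: valid_key_def W_def)
qed

text \<open>A Cartan monomial passes the next positive part at the price of a scalar.\<close>

lemma PB_mult: assumes "a \<in> PB" "b \<in> PB" shows "\<exists>c\<in>PB. a * b \<approx> c"
 using assms
proof (induction arbitrary: b rule: PB.induct)
 case (mono p y)
 note p = mono.hyps
 show ?case using mono.prems
 proof (induction rule: PB.induct)
  case (mono p' y')
  have "emb Pos y * Kmon (snd p) * (emb Pos y' * Kmon (snd p')) = emb Pos y * (Kmon (snd p) * emb Pos y') * Kmon (snd p')"
   by (simp add: mult.assoc)
  also have "... \<approx> emb Pos y * (sc (s powi (sg Pos * (\<Sum>l\<in>#fst p'. pairing (snd p) l))) * (emb Pos y' * Kmon (snd p))) * Kmon (snd p')"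
   by (intro eqU_right eqU_left Kmon_emb mono)
  also have "... = emb Pos (sc (s powi (\<Sum>l\<in>#fst p'. pairing (snd p) l)) * (y * y')) * (Kmon (snd p) * Kmon (snd p'))"
   by (simp add: emb_sc emb_mult sc_left_commute[of "emb Pos y"] mult.assoc)
  also have "... \<approx> emb Pos (sc (s powi (\<Sum>l\<in>#fst p'. pairing (snd p) l)) * (y * y')) * Kmon (%j. snd p j + snd p' j)"
   by (intro eqU_left Kmon_add)
  finally show ?case
  proof (rule bexI)
   show "emb Pos (sc (s powi (\<Sum>l\<in>#fst p'. pairing (snd p) l)) * (y * y')) * Kmon (%j. snd p j + snd p' j) \<in> PB"
    using p mono by (intro mono_PB[of "fst p + fst p'"] words_in_sc words_in_mult[OF p(2) mono(2)])
     (auto simp: valid_key_def)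
  qed
 next
  case zero
  show ?case using PB.zero eqU_refl by auto
 next
  case (add a b)
  thus ?case using PB.add eqU_add by (metis distrib_left)
 qed
next
 case zero
 show ?case using PB.zero eqU_refl by auto
next
 case (add a b)
 thus ?case using PB.add eqU_add by (metis distrib_right)
qed

lemma SB_PB: assumes "b \<in> SB" shows "\<exists>c\<in>PB. b \<approx> c"
 using assms
proof (induction rule: subalgebra.induct)
 case (scalar c)
 have "emb Pos (sc c) * Kmon (%_. 0) \<in> PB" by (rule mono_PB[of "{#}"]) (auto intro: words_in_const)
 thus ?case using eqU_refl by (auto simp: Kmon_0)
next
 case (gen b)
 then consider i where "i \<in> Ihat" "b = e Pos i" | p i where "i \<in> Ihat" "b = k p i" by (auto simp: borel_gens_def)
 thus ?case
 proof cases
  case 1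
  have "emb Pos (gen i) * Kmon (%_. 0) \<in> PB" using 1 by (intro mono_PB[of "{#i#}"]) (auto intro: words_in_gen)
  thus ?thesis using eqU_refl 1 by (auto simp: Kmon_0 emb_gen)
 next
  case 2
  obtain W where "k p i \<approx> Kmon W" using k_Kmon[OF 2(1)] by blast
  moreover have "emb Pos 1 * Kmon W \<in> PB"
   using mono_PB[of "{#}" "sc 1" W] words_in_const[of "%w. mset w = {#}" 1] by simp
  ultimately show ?thesis using 2 by auto
 qed
next
 case (add a b)
 thus ?case using PB.add eqU_add by metis
next
 case (mult a b)
 then obtain a' b' where "a' \<in> PB" "a \<approx> a'" "b' \<in> PB" "b \<approx> b'" by blast
 thus ?case using PB_mult[of a' b'] eqU_mult eqU_trans by blast
qed

text \<open>Terms with the same key are collected, so that the summands have distinct keys and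
  \<open>monomials_independent\<close> becomes applicable.\<close>

lemma PB_expansion:
 assumes "b \<in> PB"
 obtains S y where "finite S" "!!p. p \<in> S ==> valid_key p" "!!p. content (fst p) (y p)"
  "b = (\<Sum>p\<in>S. emb Pos (y p) * Kmon (snd p))"
proof -
 have "\<exists>S y. finite S \<and> (\<forall>p\<in>S. valid_key p) \<and> (\<forall>p. content (fst p) (y p)) \<and> (\<forall>p. p \<notin> S --> y p = 0)
  \<and> b = (\<Sum>p\<in>S. emb Pos (y p) * Kmon (snd p))" using assms
 proof (induction rule: PB.induct)
  case zero
  show ?case by (rule exI[of _ "{}"], rule exI[of _ "%_. 0"]) simp
 next
  case (mono p y)
  show ?case by (rule exI[of _ "{p}"], rule exI[of _ "%p'. if p' = p then y else 0"]) (use mono in auto)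
 next
  case (add a b)
  from add.IH(1) obtain S y where S: "finite S" "\<forall>p\<in>S. valid_key p" "\<forall>p. content (fst p) (y p)" "\<forall>p. p \<notin> S --> y p = 0"
   "a = (\<Sum>p\<in>S. emb Pos (y p) * Kmon (snd p))" by blast
  from add.IH(2) obtain S' y' where S': "finite S'" "\<forall>p\<in>S'. valid_key p" "\<forall>p. content (fst p) (y' p)"
   "\<forall>p. p \<notin> S' --> y' p = 0" "b = (\<Sum>p\<in>S'. emb Pos (y' p) * Kmon (snd p))" by blast
  have "a = (\<Sum>p\<in>S \<union> S'. emb Pos (y p) * Kmon (snd p))"
   unfolding S(5) using S(1,4) S'(1) by (intro sum.mono_neutral_left) auto
  moreover have "b = (\<Sum>p\<in>S \<union> S'. emb Pos (y' p) * Kmon (snd p))"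
   unfolding S'(5) using S(1) S'(1,4) by (intro sum.mono_neutral_left) auto
  ultimately have "a + b = (\<Sum>p\<in>S \<union> S'. emb Pos (y p + y' p) * Kmon (snd p))"
   by (simp add: emb_add distrib_right sum.distrib)
  thus ?case using S S'
   by (intro exI[of _ "S \<union> S'"] exI[of _ "%p. y p + y' p"]) (auto intro: words_in_add)
 qed
 thus thesis using that by blast
qed

lemma eig_kpow: "u i ~= 0 ==> eig H u (u i powi m) (kpow i m)"
 using eig_power[OF eig_k[where H = H and u = u and p = Pos and i = i], of "nat m"]
  eig_power[OF eig_k[where H = H and u = u and p = Neg and i = i], of "nat (- m)"]
 by (auto simp: kpow_def power_int_def)

lemma Kmon_SB: "Kmon U \<in> SB"
 unfolding Kmon_def kpow_def by (intro subalgebra_prod_list) (auto simp: finite_Isig intro!: subalgebra_power SB_k)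

lemma eig_Kmon: assumes "!!i. i \<in> Isig ==> u (Nd i) ~= 0"
 shows "eig H u (\<Prod>i\<in>Isig. u (Nd i) powi U i) (Kmon U)"
proof -
 have "eig H u (\<Prod>i\<leftarrow>sorted_list_of_set Isig. u (Nd i) powi U i) (Kmon U)"
  unfolding Kmon_def using assms by (intro eig_prod_list eig_kpow) (simp add: finite_Isig)
 thus ?thesis using prod.distinct_set_conv_list[of "sorted_list_of_set Isig" "%i. u (Nd i) powi U i"]
  by (simp add: finite_Isig)
qed

text \<open>Rescalings separate the keys: different contents by doubling one letter, different
  Cartan exponents by scaling one \<open>k\<close> by \<open>s\<close> and compensating at
  \<epsilon>, where the label 1 allows it.\<close>

lemma monomials_independent:
 assumes fin: "finite S" and v: "!!p. p \<in> S ==> valid_key p" and y: "!!p. p \<in> S ==> content (fst p) (y p)"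
  and sum: "(\<Sum>p\<in>S. emb Pos (y p) * Kmon (snd p)) \<in> J" and p: "p \<in> S"
 shows "y p \<in> Ipos"
proof -
 define P :: "((anode => complex) \<times> (anode => complex)) set" where
  "P = {t. admissible_twist (snd t)}"
 define c where "c t p = (\<Prod>l\<in>#fst p. fst t l) * (\<Prod>i\<in>Isig. snd t (Nd i) powi snd p i)"
  for t :: "(anode => complex) \<times> (anode => complex)" and p :: "anode multiset \<times> (nat => int)"
 have "\<forall>p\<in>S. emb Pos (y p) * Kmon (snd p) \<in> J"
 proof (rule eig_independent[where P = P and c = c])
  show "emb Pos (y p) * Kmon (snd p) \<in> SB" if "p \<in> S" for p
   using content_SB[OF y[OF that]] v[OF that] by (intro subalgebra.mult Kmon_SB) (auto simp: valid_key_def)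
  show "eig (fst t) (snd t) (c t p) (emb Pos (y p) * Kmon (snd p))" if "t \<in> P" "p \<in> S" for t p
   unfolding c_def using that
   by (intro eig_mult eig_emb[OF y] eig_Kmon) (auto simp: P_def admissible_twist_def)
  show "admissible_twist (snd t)" if "t \<in> P" for t using that by (simp add: P_def)
  show "\<exists>t\<in>P. c t p ~= c t p'" if pp: "p \<in> S" "p' \<in> S" "p ~= p'" for p p'
  proof (cases "fst p = fst p'")
   case False
   then obtain l where l: "count (fst p) l ~= count (fst p') l" using multiset_eqI[of "fst p" "fst p'"] by metis
   define H where "H m = (if m = l then 2 else 1 :: complex)" for m
   have e: "(\<Prod>m\<in>#T. H m) = 2 ^ count T l" for T by (induction T) (auto simp: H_def)
   have "(2 :: nat) ^ count (fst p) l ~= 2 ^ count (fst p') l" using l by simp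
   hence "of_nat (2 ^ count (fst p) l) ~= (of_nat (2 ^ count (fst p') l) :: complex)" unfolding of_nat_eq_iff .
   hence "c (H, %_. 1) p ~= c (H, %_. 1) p'" by (simp add: c_def e)
   moreover have "(H, %_. 1) \<in> P" by (simp add: P_def admissible_twist_def)
   ultimately show ?thesis by blast
  next
   case True
   hence "snd p ~= snd p'" using pp(3) by (metis prod_eqI)
   then obtain j where j: "snd p j ~= snd p' j" by blast
   have jI: "j \<in> Isig" using v[OF pp(1)] v[OF pp(2)] j unfolding valid_key_def by fastforce
   define u where "u m = (if m = Nd j then s else if m = Eps then 1 / s ^ label (Nd j) else 1 :: complex)" for m
   have "Ihat = insert Eps (insert (Nd j) (Nd ` (Isig - {j})))" using jI by (auto simp: Ihat_def)
   moreover have "(\<Prod>i\<in>Nd ` (Isig - {j}). u i ^ label i) = 1" by (rule prod.neutral) (auto simp: u_def)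
   moreover have "finite (Nd ` (Isig - {j}))" using finite_Isig by simp
   ultimately have "(\<Prod>i\<in>Ihat. u i ^ label i) = u Eps ^ label Eps * (u (Nd j) ^ label (Nd j) * 1)"
    by (simp add: prod.insert_if image_iff)
   hence adm: "admissible_twist u" using cf.s_nz by (auto simp: admissible_twist_def u_def label_props(1))
   have e: "(\<Prod>i\<in>Isig. u (Nd i) powi U i) = s powi U j" for U
   proof -
    have "(\<Prod>i\<in>Isig. u (Nd i) powi U i) = (\<Prod>i\<in>Isig. if i = j then s powi U j else 1)"
     by (rule prod.cong) (auto simp: u_def)
    thus ?thesis using jI finite_Isig by (simp add: prod.delta)
   qed
   have "c (%_. 1, u) p ~= c (%_. 1, u) p'" using j by (simp add: c_def e cf.s_powi_cancel)
   moreover have "(%_. 1, u) \<in> P" using adm by (simp add: P_def)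
   ultimately show ?thesis by blast
  qed
 qed (use fin sum in auto)
 thus ?thesis using p Kmon_cancel by (auto simp: Ipos_def)
qed

end

context twisted_datum begin

lemma Kmon_k: assumes "i \<in> Ihat" shows "Kmon U * k p i \<approx> k p i * Kmon U"
 unfolding Kmon_def using assms
 by (intro prod_list_commute_eqU kpow_commute k_com) (auto simp: finite_Isig)

lemma k_emb_content: assumes "i \<in> Ihat" "content T y"
 shows "k p i * emb p' y \<approx> sc (s powi (sg p * sg p' * (\<Sum>l\<in>#T. Bh i l))) * (emb p' y * k p i)"
 using beq_eqU[OF k_emb[OF assms(1) cf.content_hom[OF assms(2)]]] .

lemma k_cancel: assumes "i \<in> Ihat" shows "a * k p i \<in> J ==> a \<in> J" "k p i * a \<in> J ==> a \<in> J"
proof -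
 have "a * k p i * k (opp p) i \<approx> a" using eqU_left[OF k_inv[OF assms], of a p] by (simp add: mult.assoc)
 thus "a * k p i \<in> J ==> a \<in> J" using eqU_J J_right by blast
 have "k (opp p) i * (k p i * a) \<approx> a" using k_inv_left[OF assms, of "opp p" a] by (cases p) simp_all
 thus "k p i * a \<in> J ==> a \<in> J" using eqU_J J_left by blast
qed

lemma d_rep: "i \<in> nodes X ==> d (rep i) = d i" by (simp add: d_def csum_rep)

lemma Isig_rep: "i \<in> Isig ==> rep i = i" "i \<in> Isig ==> i \<in> nodes X" by (simp_all add: Isig_iff)

lemma borel_eq: "borel = generated borel_gens" unfolding borel_def borel_gens_def ..

text \<open>The null root \<delta>, as a multiset of letters.\<close>

definition labm :: "anode multiset" where "labm = (\<Sum>l\<in>Ihat. replicate_mset (label l) l)"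

lemma count_labm: "count labm l = (if l \<in> Ihat then label l else 0)"
 using finite_Ihat by (simp add: labm_def count_sum)

lemma sum_mset_count: "set_mset T \<subseteq> Ihat ==> (\<Sum>l\<in>#T. f l) = (\<Sum>l\<in>Ihat. int (count T l) * (f l :: int))"
proof (induction T)
 case (add m T)
 have "(\<Sum>l\<in>Ihat. int (count (add_mset m T) l) * f l) = (\<Sum>l\<in>Ihat. int (count T l) * f l + (if l = m then f m else 0))"
  by (rule sum.cong) (auto simp: distrib_right)
 also have "... = (\<Sum>l\<in>Ihat. int (count T l) * f l) + f m"
  using add.prems finite_Ihat by (simp add: sum.distrib sum.delta)
 finally show ?case using add by simp
qed simp

lemma labm_Ihat: "set_mset labm \<subseteq> Ihat"
proof
 fix l assume "l \<in># labm"
 hence "count labm l ~= 0" by simp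
 thus "l \<in> Ihat" by (simp add: count_labm split: if_splits)
qed

lemma labm_weight: "i \<in> Ihat ==> (\<Sum>l\<in>#labm. Bh i l) = 0"
 using label_null[of i] Bh_sym[of i]
 by (simp add: sum_mset_count labm_Ihat count_labm)

text \<open>The difference to the null root has no \<epsilon> component and is orthogonal to the
  finite nodes, so it is zero by nondegeneracy in finite type.\<close>

lemma content_eq_labm:
 assumes "set_mset T \<subseteq> Ihat" "count T Eps = 1" "!!i. i \<in> Isig ==> (\<Sum>l\<in>#T. Bh (Nd i) l) = 0"
 shows "T = labm"
proof (rule multiset_eqI)
 fix l
 define n where "n l = int (count T l) - int (label l)" for l
 show "count T l = count labm l"
 proof (cases "l \<in> Ihat")
  case True
  have "(\<Sum>l\<in>Ihat. n l * Bh (Nd j) l) = 0" if "j \<in> Isig" for j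
  proof -
   have "(\<Sum>l\<in>Ihat. n l * Bh (Nd j) l) = (\<Sum>l\<in>#T. Bh (Nd j) l) - (\<Sum>l\<in>#labm. Bh (Nd j) l)"
    using assms(1) labm_Ihat by (simp add: sum_mset_count n_def left_diff_distrib sum_subtractf count_labm)
   thus ?thesis using assms(3)[OF that] labm_weight[of "Nd j"] that by simp
  qed
  hence "n l = 0" using True assms(2) form_nondegenerate[of n l] by (simp add: n_def label_props(1))
  thus ?thesis using True by (simp add: n_def count_labm)
 next
  case False
  hence "l \<notin># T" using assms(1) by blast
  thus ?thesis using False by (simp add: count_labm not_in_iff)
 qed
qed

lemma pairing_nondegenerate:
 assumes "!!i. i \<in> Isig ==> pairing U (Nd i) = 0" "j \<in> Isig" shows "U j = 0"
proof -
 define n where "n l = (case l of Eps => 0 | Nd i => U i)" for l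
 have "(\<Sum>l\<in>Ihat. n l * Bh (Nd i) l) = 0" if "i \<in> Isig" for i
 proof -
  have "(\<Sum>l\<in>Ihat. n l * Bh (Nd i) l) = (\<Sum>j\<in>Isig. U j * Bh (Nd i) (Nd j))"
   unfolding Ihat_def using finite_Isig by (subst sum.insert) (auto simp: n_def sum.reindex inj_on_def)
  also have "... = pairing U (Nd i)" unfolding pairing_def using that
   by (intro sum.cong) (auto simp: Bh_sym)
  finally show ?thesis using assms(1)[OF that] by simp
 qed
 hence "n (Nd j) = 0" using assms(2) form_nondegenerate[of n "Nd j"] by (simp add: n_def)
 thus ?thesis by (simp add: n_def)
qed

end

section \<open>The affine generator\<close>

locale drinfeld = twisted_datum +
 fixes x :: "sign => nat => int => ualg" and h :: "nat => int => ualg"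
 assumes dg: "drinfeld_generators x h" and nontrivial: "1 \<notin> J"
begin

lemmas dg_all = dg[unfolded drinfeld_generators_def Let_def]
lemmas dg_x0 = dg_all[THEN conjunct2, THEN conjunct1]
lemmas dg_rest = dg_all[THEN conjunct2, THEN conjunct2]
lemmas dg_G = dg_rest[THEN conjunct1]
lemmas dg_bor = dg_rest[THEN conjunct2, THEN conjunct1]
lemmas dg_rels = dg_rest[THEN conjunct2, THEN conjunct2, THEN conjunct2, THEN conjunct2]
lemmas dg_hh = dg_rels[THEN conjunct1]
lemmas dg_kh = dg_rels[THEN conjunct2, THEN conjunct1]
lemmas dg_kx = dg_rels[THEN conjunct2, THEN conjunct2, THEN conjunct1]
lemmas dg_hx_xx = dg_rels[THEN conjunct2, THEN conjunct2, THEN conjunct2]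
lemmas dg_hx = dg_hx_xx[THEN conjunct1]
lemmas dg_xx = dg_hx_xx[THEN conjunct2]

lemma x_0: "i \<in> Isig ==> x p i 0 \<approx> e p (Nd i)"
 using dg_x0 by blast

lemma in_borel: "i \<in> nodes X ==> r \<ge> 0 ==> x Pos i r \<in> borel" "i \<in> nodes X ==> r \<ge> 0 ==> phi h Pos i r \<in> borel"
 using dg_bor by blast+

lemma grading_ex: obtains G where "grading G" "!!p m i. i \<in> nodes X ==> x p i m \<in> G m"
  "!!i r. i \<in> nodes X ==> r ~= 0 ==> h i r \<in> G r" "!!p i. i \<in> nodes X ==> kI p i \<in> G 0"
  "!!p. e p Eps \<in> G (sg p)"
proof -
 have "\<exists>G. grading G \<and> (\<forall>p m. \<forall>i\<in>nodes X. x p i m \<in> G m) \<and> (\<forall>i\<in>nodes X. \<forall>r. r ~= 0 --> h i r \<in> G r)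
    \<and> (\<forall>p. \<forall>i\<in>nodes X. kI p i \<in> G 0) \<and> (\<forall>p. e p Eps \<in> G (sg p))"
  by (rule dg_G)
 then obtain G where "grading G" "\<forall>p m. \<forall>i\<in>nodes X. x p i m \<in> G m" "\<forall>i\<in>nodes X. \<forall>r. r ~= 0 --> h i r \<in> G r"
  "\<forall>p. \<forall>i\<in>nodes X. kI p i \<in> G 0" "\<forall>p. e p Eps \<in> G (sg p)" by (elim exE conjE)
 thus thesis by (intro that[of G]) simp_all
qed

lemma h_h: "i \<in> nodes X ==> j \<in> nodes X ==> r ~= 0 ==> t ~= 0 ==> h i r * h j t \<approx> h j t * h i r"
 using dg_hh unfolding comm_def eqU_def by simp
lemma kI_h: "i \<in> nodes X ==> j \<in> nodes X ==> r ~= 0 ==> kI p i * h j r \<approx> h j r * kI p i"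
 using dg_kh unfolding comm_def eqU_def by simp
lemma kI_x: "i \<in> nodes X ==> j \<in> nodes X ==>
  kI Pos i * x p j m \<approx> sc (q powi (sg p * csum i j)) * x p j m * kI Pos i"
 using dg_kx by blast

definition hx :: "nat => nat => int => complex" where
 "hx i j r = (\<Sum>t=1..M. qnum (d i) (of_int (r * cartan X i ((\<sigma> ^^ t) j)) / d i) * \<omega> powi (r * int t)) / of_int r"

lemma h_x: "i \<in> nodes X ==> j \<in> nodes X ==> r ~= 0 ==>
 comm (h i r) (x p j l) \<approx> sc (of_int (sg p) * hx i j r) * x p j (r + l)"
 using dg_hx unfolding hx_def by simp

definition kap :: "nat => nat => int => complex" where
 "kap i j l = (\<Sum>t=1..M. if (\<sigma> ^^ t) i = j then \<omega> powi (int t * l) else 0) / (dorder i * (qp (d i) - qp (- d i)))"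

lemma x_x: "i \<in> nodes X ==> j \<in> nodes X ==>
 comm (x Pos i m) (x Neg j l) \<approx> sc (kap i j l) * (phi h Pos i (m + l) - phi h Neg i (m + l))"
 using dg_xx unfolding kap_def by blast

lemma borel_SB: "a \<in> borel ==> \<exists>b\<in>SB. a \<approx> b" unfolding borel_eq generated_def by blast

lemma qp_diff_nz: "i \<in> nodes X ==> qp (d i) - qp (- d i) ~= 0"
proof -
 assume i: "i \<in> nodes X"
 have r: "d (rep i) = d i" using d_rep[OF i] .
 have I: "Nd (rep i) \<in> Ihat" using i by (simp add: Isig_def)
 have "qp (d i) - qp (- d i) = s powi Dh (Nd (rep i)) - s powi (- Dh (Nd (rep i)))"
  using qp_Dh[OF I] r by simp
 thus ?thesis using cf.s_powi_cancel[of "Dh (Nd (rep i))" "- Dh (Nd (rep i))"] cf.D_pos[OF I] by simp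
qed

lemma exp_coeff_1: "exp_coeff a 1 = a 1"
 by (simp add: exp_coeff_def)

lemma phi_1: "i \<in> nodes X ==> phi h Pos i 1 = sc (qp (d i) - qp (- d i)) * (kI Pos i * h i 1)"
 by (simp add: phi_def exp_coeff_1 sc_left_commute[of "kI Pos i"] flip: One_nat_def)

text \<open>\<open>phi h Pos j 1\<close> lies in the Borel subalgebra, and since the exponential
  contributes only its linear term in this degree, it is a nonzero multiple of k_j times
  \<open>h j 1\<close>.\<close>

lemma h1_borel: assumes j: "j \<in> Isig" shows "\<exists>b\<in>SB. h j 1 \<approx> b"
proof -
 have J: "j \<in> nodes X" and jI: "Nd j \<in> Ihat" using j by (simp_all add: Isig_rep)
 obtain b where b: "b \<in> SB" "phi h Pos j 1 \<approx> b" using borel_SB[OF in_borel(2)[OF J, of 1]] by auto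
 define c where "c = qp (d j) - qp (- d j)"
 have c: "c ~= 0" using qp_diff_nz[OF J] by (simp add: c_def)
 have "h j 1 \<approx> k Neg (Nd j) * (k Pos (Nd j) * h j 1)" using eqU_sym[OF k_inv_left[OF jI, of Neg]] by simp
 also have "... = sc (1 / c) * (k Neg (Nd j) * phi h Pos j 1)"
  using c j by (simp add: phi_1[OF J] c_def[symmetric] kI_def Isig_rep sc_left_commute[of "k Neg (Nd j)"] sc_sc_mult)
 also have "... \<approx> sc (1 / c) * (k Neg (Nd j) * b)" by (intro eqU_left b)
 finally show ?thesis using b SB_k[OF jI] by (blast intro: subalgebra_sc subalgebra.mult)
qed

lemma grading_sc: "grading G ==> a \<in> G n ==> sc c * a \<in> G n"
 and grading_add: "grading G ==> a \<in> G n ==> b \<in> G n ==> a + b \<in> G n"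
 and grading_0: "grading G ==> 0 \<in> G n"
 and grading_mult: "grading G ==> a \<in> G m ==> b \<in> G n ==> a * b \<in> G (m + n)"
 and grading_1: "grading G ==> 1 \<in> G 0"
 and grading_eqU: "grading G ==> a \<in> G n ==> (b :: ualg) \<approx> a ==> b \<in> G n"
proof -
 assume "grading G"
 note g = this[unfolded grading_def]
 note G1 = g[THEN conjunct1] and GJ = g[THEN conjunct2, THEN conjunct1]
  and Glin = g[THEN conjunct2, THEN conjunct2, THEN conjunct1]
  and Gm = g[THEN conjunct2, THEN conjunct2, THEN conjunct2, THEN conjunct1]
 have lin: "a + sc c * b \<in> G n" if "a \<in> G n" "b \<in> G n" for a b c n using Glin that by blast
 have JG: "a \<in> G n" if "a \<in> J" for a n using GJ that by blast
 show "a \<in> G n ==> sc c * a \<in> G n" using lin[of 0 n a c] JG[OF J_0] by simp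
 show "a \<in> G n ==> b \<in> G n ==> a + b \<in> G n" using lin[of a n b 1] by simp
 show "0 \<in> G n" by (rule JG[OF J_0])
 show "a \<in> G m ==> b \<in> G n ==> a * b \<in> G (m + n)" using Gm by blast
 show "1 \<in> G 0" by (rule G1)
 show "a \<in> G n ==> (b :: ualg) \<approx> a ==> b \<in> G n" using lin[of a n "b - a" 1] JG[of "b - a"] by (simp add: eqU_def)
qed

text \<open>Weights and degree determine the content of the monomials that occur in \<open>h\<^sub>1\<close>.\<close>

lemma h1_content:
 assumes j: "j \<in> Isig"
 obtains S y where "finite S" "!!p. p \<in> S ==> valid_key p \<and> fst p = labm" "!!p. content (fst p) (y p)"
  "h j 1 \<approx> (\<Sum>p\<in>S. emb Pos (y p) * Kmon (snd p))"
proof -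
 have J: "j \<in> nodes X" using j by (simp add: Isig_rep)
 obtain b where "b \<in> SB" "h j 1 \<approx> b" using h1_borel[OF j] by blast
 moreover obtain c where "c \<in> PB" "b \<approx> c" using SB_PB[OF \<open>b \<in> SB\<close>] by blast
 ultimately have c: "c \<in> PB" "h j 1 \<approx> c" using eqU_trans by blast+
 obtain S y where S: "finite S" "!!p. p \<in> S ==> valid_key p" "!!p. content (fst p) (y p)"
  "c = (\<Sum>p\<in>S. emb Pos (y p) * Kmon (snd p))" by (rule PB_expansion[OF c(1)]) blast
 define w where "w p = emb Pos (y p) * Kmon (snd p)" for p
 obtain G where G: "grading G" "!!p m i. i \<in> nodes X ==> x p i m \<in> G m"
  "!!i r. i \<in> nodes X ==> r ~= 0 ==> h i r \<in> G r" "!!p i. i \<in> nodes X ==> kI p i \<in> G 0"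
  "!!p. e p Eps \<in> G (sg p)" by (rule grading_ex) blast
 have G0: "prod_list (map f L) \<in> G 0" if "!!a. a \<in> set L ==> f a \<in> G 0" for f and L :: "nat list"
  using that
 proof (induction L)
  case (Cons a L)
  hence "f a * prod_list (map f L) \<in> G (0 + 0)" by (intro grading_mult G) auto
  thus ?case by simp
 qed (simp add: grading_1 G)
 have Gp: "a ^ n \<in> G 0" if "a \<in> G 0" for a n
  using that by (induction n) (use grading_mult[OF G(1), of _ 0 _ 0] in "auto simp: grading_1 G")
 have kG: "k p (Nd i) \<in> G 0" if "i \<in> Isig" for p i
  using G(4)[of i p] that by (simp add: kI_def Isig_rep)
 have KG: "Kmon U \<in> G 0" for U
  unfolding Kmon_def kpow_def by (rule G0) (auto simp: finite_Isig intro!: Gp kG)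
 have eG: "e Pos l \<in> G (if l = Eps then 1 else 0)" if "l \<in> Ihat" for l
  using that
 proof (rule Ihat_cases)
  fix i assume "l = Nd i" "i \<in> Isig"
  thus ?thesis using grading_eqU[OF G(1) G(2)[of i Pos 0] eqU_sym[OF x_0]] by (simp add: Isig_rep)
 qed (use G(5)[of Pos] in simp)
 have wordG: "prod_list (map (e Pos) v) \<in> G (int (count (mset v) Eps))" if "set v \<subseteq> Ihat" for v
  using that
 proof (induction v)
  case (Cons l v)
  hence "e Pos l * prod_list (map (e Pos) v) \<in> G ((if l = Eps then 1 else 0) + int (count (mset v) Eps))"
   by (intro grading_mult G eG) auto
  thus ?case by (simp split: if_splits)
 qed (simp add: grading_1 G)
 have embG: "emb Pos z \<in> G (int (count T Eps))" if "content T z" "set_mset T \<subseteq> Ihat" for T z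
  using that
 proof (induction rule: words_in_induct)
  case (single v a)
  thus ?case using grading_sc[OF G(1) wordG[of v], of a] by (auto simp: emb_def word_ext_single)
 qed (simp_all add: grading_0 grading_add G emb_add)
 have wG: "w p \<in> G (int (count (fst p) Eps))" if "p \<in> S" for p
  using grading_mult[OF G(1) embG[OF S(3)] KG, of p "snd p"] S(2)[OF that] by (simp add: w_def valid_key_def)
 \<comment> \<open>The relation is sorted by degree, with \<open>h j 1\<close> in degree 1.
   Independence of the graded pieces then isolates the monomials with exactly one letter
   \<epsilon>.\<close>
 define D where "D = (%p. int (count (fst p) Eps)) ` S \<union> {1}"
 define f where "f n = (\<Sum>p\<in>{p\<in>S. int (count (fst p) Eps) = n}. w p) + (if n = 1 then sc (- 1) * h j 1 else 0)" for n
 have fG: "\<forall>n\<in>D. f n \<in> G n"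
 proof
  fix n
  have "(\<Sum>p\<in>F. w p) \<in> G n" if "F \<subseteq> {p\<in>S. int (count (fst p) Eps) = n}" for F
   using that by (induction F rule: infinite_finite_induct) (use wG in "auto intro: grading_0 grading_add G")
  moreover have "(if n = 1 then sc (- 1) * h j 1 else 0) \<in> G n"
   using grading_sc[OF G(1) G(3)[OF J, of 1]] grading_0[OF G(1)] by simp
  ultimately show "f n \<in> G n" unfolding f_def by (intro grading_add G) auto
 qed
 have "(\<Sum>n\<in>D. f n) = (\<Sum>n\<in>D. \<Sum>p\<in>{p\<in>S. int (count (fst p) Eps) = n}. w p) - h j 1"
  unfolding f_def sum.distrib using S(1) by (simp add: D_def sum.delta sc_minus)
 also have "(\<Sum>n\<in>D. \<Sum>p\<in>{p\<in>S. int (count (fst p) Eps) = n}. w p) = (\<Sum>p\<in>S. w p)"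
  using S(1) by (intro sum.group) (auto simp: D_def)
 finally have "(\<Sum>n\<in>D. f n) \<in> J" using J_minus c(2) S(4) by (fastforce simp: eqU_def w_def)
 hence "f 1 \<in> J" using fG S(1) G(1)[unfolded grading_def, THEN conjunct2, THEN conjunct2, THEN conjunct2, THEN conjunct2,
    THEN conjunct2, THEN spec, of D, THEN spec, of f] by (simp add: D_def)
 define S1 where "S1 = {p\<in>S. int (count (fst p) Eps) = 1}"
 have S1: "finite S1" "!!p. p \<in> S1 ==> valid_key p" using S by (auto simp: S1_def)
 have h1: "h j 1 \<approx> (\<Sum>p\<in>S1. w p)"
  using J_minus[OF \<open>f 1 \<in> J\<close>] by (simp add: f_def S1_def eqU_def sc_minus)
 define wt where "wt i p = (\<Sum>l\<in>#fst p. Bh (Nd i) l)" for i and p :: "anode multiset \<times> (nat => int)"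
 \<comment> \<open>\<open>h j 1\<close> commutes with the \<open>k\<close>'s, so every summand of
   nonzero weight must vanish.\<close>
 have drop: "y p \<in> Ipos" if p: "p \<in> S1" and i: "i \<in> Isig" and nz: "wt i p ~= 0" for p i
 proof -
  define K where "K = k Pos (Nd i)"
  have iI: "Nd i \<in> Ihat" using i by simp
  have "K * w p \<approx> sc (s powi (wt i p)) * w p * K" for p
  proof -
   have "K * w p = (K * emb Pos (y p)) * Kmon (snd p)" by (simp add: w_def mult.assoc)
   also have "... \<approx> sc (s powi (sg Pos * sg Pos * wt i p)) * (emb Pos (y p) * K) * Kmon (snd p)"
    unfolding wt_def K_def by (intro eqU_right k_emb_content iI S)
   also have "... = sc (s powi (wt i p)) * (emb Pos (y p) * (K * Kmon (snd p)))" by (simp add: mult.assoc)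
   also have "... \<approx> sc (s powi (wt i p)) * (emb Pos (y p) * (Kmon (snd p) * K))"
    unfolding K_def by (intro eqU_left eqU_sym[OF Kmon_k] iI)
   finally show ?thesis by (simp add: w_def mult.assoc)
  qed
  hence A: "K * (\<Sum>p\<in>S1. w p) \<approx> (\<Sum>p\<in>S1. sc (s powi (wt i p)) * w p * K)"
   unfolding sum_distrib_left by (intro eqU_sum)
  have B: "K * (\<Sum>p\<in>S1. w p) \<approx> (\<Sum>p\<in>S1. w p) * K"
  proof -
   have "K * (\<Sum>p\<in>S1. w p) \<approx> K * h j 1" by (intro eqU_left eqU_sym[OF h1])
   also have "... \<approx> h j 1 * K" using kI_h[of i j 1 Pos] i J by (simp add: K_def kI_def Isig_rep)
   also have "... \<approx> (\<Sum>p\<in>S1. w p) * K" by (intro eqU_right h1)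
   finally show ?thesis .
  qed
  from eqU_trans[OF eqU_sym[OF A] B] have "(\<Sum>p\<in>S1. (sc (s powi (wt i p) - 1) * w p) * K) \<in> J"
   by (simp add: eqU_def sum_distrib_right sum_subtractf sc_diff left_diff_distrib)
  hence "(\<Sum>p\<in>S1. sc (s powi (wt i p) - 1) * w p) * K \<in> J" by (simp add: sum_distrib_right)
  hence "(\<Sum>p\<in>S1. sc (s powi (wt i p) - 1) * w p) \<in> J" unfolding K_def by (rule k_cancel[OF iI])
  hence "(\<Sum>p\<in>S1. emb Pos (sc (s powi (wt i p) - 1) * y p) * Kmon (snd p)) \<in> J"
   by (simp add: w_def emb_sc mult.assoc)
  from monomials_independent[OF S1(1,2) _ this p]
  have "sc (s powi (wt i p) - 1) * y p \<in> Ipos" by (auto intro: words_in_sc S)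
  thus ?thesis using ci.N_cancel_sc nz cf.s_powi_eq_1 by simp
 qed
 define S2 where "S2 = {p\<in>S1. \<forall>i\<in>Isig. wt i p = 0}"
 have "(\<Sum>p\<in>S1. w p) \<approx> (\<Sum>p\<in>S2. w p)"
 proof -
  have "(\<Sum>p\<in>S1. w p) - (\<Sum>p\<in>S2. w p) = (\<Sum>p\<in>S1 - S2. w p)"
   using S1(1) sum_diff[of S1 S2 w] by (auto simp: S2_def)
  also have "... \<in> J"
   by (rule J_sum) (use drop in "auto simp: S2_def w_def Ipos_def intro: J_right")
  finally show ?thesis by (simp add: eqU_def)
 qed
 hence "h j 1 \<approx> (\<Sum>p\<in>S2. w p)" using h1 eqU_trans by blast
 moreover have "fst p = labm" if "p \<in> S2" for p
 proof (rule content_eq_labm)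
  show "set_mset (fst p) \<subseteq> Ihat" using that S1(2) by (simp add: S2_def valid_key_def)
  show "count (fst p) Eps = 1" using that by (simp add: S2_def S1_def)
  show "(\<Sum>l\<in>#fst p. Bh (Nd i) l) = 0" if "i \<in> Isig" for i using that \<open>p \<in> S2\<close> by (simp add: S2_def wt_def)
 qed
 ultimately show thesis using S1 S(3) by (intro that[of S2 y]) (auto simp: S2_def w_def)
qed

end

section \<open>Commutators of the first Cartan mode with the Chevalley generators\<close>

context twisted_datum begin


lemma e_f: "i \<in> Ihat ==> e Pos i * e Neg i \<approx> e Neg i * e Pos i + sc (cc i) * (k Pos i - k Neg i)"
 using beq_eqU[OF e_e[of i i Pos]] by simp

lemma emb_f: "i \<in> Ihat ==> emb Pos y * e Neg i \<approx> e Neg i * emb Pos y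
   + sc (cc i) * (k Pos i * emb Pos (cf.R (- 1) i y) - k Neg i * emb Pos (cf.R 1 i y))"
 using beq_eqU[OF emb_commutator[of i Pos y]] by simp

lemma content_Ihat: "content T y ==> set_mset T \<subseteq> Ihat ==> words_on Ihat y"
 by (erule words_in_impD) auto

text \<open>Commuting with \<open>e\<close> does not leave the lowest degrees, where the decomposition is unique.\<close>

lemma e_commutator_low:
 assumes i: "i \<in> Ihat" and z: "z \<in> SB" and b: "b \<in> SB" and c: "c \<in> SB"
  and h: "comm (e Pos i) (e Neg i * z + b) \<approx> c"
 shows "comm (e Pos i) z \<in> J"
proof -
 define b' where "b' = sc (cc i) * (k Pos i - k Neg i) * z + comm (e Pos i) b - c"
 have "e Pos i * (e Neg i * z + b) = (e Pos i * e Neg i) * z + e Pos i * b" by (simp add: distrib_left mult.assoc)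
 also have "... \<approx> (e Neg i * e Pos i + sc (cc i) * (k Pos i - k Neg i)) * z + e Pos i * b"
  by (intro eqU_add eqU_right e_f i eqU_refl)
 finally have "comm (e Pos i) (e Neg i * z + b)
   \<approx> (e Neg i * e Pos i + sc (cc i) * (k Pos i - k Neg i)) * z + e Pos i * b - (e Neg i * z + b) * e Pos i"
  unfolding comm_def by (intro eqU_diff eqU_refl)
 also have "... = e Neg i * comm (e Pos i) z + (b' + c)"
  by (simp add: comm_def b'_def algebra_simps)
 finally have "e Neg i * comm (e Pos i) z + (b' + c) \<approx> c" using h eqU_sym eqU_trans by blast
 hence "e Neg i * comm (e Pos i) z + b' \<in> J" by (simp add: eqU_def add.assoc)
 moreover have "comm (e Pos i) z \<in> SB" "b' \<in> SB" unfolding comm_def b'_def using i z b c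
  by (auto intro!: subalgebra_diff subalgebra.add subalgebra.mult subalgebra_sc SB_e SB_k)
 ultimately show ?thesis using triangular_low i by blast
qed

end

context drinfeld begin

lemma phi_Neg: "m > 0 ==> phi h Neg i m = 0" by (simp add: phi_def)

lemma x_x_1: assumes "i \<in> Isig" shows "comm (x Pos i 0) (x Neg i 1) \<approx> sc (kap i i 1) * phi h Pos i 1"
 using x_x[of i i 0 1] assms by (simp add: Isig_rep phi_Neg)

text \<open>The double commutator returns to the Borel subalgebra: \<open>h j 1\<close> takes
  \<open>x Neg i 0\<close> to \<open>x Neg i 1\<close>, and \<open>x Pos i 0\<close> takes that to
  \<open>phi h Pos i 1\<close>.\<close>

lemma e_h_f:
 assumes j: "j \<in> Isig" and i: "i \<in> Isig"
 shows "comm (e Pos (Nd i)) (comm (h j 1) (e Neg (Nd i))) \<approx> sc (- hx j i 1 * kap i i 1) * phi h Pos i 1"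
proof -
 have "comm (h j 1) (e Neg (Nd i)) \<approx> comm (h j 1) (x Neg i 0)"
  unfolding comm_def by (intro eqU_diff eqU_mult eqU_refl eqU_sym[OF x_0] i)
 also have "... \<approx> sc (- hx j i 1) * x Neg i 1" using h_x[of j i 1 Neg 0] i j by (simp add: Isig_rep)
 finally have 1: "comm (h j 1) (e Neg (Nd i)) \<approx> sc (- hx j i 1) * x Neg i 1" .
 have "comm (e Pos (Nd i)) (comm (h j 1) (e Neg (Nd i))) \<approx> comm (x Pos i 0) (sc (- hx j i 1) * x Neg i 1)"
  unfolding comm_def[of "e Pos (Nd i)"] comm_def[of "x Pos i 0"]
  by (intro eqU_diff eqU_mult eqU_sym[OF x_0] i 1)
 also have "... = sc (- hx j i 1) * comm (x Pos i 0) (x Neg i 1)"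
  by (simp add: comm_def right_diff_distrib sc_left_commute[of "x Pos i 0"] mult.assoc)
 also have "... \<approx> sc (- hx j i 1) * (sc (kap i i 1) * phi h Pos i 1)" by (intro eqU_left x_x_1 i)
 finally show ?thesis by (simp add: sc_sc_mult)
qed

text \<open>In the commutator with f = \<open>e Neg (Nd i)\<close>, a summand whose Cartan factor
  does not commute with f leaves a term with f in front. As the double commutator with e lies in the
  Borel subalgebra, the sum \<open>Z\<close> of these terms commutes with e modulo \<open>J\<close>.
  On each summand this is a skew commutation, which forces the summand to vanish. A Cartan monomial
  that pairs trivially with every node is 1.\<close>

lemma h1_emb: assumes j: "j \<in> Isig" shows "\<exists>b. content labm b \<and> h j 1 \<approx> emb Pos b"
proof -
 obtain S y where S: "finite S" "!!p. p \<in> S ==> valid_key p \<and> fst p = labm" "!!p. content (fst p) (y p)"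
  "h j 1 \<approx> (\<Sum>p\<in>S. emb Pos (y p) * Kmon (snd p))" by (rule h1_content[OF j]) blast
 have cy: "content labm (y p)" if "p \<in> S" for p using S(2)[OF that] S(3)[of p] by simp
 define w where "w p = emb Pos (y p) * Kmon (snd p)" for p
 have wSB: "w p \<in> SB" if "p \<in> S" for p
  unfolding w_def using content_SB[OF cy[OF that] labm_Ihat] by (intro subalgebra.mult Kmon_SB)
 have kill: "y p \<in> Ipos" if p: "p \<in> S" and i: "i \<in> Isig" and nz: "pairing (snd p) (Nd i) ~= 0" for p i
 proof -
  have iI: "Nd i \<in> Ihat" using i by simp
  define f E where "f = e Neg (Nd i)" and "E = e Pos (Nd i)"
  define u where "u p = pairing (snd p) (Nd i)" for p :: "anode multiset \<times> (nat => int)"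
  define \<theta> where "\<theta> p = s powi (- u p)" for p
  \<comment> \<open>The twist has the sign opposite to \<open>u p\<close>, so that the exceptional
    exponents in \<open>skew_commutator_in_ideal\<close> are avoided.\<close>
  let ?v = "if 0 < u p then - 1 else 1 :: int" and ?t = "%p. sc (\<theta> p - 1)"
  define c where "c p = sc (cc (Nd i)) * (k Pos (Nd i) * emb Pos (cf.R (- 1) (Nd i) (y p)) - k Neg (Nd i) * emb Pos (cf.R 1 (Nd i) (y p)))" for p
  have cSB: "c p \<in> SB" if "p \<in> S" for p
  proof -
   have "words_on Ihat (y p)"
    using cy[OF that] labm_Ihat by (rule content_Ihat)
   thus ?thesis unfolding c_def
    by (intro subalgebra_sc subalgebra_diff subalgebra.mult SB_k iI emb_SB cf.words_in_R)
  qed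
  have wf: "comm (w p) f \<approx> f * (?t p * w p) + sc (\<theta> p) * (c p * Kmon (snd p))" if "p \<in> S" for p
  proof -
   have "w p * f = emb Pos (y p) * (Kmon (snd p) * f)" by (simp add: w_def mult.assoc)
   also have "... \<approx> emb Pos (y p) * (sc (\<theta> p) * (f * Kmon (snd p)))"
    using Kmon_e[of "snd p" Neg "Nd i"] by (intro eqU_left) (simp add: f_def \<theta>_def u_def)
   also have "... = sc (\<theta> p) * ((emb Pos (y p) * f) * Kmon (snd p))"
    by (simp add: sc_left_commute[of "emb Pos (y p)"] mult.assoc)
   also have "... \<approx> sc (\<theta> p) * ((f * emb Pos (y p) + c p) * Kmon (snd p))"
    unfolding f_def c_def by (intro eqU_left eqU_right emb_f iI)
   finally have "comm (w p) f \<approx> sc (\<theta> p) * ((f * emb Pos (y p) + c p) * Kmon (snd p)) - f * w p"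
    unfolding comm_def by (intro eqU_diff eqU_refl)
   also have "... = f * (?t p * w p) + sc (\<theta> p) * (c p * Kmon (snd p))"
    by (simp add: w_def distrib_left distrib_right sc_diff left_diff_distrib right_diff_distrib
      sc_left_commute[of f] mult.assoc)
   finally show ?thesis .
  qed
  define Z where "Z = (\<Sum>p\<in>S. ?t p * w p)"
  define b' where "b' = (\<Sum>p\<in>S. sc (\<theta> p) * (c p * Kmon (snd p)))"
  have "comm (h j 1) f \<approx> comm (\<Sum>p\<in>S. w p) f"
   unfolding comm_def w_def by (intro eqU_diff eqU_mult eqU_refl S(4))
  also have "... = (\<Sum>p\<in>S. comm (w p) f)"
   by (simp add: comm_def sum_distrib_left sum_distrib_right sum_subtractf)
  also have "... \<approx> (\<Sum>p\<in>S. f * (?t p * w p) + sc (\<theta> p) * (c p * Kmon (snd p)))"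
   by (intro eqU_sum wf)
  also have "... = f * Z + b'" by (simp add: Z_def b'_def sum.distrib sum_distrib_left)
  finally have hf: "comm (h j 1) f \<approx> f * Z + b'" .
  obtain a where a: "a \<in> SB" "phi h Pos i 1 \<approx> a"
   using borel_SB[OF in_borel(2), of i 1] i by (auto simp: Isig_rep)
  have "comm E (f * Z + b') \<approx> comm E (comm (h j 1) f)"
   unfolding comm_def[of E] by (intro eqU_diff eqU_mult eqU_refl eqU_sym[OF hf])
  also have "... \<approx> sc (- hx j i 1 * kap i i 1) * phi h Pos i 1" unfolding E_def f_def by (rule e_h_f[OF j i])
  also have "... \<approx> sc (- hx j i 1 * kap i i 1) * a" by (intro eqU_left a)
  finally have "comm E Z \<in> J" unfolding E_def f_def
   by (rule e_commutator_low[OF iI, rotated 3])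
    (auto simp: Z_def b'_def intro!: subalgebra_sum subalgebra_sc wSB subalgebra.mult cSB Kmon_SB a)
  define Y where "Y p = ?t p * (gen (Nd i) * y p - sc (s powi (u p)) * (y p * gen (Nd i)))" for p
  have "comm E (?t p * w p) \<approx> emb Pos (Y p) * Kmon (snd p)" if "p \<in> S" for p
  proof -
   have "?t p * w p * E = ?t p * (emb Pos (y p) * (Kmon (snd p) * E))" by (simp add: w_def mult.assoc)
   also have "... \<approx> ?t p * (emb Pos (y p) * (sc (s powi (u p)) * (E * Kmon (snd p))))"
    using Kmon_e[of "snd p" Pos "Nd i"] by (intro eqU_left) (simp add: E_def u_def)
   finally have "comm E (?t p * w p) \<approx> E * (?t p * w p) - ?t p * (emb Pos (y p) * (sc (s powi (u p)) * (E * Kmon (snd p))))"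
    unfolding comm_def by (intro eqU_diff eqU_refl)
   also have "... = emb Pos (Y p) * Kmon (snd p)"
    by (simp add: Y_def w_def E_def emb_sc emb_diff emb_mult emb_gen sc_left_commute[of "emb Pos (y p)"] right_diff_distrib
      left_diff_distrib sc_left_commute[of "e Pos (Nd i)"] mult.assoc)
   finally show ?thesis .
  qed
  hence "(\<Sum>p\<in>S. comm E (?t p * w p)) \<approx> (\<Sum>p\<in>S. emb Pos (Y p) * Kmon (snd p))" by (intro eqU_sum)
  moreover have "comm E Z = (\<Sum>p\<in>S. comm E (?t p * w p))"
   by (simp add: Z_def comm_def sum_distrib_left sum_distrib_right sum_subtractf)
  ultimately have YJ: "(\<Sum>p\<in>S. emb Pos (Y p) * Kmon (snd p)) \<in> J" using \<open>comm E Z \<in> J\<close> eqU_J by metis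
  \<comment> \<open>All summands gain the same letter, so their keys are shifted injectively and
    remain distinct.\<close>
  define g where "g p = (add_mset (Nd i) labm, snd p)" for p :: "anode multiset \<times> (nat => int)"
  have inj: "inj_on g S" using S(2) by (auto simp: inj_on_def g_def prod_eq_iff)
  define Y' where "Y' p' = Y (the_inv_into S g p')" for p'
  have Y'g: "Y' (g p) = Y p" if "p \<in> S" for p using the_inv_into_f_f[OF inj that] by (simp add: Y'_def)
  have "Y' (g p) \<in> Ipos"
  proof (rule monomials_independent[of "g ` S"])
   show "valid_key p'" if "p' \<in> g ` S" for p'
    using that S(2) labm_Ihat i unfolding g_def valid_key_def by fastforce
   show "content (fst p') (Y' p')" if p': "p' \<in> g ` S" for p'
   proof -
    obtain p where p: "p \<in> S" "p' = g p" using p' by blast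
    have "content (add_mset (Nd i) labm) (y p * gen (Nd i))"
     by (rule words_in_mult[OF cy[OF p(1)] words_in_gen[of "%u. u = [Nd i]"]]) auto
    hence "content (add_mset (Nd i) labm) (sc (- (s powi (u p))) * (y p * gen (Nd i)))" by (rule words_in_sc)
    hence "content (add_mset (Nd i) labm) (gen (Nd i) * y p + sc (- (s powi (u p))) * (y p * gen (Nd i)))"
     by (intro words_in_add content_gen_mult cy p)
    hence "content (fst (g p)) (Y' (g p))"
     unfolding Y'g[OF p(1)] Y_def by (intro words_in_sc) (simp add: sc_minus g_def)
    thus ?thesis unfolding p(2) .
   qed
   have "(\<Sum>p\<in>g ` S. emb Pos (Y' p) * Kmon (snd p)) = (\<Sum>p\<in>S. emb Pos (Y p) * Kmon (snd p))"
    using inj by (simp add: sum.reindex Y'g) (simp add: g_def)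
   thus "(\<Sum>p\<in>g ` S. emb Pos (Y' p) * Kmon (snd p)) \<in> J" using YJ by simp
  qed (use S(1) p in auto)
  hence "Y p \<in> Ipos" using Y'g p by simp
  moreover have "\<theta> p - 1 ~= 0" using nz cf.s_powi_eq_1[of "- u p"] by (simp add: \<theta>_def u_def)
  ultimately have sk: "gen (Nd i) * y p - sc (s powi (u p)) * (y p * gen (Nd i)) \<in> Ipos"
   unfolding Y_def using ci.N_cancel_sc by blast
  have y0: "cf.hom (Nd i) 0 (y p)" using cf.content_hom[OF cy[OF p], of "Nd i"] labm_weight[OF iI] by simp
  show ?thesis
  proof (rule ci.skew_commutator_in_ideal[OF iI _ y0 sk, of "?v"])
   show "?v = (1 :: int) \<or> ?v = (- 1 :: int)" by simp
   fix a
   have "u p ~= 2 * ?v * Dh (Nd i) * int a"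
   proof
    assume e: "u p = 2 * ?v * Dh (Nd i) * int a"
    have "Dh (Nd i) * int a \<ge> 0" using cf.D_pos[OF iI] by simp
    moreover have "u p ~= 0" using nz by (simp add: u_def)
    moreover have "u p = 2 * ?v * (Dh (Nd i) * int a)" using e by (simp only: mult.assoc)
    moreover have "False" if "v \<ge> 0" "u p ~= 0" "u p = 2 * ?v * v" for v :: int
     using that by (auto split: if_splits)
    ultimately show False by blast
   qed
   thus "s powi u p * s powi (?v * 0) ~= s powi (2 * ?v * Dh (Nd i) * int a)"
    by (simp add: cf.s_powi_cancel)
  qed
 qed
 define p0 where "p0 = (labm, %_ :: nat. 0 :: int)"
 have "w p \<in> J" if p: "p \<in> S - {p0}" for p
 proof -
  have "\<exists>i\<in>Isig. pairing (snd p) (Nd i) ~= 0"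
  proof (rule ccontr)
   assume "\<not> ?thesis"
   hence "snd p j = 0" for j
    using pairing_nondegenerate[of "snd p" j] S(2)[of p] p by (cases "j \<in> Isig") (auto simp: valid_key_def)
   hence "p = p0" using S(2)[of p] p by (auto simp: p0_def prod_eq_iff)
   thus False using p by simp
  qed
  thus ?thesis using kill[of p] p by (auto simp: w_def Ipos_def intro: J_right)
 qed
 hence R: "(\<Sum>p\<in>S - {p0}. w p) \<in> J" by (rule J_sum)
 define b where "b = (if p0 \<in> S then y p0 else 0)"
 have "(\<Sum>p\<in>S. w p) - emb Pos b = (\<Sum>p\<in>S - {p0}. w p)"
  using S(1) by (auto simp: b_def w_def p0_def sum.remove[of S p0] Kmon_0)
 hence "(\<Sum>p\<in>S. w p) \<approx> emb Pos b" using R by (simp add: eqU_def)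
 hence "h j 1 \<approx> emb Pos b" using S(4) eqU_trans unfolding w_def by blast
 moreover have "content labm b" using cy by (simp add: b_def)
 ultimately show ?thesis by blast
qed

end

context twisted_datum begin

lemma R_content_0: assumes "content T y" "i \<notin># T" shows "cf.R t i y = 0"
proof -
 have n: "cf.Rw t i w = 0" if "i \<notin> set w" for w using that by (induction w) auto
 have "words_in (%_. False) (cf.R t i y)"
  unfolding cf.R_def using assms by (intro words_in_word_ext[OF assms(1)]) (auto simp: n)
 thus ?thesis by (auto simp: words_in_def)
qed

text \<open>\<open>R_commute\<close> relates derivations of opposite twist only, hence the pairing
  of \<open>t\<close> with \<open>- t\<close>.\<close>

lemma R_swap_Ipos:
 assumes t: "t = 1 \<or> t = - 1" and i: "i \<in> Ihat" and l: "l \<in> Ihat" and h: "cf.R t l y \<in> Ipos"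
 shows "cf.R t l (cf.R (- t) i y) \<in> Ipos"
proof -
 have "cf.R (- t) i (cf.R t l y) \<in> Ipos" using ci.N_R[OF i _ h, of "- t"] t by auto
 thus ?thesis using t
 proof (elim disjE)
  assume "t = 1" "cf.R (- t) i (cf.R t l y) \<in> Ipos"
  hence "sc (s powi (Bh i l)) * cf.R 1 l (cf.R (- 1) i y) \<in> Ipos" using cf.R_commute[OF i l, of y] by simp
  thus ?thesis using ci.N_cancel_sc cf.s_powi_nz \<open>t = 1\<close> by simp
 next
  assume t: "t = - 1" and "cf.R (- t) i (cf.R t l y) \<in> Ipos"
  hence "sc (s powi (Bh l i)) * cf.R 1 i (cf.R (- 1) l y) \<in> Ipos" using ci.N_left by simp
  thus ?thesis using cf.R_commute[OF l i, of y] t by simp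
 qed
qed

end

context drinfeld begin

lemma const_Ipos: "sc c \<in> Ipos ==> c = 0"
proof (rule ccontr)
 assume "sc c \<in> Ipos" "c ~= 0"
 hence "sc c * 1 \<in> J" by (simp add: Ipos_def)
 thus False using J_cancel_sc \<open>c ~= 0\<close> nontrivial by blast
qed

text \<open>In finite type one of the two families of skew derivations already detects zero, because the form is definite.\<close>

lemma finite_part_in_Ipos:
 assumes t: "t = 1 \<or> t = - 1"
 shows "content T z ==> set_mset T \<subseteq> Nd ` Isig ==> T ~= {#} ==>
  (!!i. i \<in> Isig ==> cf.R t (Nd i) z \<in> Ipos) ==> z \<in> Ipos"
proof (induction "size T" arbitrary: T z)
 case 0
 thus ?case by simp
next
 case (Suc n)
 have TI: "set_mset T \<subseteq> Ihat" using Suc.prems(2) by (auto simp: Ihat_def)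
 obtain l where l: "l \<in># T" using Suc.prems(3) by blast
 have "\<exists>j\<in>Isig. (\<Sum>l\<in>Ihat. int (count T l) * Bh (Nd j) l) > 0"
 proof (rule form_positive)
  show "int (count T Eps) = 0" using Suc.prems(2) by (auto simp: count_eq_zero_iff)
  show "l \<in> Ihat" using l TI by auto
  show "int (count T l) ~= 0" using l by simp
 qed simp
 then obtain i where i: "i \<in> Isig" "(\<Sum>l\<in>#T. Bh (Nd i) l) > 0" using sum_mset_count[OF TI] by metis
 have iI: "Nd i \<in> Ihat" using i by simp
 \<comment> \<open>The derivative of opposite twist satisfies the same hypothesis on a smaller
   content and vanishes by induction. With both derivatives at the node \<open>i\<close> gone, the
   positive weight there kills \<open>z\<close>.\<close>
 define w where "w = cf.R (- t) (Nd i) z"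
 have w: "content (T - {#Nd i#}) w" unfolding w_def by (rule cf.content_R[OF Suc.prems(1)])
 have wR: "cf.R t (Nd j) w \<in> Ipos" if "j \<in> Isig" for j
  unfolding w_def using that by (intro R_swap_Ipos t iI Suc.prems) simp_all
 have zR: "cf.R t (Nd i) z \<in> Ipos" using Suc.prems(4) i(1) .
 show ?case
 proof (cases "T = {#Nd i#}")
  case True
  then obtain c where c: "z = sc c * gen (Nd i)" using content_single_gen[OF Suc.prems(1)[unfolded True]] by blast
  have "cf.R t (Nd i) z = sc c" by (simp add: c cf.R_sc cf.R_gen)
  hence "c = 0" using const_Ipos zR by simp
  thus ?thesis by (simp add: c sc_0 ci.N_0)
 next
  case False
  have "w \<in> Ipos"
  proof (cases "Nd i \<in># T")
   case True
   show ?thesis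
   proof (rule Suc.hyps(1)[OF _ w])
    show "n = size (T - {#Nd i#})" using Suc.hyps(2) True by (simp add: size_Diff_singleton)
    show "set_mset (T - {#Nd i#}) \<subseteq> Nd ` Isig" using Suc.prems(2) by (auto dest: in_diffD)
    show "T - {#Nd i#} ~= {#}" using True False by (metis insert_DiffM)
   qed (rule wR)
  next
   case False
   thus ?thesis unfolding w_def using R_content_0[OF Suc.prems(1)] ci.N_0 by metis
  qed
  hence "cf.R (- 1) (Nd i) z \<in> Ipos \<and> cf.R 1 (Nd i) z \<in> Ipos" using zR t unfolding w_def by auto
  thus ?thesis using ci.positive_weight_in_ideal[OF iI cf.content_hom[OF Suc.prems(1)] i(2)] by blast
 qed
qed

definition h1 :: "nat => anode free_algebra" where
 "h1 j = (SOME b. content labm b \<and> h j 1 \<approx> emb Pos b)"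

lemma h1: assumes "j \<in> Isig" shows "content labm (h1 j)" "h j 1 \<approx> emb Pos (h1 j)"
 using someI_ex[OF h1_emb[OF assms]] unfolding h1_def by blast+

text \<open>The double commutator with e_i is computed both by the Drinfeld relations and by skew
  derivations. Comparing the parts that contain the inverse of k_i, the derivative for t = 1
  skew-commutes with \<open>gen i\<close>, at an exponent outside the exceptional set, so it
  vanishes. The other derivative then represents \<open>x Neg i 1\<close>, up to scalars and
  k_i.\<close>

lemma R_h1:
 assumes j: "j \<in> Isig" and i: "i \<in> Isig"
 shows "cf.R 1 (Nd i) (h1 j) \<in> Ipos"
  and "sc (- hx j i 1) * x Neg i 1 \<approx> sc (cc (Nd i)) * (k Pos (Nd i) * emb Pos (cf.R (- 1) (Nd i) (h1 j)))"
proof -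
 let ?i = "Nd i" and ?K = "%p a. k p (Nd i) * emb Pos a"
 have iI: "Nd i \<in> Ihat" and iN: "i \<in> nodes X" using i by (simp_all add: Isig_rep)
 define A1 A2 where "A1 = cf.R (- 1) ?i (h1 j)" and "A2 = cf.R 1 ?i (h1 j)"
 define u where "u = Bh ?i ?i"
 define E where "E = e Pos ?i"
 have win: "words_on Ihat A1" "words_on Ihat A2"
  unfolding A1_def A2_def using cf.words_in_R[OF content_Ihat[OF h1(1)[OF j] labm_Ihat]] by blast+
 have 1: "comm (h j 1) (e Neg ?i) \<approx> sc (cc ?i) * (?K Pos A1 - ?K Neg A2)"
 proof -
  have "comm (h j 1) (e Neg ?i) \<approx> comm (emb Pos (h1 j)) (e Neg ?i)"
   unfolding comm_def by (intro eqU_diff eqU_mult eqU_refl h1 j)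
  also have "... \<approx> (e Neg ?i * emb Pos (h1 j) + sc (cc ?i) * (?K Pos A1 - ?K Neg A2))
    - e Neg ?i * emb Pos (h1 j)"
   unfolding comm_def A1_def A2_def by (intro eqU_diff eqU_refl emb_f iI)
  finally show ?thesis by simp
 qed
 have 2: "comm E (?K p A)
   \<approx> ?K p (sc (s powi (- sg p * u)) * (gen ?i * A) - A * gen ?i)" for p A
 proof -
  have "comm E (?K p A) = (E * k p ?i) * emb Pos A - ?K p (A * gen ?i)"
   by (simp add: comm_def E_def emb_mult emb_gen mult.assoc)
  also have "... \<approx> (sc (s powi (- (sg p * sg Pos * u))) * (k p ?i * E)) * emb Pos A - ?K p (A * gen ?i)"
   unfolding E_def u_def by (intro eqU_diff eqU_right beq_eqU[OF e_k] iI eqU_refl)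
  also have "... = ?K p (sc (s powi (- sg p * u)) * (gen ?i * A) - A * gen ?i)"
   by (simp add: E_def emb_sc emb_diff emb_mult emb_gen sc_left_commute[of "k p ?i"] right_diff_distrib mult.assoc)
  finally show ?thesis .
 qed
 define C where "C = - hx j i 1 * kap i i 1 * (qp (d i) - qp (- d i))"
 define W1 W2 where "W1 = sc (cc ?i) * (sc (s powi (- u)) * (gen ?i * A1) - A1 * gen ?i) - sc C * h1 i"
  and "W2 = sc (cc ?i) * (sc (s powi u) * (gen ?i * A2) - A2 * gen ?i)"
 have "comm E (comm (h j 1) (e Neg ?i)) \<approx> comm E (sc (cc ?i) * (?K Pos A1 - ?K Neg A2))"
  unfolding comm_def[of E] by (intro eqU_diff eqU_mult eqU_refl 1)
 also have "... = sc (cc ?i) * (comm E (?K Pos A1) - comm E (?K Neg A2))"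
  by (simp add: comm_def right_diff_distrib left_diff_distrib sc_left_commute[of E] mult.assoc)
 also have "... \<approx> sc (cc ?i) * (?K Pos (sc (s powi (- sg Pos * u)) * (gen ?i * A1) - A1 * gen ?i)
   - ?K Neg (sc (s powi (- sg Neg * u)) * (gen ?i * A2) - A2 * gen ?i))"
  by (intro eqU_left eqU_diff 2)
 also have "... = ?K Pos W1 - ?K Neg W2 + sc C * (?K Pos (h1 i))"
  by (simp add: W1_def W2_def emb_sc emb_diff right_diff_distrib sc_left_commute[of "k p ?i" for p])
 finally have L: "comm E (comm (h j 1) (e Neg ?i))
   \<approx> ?K Pos W1 - ?K Neg W2 + sc C * (?K Pos (h1 i))" .
 have "comm E (comm (h j 1) (e Neg ?i)) \<approx> sc (- hx j i 1 * kap i i 1) * phi h Pos i 1"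
  unfolding E_def by (rule e_h_f[OF j i])
 also have "... = sc C * (k Pos ?i * h i 1)"
  using i by (simp add: phi_1[OF iN] C_def sc_sc_mult kI_def Isig_rep)
 also have "... \<approx> sc C * (?K Pos (h1 i))" by (intro eqU_left h1 i)
 finally have "?K Pos W1 - ?K Neg W2 + sc C * (?K Pos (h1 i))
   \<approx> sc C * (?K Pos (h1 i))" using L eqU_sym eqU_trans by blast
 hence J: "?K Pos W1 - ?K Neg W2 \<in> J" by (simp add: eqU_def)
 have gW: "words_on Ihat (gen ?i * A)" "words_on Ihat (A * gen ?i)"
  if "words_on Ihat A" for A
  using that iI by (auto intro!: words_in_mult[OF words_in_gen[of "%u. u = [Nd i]"]] words_in_mult[OF _ words_in_gen[of "%u. u = [Nd i]"]])
 have wd: "words_in P a ==> words_in P b ==> words_in P (a - b)" for P and a b :: "anode free_algebra"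
  using words_in_add[OF _ words_in_sc[of P b "- 1"]] by (fastforce simp: sc_minus)
 have W: "words_on Ihat W1" "words_on Ihat W2"
  unfolding W1_def W2_def by (intro wd words_in_sc gW win content_Ihat[OF h1(1)[OF i] labm_Ihat])+
 have "emb Pos W2 \<in> J"
  by (rule k_parts_in_J(2)[OF iI emb_SB[OF W(1)] eig_emb_1[OF W(1)] emb_SB[OF W(2)] eig_emb_1[OF W(2)] J])
 hence "sc (s powi u) * (gen ?i * A2) - A2 * gen ?i \<in> Ipos"
  unfolding W2_def using ci.N_cancel_sc cc_nz[OF iI] by (simp add: Ipos_def)
 hence "sc (s powi (- u)) * (sc (s powi u) * (gen ?i * A2) - A2 * gen ?i) \<in> Ipos" by (rule ci.N_left)
 hence sk: "gen ?i * A2 - sc (s powi (- u)) * (A2 * gen ?i) \<in> Ipos"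
  by (simp add: right_diff_distrib sc_sc_mult cf.s_powi_add[symmetric])
 have hom: "cf.hom ?i (0 - u) A2"
  unfolding A2_def u_def using cf.hom_R[OF cf.content_hom[OF h1(1)[OF j], of "Nd i"]] labm_weight[OF iI] by metis
 show A2: "A2 \<in> Ipos"
 proof (rule ci.skew_commutator_in_ideal[OF iI _ hom sk, of 1])
  fix a
  have "u > 0" "Dh ?i * int a \<ge> 0" using cf.D_pos[OF iI] cf.B_diag[OF iI] by (simp_all add: u_def)
  hence "- u + (0 - u) ~= 2 * Dh ?i * int a" by linarith
  thus "s powi - u * s powi (1 * (0 - u)) ~= s powi (2 * 1 * Dh ?i * int a)"
   unfolding cf.s_powi_add[symmetric] cf.s_powi_cancel by simp
 qed simp
 have "comm (h j 1) (e Neg ?i) \<approx> comm (h j 1) (x Neg i 0)"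
  unfolding comm_def by (intro eqU_diff eqU_mult eqU_refl eqU_sym[OF x_0] i)
 also have "... \<approx> sc (- hx j i 1) * x Neg i 1" using h_x[of j i 1 Neg 0] i j by (simp add: Isig_rep)
 finally have "sc (- hx j i 1) * x Neg i 1 \<approx> comm (h j 1) (e Neg ?i)" by (rule eqU_sym)
 also note 1
 also have "sc (cc ?i) * (?K Pos A1 - ?K Neg A2)
  \<approx> sc (cc ?i) * (?K Pos A1 - 0)"
  using A2 by (intro eqU_left eqU_diff eqU_refl) (simp add: eqU_0 Ipos_def J_left)
 finally show "sc (- hx j i 1) * x Neg i 1 \<approx> sc (cc ?i) * (?K Pos (cf.R (- 1) ?i (h1 j)))"
  by (simp add: A1_def)
qed

lemma \<omega>_M: "\<omega> ^ M = 1"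
 using Complex.DeMoivre[of "2 * pi / of_nat M" M] M_pos by (simp add: \<omega>_def)

text \<open>At a fixed node this constant contains the sum of all M-th roots of unity and is zero,
  hence the restriction to moved nodes. Usually only t = M contributes. If the orbit contains an
  edge, a second term appears, and the numerator is (s^2 + 1) (s^6 - 1) / s^4.\<close>

lemma hx_diag: assumes i: "i \<in> nodes X" and nf: "\<sigma> i ~= i" shows "hx i i 1 ~= 0"
proof -
 let ?f = "%t. qnum (d i) (of_int (1 * cartan X i ((\<sigma> ^^ t) i)) / d i) * \<omega> powi (1 * int t)"
 have oM: "\<omega> powi int M = 1" and MM: "(\<sigma> ^^ M) i = i"
  using order(1) by (auto simp: \<omega>_M)
 have sn: "s powi n ~= s powi m" if "n ~= m" for n m using that by (simp add: cf.s_powi_cancel)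
 consider (a) "csum i i = 2" | (b) "csum i i = 1" using csum_diag_cases[OF i] nf by auto
 thus ?thesis
 proof cases
  case a
  hence d1: "d i = 1" by (simp add: d_def)
  have z: "cartan X i ((\<sigma> ^^ t) i) = 0" if "t \<in> {1..M}" "t ~= M" for t
  proof (cases "M = 2")
   case True
   hence "t = 1" using that by auto
   thus ?thesis using csum_diag(2)[OF i nf True] a by simp
  next
   case False
   hence "M = 3" using M by auto
   thus ?thesis using csum_diag(4)[OF i nf, of t] that by auto
  qed
  have "(\<Sum>t=1..M. ?f t)
    = (\<Sum>t=1..M. if t = M then qnum 1 2 else 0)"
  proof (rule sum.cong)
   fix t assume t: "t \<in> {1..M}"
   show "?f t = (if t = M then qnum 1 2 else 0)"
   proof (cases "t = M")
    case True
    have "cartan X i ((\<sigma> ^^ M) i) = 2" unfolding MM by (simp add: cartan_def)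
    thus ?thesis using True oM by (simp add: d1 del: power_int_of_nat)
   next
    case False
    thus ?thesis using z[OF t False] by (simp add: d1 qnum_def qp_def)
   qed
  qed simp
  also have "... = qnum 1 2" using M_pos by (simp add: sum.delta)
  also have "... ~= 0" using sn[of 4 "- 4"] sn[of 2 "- 2"] by (simp add: qnum_def qp_def)
  finally show ?thesis by (simp add: hx_def)
 next
  case b
  have M2: "M = 2"
  proof (rule ccontr)
   assume "M ~= 2"
   hence "M = 3" using M by auto
   thus False using csum_diag(3)[OF i nf] b by simp
  qed
  have c1: "cartan X i (\<sigma> i) = - 1" using csum_diag(2)[OF i nf M2] b by simp
  have dh: "d i = 1 / 2" using b by (simp add: d_def)
  have "2 * pi / of_nat M = pi" using M2 by simp
  hence oo: "\<omega> = - 1" by (simp only: \<omega>_def cis_pi)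
  have S12: "{1..M} = {1, 2}" using M2 by auto
  have s2: "(\<sigma> ^^ 2) i = i" using MM M2 by simp
  have "(\<Sum>t\<in>{1..M}. ?f t)
    = qnum (1 / 2) 4 - qnum (1 / 2) (- 2)"
  proof -
   have "cartan X i i = 2" by (simp add: cartan_def)
   thus ?thesis unfolding S12 using c1 s2 by (simp add: dh oo power_int_def del: funpow.simps) simp
  qed
  also have "... = (s powi 4 - s powi (- 4) + s powi 2 - s powi (- 2)) / (s powi 1 - s powi (- 1))"
  proof -
   have "\<lfloor>- 1 :: rat\<rfloor> = - 1" by (simp add: floor_eq_iff)
   thus ?thesis by (simp add: qnum_def qp_def diff_divide_distrib add_divide_distrib)
  qed
  also have "... ~= 0"
  proof -
   have "s powi 4 - s powi (- 4) + s powi 2 - s powi (- 2) = (s ^ 2 + 1) * (s ^ 6 - 1) / s ^ 4"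
    using cf.s_nz by (simp add: power_int_def divide_simps) algebra
   moreover have "s ^ 2 + 1 ~= 0"
   proof
    assume "s ^ 2 + 1 = 0"
    moreover have "s ^ 4 - 1 = (s ^ 2 + 1) * (s ^ 2 - 1)" by algebra
    ultimately have "s ^ 4 = 1" by simp
    thus False using s_gen[of 4] by simp
   qed
   moreover have "s ^ 6 - 1 ~= 0" using s_gen[of 6] by simp
   ultimately show ?thesis using sn[of 1 "- 1"] cf.s_nz by simp
  qed
  finally show ?thesis by (simp add: hx_def)
 qed
qed

lemma kap_diag: assumes i: "i \<in> nodes X" and nf: "\<sigma> i ~= i" shows "kap i i l ~= 0"
proof -
 have oM: "\<omega> powi (int M * l) = 1"
 proof -
  have "\<omega> powi int M = 1" by (simp add: \<omega>_M)
  thus ?thesis by (metis power_int_mult power_int_1_left)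
 qed
 have "(\<Sum>t=1..M. if (\<sigma> ^^ t) i = i then \<omega> powi (int t * l) else 0) = (\<Sum>t=1..M. if t = M then 1 else 0)"
 proof (rule sum.cong)
  fix t assume "t \<in> {1..M}"
  thus "(if (\<sigma> ^^ t) i = i then \<omega> powi (int t * l) else 0) = (if t = M then 1 else 0)"
   using pow_neq[OF nf, of t] oM order(1) by auto
 qed simp
 also have "... = 1" using M_pos by (simp add: sum.delta)
 finally show ?thesis using qp_diff_nz[OF i] nf by (simp add: kap_def dorder_def)
qed

text \<open>If it vanished, then so would in turn \<open>h i 1\<close>, the generators e_i of both
  signs, k_i minus its inverse, and finally 1.\<close>

lemma x_Neg_1_nz: assumes i: "i \<in> Isig" and nf: "\<sigma> i ~= i" shows "x Neg i 1 \<notin> J"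
proof
 assume h0: "x Neg i 1 \<in> J"
 have iI: "Nd i \<in> Ihat" and iN: "i \<in> nodes X" using i by (simp_all add: Isig_rep)
 have "comm (x Pos i 0) (x Neg i 1) \<in> J" unfolding comm_def by (intro J_diff J_left J_right h0)
 hence "sc (kap i i 1) * phi h Pos i 1 \<in> J" using eqU_J[OF x_x_1[OF i]] by simp
 hence "phi h Pos i 1 \<in> J" using J_cancel_sc kap_diag[OF iN nf] by blast
 hence "k Pos (Nd i) * h i 1 \<in> J"
  using J_cancel_sc qp_diff_nz[OF iN] i by (simp add: phi_1[OF iN] kI_def Isig_rep)
 hence hJ: "h i 1 \<in> J" by (rule k_cancel(2)[OF iI])
 have eJ: "e p (Nd i) \<in> J" for p
 proof -
  have "comm (h i 1) (x p i (- 1)) \<in> J" unfolding comm_def by (intro J_diff J_left J_right hJ)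
  hence "sc (of_int (sg p) * hx i i 1) * x p i 0 \<in> J" using eqU_J[OF h_x[OF iN iN, of 1 p "- 1"]] by simp
  moreover have "sg p ~= 0" by (cases p) auto
  ultimately have "x p i 0 \<in> J" using J_cancel_sc hx_diag[OF iN nf] by (metis mult_eq_0_iff of_int_eq_0_iff)
  thus ?thesis using eqU_J[OF x_0[OF i]] by blast
 qed
 have "sc (cc (Nd i)) * (k Pos (Nd i) - k Neg (Nd i)) \<in> J"
 proof -
  have "e Pos (Nd i) * e Neg (Nd i) - e Neg (Nd i) * e Pos (Nd i) \<in> J" by (intro J_diff J_left eJ)
  moreover have "e Pos (Nd i) * e Neg (Nd i) - e Neg (Nd i) * e Pos (Nd i)
   \<approx> e Neg (Nd i) * e Pos (Nd i) + sc (cc (Nd i)) * (k Pos (Nd i) - k Neg (Nd i)) - e Neg (Nd i) * e Pos (Nd i)"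
   by (intro eqU_diff e_f iI eqU_refl)
  ultimately show ?thesis using eqU_J by simp
 qed
 hence "k Pos (Nd i) * 1 - k Neg (Nd i) * 1 \<in> J" using J_cancel_sc cc_nz[OF iI] by simp
 hence "1 \<in> J" by (rule k_parts_in_J(1)[OF iI, rotated 4]) (auto intro: subalgebra_1 eig_1)
 thus False using nontrivial by simp
qed

text \<open>Nonnegative modes of both signs of \<open>x\<close>. The Borel subalgebra turns out to
  be contained in it (\<open>SB_Dplus\<close>), for which only the affine generator is in
  doubt.\<close>

definition Dplus :: "ualg set" where
 "Dplus = generated ({x p i r | p i r. i \<in> Isig \<and> r \<ge> 0} \<union> {h i r | i r. i \<in> Isig \<and> r > 0} \<union> {k p (Nd i) | p i. i \<in> Isig})"

lemma generated_add: "a \<in> generated S ==> b \<in> generated S ==> a + b \<in> generated S"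
 unfolding generated_def using eqU_add subalgebra.add by blast
lemma generated_mult: "a \<in> generated S ==> b \<in> generated S ==> a * b \<in> generated S"
 unfolding generated_def using eqU_mult subalgebra.mult by blast
lemma generated_sc: "a \<in> generated S ==> sc c * a \<in> generated S"
 unfolding generated_def using eqU_left subalgebra_sc by blast
lemma generated_minus: "a \<in> generated S ==> - a \<in> generated S"
 using generated_sc[of a S "- 1"] by (simp add: sc_minus)
lemma generated_diff: "a \<in> generated S ==> b \<in> generated S ==> a - b \<in> generated S"
 using generated_add[OF _ generated_minus, of a S b] by simp
lemma generated_gen: "a \<in> S ==> a \<in> generated S"
 unfolding generated_def using eqU_refl subalgebra.gen by blast
lemma generated_eqU: "a \<in> generated S ==> b \<approx> a ==> b \<in> generated S"
 unfolding generated_def using eqU_trans by blast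

lemma Dplus_k: "i \<in> Isig ==> k p (Nd i) \<in> Dplus" and Dplus_x: "i \<in> Isig ==> r \<ge> 0 ==> x p i r \<in> Dplus"
 unfolding Dplus_def by (rule generated_gen, blast)+

lemma Dplus_mult: "a \<in> Dplus ==> b \<in> Dplus ==> a * b \<in> Dplus"
 and Dplus_sc: "a \<in> Dplus ==> sc c * a \<in> Dplus"
 and Dplus_diff: "a \<in> Dplus ==> b \<in> Dplus ==> a - b \<in> Dplus"
 and Dplus_eqU: "a \<in> Dplus ==> b \<approx> a ==> b \<in> Dplus"
 unfolding Dplus_def by (rule generated_mult generated_sc generated_diff generated_eqU; assumption)+

lemma Dplus_e: "i \<in> Isig ==> e p (Nd i) \<in> Dplus"
 using Dplus_eqU[OF Dplus_x[of i 0 p] eqU_sym[OF x_0]] by simp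

lemma Dplus_cancel: assumes "sc c * (k p (Nd i) * a) \<in> Dplus" "c ~= 0" "i \<in> Isig" shows "a \<in> Dplus"
proof (rule Dplus_eqU)
 show "sc (1 / c) * (k (opp p) (Nd i) * (sc c * (k p (Nd i) * a))) \<in> Dplus"
  by (rule Dplus_sc[OF Dplus_mult[OF Dplus_k[OF assms(3)] assms(1)]])
 have "sc (1 / c) * (k (opp p) (Nd i) * (sc c * (k p (Nd i) * a))) = k (opp p) (Nd i) * (k p (Nd i) * a)"
  using assms(2) by (simp add: sc_left_commute[of "k (opp p) (Nd i)"] sc_sc_mult)
 also have "... \<approx> a"
  using k_inv_left[of "Nd i" "opp p" a] assms(3) by (cases p) simp_all
 finally show "a \<approx> sc (1 / c) * (k (opp p) (Nd i) * (sc c * (k p (Nd i) * a)))" by (rule eqU_sym)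
qed

text \<open>Commutators with finite negative generators strip letters off \<open>y\<close> without
  leaving \<open>Dplus\<close>. If no letter can be stripped and \<open>y\<close> is not a multiple
  of \<open>gen Eps\<close>, all derivatives vanish. Then no weight of \<open>y\<close> is positive;
  the labels combine the weights to zero, so all of them are zero, and the content would be the null
  root, which is excluded.\<close>

lemma lower_to_e_Eps:
 "content T y ==> set_mset T \<subseteq> Ihat ==> count T Eps = 1 ==> T ~= labm ==> T \<subseteq># labm ==> y \<notin> Ipos ==>
  (!!i. i \<in> Isig ==> cf.R 1 (Nd i) y \<in> Ipos) ==> emb Pos y \<in> Dplus ==> e Pos Eps \<in> Dplus"
proof (induction "size T" arbitrary: T y rule: less_induct)
 case less
 note y = less.prems(1) and TI = less.prems(2) and yR = less.prems(7)
 show ?case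
 proof (cases "\<exists>i\<in>Isig. cf.R (- 1) (Nd i) y \<notin> Ipos")
  case True
  then obtain i where i: "i \<in> Isig" "cf.R (- 1) (Nd i) y \<notin> Ipos" by blast
  have iI: "Nd i \<in> Ihat" using i by simp
  let ?f = "e Neg (Nd i)" and ?y = "emb Pos y" and ?R = "%t. emb Pos (cf.R t (Nd i) y)" and ?k = "%p. k p (Nd i)"
  have iT: "Nd i \<in># T"
  proof (rule ccontr)
   assume "Nd i \<notin># T"
   thus False using R_content_0[OF y] i(2) ci.N_0 by simp
  qed
  show ?thesis
  proof (rule less.hyps)
   show "size (T - {#Nd i#}) < size T" using iT by (simp add: size_Diff1_less)
   show "content (T - {#Nd i#}) (cf.R (- 1) (Nd i) y)" by (rule cf.content_R[OF y])
   show "set_mset (T - {#Nd i#}) \<subseteq> Ihat" using TI by (auto dest: in_diffD)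
   show "count (T - {#Nd i#}) Eps = 1" using less.prems(3) by simp
   show sub: "T - {#Nd i#} \<subseteq># labm" using less.prems(5) by (meson diff_subset_eq_self subset_mset.order_trans)
   show "T - {#Nd i#} ~= labm"
    using iT less.prems(5) by (metis mset_subset_size size_Diff1_less leD size_mset_mono)
   show "cf.R (- 1) (Nd i) y \<notin> Ipos" by (rule i)
   show "cf.R 1 (Nd j) (cf.R (- 1) (Nd i) y) \<in> Ipos" if "j \<in> Isig" for j
    using R_swap_Ipos[of 1 "Nd i" "Nd j" y] iI that yR[OF that] by simp
   \<comment> \<open>The derivative for t = 1 vanishes, so the commutator is a single Cartan element
     times the other derivative, which can therefore be extracted inside
     \<open>Dplus\<close>.\<close>
   have "?y * ?f - ?f * ?y
    \<approx> (?f * ?y + sc (cc (Nd i)) * (?k Pos * ?R (- 1) - ?k Neg * ?R 1))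
     - ?f * ?y" by (intro eqU_diff emb_f iI eqU_refl)
   also have "... = sc (cc (Nd i)) * (?k Pos * ?R (- 1) - ?k Neg * ?R 1)" by simp
   also have "... \<approx> sc (cc (Nd i)) * (?k Pos * ?R (- 1) - 0)"
    using yR[OF i(1)] by (intro eqU_left eqU_diff eqU_refl) (simp add: eqU_0 Ipos_def J_left)
   finally have "sc (cc (Nd i)) * (?k Pos * ?R (- 1)) \<approx> ?y * ?f - ?f * ?y"
    using eqU_sym by simp
   moreover have "?y * ?f - ?f * ?y \<in> Dplus"
    by (intro Dplus_diff Dplus_mult less.prems(8) Dplus_e i(1))
   ultimately have "sc (cc (Nd i)) * (?k Pos * ?R (- 1)) \<in> Dplus"
    by (rule Dplus_eqU[rotated])
   thus "?R (- 1) \<in> Dplus" using Dplus_cancel cc_nz[OF iI] i(1) by blast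
  qed
 next
  case False
  hence yR': "cf.R t (Nd i) y \<in> Ipos" if "i \<in> Isig" "t = 1 \<or> t = - 1" for i t using that yR by blast
  define N where "N = T - {#Eps#}"
  have T: "T = add_mset Eps N" unfolding N_def using less.prems(3) by (metis insert_DiffM count_greater_zero_iff zero_less_one)
  show ?thesis
  proof (cases "N = {#}")
   case True
   then obtain c where c: "y = sc c * gen Eps" using content_single_gen[OF y[unfolded T True]] by blast
   hence "c ~= 0" using less.prems(6) ci.N_0 by (auto simp: sc_0)
   hence "e Pos Eps = sc (1 / c) * emb Pos y" by (simp add: c emb_sc emb_gen sc_sc_mult)
   thus ?thesis using less.prems(8) by (simp add: Dplus_sc)
  next
   case False
   have NI: "set_mset N \<subseteq> Nd ` Isig"
   proof
    fix l assume l: "l \<in># N"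
    have "count N Eps = 0" using less.prems(3) T by simp
    hence "l ~= Eps" using l by (metis count_eq_zero_iff)
    thus "l \<in> Nd ` Isig" using l TI T by (auto simp: Ihat_def)
   qed
   \<comment> \<open>The derivative at \<epsilon> has its content in the finite nodes, where one
     family of derivations detects zero; swapping requires the family with the opposite
     twist.\<close>
   have RE: "cf.R t Eps y \<in> Ipos" if t: "t = 1 \<or> t = - 1" for t
   proof (rule finite_part_in_Ipos[where t = "- t" and T = N])
    show "content N (cf.R t Eps y)" unfolding N_def by (rule cf.content_R[OF y])
    show "cf.R (- t) (Nd i) (cf.R t Eps y) \<in> Ipos" if "i \<in> Isig" for i
     using R_swap_Ipos[of "- t" Eps "Nd i" y] t yR'[OF that, of "- t"] that by auto
   qed (use NI False t in auto)
   define wt where "wt i = (\<Sum>l\<in>#T. Bh i l)" for i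
   have "y \<in> Ipos" if "i \<in> Ihat" "wt i > 0" for i
   proof (rule ci.positive_weight_in_ideal[OF that(1) cf.content_hom[OF y]])
    show "0 < (\<Sum>l\<in>#T. Bh i l)" using that(2) by (simp add: wt_def)
    show "cf.R (- 1) i y \<in> Ipos" "cf.R 1 i y \<in> Ipos" using that(1) RE yR' by (auto elim: Ihat_cases)
   qed
   hence neg: "wt i \<le> 0" if "i \<in> Ihat" for i using that less.prems(6) by force
   have "(\<Sum>i\<in>Ihat. int (label i) * wt i) = 0"
   proof -
    have "(\<Sum>i\<in>Ihat. int (label i) * wt i) = (\<Sum>l\<in>#T. \<Sum>i\<in>Ihat. int (label i) * Bh i l)"
     unfolding wt_def by (induction T) (simp_all add: distrib_left sum.distrib)
    also have "... = (\<Sum>l\<in>#T. 0)"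
     using TI label_null by (intro arg_cong[where f = sum_mset] image_mset_cong) auto
    finally show ?thesis by simp
   qed
   moreover have "int (label i) * wt i \<le> 0" if "i \<in> Ihat" for i using neg[OF that] by (simp add: mult_nonneg_nonpos)
   ultimately have lw: "int (label i) * wt i = 0" if "i \<in> Ihat" for i
    using that finite_Ihat sum_nonneg_eq_0_iff[of Ihat "%i. - (int (label i) * wt i)"] by (simp add: sum_negf)
   have "wt i = 0" if "i \<in> Ihat" for i using lw[OF that] label_props(2)[OF that] by simp
   hence "T = labm" using TI less.prems(3) by (intro content_eq_labm) (auto simp: wt_def)
   thus ?thesis using less.prems(4) by blast
  qed
 qed
qed

text \<open>The descent starts from \<open>x Neg j 1\<close> for a node \<open>j\<close> moved by
  \<sigma>, where neither this element nor the constant \<open>hx j j 1\<close> vanishes. By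
  \<open>R_h1\<close> it is, up to a scalar, k_j times a positive element whose content is the null
  root minus one letter.\<close>

lemma e_Eps_Dplus: "e Pos Eps \<in> Dplus"
proof -
 obtain j' where j': "j' \<in> nodes X" "\<sigma> j' ~= j'" using not_id by blast
 define j where "j = rep j'"
 have j: "j \<in> Isig" "\<sigma> j ~= j"
 proof -
  show "j \<in> Isig" using j' by (simp add: j_def Isig_def)
  show "\<sigma> j ~= j"
  proof
   assume f: "\<sigma> j = j"
   have "j' \<in> orbit j" using rep_rep[of j'] rep_eq_iff[of j j'] by (simp add: j_def)
   hence "j' = j" using orbit_fixed[OF f] by simp
   thus False using f j' by simp
  qed
 qed
 have jI: "Nd j \<in> Ihat" and jN: "j \<in> nodes X" using j by (simp_all add: Isig_rep)
 define y where "y = cf.R (- 1) (Nd j) (h1 j)"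
 have x1: "sc (- hx j j 1) * x Neg j 1 \<approx> sc (cc (Nd j)) * (k Pos (Nd j) * emb Pos y)"
  unfolding y_def by (rule R_h1(2)[OF j(1) j(1)])
 have jl: "Nd j \<in># labm" using label_props(2)[OF jI] jI by (simp add: count_labm flip: count_greater_zero_iff)
 show ?thesis
 proof (rule lower_to_e_Eps)
  show "content (labm - {#Nd j#}) y" unfolding y_def by (rule cf.content_R[OF h1(1)[OF j(1)]])
  show "set_mset (labm - {#Nd j#}) \<subseteq> Ihat" using labm_Ihat by (auto dest: in_diffD)
  show "count (labm - {#Nd j#}) Eps = 1" by (simp add: count_labm label_props(1))
  show "labm - {#Nd j#} ~= labm" using jl by (metis size_Diff1_less less_irrefl)
  show "y \<notin> Ipos"
  proof
   assume "y \<in> Ipos"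
   hence "sc (- hx j j 1) * x Neg j 1 \<in> J" using eqU_J[OF x1] by (simp add: Ipos_def J_left)
   thus False using J_cancel_sc hx_diag[OF jN j(2)] x_Neg_1_nz[OF j] by (metis neg_0_equal_iff_equal)
  qed
  show "cf.R 1 (Nd i) y \<in> Ipos" if "i \<in> Isig" for i
   unfolding y_def using R_swap_Ipos[of 1 "Nd j" "Nd i" "h1 j"] jI that R_h1(1)[OF j(1) that] by simp
  have "sc (- hx j j 1) * x Neg j 1 \<in> Dplus"
   using Dplus_x[OF j(1), of 1 Neg] by (intro Dplus_sc) simp
  hence "sc (cc (Nd j)) * (k Pos (Nd j) * emb Pos y) \<in> Dplus"
   using Dplus_eqU eqU_sym[OF x1] by blast
  thus "emb Pos y \<in> Dplus" using Dplus_cancel cc_nz[OF jI] j(1) by blast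
 qed auto
qed

end

section \<open>Linear recurrences modulo a subspace\<close>

locale quotient_space = vector_space scale for scale :: "complex => 'm => 'm::ab_group_add" +
 fixes N :: "'m set"
 assumes sub_N: "subspace N"
begin

lemma N_0: "0 \<in> N" and N_add: "a \<in> N ==> b \<in> N ==> a + b \<in> N" and N_scale: "a \<in> N ==> scale c a \<in> N"
 and N_diff: "a \<in> N ==> b \<in> N ==> a - b \<in> N" and N_minus: "a \<in> N ==> - a \<in> N"
 using sub_N by (auto intro: subspace_0 subspace_add subspace_scale subspace_diff subspace_neg)
lemma N_sum: "(!!i. i \<in> F ==> f i \<in> N) ==> sum f F \<in> N" using sub_N by (rule subspace_sum)
lemma N_cong: "a - b \<in> N ==> a \<in> N \<longleftrightarrow> b \<in> N" using N_add[of "a - b" b] N_diff[of a "a - b"] by auto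

text \<open>The operator S - z, with S the shift of sequences.\<close>

definition step :: "complex => (nat => 'm) => nat => 'm" where
 "step z f l = f (Suc l) - scale z (f l)"

definition steps :: "complex list => (nat => 'm) => nat => 'm" where
 "steps zs f = foldr step zs f"

text \<open>A complex recurrence polynomial splits, so it is given by the list of its roots;
  repeated roots are allowed, and roots 0 discard initial terms. The operators commute, hence
  annihilators of several sequences can be concatenated.\<close>

definition kills :: "complex list => (nat => 'm) => bool" where
 "kills zs f \<longleftrightarrow> (\<forall>l. steps zs f l \<in> N)"

definition torsion :: "(nat => 'm) => bool" where "torsion f \<longleftrightarrow> (\<exists>zs. kills zs f)"

lemma steps_simps [simp]: "steps [] f = f" "steps (z # zs) f = step z (steps zs f)"
 by (simp_all add: steps_def)
lemma steps_append: "steps (as @ bs) f = steps as (steps bs f)" by (simp add: steps_def)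

lemma step_commute: "step a (step b f) = step b (step a f)"
 by (rule ext) (simp add: step_def scale_right_diff_distrib algebra_simps)
lemma steps_step: "steps zs (step a f) = step a (steps zs f)"
 by (induction zs) (simp_all add: step_commute)
lemma steps_commute: "steps as (steps bs f) = steps bs (steps as f)"
 by (induction as) (simp_all add: steps_step)

lemma step_N: "(!!l. f l \<in> N) ==> step z f l \<in> N" by (simp add: step_def N_diff N_scale)
lemma steps_N: "(!!l. f l \<in> N) ==> steps zs f l \<in> N"
 by (induction zs arbitrary: l) (simp_all add: step_N)

lemma kills_append1: "kills bs f ==> kills (as @ bs) f"
 unfolding kills_def steps_append by (blast intro: steps_N)
lemma kills_append2: "kills as f ==> kills (as @ bs) f"
 unfolding kills_def steps_append steps_commute[of as] by (blast intro: steps_N)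

lemma steps_add: "steps zs (%l. f l + g l) = (%l. steps zs f l + steps zs g l)"
 by (induction zs) (auto simp: step_def fun_eq_iff scale_right_distrib)
lemma steps_scale: "steps zs (%l. scale c (f l)) = (%l. scale c (steps zs f l))"
 by (induction zs) (auto simp: step_def fun_eq_iff scale_right_diff_distrib mult.commute)
lemma steps_diff: "steps zs (%l. f l - g l) = (%l. steps zs f l - steps zs g l)"
 by (induction zs) (auto simp: step_def fun_eq_iff scale_right_diff_distrib)
lemma steps_shift: "steps zs (%l. f (r + l)) = (%l. steps zs f (r + l))"
 by (induction zs) (auto simp: step_def fun_eq_iff)
lemma steps_geometric:
 "steps (map ((*) c) zs) (%l. scale (c ^ l) (f l)) = (%l. scale (c ^ (l + length zs)) (steps zs f l))"
 by (induction zs) (auto simp: step_def fun_eq_iff scale_right_diff_distrib mult_ac)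
lemma steps_linear:
 assumes "!!a b. G (a - b) = G a - G b" "!!c a. G (scale c a) = scale c (G a)"
 shows "steps zs (%l. G (f l)) = (%l. G (steps zs f l))"
 by (induction zs) (auto simp: step_def fun_eq_iff assms)

lemma kills_add: "kills zs f ==> kills zs g ==> kills zs (%l. f l + g l)"
 by (simp add: kills_def steps_add N_add)
lemma kills_scale: "kills zs f ==> kills zs (%l. scale c (f l))"
 by (simp add: kills_def steps_scale N_scale)
lemma kills_shift: "kills zs f ==> kills zs (%l. f (r + l))"
 by (simp add: kills_def steps_shift)
lemma kills_geometric: "kills zs f ==> kills (map ((*) c) zs) (%l. scale (c ^ l) (f l))"
 by (simp add: kills_def steps_geometric N_scale)
lemma kills_cong: assumes "!!l. f l - g l \<in> N" "kills zs g" shows "kills zs f"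
proof -
 have "steps zs f l - steps zs g l \<in> N" for l
  using steps_N[of "%l. f l - g l" zs l] assms(1) by (simp add: steps_diff)
 thus ?thesis using assms(2) N_cong unfolding kills_def by blast
qed
lemma kills_N: "(!!l. f l \<in> N) ==> kills zs f" by (simp add: kills_def steps_N)

lemma kills_finite:
 assumes "finite F" "!!i. i \<in> F ==> torsion (f i)" shows "\<exists>zs. \<forall>i\<in>F. kills zs (f i)"
 using assms
proof (induction F rule: finite_induct)
 case (insert i F)
 then obtain as bs where "\<forall>i\<in>F. kills as (f i)" "kills bs (f i)" unfolding torsion_def by blast
 hence "\<forall>j\<in>insert i F. kills (as @ bs) (f j)" using kills_append1 kills_append2 by blast
 thus ?case by blast
qed simp

lemma torsion_add: "torsion f ==> torsion g ==> torsion (%l. f l + g l)"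
 unfolding torsion_def using kills_add kills_append1 kills_append2 by blast
lemma torsion_scale: "torsion f ==> torsion (%l. scale c (f l))" unfolding torsion_def using kills_scale by blast
lemma torsion_cong: "(!!l. f l - g l \<in> N) ==> torsion g ==> torsion f" unfolding torsion_def using kills_cong by blast
lemma torsion_N: "(!!l. f l \<in> N) ==> torsion f" unfolding torsion_def using kills_N by blast
lemma torsion_step: "torsion (step z f) ==> torsion f"
 unfolding torsion_def kills_def steps_step by (metis steps_simps(2))
lemma torsion_shift: "torsion f ==> torsion (%l. f (r + l))" unfolding torsion_def using kills_shift by blast

definition nspan :: "'m set => 'm set" where "nspan B = {u. \<exists>b\<in>span B. u - b \<in> N}"

lemma nspan_mono: "B \<subseteq> B' ==> nspan B \<subseteq> nspan B'" unfolding nspan_def using span_mono by blast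
lemma span_nspan: "b \<in> span B ==> b \<in> nspan B" by (auto simp: nspan_def N_0 intro!: bexI[of _ b])
lemma N_nspan: "u \<in> N ==> u \<in> nspan B" using span_zero by (auto simp: nspan_def intro!: bexI[of _ 0])
lemma subspace_nspan: "subspace (nspan B)"
proof (rule subspaceI)
 show "0 \<in> nspan B" by (rule N_nspan[OF N_0])
 show "u + u' \<in> nspan B" if uu: "u \<in> nspan B" "u' \<in> nspan B" for u u'
 proof -
  obtain b b' where "b \<in> span B" "u - b \<in> N" "b' \<in> span B" "u' - b' \<in> N" using uu by (auto simp: nspan_def)
  hence "b + b' \<in> span B" "(u + u') - (b + b') \<in> N" using N_add[of "u - b" "u' - b'"] by (auto simp: span_add algebra_simps)
  thus ?thesis unfolding nspan_def by blast
 qed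
 show "scale c u \<in> nspan B" if uu: "u \<in> nspan B" for c u
 proof -
  obtain b where "b \<in> span B" "u - b \<in> N" using uu by (auto simp: nspan_def)
  hence "scale c b \<in> span B" "scale c u - scale c b \<in> N"
   using N_scale[of "u - b" c] by (auto simp: span_scale scale_right_diff_distrib)
  thus ?thesis unfolding nspan_def by blast
 qed
qed
lemma nspan_minimal: assumes "B \<subseteq> W" "N \<subseteq> W" "subspace W" shows "nspan B \<subseteq> W"
proof
 fix u assume "u \<in> nspan B"
 then obtain b where "b \<in> span B" "u - b \<in> N" by (auto simp: nspan_def)
 thus "u \<in> W" using span_minimal[OF assms(1,3)] subspace_add[OF assms(3), of "u - b" b] assms(2) by auto
qed

text \<open>A recurrence of order n expresses every term through the first n.\<close>

lemma torsion_spanned: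
 assumes "kills zs f" shows "f l \<in> nspan (f ` {..<length zs})"
 using assms
proof (induction zs arbitrary: f l)
 case Nil
 thus ?case by (auto simp: kills_def intro: N_nspan)
next
 case (Cons z zs)
 let ?B = "f ` {..<length (z # zs)}"
 note sub = subspace_nspan[of ?B]
 have "step z f ` {..<length zs} \<subseteq> nspan ?B"
 proof (rule image_subsetI)
  fix l assume "l \<in> {..<length zs}"
  hence "f l \<in> span ?B" "f (Suc l) \<in> span ?B" by (auto intro: span_base)
  thus "step z f l \<in> nspan ?B" unfolding step_def by (intro span_nspan span_diff span_scale)
 qed
 hence "nspan (step z f ` {..<length zs}) \<subseteq> nspan ?B" using N_nspan by (intro nspan_minimal sub) auto
 moreover have "kills zs (step z f)" using Cons.prems by (simp add: kills_def steps_step)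
 ultimately have st: "step z f l \<in> nspan ?B" for l using Cons.IH by blast
 show ?case
 proof (induction l)
  case 0
  show ?case by (intro span_nspan span_base) auto
 next
  case (Suc l)
  have "f (Suc l) = step z f l + scale z (f l)" by (simp add: step_def)
  thus ?case using st Suc subspace_add[OF sub] subspace_scale[OF sub] by metis
 qed
qed

text \<open>A common annihilator for a finite spanning set serves the whole space by linearity. This
  uniformity is what finite dimension is used for in \<open>Xm_torsion\<close>.\<close>

lemma kills_nspan:
 assumes B: "finite B" and tor: "!!b. b \<in> B ==> torsion (%l. G l b)"
  and G: "!!l a b. G l (a + b) = G l a + G l b" "!!l c a. G l (scale c a) = scale c (G l a)"
   "!!l a. a \<in> N ==> G l a \<in> N"
 shows "\<exists>zs. \<forall>u\<in>nspan B. kills zs (%l. G l u)"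
proof -
 obtain zs where zs: "\<forall>b\<in>B. kills zs (%l. G l b)" using kills_finite[OF B, of "%b l. G l b"] tor by blast
 have "subspace {u. kills zs (%l. G l u)}"
 proof (rule subspaceI)
  have "G l 0 = 0" for l using G(2)[of l 0 0] by simp
  thus "0 \<in> {u. kills zs (%l. G l u)}" by (simp add: kills_N N_0)
 qed (auto simp: G intro: kills_add kills_scale)
 hence "nspan B \<subseteq> {u. kills zs (%l. G l u)}"
  using zs G(3) by (intro nspan_minimal) (auto intro: kills_N)
 thus ?thesis by blast
qed

lemma nspan_image:
 assumes G: "!!a b. G (a + b) = G a + G b" "!!c a. G (scale c a) = scale c (G a)" "!!a. a \<in> N ==> G a \<in> N"
  and B: "!!b. b \<in> B ==> G b \<in> nspan C" and u: "u \<in> nspan B"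
 shows "G u \<in> nspan C"
proof -
 have "G 0 = 0" using G(2)[of 0 0] by simp
 hence "subspace {u. G u \<in> nspan C}"
  using subspace_nspan[of C] by (intro subspaceI) (auto simp: G subspace_add subspace_scale subspace_0)
 hence "nspan B \<subseteq> {u. G u \<in> nspan C}" using B G(3) N_nspan by (intro nspan_minimal) auto
 thus ?thesis using u by blast
qed

section \<open>Recurrences in two variables\<close>

text \<open>The operator a T + b S + c, where T and S shift the first and the second index.\<close>

definition opg :: "complex => complex => complex => (nat => nat => 'm) => nat => nat => 'm" where
 "opg a b c C m l = scale a (C (Suc m) l) + scale b (C m (Suc l)) + scale c (C m l)"

lemma opg_commute: "opg a b c (opg a' b' c' C) = opg a' b' c' (opg a b c C)"
 by (intro ext) (simp add: opg_def scale_right_distrib mult.commute add_ac)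

definition opgs :: "(complex \<times> complex \<times> complex) list => (nat => nat => 'm) => nat => nat => 'm" where
 "opgs ps C = foldr (%(a, b, c). opg a b c) ps C"

lemma opgs_simps [simp]: "opgs [] C = C" "opgs ((a, b, c) # ps) C = opg a b c (opgs ps C)"
 by (simp_all add: opgs_def)
lemma opgs_append: "opgs (ps @ ps') C = opgs ps (opgs ps' C)" by (simp add: opgs_def)
lemma opgs_opg: "opgs ps (opg a b c C) = opg a b c (opgs ps C)"
 by (induction ps) (auto simp: opg_commute)
lemma opgs_commute: "opgs ps (opgs ps' C) = opgs ps' (opgs ps C)"
 by (induction ps) (auto simp: opgs_opg)

definition null :: "(nat => nat => 'm) => bool" where "null C \<longleftrightarrow> (\<forall>m l. C m l \<in> N)"

lemma null_opg: "null C ==> null (opg a b c C)" by (simp add: null_def opg_def N_add N_scale)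
lemma null_opgs: "null C ==> null (opgs ps C)"
 by (induction ps) (auto intro: null_opg)
lemma null_lincomb: "null C ==> null C' ==> null (%m l. C m l + scale c (C' m l))"
 by (simp add: null_def N_add N_scale)

abbreviation sroots :: "complex list => (complex \<times> complex \<times> complex) list" where
 "sroots \<equiv> map (%z. (0, 1, - z))"
abbreviation troots :: "complex list => (complex \<times> complex \<times> complex) list" where
 "troots \<equiv> map (%z. (1, 0, - z))"

lemma opgs_add: "opgs ps (%m l. C m l + scale c (C' m l)) = (%m l. opgs ps C m l + scale c (opgs ps C' m l))"
proof (induction ps)
 case (Cons p ps)
 obtain a b c' where "p = (a, b, c')" by (cases p)
 thus ?case by (simp add: Cons opg_def scale_right_distrib mult.commute add_ac fun_eq_iff)
qed simp

text \<open>Modulo \<open>T - u S\<close> a polynomial in \<open>S\<close> becomes a polynomial in \<open>T\<close> with roots scaled by \<open>u\<close>.\<close>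

lemma eliminate_one:
 assumes "null (opgs (sroots zs) C)" "null (opg 1 (- u) 0 C)" shows "null (opgs (troots (map ((*) u) zs)) C)"
 using assms
proof (induction zs arbitrary: C)
 case (Cons z zs)
 define C' where "C' = opg 0 1 (- z) C"
 have e: "opg 1 0 (- (u * z)) C = (%m l. opg 1 (- u) 0 C m l + scale u (C' m l))"
  by (intro ext) (simp add: C'_def opg_def scale_right_distrib scale_right_diff_distrib)
 have "null (opgs (troots (map ((*) u) zs)) C')"
 proof (rule Cons.IH)
  show "null (opgs (sroots zs) C')" using Cons.prems(1) by (simp add: C'_def opgs_opg)
  show "null (opg 1 (- u) 0 C')" unfolding C'_def opg_commute[of 1] by (rule null_opg[OF Cons.prems(2)])
 qed
 hence "null (opgs (troots (map ((*) u) zs)) (opg 1 0 (- (u * z)) C))"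
  unfolding e opgs_add by (rule null_lincomb[OF null_opgs[OF Cons.prems(2)]])
 thus ?case by (simp add: opgs_opg)
qed simp

text \<open>A resultant in factored form: a polynomial in S and a product of factors T - u S both
  annihilate \<open>C\<close>. For each \<open>u\<close> the polynomial in S turns into one in T,
  and the factors are removed one after the other.\<close>

lemma eliminate:
 assumes "null (opgs (sroots zs) C)" "null (opgs (map (%u. (1, - u, 0)) us) C)"
 shows "\<exists>ts. null (opgs (troots ts) C)"
 using assms
proof (induction us arbitrary: C)
 case Nil
 thus ?case by (intro exI[of _ "[]"]) simp
next
 case (Cons u us)
 let ?X = "opgs (map (%u. (1, - u, 0)) us)" and ?T = "troots (map ((*) u) zs)"
 have "null (opgs ?T (?X C))"
 proof (rule eliminate_one)
  show "null (opgs (sroots zs) (?X C))" unfolding opgs_commute[of "sroots zs"] by (rule null_opgs[OF Cons.prems(1)])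
  show "null (opg 1 (- u) 0 (?X C))" using Cons.prems(2) by simp
 qed
 hence X: "null (?X (opgs ?T C))" unfolding opgs_commute[of ?T] .
 have "null (opgs (sroots zs) (opgs ?T C))" unfolding opgs_commute[of "sroots zs"] by (rule null_opgs[OF Cons.prems(1)])
 from Cons.IH[OF this X] obtain ts where "null (opgs (troots ts) (opgs ?T C))" by blast
 hence "null (opgs (troots (ts @ map ((*) u) zs)) C)" by (simp add: opgs_append)
 thus ?case by blast
qed

lemma opgs_sroots: "opgs (sroots zs) C m l = steps zs (C m) l"
 by (induction zs arbitrary: l) (simp_all add: opg_def step_def)
lemma opgs_troots: "opgs (troots zs) C m l = steps zs (%m. C m l) m"
 by (induction zs arbitrary: m) (simp_all add: opg_def step_def)

text \<open>\<open>F\<close> stands for \<phi>_m x_l v and \<open>B\<close> for x_l \<phi>_m v. The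
  exchange relation carries the recurrence of \<open>B\<close> in m over to a product of factors T -
  u S on \<open>F\<close>; with the recurrence of \<open>F\<close> in l, elimination gives one in
  m.\<close>

lemma torsion_exchange:
 assumes F: "!!m. kills zs (F m)" and B: "!!l. kills ts (%m. B m l)"
  and rel: "!!m l. opgs (map (%u. (1, - u, 0)) us) F m l
   - scale c (opgs (map (%H. (1, - H, 0)) Hs) B m l) \<in> N"
 shows "torsion (%m. F m l)"
proof -
 let ?X = "map (%u. (1, - u, 0)) us :: (complex \<times> complex \<times> complex) list"
  and ?E = "map (%H. (1, - H, 0)) Hs :: (complex \<times> complex \<times> complex) list"
 let ?T = "troots ts"
 have BN: "null (opgs ?T B)" using B by (simp add: null_def opgs_troots kills_def)
 have "null (opgs ?T (opgs ?X F))"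
 proof -
  define R where "R m l = opgs ?X F m l - scale c (opgs ?E B m l)" for m l
  have "null R" using rel by (simp add: null_def R_def)
  have e: "opgs ?X F = (%m l. R m l + scale c (opgs ?E B m l))" by (simp add: R_def fun_eq_iff)
  have "null (opgs ?T (opgs ?E B))" unfolding opgs_commute[of ?T] by (rule null_opgs[OF BN])
  thus ?thesis unfolding e opgs_add by (rule null_lincomb[OF null_opgs[OF \<open>null R\<close>]])
 qed
 hence 1: "null (opgs ?X (opgs ?T F))" unfolding opgs_commute[of ?T] .
 have "null (opgs (sroots zs) F)" using F by (simp add: null_def opgs_sroots kills_def)
 hence "null (opgs (sroots zs) (opgs ?T F))" unfolding opgs_commute[of "sroots zs"] by (rule null_opgs)
 from eliminate[OF this 1] obtain \<theta>s where "null (opgs (troots \<theta>s) (opgs ?T F))" by blast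
 hence "null (opgs (troots (\<theta>s @ ts)) F)" by (simp add: opgs_append)
 hence "kills (\<theta>s @ ts) (%m. F m l)" unfolding null_def opgs_troots kills_def by blast
 thus ?thesis unfolding torsion_def by blast
qed

end

section \<open>Generating functions\<close>

lemma fps_power_nth_eq_0:
 fixes F :: "'a::ring_1 fps"
 assumes "fps_nth F 0 = 0" shows "n < k ==> fps_nth (F ^ k) n = 0"
proof (induction k arbitrary: n)
 case (Suc k)
 have "fps_nth F i * fps_nth (F ^ k) (n - i) = 0" if "i \<le> n" for i
 proof (cases "i = 0")
  case False
  hence "n - i < k" using that Suc.prems by auto
  thus ?thesis using Suc.IH by simp
 qed (simp add: assms)
 thus ?case by (simp add: fps_mult_nth)
qed simp

lemma sum_triangle_swap:
 "(\<Sum>i=0..n. \<Sum>l=0..n - i. f i l) = (\<Sum>l=0..n. \<Sum>i=0..n - l. f i (l :: nat))" for n :: nat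
proof -
 have "(\<Sum>i=0..n. \<Sum>l=0..n - i. f i l) = (\<Sum>i=0..n. \<Sum>l | l \<in> {0..n} \<and> i + l \<le> n. f i l)"
  by (intro sum.cong refl) auto
 also have "... = (\<Sum>l=0..n. \<Sum>i | i \<in> {0..n} \<and> i + l \<le> n. f i l)" by (rule sum.swap_restrict) auto
 also have "... = (\<Sum>l=0..n. \<Sum>i=0..n - l. f i l)" by (intro sum.cong refl) auto
 finally show ?thesis .
qed

lemma ideq_eq_trans [trans]: "ideq R a b ==> b = c ==> ideq R a c"
 and eq_ideq_trans [trans]: "a = b ==> ideq R b c ==> ideq R a c" by simp_all

text \<open>The derivation \<open>u d/du\<close> applied to powers and to the exponential of a series with commuting coefficients.\<close>

lemma power_coeff_rec:
 fixes a :: "nat => 'g free_algebra"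
 assumes comm: "!!l l'. l > 0 ==> l' > 0 ==> ideq R (a l * a l') (a l' * a l)"
 defines "F \<equiv> Abs_fps (%l. if l = 0 then 0 else a l)"
 shows "ideq R (sc (of_nat n) * fps_nth (F ^ Suc k) n)
  (sc (of_nat (Suc k)) * (\<Sum>l=0..n. sc (of_nat l) * (fps_nth F l * fps_nth (F ^ k) (n - l))))"
proof (induction k arbitrary: n)
 case 0
 have "(\<Sum>l=0..n. sc (of_nat l) * (fps_nth F l * fps_nth 1 (n - l))) = (\<Sum>l=0..n. if l = n then sc (of_nat n) * fps_nth F n else 0)"
  by (intro sum.cong) auto
 thus ?case by (simp add: sum.delta)
next
 case (Suc k)
 have FF: "ideq R (fps_nth F i * fps_nth F l) (fps_nth F l * fps_nth F i)" for i l
  using comm[of i l] by (cases "i = 0 \<or> l = 0") (auto simp: F_def)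
 define W where "W l = sc (of_nat l) * (fps_nth F l * fps_nth (F ^ Suc k) (n - l))" for l
 have "sc (of_nat n) * fps_nth (F ^ Suc (Suc k)) n = (\<Sum>i=0..n. sc (of_nat n) * (fps_nth F i * fps_nth (F ^ Suc k) (n - i)))"
  unfolding power_Suc[of F "Suc k"] by (simp only: fps_mult_nth sum_distrib_left)
 also have "... = (\<Sum>i=0..n. W i + fps_nth F i * (sc (of_nat (n - i)) * fps_nth (F ^ Suc k) (n - i)))"
 proof (rule sum.cong)
  fix i assume "i \<in> {0..n}"
  hence "(of_nat n :: complex) = of_nat i + of_nat (n - i)" by (simp flip: of_nat_add)
  thus "sc (of_nat n) * (fps_nth F i * fps_nth (F ^ Suc k) (n - i))
   = W i + fps_nth F i * (sc (of_nat (n - i)) * fps_nth (F ^ Suc k) (n - i))"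
   by (simp only: W_def sc_add distrib_right sc_left_commute[of "fps_nth F i"])
 qed simp
 also have "ideq R ... (\<Sum>i=0..n. W i + fps_nth F i * (sc (of_nat (Suc k)) *
   (\<Sum>l=0..n - i. sc (of_nat l) * (fps_nth F l * fps_nth (F ^ k) (n - i - l)))))"
  by (intro ideq_sum ideq_add ideq_refl ideq_left[OF Suc.IH])
 also have "... = (\<Sum>i=0..n. W i) + sc (of_nat (Suc k)) * (\<Sum>i=0..n. \<Sum>l=0..n - i.
   sc (of_nat l) * ((fps_nth F i * fps_nth F l) * fps_nth (F ^ k) (n - i - l)))"
 proof -
  have "fps_nth F i * (sc (of_nat (Suc k)) * (\<Sum>l=0..n - i. sc (of_nat l) * (fps_nth F l * fps_nth (F ^ k) (n - i - l))))
   = sc (of_nat (Suc k)) * (\<Sum>l=0..n - i. sc (of_nat l) * ((fps_nth F i * fps_nth F l) * fps_nth (F ^ k) (n - i - l)))" for i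
   unfolding sc_left_commute[of "fps_nth F i"] sum_distrib_left[of "fps_nth F i"] mult.assoc ..
  thus ?thesis by (simp only: sum.distrib sum_distrib_left)
 qed
 also have "ideq R ... ((\<Sum>i=0..n. W i) + sc (of_nat (Suc k)) * (\<Sum>i=0..n. \<Sum>l=0..n - i.
   sc (of_nat l) * ((fps_nth F l * fps_nth F i) * fps_nth (F ^ k) (n - i - l))))"
  by (intro ideq_add ideq_refl ideq_left ideq_sum ideq_right FF)
 also have "(\<Sum>i=0..n. \<Sum>l=0..n - i. sc (of_nat l) * ((fps_nth F l * fps_nth F i) * fps_nth (F ^ k) (n - i - l)))
  = (\<Sum>l=0..n. \<Sum>i=0..n - l. sc (of_nat l) * ((fps_nth F l * fps_nth F i) * fps_nth (F ^ k) (n - i - l)))"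
  by (rule sum_triangle_swap)
 also have "... = (\<Sum>l=0..n. W l)"
  by (simp add: W_def power_Suc fps_mult_nth sum_distrib_left mult.assoc add.commute)
 also have "(\<Sum>i=0..n. W i) + sc (of_nat (Suc k)) * (\<Sum>i=0..n. W i) = sc (of_nat (Suc (Suc k))) * (\<Sum>i=0..n. W i)"
 proof -
  have "sc (of_nat (Suc (Suc k))) = 1 + (sc (of_nat (Suc k)) :: 'g free_algebra)"
   using sc_add[of 1 "of_nat (Suc k)"] by simp
  thus ?thesis by (simp only: distrib_right mult_1_left)
 qed
 finally show ?case by (simp only: W_def)
qed

lemma exp_coeff_rec:
 fixes a :: "nat => 'g free_algebra"
 assumes comm: "!!l l'. l > 0 ==> l' > 0 ==> ideq R (a l * a l') (a l' * a l)"
 shows "ideq R (sc (of_nat n) * exp_coeff a n) (\<Sum>l=1..n. sc (of_nat l) * (a l * exp_coeff a (n - l)))"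
proof -
 define F where "F = Abs_fps (%l. if l = 0 then 0 else a l)"
 define P where "P k m = fps_nth (F ^ k) m" for k m
 have P0: "P k m = 0" if "m < k" for k m unfolding P_def by (rule fps_power_nth_eq_0) (use that in "auto simp: F_def")
 have E: "exp_coeff a m = (\<Sum>k<n'. sc (1 / fact k) * P k m)" if "m < n'" for m n'
 proof -
  have "(\<Sum>k<n'. sc (1 / fact k) * P k m) = (\<Sum>k\<le>m. sc (1 / fact k) * P k m)"
   using that by (intro sum.mono_neutral_right) (auto simp: P0)
  thus ?thesis by (simp add: exp_coeff_def P_def F_def)
 qed
 have "sc (of_nat n) * exp_coeff a n = (\<Sum>k<Suc n. sc (1 / fact k) * (sc (of_nat n) * P k n))"
  unfolding E[of n "Suc n", OF lessI] sum_distrib_left sc_left_commute[of "sc (of_nat n)"] ..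
 also have "... = sc (1 / fact 0) * (sc (of_nat n) * P 0 n) + (\<Sum>k<n. sc (1 / fact (Suc k)) * (sc (of_nat n) * P (Suc k) n))"
  by (rule sum.lessThan_Suc_shift)
 also have "sc (1 / fact 0) * (sc (of_nat n) * P 0 n) = 0" by (cases "n = 0") (auto simp: P_def sc_0)
 also have "ideq R (0 + (\<Sum>k<n. sc (1 / fact (Suc k)) * (sc (of_nat n) * P (Suc k) n)))
   (0 + (\<Sum>k<n. sc (1 / fact (Suc k)) * (sc (of_nat (Suc k)) * (\<Sum>l=0..n. sc (of_nat l) * (fps_nth F l * P k (n - l))))))"
  unfolding P_def F_def by (intro ideq_add ideq_refl ideq_sum ideq_left power_coeff_rec comm)
 also have "... = (\<Sum>k<n. \<Sum>l=0..n. sc (of_nat l) * (fps_nth F l * (sc (1 / fact k) * P k (n - l))))"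
 proof -
  have "sc (1 / fact (Suc k)) * (sc (of_nat (Suc k)) * x) = sc (1 / fact k) * x" for k and x :: "'g free_algebra"
  proof -
   have "1 / fact (Suc k) * of_nat (Suc k) = (1 / fact k :: complex)"
    by (simp add: fact_Suc del: of_nat_Suc)
   thus ?thesis by (simp only: sc_sc_mult)
  qed
  moreover have "sc c * (sc c' * (y * z)) = sc c' * (y * (sc c * z))" for c c' and y z :: "'g free_algebra"
   by (simp only: sc_left_commute[of y] sc_left_commute[of "sc c" c'])
  ultimately show ?thesis by (simp only: add_0 sum_distrib_left)
 qed
 also have "... = (\<Sum>l=0..n. sc (of_nat l) * (fps_nth F l * (\<Sum>k<n. sc (1 / fact k) * P k (n - l))))"
  by (subst sum.swap) (simp only: sum_distrib_left)
 also have "... = (\<Sum>l=1..n. sc (of_nat l) * (fps_nth F l * (\<Sum>k<n. sc (1 / fact k) * P k (n - l))))"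
  by (rule sum.mono_neutral_right) (auto simp: sc_0 not_less_eq_eq)
 also have "... = (\<Sum>l=1..n. sc (of_nat l) * (a l * exp_coeff a (n - l)))"
 proof (rule sum.cong)
  fix l assume "l \<in> {1..n}"
  hence "n - l < n" "fps_nth F l = a l" by (auto simp: F_def)
  thus "sc (of_nat l) * (fps_nth F l * (\<Sum>k<n. sc (1 / fact k) * P k (n - l))) = sc (of_nat l) * (a l * exp_coeff a (n - l))"
   using E[of "n - l" n] by simp
 qed simp
 finally show ?thesis .
qed

context twisted_datum begin

lemma eqU_eq_trans [trans]: "(a :: ualg) \<approx> b ==> b = c ==> a \<approx> c"
 and eq_eqU_trans [trans]: "(a :: ualg) = b ==> b \<approx> c ==> a \<approx> c" by simp_all

sublocale U: quotient_space "%c (a :: ualg). sc c * a" J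
proof (rule quotient_space.intro[OF vector_space_sc], unfold_locales)
 interpret V: vector_space "%c (a :: ualg). sc c * a" by (rule vector_space_sc)
 show "V.subspace J" by (rule V.subspaceI) (auto intro: J_0 J_add J_left)
qed

text \<open>With z the variable for the first index and S the shift of the second, this is the
  equation z dF/dz = (\<Sum> p a_p z^p + \<Sum> g_p z^p S^p) F, which determines F by its value at z
  = 0.\<close>

definition gf_rec :: "(nat => ualg) => (nat => complex) => (nat => nat => ualg) => bool" where
 "gf_rec a g F \<longleftrightarrow> (\<forall>m l. sc (of_nat m) * F m l \<approx>
   (\<Sum>p=1..m. sc (of_nat p) * (a p * F (m - p) l) + sc (g p) * F (m - p) (l + p)))"

text \<open>Multiplication by 1 - u z S.\<close>

definition opz :: "complex => (nat => nat => ualg) => nat => nat => ualg" where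
 "opz u F m l = F m l - sc u * (if m = 0 then 0 else F (m - 1) (Suc l))"

lemma opz_telescope: "(\<Sum>p=1..Suc n. sc (u ^ p) * opz u F (Suc n - p) (l + p)) = sc u * F n (Suc l)"
proof (induction n arbitrary: l)
 case 0
 show ?case by (simp add: opz_def)
next
 case (Suc n)
 have "(\<Sum>p=1..Suc (Suc n). sc (u ^ p) * opz u F (Suc (Suc n) - p) (l + p))
  = sc (u ^ 1) * opz u F (Suc (Suc n) - 1) (l + 1) + (\<Sum>p=Suc 1..Suc (Suc n). sc (u ^ p) * opz u F (Suc (Suc n) - p) (l + p))"
  by (rule sum.atLeast_Suc_atMost) simp
 also have "(\<Sum>p=Suc 1..Suc (Suc n). sc (u ^ p) * opz u F (Suc (Suc n) - p) (l + p))
  = (\<Sum>p=1..Suc n. sc (u ^ Suc p) * opz u F (Suc (Suc n) - Suc p) (l + Suc p))"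
  by (rule sum.shift_bounds_cl_Suc_ivl)
 also have "... = sc u * (\<Sum>p=1..Suc n. sc (u ^ p) * opz u F (Suc n - p) (Suc l + p))"
  unfolding sum_distrib_left by (simp add: sc_sc_mult)
 also have "... = sc u * (sc u * F n (Suc (Suc l)))" unfolding Suc.IH ..
 finally show ?case by (simp add: opz_def right_diff_distrib)
qed

text \<open>The logarithmic derivative of 1 - u z S is minus the sum of all u^p z^p S^p, so this
  factor subtracts u^p from g_p.\<close>

lemma gf_rec_opz:
 assumes "gf_rec a g F" shows "gf_rec a (%p. g p - u ^ p) (opz u F)"
 unfolding gf_rec_def
proof (intro allI)
 fix m l
 show "sc (of_nat m) * opz u F m l \<approx> (\<Sum>p=1..m. sc (of_nat p) * (a p * opz u F (m - p) l)
   + sc (g p - u ^ p) * opz u F (m - p) (l + p))"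
 proof (cases m)
  case 0
  thus ?thesis by (simp add: sc_0 eqU_refl)
 next
  case (Suc n)
  define W where "W n l p = sc (of_nat p) * (a p * F (n - p) l) + sc (g p) * F (n - p) (l + p)" for n l p
  have rec: "sc (of_nat m) * F m l \<approx> (\<Sum>p=1..m. W m l p)" for m l
   using assms unfolding gf_rec_def W_def by blast
  let ?Z = "%p. sc (of_nat p) * (a p * opz u F (Suc n - p) l) + sc (g p) * opz u F (Suc n - p) (l + p)"
  have "sc (of_nat m) * opz u F m l = sc (of_nat (Suc n)) * F (Suc n) l - sc u * (sc (of_nat n) * F n (Suc l)) - sc u * F n (Suc l)"
   by (simp add: Suc opz_def right_diff_distrib distrib_right distrib_left sc_add sc_left_commute[of "sc u"] algebra_simps)
  also have "... \<approx> (\<Sum>p=1..Suc n. W (Suc n) l p) - sc u * (\<Sum>p=1..n. W n (Suc l) p) - sc u * F n (Suc l)"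
   by (intro eqU_diff eqU_left rec eqU_refl)
  also have "(\<Sum>p=1..Suc n. W (Suc n) l p) - sc u * (\<Sum>p=1..n. W n (Suc l) p)
   = (\<Sum>p=1..Suc n. ?Z p)"
  proof -
   have "W (Suc n) l p - sc u * W n (Suc l) p
    = ?Z p" if "p \<in> {1..n}" for p
   proof -
    have "Suc n - p = Suc (n - p)" using that by auto
    thus ?thesis
     by (simp add: W_def opz_def right_diff_distrib distrib_left sc_left_commute[of "a p"] sc_sc_mult mult.commute[of u])
   qed
   hence "(\<Sum>p=1..n. W (Suc n) l p) - sc u * (\<Sum>p=1..n. W n (Suc l) p)
    = (\<Sum>p=1..n. ?Z p)"
    unfolding sum_distrib_left sum_subtractf[symmetric] by (intro sum.cong) auto
   thus ?thesis by (simp add: W_def opz_def algebra_simps)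
  qed
  also have "(\<Sum>p=1..Suc n. ?Z p) - sc u * F n (Suc l)
   = (\<Sum>p=1..m. sc (of_nat p) * (a p * opz u F (m - p) l) + sc (g p - u ^ p) * opz u F (m - p) (l + p))"
   unfolding opz_telescope[symmetric] sum_subtractf[symmetric] Suc
   by (intro sum.cong refl) (simp add: sc_diff left_diff_distrib)
  finally show ?thesis .
 qed
qed

lemma gf_rec_scale: assumes "gf_rec a g F" shows "gf_rec a g (%m l. sc c * F m l)"
 unfolding gf_rec_def
proof (intro allI)
 fix m l
 have "sc (of_nat m) * (sc c * F m l) = sc c * (sc (of_nat m) * F m l)" by (rule sc_left_commute)
 also have "... \<approx> sc c * (\<Sum>p=1..m. sc (of_nat p) * (a p * F (m - p) l) + sc (g p) * F (m - p) (l + p))"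
  using assms unfolding gf_rec_def by (intro eqU_left) blast
 also have "... = (\<Sum>p=1..m. sc (of_nat p) * (a p * (sc c * F (m - p) l)) + sc (g p) * (sc c * F (m - p) (l + p)))"
  by (simp add: sum_distrib_left distrib_left sc_left_commute[of "a p" for p] sc_sc_mult mult.commute[of c])
 finally show "sc (of_nat m) * (sc c * F m l)
  \<approx> (\<Sum>p=1..m. sc (of_nat p) * (a p * (sc c * F (m - p) l)) + sc (g p) * (sc c * F (m - p) (l + p)))" .
qed

lemma gf_rec_unique:
 assumes "gf_rec a g F" "gf_rec a g G" "!!l. (F 0 l :: ualg) \<approx> G 0 l" shows "(F m l :: ualg) \<approx> G m l"
proof (induction m arbitrary: l rule: less_induct)
 case (less m)
 show ?case
 proof (cases "m = 0")
  case False
  have "sc (of_nat m) * F m l \<approx> (\<Sum>p=1..m. sc (of_nat p) * (a p * F (m - p) l) + sc (g p) * F (m - p) (l + p))"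
   using assms(1) unfolding gf_rec_def by blast
  also have "... \<approx> (\<Sum>p=1..m. sc (of_nat p) * (a p * G (m - p) l) + sc (g p) * G (m - p) (l + p))"
   using False by (intro eqU_sum eqU_add eqU_left less.IH) auto
  also have "... \<approx> sc (of_nat m) * G m l"
   by (rule eqU_sym, insert assms(2), unfold gf_rec_def, blast)
  finally have "sc (of_nat m) * (F m l - G m l) \<in> J" by (simp add: eqU_def right_diff_distrib)
  thus ?thesis using J_cancel_sc False by (simp add: eqU_def)
 qed (simp add: assms(3))
qed

definition opzs :: "complex list => (nat => nat => ualg) => nat => nat => ualg" where
 "opzs us F = foldr opz us F"

lemma opzs_simps [simp]: "opzs [] F = F" "opzs (u # us) F = opz u (opzs us F)" by (simp_all add: opzs_def)
lemma opzs_0: "opzs us F 0 l = F 0 l" by (induction us) (simp_all add: opz_def)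
lemma gf_rec_opzs: assumes "gf_rec a g F" shows "gf_rec a (%p. g p - (\<Sum>u\<leftarrow>us. u ^ p)) (opzs us F)"
proof (induction us)
 case (Cons u us)
 from gf_rec_opz[OF Cons, of u] show ?case by (simp add: algebra_simps)
qed (simp add: assms)
text \<open>Once the first index is at least the number of factors, no factor reaches the truncation
  at 0 in \<open>opz\<close>, and 1 - u z S becomes the homogeneous factor T - u S.\<close>

lemma opzs_opgs: "opzs us F (m + length us) l = U.opgs (map (%u. (1, - u, 0)) us) F m l"
proof (induction us arbitrary: m l)
 case (Cons u us)
 have "opzs (u # us) F (m + length (u # us)) l = opzs us F (Suc m + length us) l - sc u * opzs us F (m + length us) (Suc l)"
  by (simp add: opz_def)
 thus ?case unfolding Cons.IH by (simp add: U.opg_def sc_minus sc_0)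
qed simp

end

context drinfeld begin

definition ah :: "nat => nat => ualg" where
 "ah i l = sc (qp (d i) - qp (- d i)) * h i (int l)"

abbreviation ph :: "nat => nat => ualg" where "ph i m \<equiv> phi h Pos i (int m)"

lemma ph_exp: "ph i m = kI Pos i * exp_coeff (ah i) m"
 by (simp add: phi_def ah_def[abs_def])

lemma kI_ah: "i \<in> nodes X ==> j \<in> nodes X ==> l > 0 ==> kI p i * ah j l \<approx> ah j l * kI p i"
 unfolding ah_def using eqU_left[OF kI_h[of i j "int l" p], of "sc (qp (d j) - qp (- d j))"]
 by (simp add: sc_left_commute[of "kI p i"] mult.assoc)

lemma ph_rec: assumes i: "i \<in> nodes X"
 shows "sc (of_nat m) * ph i m \<approx> (\<Sum>l=1..m. sc (of_nat l) * (ah i l * ph i (m - l)))"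
proof -
 have c: "ideq relators (ah i l * ah i l') (ah i l' * ah i l)" if "l > 0" "l' > 0" for l l'
 proof -
  have "ah i l * ah i l' = sc (qp (d i) - qp (- d i)) * (sc (qp (d i) - qp (- d i)) * (h i (int l) * h i (int l')))"
   by (simp add: ah_def mult.assoc sc_left_commute[of "h i (int l)"])
  also have "... \<approx> sc (qp (d i) - qp (- d i)) * (sc (qp (d i) - qp (- d i)) * (h i (int l') * h i (int l)))"
   using that by (intro eqU_left h_h i) auto
  also have "... = ah i l' * ah i l" by (simp add: ah_def mult.assoc sc_left_commute[of "h i (int l')"])
  finally show ?thesis by (simp add: eqU_ideq)
 qed
 have "sc (of_nat m) * ph i m = kI Pos i * (sc (of_nat m) * exp_coeff (ah i) m)"
  unfolding ph_exp by (rule sc_left_commute[symmetric])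
 also have "... \<approx> kI Pos i * (\<Sum>l=1..m. sc (of_nat l) * (ah i l * exp_coeff (ah i) (m - l)))"
  using exp_coeff_rec[of relators "ah i" m, OF c] by (intro eqU_left) (simp add: eqU_ideq)
 also have "... = (\<Sum>l=1..m. sc (of_nat l) * ((kI Pos i * ah i l) * exp_coeff (ah i) (m - l)))"
  by (simp add: sum_distrib_left sc_left_commute[of "kI Pos i"] mult.assoc)
 also have "... \<approx> (\<Sum>l=1..m. sc (of_nat l) * ((ah i l * kI Pos i) * exp_coeff (ah i) (m - l)))"
  by (intro eqU_sum eqU_left eqU_right kI_ah i) auto
 also have "... = (\<Sum>l=1..m. sc (of_nat l) * (ah i l * ph i (m - l)))" by (simp only: ph_exp mult.assoc)
 finally show ?thesis .
qed

lemma ph_0: "ph i 0 = kI Pos i" unfolding ph_exp by (simp add: exp_coeff_def)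

text \<open>The quantum numbers in the relation between \<open>h\<close> and \<open>x\<close> are
  differences of p-th powers; these are their bases, so that by \<open>hx_eta\<close> the
  commutators become power sums.\<close>

definition eta :: "nat => nat => int => nat => complex" where
 "eta i j v t = q powi (v * cartan X i ((\<sigma> ^^ t) j)) * \<omega> ^ t"

lemma hx_eta: assumes i: "i \<in> nodes X" and p: "p > 0"
 shows "of_nat p * (qp (d i) - qp (- d i)) * hx i j (int p) = (\<Sum>t=1..M. eta i j 1 t ^ p - eta i j (- 1) t ^ p)"
proof -
 have d: "d i ~= 0" using d_pos[OF i] by simp
 have qq: "qp (of_int (v * (int p * C))) * \<omega> powi (int p * int t) = (q powi (v * C) * \<omega> ^ t) ^ p" for C t v
 proof -
  have "qp (of_int (v * (int p * C))) = s powi (2 * (v * (int p * C)))" by (rule qp_int) simp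
  also have "2 * (v * (int p * C)) = 2 * ((v * C) * int p)" by (simp only: mult_ac)
  also have "s powi (2 * ((v * C) * int p)) = (s powi 2) powi (v * C * int p)" by (rule power_int_mult)
  also have "s powi 2 = q" using s by (simp add: power_int_def)
  also have "q powi (v * C * int p) = (q powi (v * C)) ^ p" by (simp only: power_int_mult power_int_of_nat)
  finally have "qp (of_int (v * (int p * C))) = (q powi (v * C)) ^ p" .
  moreover have "\<omega> powi (int p * int t) = (\<omega> ^ t) ^ p"
   by (simp only: mult.commute[of "int p"] power_int_mult power_int_of_nat)
  ultimately show ?thesis by (simp add: power_mult_distrib)
 qed
 have "of_nat p * (qp (d i) - qp (- d i)) * hx i j (int p)
  = (qp (d i) - qp (- d i)) * (\<Sum>t=1..M. qnum (d i) (of_int (int p * cartan X i ((\<sigma> ^^ t) j)) / d i) * \<omega> powi (int p * int t))"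
  using p by (simp add: hx_def)
 also have "... = (\<Sum>t=1..M. (qp (of_int (int p * cartan X i ((\<sigma> ^^ t) j))) - qp (- of_int (int p * cartan X i ((\<sigma> ^^ t) j)))) * \<omega> powi (int p * int t))"
  unfolding sum_distrib_left qnum_def using qp_diff_nz[OF i] d by (intro sum.cong) (simp_all add: field_simps)
 also have "... = (\<Sum>t=1..M. eta i j 1 t ^ p - eta i j (- 1) t ^ p)"
  unfolding eta_def qq[symmetric] by (intro sum.cong) (simp_all add: left_diff_distrib)
 finally show ?thesis .
qed

text \<open>Both orders of the product satisfy an equation \<open>gf_rec\<close>, with coefficients
  g_p that differ by power sums of the \<open>eta\<close>. Multiplying by the corresponding linear
  factors makes the equations equal, and uniqueness reduces the claim to m = 0, the relation between
  k and x.\<close>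

lemma ph_x_exchange:
 assumes i: "i \<in> nodes X" and j: "j \<in> nodes X"
 shows "U.opgs (map (%u. (1, - u, 0)) (map (eta i j (- 1)) [1..<Suc M])) (%m l. ph i m * x Neg j (int l)) m l
  \<approx> sc (q powi (- csum i j)) * U.opgs (map (%H. (1, - H, 0)) (map (eta i j 1) [1..<Suc M])) (%m l. x Neg j (int l) * ph i m) m l"
proof -
 let ?x = "%l. x Neg j (int l)"
 define F G where "F m l = ph i m * ?x l" and "G m l = ?x l * ph i m" for m l
 define us Hs where "us = map (eta i j (- 1)) [1..<Suc M]" and "Hs = map (eta i j 1) [1..<Suc M]"
 define g where "g p = (\<Sum>t=1..M. eta i j 1 t ^ p - eta i j (- 1) t ^ p)" for p
 define c where "c = qp (d i) - qp (- d i)"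
 have Su: "(\<Sum>u\<leftarrow>us. u ^ p) = (\<Sum>t=1..M. eta i j (- 1) t ^ p)" for p
  unfolding us_def by (simp only: map_map o_def interv_sum_list_conv_sum_set_nat atLeastLessThanSuc_atLeastAtMost set_upt)
 have SH: "(\<Sum>H\<leftarrow>Hs. H ^ p) = (\<Sum>t=1..M. eta i j 1 t ^ p)" for p
  unfolding Hs_def by (simp only: map_map o_def interv_sum_list_conv_sum_set_nat atLeastLessThanSuc_atLeastAtMost set_upt)
 have F: "gf_rec (ah i) (%_. 0) F"
  unfolding gf_rec_def
 proof (intro allI)
  fix m l
  have "sc (of_nat m) * F m l = (sc (of_nat m) * ph i m) * ?x l" by (simp add: F_def mult.assoc)
  also have "... \<approx> (\<Sum>p=1..m. sc (of_nat p) * (ah i p * ph i (m - p))) * ?x l" by (intro eqU_right ph_rec i)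
  also have "... = (\<Sum>p=1..m. sc (of_nat p) * (ah i p * F (m - p) l) + sc 0 * F (m - p) (l + p))"
   by (simp add: sum_distrib_right F_def mult.assoc sc_0)
  finally show "sc (of_nat m) * F m l \<approx> (\<Sum>p=1..m. sc (of_nat p) * (ah i p * F (m - p) l) + sc 0 * F (m - p) (l + p))" .
 qed
 have xa: "sc (of_nat p) * (?x l * ah i p) \<approx> sc (of_nat p) * (ah i p * ?x l) + sc (g p) * ?x (l + p)"
  if p: "p > 0" for l p
 proof -
  have "h i (int p) * ?x l - ?x l * h i (int p) \<approx> sc (- hx i j (int p)) * x Neg j (int p + int l)"
   using h_x[OF i j, of "int p" Neg "int l"] p by (simp add: comm_def)
  hence "h i (int p) * ?x l - (h i (int p) * ?x l - ?x l * h i (int p))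
   \<approx> h i (int p) * ?x l - sc (- hx i j (int p)) * x Neg j (int p + int l)"
   by (intro eqU_diff eqU_refl)
  hence 1: "?x l * h i (int p) \<approx> h i (int p) * ?x l + sc (hx i j (int p)) * ?x (l + p)"
   by (simp add: sc_minus add.commute)
  have "sc (of_nat p) * (?x l * ah i p) = sc (of_nat p * c) * (?x l * h i (int p))"
   by (simp add: ah_def c_def sc_left_commute[of "?x l"] sc_sc_mult)
  also have "... \<approx> sc (of_nat p * c) * (h i (int p) * ?x l + sc (hx i j (int p)) * ?x (l + p))"
   by (intro eqU_left 1)
  also have "... = sc (of_nat p) * (ah i p * ?x l) + sc (of_nat p * c * hx i j (int p)) * ?x (l + p)"
   by (simp add: distrib_left ah_def c_def sc_sc_mult flip: mult.assoc)
    (simp add: mult.assoc sc_sc_mult)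
  also have "of_nat p * c * hx i j (int p) = g p" unfolding c_def g_def by (rule hx_eta[OF i p])
  finally show ?thesis .
 qed
 have G: "gf_rec (ah i) g G"
  unfolding gf_rec_def
 proof (intro allI)
  fix m l
  have "sc (of_nat m) * G m l = ?x l * (sc (of_nat m) * ph i m)"
   by (simp add: G_def sc_left_commute[of "?x l"])
  also have "... \<approx> ?x l * (\<Sum>p=1..m. sc (of_nat p) * (ah i p * ph i (m - p)))" by (intro eqU_left ph_rec i)
  also have "... = (\<Sum>p=1..m. (sc (of_nat p) * (?x l * ah i p)) * ph i (m - p))"
   by (simp add: sum_distrib_left sc_left_commute[of "?x l"] mult.assoc)
  also have "... \<approx> (\<Sum>p=1..m. (sc (of_nat p) * (ah i p * ?x l) + sc (g p) * ?x (l + p)) * ph i (m - p))"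
   by (intro eqU_sum eqU_right xa) auto
  also have "... = (\<Sum>p=1..m. sc (of_nat p) * (ah i p * G (m - p) l) + sc (g p) * G (m - p) (l + p))"
   by (simp add: G_def distrib_right mult.assoc)
  finally show "sc (of_nat m) * G m l \<approx> (\<Sum>p=1..m. sc (of_nat p) * (ah i p * G (m - p) l) + sc (g p) * G (m - p) (l + p))" .
 qed
 have eq: "opzs us F m l \<approx> sc (q powi (- csum i j)) * opzs Hs G m l" for m l
 proof (rule gf_rec_unique)
  show "gf_rec (ah i) (%p. 0 - (\<Sum>u\<leftarrow>us. u ^ p)) (opzs us F)" by (rule gf_rec_opzs[OF F])
  have "(%p. g p - (\<Sum>H\<leftarrow>Hs. H ^ p)) = (%p. 0 - (\<Sum>u\<leftarrow>us. u ^ p))"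
   unfolding Su SH g_def by (simp add: sum_subtractf fun_eq_iff)
  thus "gf_rec (ah i) (%p. 0 - (\<Sum>u\<leftarrow>us. u ^ p)) (%m l. sc (q powi (- csum i j)) * opzs Hs G m l)"
   using gf_rec_scale[OF gf_rec_opzs[OF G, of Hs]] by simp
  show "opzs us F 0 l \<approx> sc (q powi (- csum i j)) * opzs Hs G 0 l" for l
   using kI_x[OF i j, of Neg "int l"] by (simp add: opzs_0 F_def G_def ph_0[simplified] mult.assoc)
 qed
 have len: "length us = length Hs" by (simp add: us_def Hs_def)
 show ?thesis using eq[of "m + length us" l] unfolding opzs_opgs len unfolding opzs_opgs[of Hs] len[symmetric] opzs_opgs[of us]
  by (simp add: F_def[abs_def] G_def[abs_def] us_def Hs_def)
qed

end

section \<open>Highest weight modules\<close>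

text \<open>A module presented as \<open>Mt\<close> modulo \<open>NN\<close>, with a highest weight
  vector for the nonnegative modes. The last assumption expresses the rationality of \<gamma> by
  linear recurrences.\<close>

locale loop_module = drinfeld X \<sigma> M q s x h + L: lin_ops sclM opM
 for X \<sigma> M q s x h and sclM :: "complex => 'm => 'm::ab_group_add" and opM :: "ugen => 'm => 'm" +
 fixes Mt NN :: "'m set" and v0 :: 'm and \<gamma> :: "nat => nat => complex"
 assumes sub_Mt: "L.subspace Mt" and sub_NN: "L.subspace NN" and NN_Mt: "NN \<subseteq> Mt"
  and act_Mt: "!!a m. m \<in> Mt ==> L.act a m \<in> Mt" and act_NN: "!!a m. m \<in> NN ==> L.act a m \<in> NN"
  and act_J: "!!a m. a \<in> J ==> m \<in> Mt ==> L.act a m \<in> NN"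
  and v0: "v0 \<in> Mt" "v0 \<notin> NN"
  and v0_x: "!!i r. i \<in> Isig ==> L.act (x Pos i (int r)) v0 \<in> NN"
  and v0_ph: "!!i m. i \<in> Isig ==> L.act (ph i m) v0 - sclM (\<gamma> i m) v0 \<in> NN"
  and \<gamma>_torsion: "!!i. i \<in> Isig ==> \<exists>zs. \<forall>l. quotient_space.steps (*) zs (\<gamma> i) l = 0"
begin

sublocale QN: quotient_space sclM NN by unfold_locales (rule sub_NN)

abbreviation "Xp i r \<equiv> L.act (x Pos i (int r))"
abbreviation "Xm i r \<equiv> L.act (x Neg i (int r))"
abbreviation "Hh i r \<equiv> L.act (h i (int r))"
abbreviation "Kk p i \<equiv> L.act (k p (Nd i))"
abbreviation "Ph i r \<equiv> L.act (ph i r)"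

lemmas L_lin = L.act_add_right L.act_scl L.act_diff_right L.act_minus_right L.act_0_right L.act_sum_right
lemmas L_act = L.act_add L.act_diff L.act_mult L.act_sc L.act_sum L.act_minus L.act_0 L.act_1

lemma act_eqU: "a \<approx> b ==> m \<in> Mt ==> L.act a m - L.act b m \<in> NN"
 using act_J[of "a - b" m] by (simp add: eqU_def L_act)

lemma kI_Isig: "i \<in> Isig ==> kI p i = k p (Nd i)" by (simp add: kI_def Isig_rep)

text \<open>With nonnegative modes \<phi>^- enters only in degree 0, as the inverse of k, and
  \<open>kap\<close> vanishes between different orbits.\<close>

lemma rel_xx:
 assumes "i \<in> Isig" "j \<in> Isig" "m \<in> Mt"
 shows "Xp j r (Xm i l m) - (Xm i l (Xp j r m)
  + (if i = j then sclM (kap i i (int l)) (Ph i (r + l) m - (if r + l = 0 then Kk Neg i m else 0)) else 0)) \<in> NN"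
proof -
 have n: "i \<in> nodes X" "j \<in> nodes X" using assms by (simp_all add: Isig_rep)
 have k0: "kap j i (int l) = 0" if "i ~= j"
 proof -
  have "(\<sigma> ^^ t) j ~= i" for t using that assms rep_pow[of t j] by (metis Isig_rep(1))
  thus ?thesis by (simp add: kap_def)
 qed
 define z where "z = (if r + l = 0 then k Neg (Nd i) else 0)"
 have z: "L.act z m = (if r + l = 0 then Kk Neg i m else 0)" by (simp add: z_def L_act)
 have pN: "phi h Neg i (int r + int l) = z"
  using assms(1) by (auto simp: phi_def exp_coeff_def kI_Isig z_def)
 have "comm (x Pos j (int r)) (x Neg i (int l)) \<approx> sc (kap j i (int l)) * (phi h Pos j (int r + int l) - phi h Neg j (int r + int l))"
  by (rule x_x[OF n(2,1)])
 hence "comm (x Pos j (int r)) (x Neg i (int l)) \<approx> (if i = j then sc (kap i i (int l)) * (ph i (r + l) - z) else 0)"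
  using pN k0 by (cases "i = j") (auto simp: sc_0)
 from act_eqU[OF this assms(3)] show ?thesis
  unfolding z[symmetric] by (cases "i = j") (simp_all add: comm_def L_act algebra_simps)
qed

lemma rel_hx:
 assumes "i \<in> Isig" "j \<in> Isig" "m \<in> Mt" "r > 0"
 shows "Hh i r (L.act (x p j (int l)) m) - (L.act (x p j (int l)) (Hh i r m)
  + sclM (of_int (sg p) * hx i j (int r)) (L.act (x p j (int (r + l))) m)) \<in> NN"
proof -
 have "comm (h i (int r)) (x p j (int l)) \<approx> sc (of_int (sg p) * hx i j (int r)) * x p j (int r + int l)"
  using assms by (intro h_x) (auto simp: Isig_rep)
 from act_eqU[OF this assms(3)] show ?thesis by (simp add: comm_def L_act algebra_simps)
qed

lemma kI_x_sign:
 assumes "i \<in> Isig" "j \<in> Isig"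
 shows "k p (Nd i) * x p' j l \<approx> sc (q powi (sg p * sg p' * csum i j)) * (x p' j l * k p (Nd i))"
proof -
 have 1: "k Pos (Nd i) * x p' j l \<approx> sc (q powi (sg p' * csum i j)) * (x p' j l * k Pos (Nd i))"
  using kI_x[of i j p' l] assms by (simp add: kI_Isig Isig_rep mult.assoc)
 have I: "Nd i \<in> Ihat" using assms by simp
 show ?thesis
 proof (cases p)
  case Neg
  have "k Neg (Nd i) * x p' j l \<approx> sc (inverse (q powi (sg p' * csum i j))) * (x p' j l * k Neg (Nd i))"
   using ideq_inverse_commute[OF 1[unfolded eqU_ideq] k_inv[OF I, of Pos, unfolded eqU_ideq, simplified] k_inv[OF I, of Neg, unfolded eqU_ideq, simplified]]
    q(1) by (simp add: eqU_ideq)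
  thus ?thesis using Neg by (simp add: power_int_minus)
 qed (use 1 in simp)
qed

lemma rel_kx:
 assumes "i \<in> Isig" "j \<in> Isig" "m \<in> Mt"
 shows "Kk p i (L.act (x p' j (int l)) m) - sclM (q powi (sg p * sg p' * csum i j)) (L.act (x p' j (int l)) (Kk p i m)) \<in> NN"
 using act_eqU[OF kI_x_sign[OF assms(1,2)] assms(3)] by (simp add: L_act)

lemma rel_ph:
 assumes "i \<in> Isig" "m \<in> Mt"
 shows "sclM (of_nat n) (Ph i n m) - (\<Sum>l=1..n. sclM (of_nat l) (L.act (ah i l) (Ph i (n - l) m))) \<in> NN"
 using act_eqU[OF ph_rec[of i n] assms(2)] assms(1) by (simp add: L_act Isig_rep)

lemma Ph_0: "i \<in> Isig ==> Ph i 0 m = Kk Pos i m" using ph_0[of i] by (simp add: kI_Isig)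

text \<open>The recursion \<open>rel_ph\<close> recovers \<phi> from k and the h's, so stability
  passes on to it.\<close>

lemma Ph_stable:
 assumes W: "L.subspace W" "NN \<subseteq> W" "W \<subseteq> Mt" and i: "i \<in> Isig"
  and H: "!!r w. r > 0 ==> w \<in> W ==> Hh i r w \<in> W" and K: "!!w. w \<in> W ==> Kk Pos i w \<in> W"
 shows "w \<in> W ==> Ph i n w \<in> W"
proof (induction n rule: less_induct)
 case (less n)
 show ?case
 proof (cases "n = 0")
  case True
  thus ?thesis using K less.prems Ph_0[OF i] by simp
 next
  case False
  have S: "(\<Sum>l=1..n. sclM (of_nat l) (L.act (ah i l) (Ph i (n - l) w))) \<in> W"
  proof (rule L.subspace_sum[OF W(1)], rule L.subspace_scale[OF W(1)])
   fix l assume l: "l \<in> {1..n}"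
   hence "n - l < n" by auto
   hence "Ph i (n - l) w \<in> W" using less by blast
   hence "Hh i l (Ph i (n - l) w) \<in> W" using l by (intro H) auto
   thus "L.act (ah i l) (Ph i (n - l) w) \<in> W" unfolding ah_def L_act by (rule L.subspace_scale[OF W(1)])
  qed
  have "sclM (of_nat n) (Ph i n w) - (\<Sum>l=1..n. sclM (of_nat l) (L.act (ah i l) (Ph i (n - l) w))) \<in> W"
   using rel_ph[OF i, of w n] less.prems W by blast
  from L.subspace_add[OF W(1) this S] have "sclM (of_nat n) (Ph i n w) \<in> W" by simp
  hence "sclM (1 / of_nat n) (sclM (of_nat n) (Ph i n w)) \<in> W" by (rule L.subspace_scale[OF W(1)])
  thus ?thesis using False by simp
 qed
qed

text \<open>The graded piece spanned by products of lowering currents on \<open>v0\<close> with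
  multiset of nodes \<open>W\<close>. It contains \<open>NN\<close>, so that each piece is closed
  under congruence.\<close>

inductive Yb :: "nat multiset => 'm => bool" where
 null: "m \<in> NN ==> Yb W m"
| top: "Yb {#} v0"
| lower: "Yb W m ==> i \<in> Isig ==> Yb (add_mset i W) (Xm i l m)"
| add: "Yb W m ==> Yb W m' ==> Yb W (m + m')"
| scale: "Yb W m ==> Yb W (sclM c m)"

abbreviation "Y W \<equiv> Collect (Yb W)"

lemma Y_subspace: "L.subspace (Y W)"
 by (rule L.subspaceI) (auto intro: Yb.intros QN.N_0)
lemma Y_Mt: "Yb W m ==> m \<in> Mt"
 by (induction rule: Yb.induct)
  (use NN_Mt v0 sub_Mt in "auto intro: act_Mt L.subspace_add L.subspace_scale")
lemma Y_cong: assumes "m - m' \<in> NN" "Yb W m'" shows "Yb W m"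
 using Yb.add[OF Yb.null[OF assms(1)] assms(2)] by simp
lemma Y_diff: "Yb W m ==> Yb W m' ==> Yb W (m - m')" using L.subspace_diff[OF Y_subspace, of m W m'] by simp

lemma k_top: assumes "i \<in> Isig" shows "Kk Pos i v0 - sclM (\<gamma> i 0) v0 \<in> NN"
 using v0_ph[OF assms, of 0] Ph_0[OF assms] by simp

lemma Kk_inverse: "i \<in> Isig ==> m \<in> Mt ==> Kk (opp p) i (Kk p i m) - m \<in> NN"
 using act_eqU[OF k_inv[of "Nd i" "opp p"]] by (cases p) (simp_all add: L_act)

lemma \<gamma>_nz: assumes i: "i \<in> Isig" shows "\<gamma> i 0 ~= 0"
proof
 assume "\<gamma> i 0 = 0"
 hence "Kk Pos i v0 \<in> NN" using k_top[OF i] by simp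
 hence "Kk Neg i (Kk Pos i v0) \<in> NN" by (rule act_NN)
 hence "v0 \<in> NN" using Kk_inverse[OF i v0(1), of Pos] QN.N_cong[of "Kk Neg i (Kk Pos i v0)" v0] by simp
 thus False using v0 by simp
qed

definition wtc :: "nat => nat multiset => complex" where
 "wtc i W = \<gamma> i 0 * (\<Prod>j\<in>#W. q powi (- csum i j))"

lemma wtc_nz: "i \<in> Isig ==> wtc i W ~= 0"
 using \<gamma>_nz q(1) by (auto simp: wtc_def prod_mset_zero_iff)

lemma K_weight: assumes i: "i \<in> Isig" shows "Yb W m ==> Kk Pos i m - sclM (wtc i W) m \<in> NN"
proof (induction rule: Yb.induct)
 case (null m W)
 thus ?case by (intro QN.N_diff QN.N_scale act_NN)
next
 case top
 show ?case using k_top[OF i] by (simp add: wtc_def)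
next
 case (lower W m j l)
 have "Kk Pos i (Xm j l m) - sclM (q powi (- csum i j)) (Xm j l (Kk Pos i m)) \<in> NN"
  using rel_kx[OF i lower(2) Y_Mt[OF lower(1)], of Pos Neg l] by simp
 moreover have "sclM (q powi (- csum i j)) (Xm j l (Kk Pos i m - sclM (wtc i W) m)) \<in> NN"
  by (intro QN.N_scale act_NN lower)
 ultimately have "Kk Pos i (Xm j l m) - sclM (q powi (- csum i j)) (Xm j l (Kk Pos i m))
   + sclM (q powi (- csum i j)) (Xm j l (Kk Pos i m - sclM (wtc i W) m)) \<in> NN" by (rule QN.N_add)
 thus ?case by (simp add: L_lin L.scale_right_diff_distrib wtc_def mult_ac)
next
 case (add W m m')
 thus ?case using QN.N_add[OF add.IH] by (simp add: L_lin L.scale_right_distrib algebra_simps)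
next
 case (scale W m c)
 thus ?case using QN.N_scale[OF scale.IH, of c] by (simp add: L_lin L.scale_right_diff_distrib mult.commute)
qed

lemma Y_K: assumes i: "i \<in> Isig" and m: "Yb W m" shows "Yb W (Kk p i m)"
proof -
 have P: "Yb W (Kk Pos i m)" using Y_cong[OF K_weight[OF i m]] Yb.scale m by blast
 show ?thesis
 proof (cases p)
  case Neg
  have "Kk Neg i (Kk Pos i m - sclM (wtc i W) m) \<in> NN" by (intro act_NN K_weight i m)
  hence "Kk Neg i (Kk Pos i m) - sclM (wtc i W) (Kk Neg i m) \<in> NN" by (simp add: L_lin)
  moreover have "Kk Neg i (Kk Pos i m) - m \<in> NN" using Kk_inverse[OF i Y_Mt[OF m], of Pos] by simp
  ultimately have "(Kk Neg i (Kk Pos i m) - m) - (Kk Neg i (Kk Pos i m) - sclM (wtc i W) (Kk Neg i m)) \<in> NN" by (rule QN.N_diff[rotated])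
  hence "sclM (wtc i W) (Kk Neg i m) - m \<in> NN" by simp
  hence "Yb W (sclM (wtc i W) (Kk Neg i m))" using Y_cong m by blast
  hence "Yb W (sclM (1 / wtc i W) (sclM (wtc i W) (Kk Neg i m)))" by (rule Yb.scale)
  thus ?thesis using wtc_nz[OF i] Neg by simp
 qed (use P in simp)
qed

text \<open>The recursion that expresses \<phi> through h is solved for its top term, which is
  possible as \<gamma>_i(0) is nonzero. So h acts on \<open>v0\<close> by scalars although only
  \<phi> was prescribed.\<close>

lemma ah_top: assumes i: "i \<in> Isig" shows "r > 0 ==> \<exists>c. L.act (ah i r) v0 - sclM c v0 \<in> NN"
proof (induction r rule: less_induct)
 case (less n)
 have "\<exists>c. \<forall>l. 0 < l \<and> l < n --> L.act (ah i l) v0 - sclM (c l) v0 \<in> NN" using less.IH by metis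
 then obtain c where c: "!!l. 0 < l ==> l < n ==> L.act (ah i l) v0 - sclM (c l) v0 \<in> NN" by blast
 define z where "z l = sclM (of_nat l) (L.act (ah i l) (Ph i (n - l) v0))" for l
 have z: "z l - sclM (of_nat l * \<gamma> i (n - l)) (L.act (ah i l) v0) \<in> NN" for l
  using QN.N_scale[OF act_NN[OF v0_ph[OF i, of "n - l"], of "ah i l"], of "of_nat l"]
  by (simp add: z_def L_lin L.scale_right_diff_distrib)
 have z': "z l - sclM (of_nat l * \<gamma> i (n - l) * c l) v0 \<in> NN" if "0 < l" "l < n" for l
  using QN.N_add[OF z[of l] QN.N_scale[OF c[OF that], of "of_nat l * \<gamma> i (n - l)"]]
  by (simp add: L.scale_right_diff_distrib)
 define T where "T = (\<Sum>l=1..<n. of_nat l * \<gamma> i (n - l) * c l)"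
 have "(\<Sum>l=1..<n. z l - sclM (of_nat l * \<gamma> i (n - l) * c l) v0) \<in> NN" by (intro QN.N_sum z') auto
 hence s1: "(\<Sum>l=1..<n. z l) - sclM T v0 \<in> NN" by (simp add: sum_subtractf T_def L.scale_sum_left)
 have s2: "sclM (of_nat n) (Ph i n v0) - ((\<Sum>l=1..<n. z l) + z n) \<in> NN"
 proof -
  have "{1..n} = insert n {1..<n}" using less.prems by auto
  hence "(\<Sum>l=1..n. z l) = (\<Sum>l=1..<n. z l) + z n" by (simp add: add.commute)
  thus ?thesis using rel_ph[OF i v0(1), of n] by (simp add: z_def)
 qed
 have s3: "sclM (of_nat n) (Ph i n v0) - sclM (of_nat n * \<gamma> i n) v0 \<in> NN"
  using QN.N_scale[OF v0_ph[OF i, of n], of "of_nat n"] by (simp add: L.scale_right_diff_distrib)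
 have s4: "z n - sclM (of_nat n * \<gamma> i 0) (L.act (ah i n) v0) \<in> NN" using z[of n] by simp
 define c0 where "c0 = of_nat n * \<gamma> i 0"
 have c0: "c0 ~= 0" using \<gamma>_nz[OF i] less.prems by (simp add: c0_def)
 have "(sclM (of_nat n) (Ph i n v0) - sclM (of_nat n * \<gamma> i n) v0) - (sclM (of_nat n) (Ph i n v0) - ((\<Sum>l=1..<n. z l) + z n))
   - ((\<Sum>l=1..<n. z l) - sclM T v0) - (z n - sclM c0 (L.act (ah i n) v0)) \<in> NN"
  unfolding c0_def by (intro QN.N_diff s1 s2 s3 s4)
 hence "sclM c0 (L.act (ah i n) v0) - sclM (of_nat n * \<gamma> i n - T) v0 \<in> NN"
  by (simp add: L.scale_left_diff_distrib algebra_simps)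
 hence "sclM (1 / c0) (sclM c0 (L.act (ah i n) v0) - sclM (of_nat n * \<gamma> i n - T) v0) \<in> NN" by (rule QN.N_scale)
 thus ?case using c0 by (auto simp: L.scale_right_diff_distrib)
qed

lemma H_top: assumes i: "i \<in> Isig" and r: "r > 0" shows "Yb {#} (Hh i r v0)"
proof -
 obtain c where "L.act (ah i r) v0 - sclM c v0 \<in> NN" using ah_top[OF i r] by blast
 hence "Yb {#} (sclM (qp (d i) - qp (- d i)) (Hh i r v0))"
  using Y_cong[OF _ Yb.scale[OF Yb.top]] by (simp add: ah_def L_act)
 hence "Yb {#} (sclM (1 / (qp (d i) - qp (- d i))) (sclM (qp (d i) - qp (- d i)) (Hh i r v0)))" by (rule Yb.scale)
 thus ?thesis using qp_diff_nz[of i] i by (simp add: Isig_rep)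
qed

lemma Y_H: assumes i: "i \<in> Isig" and r: "r > 0" shows "Yb W m ==> Yb W (Hh i r m)"
proof (induction rule: Yb.induct)
 case (lower W m j l)
 show ?case
  using rel_hx[OF i lower(2) Y_Mt[OF lower(1)] r, of Neg l]
  by (rule Y_cong) (intro Yb.add Yb.scale Yb.lower lower)
qed (use H_top[OF i r] in "auto simp: L_lin intro: Yb.intros act_NN")

lemma Y_Ph: assumes i: "i \<in> Isig" and m: "Yb W m" shows "Yb W (Ph i n m)"
 using Ph_stable[OF Y_subspace, of W i m n] i m Y_H Y_K Yb.null Y_Mt by blast

text \<open>A raising current is moved through the lowering ones. Each commutator consists of
  \<phi>'s and k's, which preserve the piece with that lowering current removed.\<close>

lemma Y_raise: assumes j: "j \<in> Isig"
 shows "Yb W m ==> (if j \<in># W then Yb (W - {#j#}) (Xp j r m) else Xp j r m \<in> NN)"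
proof (induction rule: Yb.induct)
 case (lower W m i l)
 note rel = rel_xx[OF lower(2) j Y_Mt[OF lower(1)], of r l]
 define D where "D = (if i = j then sclM (kap i i (int l)) (Ph i (r + l) m - (if r + l = 0 then Kk Neg i m else 0)) else 0)"
 have Y0: "Yb W 0" by (rule Yb.null[OF QN.N_0])
 have "Yb W (if r + l = 0 then Kk Neg i m else 0)" using Y_K[OF lower(2,1), of Neg] Y0 by (simp split: if_split)
 from Yb.scale[OF Y_diff[OF Y_Ph[OF lower(2,1)] this]] have D: "Yb W D"
  unfolding D_def by (cases "i = j") (simp_all only: if_True if_False Y0 simp_thms)
 have D0: "D = 0" if "i ~= j" using that by (simp add: D_def)
 have 1: "Xp j r (Xm i l m) - (Xm i l (Xp j r m) + D) \<in> NN" using rel by (simp add: D_def)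
 show ?case
 proof (cases "j \<in># W")
  case True
  hence "Yb (add_mset i (W - {#j#})) (Xm i l (Xp j r m))" using lower by (intro Yb.lower) auto
  moreover have "add_mset i (W - {#j#}) = add_mset i W - {#j#}" using True by simp
  ultimately have "Yb (add_mset i W - {#j#}) (Xm i l (Xp j r m))" by simp
  moreover have "Yb (add_mset i W - {#j#}) D"
   using D D0 by (cases "i = j") (auto intro: Yb.null QN.N_0)
  ultimately show ?thesis using Y_cong[OF 1] Yb.add True by auto
 next
  case False
  hence N: "Xm i l (Xp j r m) \<in> NN" using lower.IH by (auto intro: act_NN)
  show ?thesis
  proof (cases "i = j")
   case True
   thus ?thesis using Y_cong[OF 1] Yb.add[OF Yb.null[OF N] D] by simp
  next
   case ne: False
   have "Xm i l (Xp j r m) + D \<in> NN" using N D0[OF ne] by simp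
   hence "Xp j r (Xm i l m) \<in> NN" using QN.N_cong[OF 1] by simp
   thus ?thesis using ne False by simp
  qed
 qed
qed (use v0_x[OF j] in "auto simp: L_lin intro: Yb.intros act_NN QN.N_add QN.N_scale")

definition YA :: "'m set" where "YA = L.span (\<Union>W. Y W)"
definition YL :: "'m set" where "YL = L.span (\<Union>W\<in>{W. W ~= {#}}. Y W)"

lemma YA_subspace: "L.subspace YA" and YL_subspace: "L.subspace YL"
 unfolding YA_def YL_def by (rule L.subspace_span)+
lemma Y_YA: "Yb W m ==> m \<in> YA" unfolding YA_def by (rule L.span_base) auto
lemma Y_YL: "Yb W m ==> W ~= {#} ==> m \<in> YL" unfolding YL_def by (rule L.span_base) auto
lemma NN_YL: "m \<in> NN ==> m \<in> YL" using Y_YL[OF Yb.null, of m "{#0#}"] by simp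
lemma YL_YA: "YL \<subseteq> YA" unfolding YA_def YL_def by (rule L.span_mono) auto
lemma YA_Mt: "YA \<subseteq> Mt" unfolding YA_def by (rule L.span_minimal[OF _ sub_Mt]) (auto intro: Y_Mt)

lemma span_act:
 assumes "m \<in> L.span S" "!!m. m \<in> S ==> L.act a m \<in> W" "L.subspace W" shows "L.act a m \<in> W"
proof -
 have "L.subspace {m. L.act a m \<in> W}"
  using assms(3) by (intro L.subspaceI) (auto simp: L_lin L.subspace_0 L.subspace_add L.subspace_scale)
 hence "L.span S \<subseteq> {m. L.act a m \<in> W}" using assms(2) by (intro L.span_minimal) auto
 thus ?thesis using assms(1) by blast
qed

lemma YA_H: assumes i: "i \<in> Isig" and r: "r > 0" and m: "m \<in> YA" shows "Hh i r m \<in> YA"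
 by (rule span_act[OF m[unfolded YA_def] _ YA_subspace]) (auto intro: Y_YA Y_H i r)
lemma YL_H: assumes i: "i \<in> Isig" and r: "r > 0" and m: "m \<in> YL" shows "Hh i r m \<in> YL"
 by (rule span_act[OF m[unfolded YL_def] _ YL_subspace]) (auto intro: Y_YL Y_H i r)
lemma YA_K: assumes i: "i \<in> Isig" and m: "m \<in> YA" shows "Kk p i m \<in> YA"
 by (rule span_act[OF m[unfolded YA_def] _ YA_subspace]) (auto intro: Y_YA Y_K i)
lemma YL_K: assumes i: "i \<in> Isig" and m: "m \<in> YL" shows "Kk p i m \<in> YL"
 by (rule span_act[OF m[unfolded YL_def] _ YL_subspace]) (auto intro: Y_YL Y_K i)
lemma YA_Xm: assumes i: "i \<in> Isig" and m: "m \<in> YA" shows "Xm i l m \<in> YL"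
 by (rule span_act[OF m[unfolded YA_def] _ YL_subspace]) (auto intro!: Y_YL[OF Yb.lower[OF _ i]])

lemma YA_Xp: assumes "j \<in> Isig" "m \<in> YA" shows "Xp j r m \<in> YA"
proof -
 have "Xp j r m \<in> YA" if "Yb W m" for W m
  using Y_raise[OF assms(1) that, of r] Y_YA NN_YL YL_YA by (auto split: if_splits)
 thus ?thesis by (intro span_act[OF assms(2)[unfolded YA_def] _ YA_subspace]) auto
qed

primrec xpw :: "(nat \<times> nat) list => 'm => 'm" where
 "xpw [] m = m"
| "xpw (p # ps) m = xpw ps (Xp (fst p) (snd p) m)"

lemma xpw_lin: "xpw ps (m + m') = xpw ps m + xpw ps m'" "xpw ps (sclM c m) = sclM c (xpw ps m)"
 by (induction ps arbitrary: m m') (simp_all add: L_lin)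
lemma xpw_NN: "m \<in> NN ==> xpw ps m \<in> NN" by (induction ps arbitrary: m) (auto intro: act_NN)

text \<open>The quotient by this radical has the simple module as a submodule.\<close>

definition Rad :: "'m set" where
 "Rad = {m\<in>YA. \<forall>ps. fst ` set ps \<subseteq> Isig --> xpw ps m \<in> YL}"

lemma Rad_subspace: "L.subspace Rad"
 using YA_subspace YL_subspace
 by (intro L.subspaceI) (auto simp: Rad_def xpw_lin L.subspace_add L.subspace_scale L.subspace_0 intro!: NN_YL xpw_NN QN.N_0)

lemma NN_Rad: "NN \<subseteq> Rad" using NN_YL YL_YA xpw_NN by (auto simp: Rad_def)
lemma Rad_YA: "m \<in> Rad ==> m \<in> YA" by (simp add: Rad_def)
lemma Rad_YL: "m \<in> Rad ==> m \<in> YL" unfolding Rad_def using xpw.simps(1) by (metis (mono_tags, lifting) empty_set image_empty empty_subsetI mem_Collect_eq)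
lemma Rad_Mt: "m \<in> Rad ==> m \<in> Mt" using Rad_YA YA_Mt by blast
lemma Rad_Xp: "m \<in> Rad ==> j \<in> Isig ==> Xp j r m \<in> Rad"
proof -
 assume m: "m \<in> Rad" and j: "j \<in> Isig"
 have "xpw ps (Xp j r m) \<in> YL" if "fst ` set ps \<subseteq> Isig" for ps
 proof -
  have "xpw ((j, r) # ps) m \<in> YL" using m j that unfolding Rad_def by (auto simp del: xpw.simps)
  thus ?thesis by simp
 qed
 thus ?thesis using YA_Xp[OF j Rad_YA[OF m]] by (auto simp: Rad_def)
qed

lemma RadI: assumes "m \<in> YL" "!!j r. j \<in> Isig ==> Xp j r m \<in> Rad" shows "m \<in> Rad"
proof -
 have "xpw ps m \<in> YL" if ps: "fst ` set ps \<subseteq> Isig" for ps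
 proof (cases ps)
  case (Cons p ps')
  hence "Xp (fst p) (snd p) m \<in> Rad" using assms(2) ps by auto
  thus ?thesis using Cons ps unfolding Rad_def by auto
 qed (use assms(1) in simp)
 thus ?thesis using assms(1) YL_YA by (auto simp: Rad_def)
qed

text \<open>Induction on the length of the raising product: \<open>T\<close> passes each raising
  operator up to a vector that is again in the radical, and at the end only \<open>T\<close> mapping
  the radical into \<open>YL\<close> is left.\<close>

lemma Rad_op:
 assumes YA: "!!m. m \<in> Rad ==> T m \<in> YA" and YL: "!!m. m \<in> Rad ==> T m \<in> YL"
  and X: "!!m j r. m \<in> Rad ==> j \<in> Isig ==> \<exists>m'\<in>Rad. \<exists>m''\<in>Rad. Xp j r (T m) - (T m' + m'') \<in> NN"
  and m: "m \<in> Rad"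
 shows "T m \<in> Rad"
proof -
 have "xpw ps (T m) \<in> YL" if "fst ` set ps \<subseteq> Isig" "m \<in> Rad" for ps m
  using that
 proof (induction ps arbitrary: m)
  case (Cons p ps)
  obtain m' m'' where m': "m' \<in> Rad" "m'' \<in> Rad" "Xp (fst p) (snd p) (T m) - (T m' + m'') \<in> NN"
   using X[of m "fst p" "snd p"] Cons.prems by auto
  have "xpw ps (T m') \<in> YL" "xpw ps m'' \<in> YL" "xpw ps (Xp (fst p) (snd p) (T m) - (T m' + m'')) \<in> YL"
   using Cons m' by (auto simp: Rad_def intro: NN_YL xpw_NN)
  hence "xpw ps (T m') + xpw ps m'' + xpw ps (Xp (fst p) (snd p) (T m) - (T m' + m'')) \<in> YL"
   by (intro L.subspace_add[OF YL_subspace])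
  thus ?case by (simp add: xpw_lin[symmetric])
 qed (simp add: YL)
 thus ?thesis using YA m by (auto simp: Rad_def)
qed

lemma Rad_H: assumes i: "i \<in> Isig" and t: "t > 0" and m: "m \<in> Rad" shows "Hh i t m \<in> Rad"
proof (rule Rad_op[OF _ _ _ m])
 fix m j r assume m: "m \<in> Rad" and j: "j \<in> Isig"
 let ?c = "of_int (sg Pos) * hx i j (int t)"
 show "\<exists>m'\<in>Rad. \<exists>m''\<in>Rad. Xp j r (Hh i t m) - (Hh i t m' + m'') \<in> NN"
 proof (intro bexI)
  have "- (Hh i t (Xp j r m) - (Xp j r (Hh i t m) + sclM ?c (Xp j (t + r) m))) \<in> NN"
   by (intro QN.N_minus rel_hx i j t Rad_Mt m)
  thus "Xp j r (Hh i t m) - (Hh i t (Xp j r m) + sclM (- ?c) (Xp j (t + r) m)) \<in> NN" by (simp add: algebra_simps)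
  show "Xp j r m \<in> Rad" "sclM (- ?c) (Xp j (t + r) m) \<in> Rad"
   by (intro L.subspace_scale Rad_subspace Rad_Xp m j)+
 qed
qed (use YA_H YL_H i t Rad_YA Rad_YL in auto)

lemma Rad_K: assumes i: "i \<in> Isig" and m: "m \<in> Rad" shows "Kk p i m \<in> Rad"
proof (rule Rad_op[OF _ _ _ m])
 fix m j r assume m: "m \<in> Rad" and j: "j \<in> Isig"
 let ?c = "q powi (sg p * sg Pos * csum i j)"
 have c: "?c ~= 0" using q by simp
 show "\<exists>m'\<in>Rad. \<exists>m''\<in>Rad. Xp j r (Kk p i m) - (Kk p i m' + m'') \<in> NN"
 proof (intro bexI)
  have "sclM (- (1 / ?c)) (Kk p i (Xp j r m) - sclM ?c (Xp j r (Kk p i m))) \<in> NN"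
   by (intro QN.N_scale rel_kx i j Rad_Mt m)
  thus "Xp j r (Kk p i m) - (Kk p i (sclM (1 / ?c) (Xp j r m)) + 0) \<in> NN"
   using q(1) by (simp add: L_lin L.scale_right_diff_distrib algebra_simps)
  show "sclM (1 / ?c) (Xp j r m) \<in> Rad" "0 \<in> Rad"
   by (intro L.subspace_scale L.subspace_0 Rad_subspace Rad_Xp m j)+
 qed
qed (use YA_K YL_K i Rad_YA Rad_YL in auto)

lemma Rad_Ph: assumes i: "i \<in> Isig" and m: "m \<in> Rad" shows "Ph i n m \<in> Rad"
 by (rule Ph_stable[OF Rad_subspace NN_Rad _ i _ _ m]) (auto intro: Rad_H Rad_K i Rad_Mt)

lemma Rad_Xm: assumes i: "i \<in> Isig" and m: "m \<in> Rad" shows "Xm i l m \<in> Rad"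
proof (rule Rad_op[OF _ _ _ m])
 fix m j r assume m: "m \<in> Rad" and j: "j \<in> Isig"
 let ?D = "if i = j then sclM (kap i i (int l)) (Ph i (r + l) m - (if r + l = 0 then Kk Neg i m else 0)) else 0"
 show "\<exists>m'\<in>Rad. \<exists>m''\<in>Rad. Xp j r (Xm i l m) - (Xm i l m' + m'') \<in> NN"
 proof (intro bexI)
  show "Xp j r (Xm i l m) - (Xm i l (Xp j r m) + ?D) \<in> NN" by (intro rel_xx i j Rad_Mt m)
  show "Xp j r m \<in> Rad" by (intro Rad_Xp m j)
  have R0: "0 \<in> Rad" by (rule L.subspace_0[OF Rad_subspace])
  have "(if r + l = 0 then Kk Neg i m else 0) \<in> Rad" using Rad_K[OF i m, of Neg] R0 by (simp split: if_split)
  from L.subspace_scale[OF Rad_subspace L.subspace_diff[OF Rad_subspace Rad_Ph[OF i m] this]] show "?D \<in> Rad"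
   by (cases "i = j") (simp_all only: if_True if_False R0 simp_thms)
 qed
qed (use YA_Xm YL_YA i Rad_YA in auto)

sublocale QR: quotient_space sclM Rad by unfold_locales (rule Rad_subspace)

definition fd :: "nat multiset => bool" where
 "fd W \<longleftrightarrow> (\<exists>B. finite B \<and> B \<subseteq> Y W \<and> Y W \<subseteq> QR.nspan B)"

lemma fd_step:
 assumes W: "W ~= {#}" and fd: "!!i. i \<in># W ==> fd (W - {#i#})"
  and tor: "!!i m. i \<in># W ==> i \<in> Isig ==> Yb (W - {#i#}) m ==> QR.torsion (%l. Xm i l m)"
 shows "fd W"
proof -
 have "\<forall>i\<in>set_mset W. \<exists>B. finite B \<and> B \<subseteq> Y (W - {#i#}) \<and> Y (W - {#i#}) \<subseteq> QR.nspan B"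
  using fd unfolding fd_def by blast
 then obtain B where B: "!!i. i \<in># W ==> finite (B i)" "!!i. i \<in># W ==> B i \<subseteq> Y (W - {#i#})"
  "!!i. i \<in># W ==> Y (W - {#i#}) \<subseteq> QR.nspan (B i)" using bchoice by metis
 have "\<exists>n. \<forall>b\<in>B i. \<forall>l. Xm i l b \<in> QR.nspan ((%l. Xm i l b) ` {..<n})" if i: "i \<in># W" "i \<in> Isig" for i
 proof -
  obtain zs where zs: "\<forall>b\<in>B i. QR.kills zs (%l. Xm i l b)"
   using QR.kills_finite[OF B(1)[OF i(1)], of "%b l. Xm i l b"] tor[OF i] B(2)[OF i(1)] by blast
  hence "\<forall>b\<in>B i. \<forall>l. Xm i l b \<in> QR.nspan ((%l. Xm i l b) ` {..<length zs})"
   using QR.torsion_spanned by blast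
  thus ?thesis by blast
 qed
 then obtain n where n: "!!i b l. i \<in># W ==> i \<in> Isig ==> b \<in> B i ==> Xm i l b \<in> QR.nspan ((%l. Xm i l b) ` {..<n i})"
  by metis
 define C where "C = (\<Union>i\<in>set_mset W \<inter> Isig. \<Union>b\<in>B i. (%l. Xm i l b) ` {..<n i})"
 have "finite C" unfolding C_def using B(1) by (intro finite_UN_I finite_Int finite_imageI) auto
 moreover have "C \<subseteq> Y W"
 proof
  fix c assume "c \<in> C"
  then obtain i b l where c: "i \<in># W" "i \<in> Isig" "b \<in> B i" "c = Xm i l b" by (auto simp: C_def)
  hence "Yb (W - {#i#}) b" using B(2) by blast
  hence "Yb (add_mset i (W - {#i#})) c" unfolding c(4) by (rule Yb.lower[OF _ c(2)])
  thus "c \<in> Y W" using c(1) by simp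
 qed
 moreover have "m \<in> QR.nspan C" if "Yb W' m" "W' = W" for W' m
  using that
 proof (induction rule: Yb.induct)
  case (null m W')
  thus ?case using NN_Rad QR.N_nspan by blast
 next
  case top
  thus ?case using W by simp
 next
  case (lower W' m i l)
  hence i: "i \<in># W" and W': "W' = W - {#i#}" by auto
  have XC: "Xm i l b \<in> QR.nspan C" if b: "b \<in> B i" for b
   using n[OF i lower.hyps(2) b, of l] QR.nspan_mono[of "(%l. Xm i l b) ` {..<n i}" C] i lower.hyps(2) b by (auto simp: C_def)
  have mB: "m \<in> QR.nspan (B i)" using B(3)[OF i] lower.hyps(1) W' by auto
  show ?case
   by (rule QR.nspan_image[where G = "Xm i l" and B = "B i", OF L.act_add_right L.act_scl _ XC mB])
    (rule Rad_Xm[OF lower.hyps(2)])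
 next
  case (add W' m m')
  thus ?case using L.subspace_add[OF QR.subspace_nspan] by blast
 next
  case (scale W' m c)
  thus ?case using L.subspace_scale[OF QR.subspace_nspan] by blast
 qed
 ultimately show ?thesis unfolding fd_def by blast
qed

lemma act_opgs: "L.act (U.opgs ps C m l) v = QR.opgs ps (%m l. L.act (C m l) v) m l"
proof (induction ps arbitrary: m l)
 case (Cons p ps)
 obtain a b c where "p = (a, b, c)" by (cases p)
 thus ?case by (simp add: U.opg_def QR.opg_def L_act Cons.IH)
qed simp

text \<open>Two recurrences are fed into the exchange relation: that of the lowered vectors in the
  mode of the lowering current, and that of \<phi> on \<open>m\<close>.\<close>

lemma Ph_torsion_lower:
 assumes i: "i \<in> Isig" and j: "j \<in> Isig" and m: "Yb W m"
  and T1: "QR.torsion (%l. Xm j l m)" and T2: "QR.torsion (%t. Ph i t m)"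
 shows "QR.torsion (%t. Ph i t (Xm j l m))"
proof -
 obtain zs where zs: "QR.kills zs (%l. Xm j l m)" using T1 unfolding QR.torsion_def by blast
 obtain ts where ts: "QR.kills ts (%t. Ph i t m)" using T2 unfolding QR.torsion_def by blast
 show ?thesis
 proof (rule QR.torsion_exchange[where F = "%t l. Ph i t (Xm j l m)" and B = "%t l. Xm j l (Ph i t m)"])
  show "QR.kills zs (%l. Ph i t (Xm j l m))" for t
   using zs Rad_Ph[OF i] unfolding QR.kills_def by (subst QR.steps_linear) (auto simp: L_lin)
  show "QR.kills ts (%t. Xm j l (Ph i t m))" for l
   using ts Rad_Xm[OF j] unfolding QR.kills_def by (subst QR.steps_linear) (auto simp: L_lin)
  fix t l
  have n: "i \<in> nodes X" "j \<in> nodes X" using i j by (simp_all add: Isig_rep)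
  have "QR.opgs (map (%u. (1, - u, 0)) (map (eta i j (- 1)) [1..<Suc M])) (%t l. Ph i t (Xm j l m)) t l
   - sclM (q powi (- csum i j)) (QR.opgs (map (%H. (1, - H, 0)) (map (eta i j 1) [1..<Suc M])) (%t l. Xm j l (Ph i t m)) t l) \<in> NN"
   using act_eqU[OF ph_x_exchange[OF n, of t l] Y_Mt[OF m]]
   by (simp only: L_act act_opgs)
  thus "QR.opgs (map (%u. (1, - u, 0)) (map (eta i j (- 1)) [1..<Suc M])) (%t l. Ph i t (Xm j l m)) t l
   - sclM (q powi (- csum i j)) (QR.opgs (map (%H. (1, - H, 0)) (map (eta i j 1) [1..<Suc M])) (%t l. Xm j l (Ph i t m)) t l) \<in> Rad"
   using NN_Rad by blast
 qed
qed

text \<open>Membership in the radical is tested by raising operators (\<open>RadI\<close>), so one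
  recurrence must serve all modes r of these. Raising produces lowering currents on smaller pieces,
  where finite dimension gives a common annihilator, and multiples of \<phi> in mode r + l on
  \<open>m\<close>, where a recurrence is insensitive to the shift by r.\<close>

lemma Xm_torsion:
 assumes i: "i \<in> Isig" and m: "Yb W m" and fd: "!!j. j \<in># W ==> fd (W - {#j#})"
  and T1: "!!j m. j \<in># W ==> Yb (W - {#j#}) m ==> QR.torsion (%l. Xm i l m)"
  and T2: "QR.torsion (%t. Ph i t m)"
 shows "QR.torsion (%l. Xm i l m)"
proof -
 let ?X = "%m l. Xm i l m"
 have "\<exists>zs. \<forall>u\<in>Y (W - {#j#}). QR.kills zs (?X u)" if j: "j \<in># W" for j
 proof -
  obtain B where B: "finite B" "B \<subseteq> Y (W - {#j#})" "Y (W - {#j#}) \<subseteq> QR.nspan B"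
   using fd[OF j] unfolding fd_def by blast
  have "\<exists>zs. \<forall>u\<in>QR.nspan B. QR.kills zs (?X u)"
   using B(2) T1[OF j] by (intro QR.kills_nspan[OF B(1)]) (auto simp: L_lin intro: Rad_Xm i)
  thus ?thesis using B(3) by blast
 qed
 then obtain R where R: "!!j u. j \<in># W ==> Yb (W - {#j#}) u ==> QR.kills (R j) (?X u)" by (metis mem_Collect_eq)
 have "\<exists>R1. \<forall>j\<in>F. \<forall>u. Yb (W - {#j#}) u --> QR.kills R1 (?X u)" if "finite F" "F \<subseteq> set_mset W" for F
  using that
 proof (induction F rule: finite_induct)
  case (insert j F)
  then obtain R1 where "\<forall>j\<in>F. \<forall>u. Yb (W - {#j#}) u --> QR.kills R1 (?X u)" by auto
  hence "\<forall>j'\<in>insert j F. \<forall>u. Yb (W - {#j'#}) u --> QR.kills (R1 @ R j) (?X u)"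
   using R insert.prems QR.kills_append1 QR.kills_append2 by auto
  thus ?case by blast
 qed simp
 then obtain R1 where R1: "!!j u. j \<in># W ==> Yb (W - {#j#}) u ==> QR.kills R1 (?X u)"
  by (metis finite_set_mset order_refl)
 have X1: "QR.kills R1 (%l. Xm i l (Xp j r m))" if j: "j \<in> Isig" for j r
 proof (cases "j \<in># W")
  case True
  thus ?thesis using Y_raise[OF j m, of r] R1 by simp
 next
  case False
  hence "Xp j r m \<in> NN" using Y_raise[OF j m, of r] by simp
  thus ?thesis using NN_Rad act_NN by (intro QR.kills_N) blast
 qed
 obtain ts where ts: "QR.kills ts (%t. Ph i t m)" using T2 unfolding QR.torsion_def by blast
 define f where "f r l = Ph i (r + l) m - (if r + l = 0 then Kk Neg i m else 0)" for r l
 \<comment> \<open>The extra root 0 discards the term l = 0, the only place where the inverse of k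
   can occur.\<close>
 have f: "QR.kills (0 # ts) (f r)" for r
 proof -
  have d: "QR.step 0 (f r) = (%l. Ph i (Suc r + l) m)" by (rule ext) (simp add: QR.step_def f_def)
  have "QR.kills ts (%l. Ph i (Suc r + l) m)" by (rule QR.kills_shift[OF ts])
  thus ?thesis by (simp add: QR.kills_def QR.steps_step[symmetric] d)
 qed
 define Ts where "Ts = {t\<in>{1..M}. (\<sigma> ^^ t) i = i}"
 define D where "D = dorder i * (qp (d i) - qp (- d i))"
 \<comment> \<open>As a function of l, \<open>kap\<close> is a combination of geometric sequences,
   and these merely rescale the roots of a recurrence.\<close>
 have kap: "kap i i (int l) = (\<Sum>t\<in>Ts. (\<omega> ^ t) ^ l) / D" for l
 proof -
  have "(\<Sum>t=1..M. if (\<sigma> ^^ t) i = i then \<omega> powi (int t * int l) else 0) = (\<Sum>t\<in>Ts. \<omega> powi (int t * int l))"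
   unfolding Ts_def by (rule sum.inter_filter[symmetric]) simp
  also have "... = (\<Sum>t\<in>Ts. (\<omega> ^ t) ^ l)" by (simp only: power_int_mult power_int_of_nat)
  finally show ?thesis by (simp add: kap_def D_def)
 qed
 have "\<exists>R2. \<forall>t\<in>F. \<forall>r. QR.kills R2 (%l. sclM ((\<omega> ^ t) ^ l) (f r l))" if "finite F" for F
  using that
 proof (induction F rule: finite_induct)
  case (insert t F)
  then obtain R2 where "\<forall>t\<in>F. \<forall>r. QR.kills R2 (%l. sclM ((\<omega> ^ t) ^ l) (f r l))" by blast
  moreover have "\<forall>r. QR.kills (map ((*) (\<omega> ^ t)) (0 # ts)) (%l. sclM ((\<omega> ^ t) ^ l) (f r l))"
   using QR.kills_geometric[OF f] by blast
  ultimately have "\<forall>t'\<in>insert t F. \<forall>r. QR.kills (R2 @ map ((*) (\<omega> ^ t)) (0 # ts)) (%l. sclM ((\<omega> ^ t') ^ l) (f r l))"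
   using QR.kills_append1 QR.kills_append2 by blast
  thus ?case by blast
 qed simp
 from this[of Ts] obtain R2 where R2: "!!t r. t \<in> Ts ==> QR.kills R2 (%l. sclM ((\<omega> ^ t) ^ l) (f r l))"
  by (auto simp: Ts_def)
 have X2: "QR.kills R2 (%l. sclM (kap i i (int l)) (f r l))" for r
 proof -
  have "QR.kills R2 (%l. \<Sum>t\<in>F. sclM ((\<omega> ^ t) ^ l) (f r l))" if "F \<subseteq> Ts" for F
   using that by (induction F rule: infinite_finite_induct) (auto intro: QR.kills_add R2 QR.kills_N QR.N_0)
  from QR.kills_scale[OF this[of Ts], of "1 / D"] show ?thesis
   by (simp add: kap L.scale_sum_left[symmetric])
 qed
 have "QR.steps (R1 @ R2) (?X m) l \<in> Rad" for l
 proof (rule RadI)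
  have steps_Y: "Yb (add_mset i W) (QR.steps zs (?X m) l)" for zs l
   by (induction zs arbitrary: l) (auto simp: QR.step_def intro!: Y_diff Yb.scale Yb.lower m i)
  show "QR.steps (R1 @ R2) (?X m) l \<in> YL" by (rule Y_YL[OF steps_Y]) simp
  fix j r assume j: "j \<in> Isig"
  have e: "Xp j r (QR.steps (R1 @ R2) (?X m) l) = QR.steps (R1 @ R2) (%l. Xp j r (Xm i l m)) l"
   by (subst QR.steps_linear) (simp_all add: L_lin)
  have "QR.kills (R1 @ R2) (%l. Xm i l (Xp j r m) + (if i = j then sclM (kap i i (int l)) (f r l) else 0))"
  proof (rule QR.kills_add[OF QR.kills_append2[OF X1[OF j]]])
   show "QR.kills (R1 @ R2) (%l. if i = j then sclM (kap i i (int l)) (f r l) else 0)"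
    using QR.kills_append1[OF X2[of r], of R1] QR.kills_N[of "%_. 0"] QR.N_0 by (cases "i = j") simp_all
  qed
  hence "QR.kills (R1 @ R2) (%l. Xp j r (Xm i l m))"
  proof (rule QR.kills_cong[rotated])
   show "Xp j r (Xm i l m) - (Xm i l (Xp j r m) + (if i = j then sclM (kap i i (int l)) (f r l) else 0)) \<in> Rad" for l
    unfolding f_def using rel_xx[OF i j Y_Mt[OF m], of r l] NN_Rad by blast
  qed
  thus "Xp j r (QR.steps (R1 @ R2) (?X m) l) \<in> Rad" unfolding e by (simp add: QR.kills_def)
 qed
 thus ?thesis unfolding QR.torsion_def QR.kills_def by blast
qed

lemma Ph_top_torsion: assumes i: "i \<in> Isig" shows "QR.torsion (%t. Ph i t v0)"
proof -
 interpret C: quotient_space "(*) :: complex => complex => complex" "{0}"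
  by unfold_locales (auto simp: algebra_simps module.subspace_def[OF module.intro] module.subspace_def)
 obtain zs where zs: "\<forall>l. C.steps zs (\<gamma> i) l = 0" using \<gamma>_torsion[OF i] by blast
 have "QR.steps zs (%t. sclM (\<gamma> i t) v0) l = sclM (C.steps zs (\<gamma> i) l) v0" for l
  by (induction zs arbitrary: l) (simp_all add: QR.step_def C.step_def L.scale_left_diff_distrib)
 hence "QR.kills zs (%t. sclM (\<gamma> i t) v0)" using zs by (simp add: QR.kills_def QR.N_0)
 hence "QR.torsion (%t. sclM (\<gamma> i t) v0)" unfolding QR.torsion_def by blast
 thus ?thesis
 proof (rule QR.torsion_cong[rotated])
  show "Ph i t v0 - sclM (\<gamma> i t) v0 \<in> Rad" for t using v0_ph[OF i, of t] NN_Rad by blast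
 qed
qed

text \<open>The three statements depend on each other and are proved by one induction on the size:
  finite dimension from the recurrences of smaller pieces, then the recurrence of \<phi> by
  lowering, then that of the lowering currents from all of these.\<close>

theorem graded_pieces_fd: "fd W \<and> (\<forall>i\<in>Isig. \<forall>m. Yb W m --> QR.torsion (%t. Ph i t m) \<and> QR.torsion (%l. Xm i l m))"
proof (induction "size W" arbitrary: W rule: less_induct)
 case less
 have IH: "fd (W - {#j#})" "!!i m. i \<in> Isig ==> Yb (W - {#j#}) m ==> QR.torsion (%t. Ph i t m)"
  "!!i m. i \<in> Isig ==> Yb (W - {#j#}) m ==> QR.torsion (%l. Xm i l m)" if "j \<in># W" for j
  using less[of "W - {#j#}"] that by (auto simp: size_Diff1_less)
 have fd: "fd W"
 proof (cases "W = {#}")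
  case True
  have "m \<in> QR.nspan {v0}" if "Yb W' m" "W' = {#}" for W' m
   using that
  proof (induction rule: Yb.induct)
   case (null m W')
   thus ?case using NN_Rad QR.N_nspan by blast
  next
   case top
   show ?case by (intro QR.span_nspan L.span_base) simp
  next
   case (add W' m m')
   thus ?case using L.subspace_add[OF QR.subspace_nspan] by blast
  next
   case (scale W' m c)
   thus ?case using L.subspace_scale[OF QR.subspace_nspan] by blast
  qed simp
  thus ?thesis unfolding fd_def True by (intro exI[of _ "{v0}"]) (auto intro: Yb.top)
 next
  case False
  thus ?thesis by (rule fd_step) (use IH in auto)
 qed
 have T2: "QR.torsion (%t. Ph i t m)" if i: "i \<in> Isig" and m: "Yb W' m" "W' = W" for i m W'
  using m
 proof (induction rule: Yb.induct)
  case (null m W')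
  thus ?case using NN_Rad act_NN by (intro QR.torsion_N) blast
 next
  case top
  show ?case by (rule Ph_top_torsion[OF i])
 next
  case (lower W' m j l)
  hence j: "j \<in># W" "W' = W - {#j#}" by auto
  have m: "Yb (W - {#j#}) m" using lower.hyps(1) j(2) by simp
  show ?case by (rule Ph_torsion_lower[OF i lower.hyps(2,1) IH(3)[OF j(1) lower.hyps(2) m] IH(2)[OF j(1) i m]])
 next
  case (add W' m m')
  thus ?case using QR.torsion_add by (simp add: L_lin)
 next
  case (scale W' m c)
  thus ?case using QR.torsion_scale by (simp add: L_lin)
 qed
 have "QR.torsion (%l. Xm i l m)" if "i \<in> Isig" "Yb W m" for i m
  by (rule Xm_torsion[OF that IH(1) IH(3)[OF _ that(1)] T2[OF that(1,2) refl]])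
 thus ?case using fd T2 by blast
qed

end

section \<open>The Borel subalgebra inside the nonnegative modes\<close>

context drinfeld begin

lemma Dplus_sum_gens: "i \<in> Ihat ==> e Pos i \<in> Dplus"
 using e_Eps_Dplus Dplus_e by (auto elim: Ihat_cases)

lemma Dplus_1: "1 \<in> Dplus"
 unfolding Dplus_def generated_def using subalgebra_1 eqU_refl by blast

lemma Dplus_power: "a \<in> Dplus ==> a ^ n \<in> Dplus" by (induction n) (auto intro: Dplus_1 Dplus_mult)

lemma Kmon_Dplus: "Kmon U \<in> Dplus"
proof -
 have pl: "prod_list (map f L) \<in> Dplus" if "!!a. a \<in> set L ==> f a \<in> Dplus" for f and L :: "nat list"
  using that by (induction L) (auto intro: Dplus_1 Dplus_mult)
 show ?thesis unfolding Kmon_def kpow_def by (rule pl) (auto simp: finite_Isig intro: Dplus_power Dplus_k)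
qed

lemma SB_Dplus: "b \<in> SB ==> b \<in> Dplus"
proof (induction rule: subalgebra.induct)
 case (scalar c)
 show ?case unfolding Dplus_def generated_def using subalgebra.scalar eqU_refl by blast
next
 case (gen b)
 then consider i where "i \<in> Ihat" "b = e Pos i" | p i where "i \<in> Ihat" "b = k p i" by (auto simp: borel_gens_def)
 thus ?case
 proof cases
  case 2
  obtain W where "k p i \<approx> Kmon W" using k_Kmon[OF 2(1)] by blast
  thus ?thesis using Dplus_eqU[OF Kmon_Dplus] 2 by blast
 qed (use Dplus_sum_gens in simp)
next
 case (add a b)
 hence "a - sc (- 1) * b \<in> Dplus" by (intro Dplus_diff Dplus_sc)
 thus ?case by (simp add: sc_minus)
qed (rule Dplus_mult)

end

section \<open>Weights of the graded pieces\<close>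

context loop_module begin

lemma wtc_eq: "wtc i W = \<gamma> i 0 * q powi (- (\<Sum>j\<in>#W. csum i j))"
proof -
 have "(\<Prod>j\<in>#W. q powi (- csum i j)) = q powi (- (\<Sum>j\<in>#W. csum i j))"
  using q(1) by (induction W) (simp_all add: power_int_add[symmetric])
 thus ?thesis by (simp add: wtc_def)
qed

lemma q_powi_inj: "q powi a = q powi b \<longleftrightarrow> a = b"
proof -
 have "q powi a = s powi (2 * a)" for a using s by (simp add: power_int_mult power_int_def[of s 2])
 thus ?thesis by (simp add: cf.s_powi_cancel)
qed

lemma csum_mset: "set_mset W \<subseteq> Isig ==> (\<Sum>j\<in>#W. csum i j) = (\<Sum>j\<in>Isig. int (count W j) * csum i j)"
proof (induction W)
 case (add m W)
 have "(\<Sum>j\<in>Isig. int (count (add_mset m W) j) * csum i j) = (\<Sum>j\<in>Isig. int (count W j) * csum i j + (if j = m then csum i m else 0))"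
  by (rule sum.cong) (auto simp: distrib_right)
 also have "... = (\<Sum>j\<in>Isig. int (count W j) * csum i j) + csum i m"
  using add.prems finite_Isig by (simp add: sum.distrib sum.delta)
 finally show ?case using add by simp
qed simp

text \<open>The exponents of q must agree since q is not a root of unity, and nondegeneracy of the
  finite form then identifies the multisets.\<close>

lemma wtc_separates:
 assumes "set_mset W \<subseteq> Isig" "set_mset W' \<subseteq> Isig" "!!i. i \<in> Isig ==> wtc i W = wtc i W'"
 shows "W = W'"
proof (rule multiset_eqI)
 fix j
 define U where "U j = int (count W j) - int (count W' j)" for j
 show "count W j = count W' j"
 proof (cases "j \<in> Isig")
  case True
  have "pairing U (Nd i) = 0" if i: "i \<in> Isig" for i
  proof -
   have "pairing U (Nd i) = (\<Sum>j\<in>Isig. 2 * (U j * csum i j))"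
    unfolding pairing_def using i by (intro sum.cong) (auto simp: Bh_Nd csum_sym Isig_rep)
   also have "... = 2 * ((\<Sum>j\<in>#W. csum i j) - (\<Sum>j\<in>#W'. csum i j))"
    unfolding csum_mset[OF assms(1)] csum_mset[OF assms(2)] U_def
    by (simp add: sum_distrib_left[symmetric] left_diff_distrib sum_subtractf)
   also have "... = 0" using assms(3)[OF i] \<gamma>_nz[OF i] by (simp add: wtc_eq q_powi_inj)
   finally show ?thesis .
  qed
  hence "U j = 0" using pairing_nondegenerate True by blast
  thus ?thesis by (simp add: U_def)
 next
  case False
  thus ?thesis using assms(1,2) by (metis count_eq_zero_iff subsetD)
 qed
qed

lemma Y_Isig: "Yb W m ==> \<not> set_mset W \<subseteq> Isig ==> m \<in> NN"
 by (induction rule: Yb.induct) (auto intro: act_NN QN.N_add QN.N_scale)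

lemma Y_independent:
 assumes fin: "finite S" and S: "!!W. W \<in> S ==> set_mset W \<subseteq> Isig" and y: "!!W. W \<in> S ==> Yb W (y W)"
  and sum: "(\<Sum>W\<in>S. y W) \<in> NN" and W: "W \<in> S"
 shows "y W \<in> NN"
proof -
 have "\<forall>W\<in>S. y W \<in> NN"
 proof (rule L.eigen_independent[where T = "%i. Kk Pos i" and c = wtc and P = Isig])
  show "\<exists>p\<in>Isig. wtc p a ~= wtc p b" if "a \<in> S" "b \<in> S" "a ~= b" for a b
   using wtc_separates[of a b] S that by blast
 qed (use fin sum y in "auto simp: L_lin intro: QN.N_0 QN.N_add QN.N_scale act_NN K_weight")
 thus ?thesis using W by blast
qed

lemma span_Y_decomp:
 assumes "m \<in> L.span (\<Union>W\<in>C. Y W)"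
 obtains S y where "finite S" "S \<subseteq> C" "!!W. W \<in> S ==> set_mset W \<subseteq> Isig" "!!W. Yb W (y W)"
  "m - (\<Sum>W\<in>S. y W) \<in> NN"
proof -
 have "\<exists>S y. finite S \<and> S \<subseteq> C \<and> (\<forall>W\<in>S. set_mset W \<subseteq> Isig) \<and> (\<forall>W. Yb W (y W)) \<and> (\<forall>W. W \<notin> S --> y W = 0)
  \<and> m - (\<Sum>W\<in>S. y W) \<in> NN"
  using assms
 proof (induction rule: L.span_induct_alt)
  case base
  show ?case by (rule exI[of _ "{}"], rule exI[of _ "%_. 0"]) (auto intro: Yb.null QN.N_0)
 next
  case (step c w m)
  then obtain S y where S: "finite S" "S \<subseteq> C" "\<forall>W\<in>S. set_mset W \<subseteq> Isig" "\<forall>W. Yb W (y W)" "\<forall>W. W \<notin> S --> y W = 0"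
   "m - (\<Sum>W\<in>S. y W) \<in> NN" by blast
  obtain W where W: "W \<in> C" "Yb W w" using step by auto
  show ?case
  proof (cases "set_mset W \<subseteq> Isig")
   case True
   define y' where "y' = y(W := sclM c w + y W)"
   have "(\<Sum>b\<in>insert W S. y' b) = sclM c w + (\<Sum>b\<in>insert W S. y b)"
    using S(1) by (simp add: y'_def sum.insert_remove sum.remove algebra_simps)
   also have "(\<Sum>b\<in>insert W S. y b) = (\<Sum>b\<in>S. y b)" using S(1,5) by (intro sum.mono_neutral_right) auto
   finally have "sclM c w + m - (\<Sum>b\<in>insert W S. y' b) \<in> NN" using S(6) by simp
   moreover have "Yb b (y' b)" for b using S(4) W by (auto simp: y'_def intro: Yb.add Yb.scale)
   ultimately show ?thesis using S W True
    by (intro exI[of _ "insert W S"] exI[of _ y']) (auto simp: y'_def)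
  next
   case False
   hence "sclM c w \<in> NN" using Y_Isig W(2) QN.N_scale by blast
   from QN.N_add[OF this S(6)] have "sclM c w + m - (\<Sum>b\<in>S. y b) \<in> NN" by (simp add: add_diff_eq)
   thus ?thesis using S by blast
  qed
 qed
 then obtain S y where "finite S \<and> S \<subseteq> C \<and> (\<forall>W\<in>S. set_mset W \<subseteq> Isig) \<and> (\<forall>W. Yb W (y W)) \<and> (\<forall>W. W \<notin> S --> y W = 0)
  \<and> m - (\<Sum>W\<in>S. y W) \<in> NN" by (elim exE)
 thus thesis by (intro that[of S y]) simp_all
qed

text \<open>The radical lies in \<open>YL\<close>, whose pieces have nonempty multisets, hence
  weights different from that of \<open>v0\<close>; the weight decomposition would put
  \<open>v0\<close> into \<open>NN\<close>.\<close>

lemma v0_Rad: "v0 \<notin> Rad"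
proof
 assume "v0 \<in> Rad"
 hence "v0 \<in> L.span (\<Union>W\<in>{W. W ~= {#}}. Y W)" using Rad_YL by (simp add: YL_def)
 then obtain S y where S: "finite S" "S \<subseteq> {W. W ~= {#}}" "!!W. W \<in> S ==> set_mset W \<subseteq> Isig" "!!W. Yb W (y W)"
  "v0 - (\<Sum>W\<in>S. y W) \<in> NN" by (rule span_Y_decomp) blast
 define y' where "y' W = (if W = {#} then v0 else - y W)" for W
 have "(\<Sum>W\<in>S. y' W) = (\<Sum>W\<in>S. - y W)" using S(2) by (intro sum.cong) (auto simp: y'_def)
 hence "(\<Sum>W\<in>insert {#} S. y' W) = v0 - (\<Sum>W\<in>S. y W)"
  using S(1,2) by (subst sum.insert) (auto simp: y'_def sum_negf)
 hence sm: "(\<Sum>W\<in>insert {#} S. y' W) \<in> NN" using S(5) by simp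
 have yy: "Yb W (y' W)" for W using Yb.top Yb.scale[OF S(4), of W "- 1"] by (simp add: y'_def)
 have "y' {#} \<in> NN" by (rule Y_independent[OF _ _ yy sm]) (use S(1,3) in auto)
 thus False using v0 by (simp add: y'_def)
qed

text \<open>The weights of the pieces are distinct, so only one component of a weight vector
  survives modulo \<open>NN\<close>.\<close>

lemma weight_vector_graded:
 assumes m: "m \<in> YA" "m \<notin> NN" and K: "!!i. i \<in> Isig ==> Kk Pos i m - sclM (c i) m \<in> NN"
 obtains W y where "set_mset W \<subseteq> Isig" "!!i. i \<in> Isig ==> c i = wtc i W" "Yb W y" "m - y \<in> NN"
proof -
 obtain S y where S: "finite S" "!!W. W \<in> S ==> set_mset W \<subseteq> Isig" "!!W. Yb W (y W)"
  "m - (\<Sum>W\<in>S. y W) \<in> NN" using m(1) unfolding YA_def by (rule span_Y_decomp) blast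
 have comp: "sclM (wtc i W - c i) (y W) \<in> NN" if i: "i \<in> Isig" and W: "W \<in> S" for i W
 proof (rule Y_independent[OF S(1,2) _ _ W])
  show "Yb W (sclM (wtc i W - c i) (y W))" for W by (rule Yb.scale[OF S(3)])
  have "(\<Sum>W\<in>S. Kk Pos i (y W) - sclM (wtc i W) (y W)) \<in> NN" by (intro QN.N_sum K_weight i S)
  hence 1: "Kk Pos i (\<Sum>W\<in>S. y W) - (\<Sum>W\<in>S. sclM (wtc i W) (y W)) \<in> NN" by (simp add: L_lin sum_subtractf)
  have 2: "Kk Pos i m - Kk Pos i (\<Sum>W\<in>S. y W) \<in> NN" using act_NN[OF S(4), of "k Pos (Nd i)"] by (simp add: L.act_diff_right)
  have 3: "sclM (c i) m - sclM (c i) (\<Sum>W\<in>S. y W) \<in> NN" using QN.N_scale[OF S(4), of "c i"] by (simp add: L.scale_right_diff_distrib)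
  have "(Kk Pos i m - sclM (c i) m) - (Kk Pos i m - Kk Pos i (\<Sum>W\<in>S. y W)) + (sclM (c i) m - sclM (c i) (\<Sum>W\<in>S. y W))
    - (Kk Pos i (\<Sum>W\<in>S. y W) - (\<Sum>W\<in>S. sclM (wtc i W) (y W))) \<in> NN"
   by (intro QN.N_diff QN.N_add K i 1 2 3)
  thus "(\<Sum>W\<in>S. sclM (wtc i W - c i) (y W)) \<in> NN"
   by (simp add: L.scale_left_diff_distrib sum_subtractf L.scale_sum_right)
 qed
 have "\<exists>W\<in>S. y W \<notin> NN"
 proof (rule ccontr)
  assume "\<not> ?thesis"
  hence "(\<Sum>W\<in>S. y W) \<in> NN" by (intro QN.N_sum) auto
  thus False using S(4) m(2) QN.N_cong by blast
 qed
 then obtain W where W: "W \<in> S" "y W \<notin> NN" by blast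
 have c: "c i = wtc i W" if "W \<in> S" "y W \<notin> NN" "i \<in> Isig" for i W
 proof (rule ccontr)
  assume "c i ~= wtc i W"
  moreover have "sclM (1 / (wtc i W - c i)) (sclM (wtc i W - c i) (y W)) \<in> NN" by (intro QN.N_scale comp that)
  ultimately show False using that(2) by simp
 qed
 have others: "y W' \<in> NN" if "W' \<in> S - {W}" for W'
 proof (rule ccontr)
  assume "y W' \<notin> NN"
  hence "wtc i W' = wtc i W" if "i \<in> Isig" for i using c[of W' i] c[OF W, of i] \<open>W' \<in> S - {W}\<close> that by auto
  thus False using wtc_separates[of W' W] S(2) W(1) that by blast
 qed
 have "(\<Sum>W'\<in>S - {W}. y W') \<in> NN" by (intro QN.N_sum others)
 from QN.N_add[OF S(4) this] have "m - y W \<in> NN" using S(1) W(1) by (simp add: sum.remove[of S W])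
 thus thesis using that S(2,3) W c[OF W] by blast
qed

lemma Dplus_stable:
 assumes a: "a \<in> Dplus" and W: "L.subspace W" "NN \<subseteq> W" "W \<subseteq> Mt"
  and Xp: "!!i r m. i \<in> Isig ==> m \<in> W ==> Xp i r m \<in> W" and Xm: "!!i r m. i \<in> Isig ==> m \<in> W ==> Xm i r m \<in> W"
  and H: "!!i r m. i \<in> Isig ==> r > 0 ==> m \<in> W ==> Hh i r m \<in> W" and K: "!!p i m. i \<in> Isig ==> m \<in> W ==> Kk p i m \<in> W"
  and m: "m \<in> W"
 shows "L.act a m \<in> W"
proof -
 let ?S = "{x p i r | p i r. i \<in> Isig \<and> r \<ge> 0} \<union> {h i r | i r. i \<in> Isig \<and> r > 0} \<union> {k p (Nd i) | p i. i \<in> Isig}"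
 obtain b where b: "b \<in> subalgebra ?S" "a \<approx> b" using a unfolding Dplus_def generated_def by blast
 have "L.act b m \<in> W" if "m \<in> W" for m
  using b(1) that
 proof (induction arbitrary: m rule: subalgebra.induct)
  case (gen b)
  then consider p i r where "i \<in> Isig" "r \<ge> 0" "b = x p i r" | i r where "i \<in> Isig" "r > 0" "b = h i r"
   | p i where "i \<in> Isig" "b = k p (Nd i)" by blast
  thus ?case
  proof cases
   case 1
   thus ?thesis using Xp[OF 1(1) gen.prems, of "nat r"] Xm[OF 1(1) gen.prems, of "nat r"] by (cases p) simp_all
  next
   case 2
   thus ?thesis using H[OF 2(1) _ gen.prems, of "nat r"] by simp
  next
   case 3
   thus ?thesis using K gen.prems by simp
  qed
 qed (use W(1) in "auto simp: L_act intro: L.subspace_scale L.subspace_add")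
 hence "L.act b m \<in> W" using m by blast
 moreover have "L.act a m - L.act b m \<in> W" using act_eqU[OF b(2)] m W by blast
 ultimately show ?thesis using L.subspace_add[OF W(1), of "L.act a m - L.act b m" "L.act b m"] by simp
qed

lemma YA_Dplus: assumes "a \<in> Dplus" "m \<in> YA" shows "L.act a m \<in> YA"
proof (rule Dplus_stable[OF assms(1) YA_subspace _ YA_Mt _ _ _ _ assms(2)])
 show "NN \<subseteq> YA" using NN_YL YL_YA by auto
 show "Xm i r m \<in> YA" if "i \<in> Isig" "m \<in> YA" for i r m using YA_Xm[OF that] YL_YA by blast
qed (fact YA_Xp YA_H YA_K)+

lemma Rad_Dplus: assumes "a \<in> Dplus" "m \<in> Rad" shows "L.act a m \<in> Rad"
proof (rule Dplus_stable[OF assms(1) Rad_subspace NN_Rad _ _ _ _ _ assms(2)])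
 show "Rad \<subseteq> Mt" using Rad_Mt by blast
 show "Xp i r m \<in> Rad" if "i \<in> Isig" "m \<in> Rad" for i r m by (rule Rad_Xp[OF that(2,1)])
qed (fact Rad_Xm Rad_H Rad_K)+

end

text \<open>\<open>f\<close> is injective on \<open>U\<close> modulo \<open>N\<close>. For a basis
  \<open>E\<close> of \<open>U\<close>, representatives \<open>g u\<close> of the images are chosen
  in the span of \<open>B\<close>. A linear relation among them lifts to one in \<open>U\<close>, so
  they are independent and \<open>E\<close> has at most as many elements as
  \<open>B\<close>.\<close>

lemma (in quotient_space) embedded_finite_dim:
 fixes scl :: "complex => 'v => 'v::ab_group_add"
 assumes V: "vector_space scl" and U: "module.subspace scl U"
  and f: "!!a b. f (a + b) = f a + f b" "!!c a. f (scl c a) = scale c (f a)"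
  and inj: "!!u. u \<in> U ==> f u \<in> N ==> u = 0"
  and B: "finite B" "!!u. u \<in> U ==> f u \<in> nspan B"
 shows "\<exists>E. finite E \<and> U \<subseteq> module.span scl E"
proof -
 interpret V: vector_space scl by (rule V)
 obtain E where E: "E \<subseteq> U" "V.independent E" "U \<subseteq> V.span E" by (rule V.maximal_independent_subset[of U])
 have "\<forall>u\<in>U. \<exists>b\<in>span B. f u - b \<in> N" using B(2) by (auto simp: nspan_def)
 then obtain g where g: "!!u. u \<in> U ==> g u \<in> span B" "!!u. u \<in> U ==> f u - g u \<in> N" by metis
 have f0: "f 0 = 0" using f(2)[of 0 0] by simp
 have fs: "f (\<Sum>u\<in>F. scl (a u) u) = (\<Sum>u\<in>F. scale (a u) (f u))" for F a
  by (induction F rule: infinite_finite_induct) (auto simp: f f0)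
 have indep: "a u = 0" if F: "finite F" "F \<subseteq> E" and z: "(\<Sum>u\<in>F. scale (a u) (g u)) = 0" and u: "u \<in> F" for F a u
 proof -
  have FU: "w \<in> U" if "w \<in> F" for w using that F E by blast
  have "(\<Sum>u\<in>F. scale (a u) (f u - g u)) \<in> N" by (intro N_sum N_scale g FU)
  hence "f (\<Sum>u\<in>F. scl (a u) u) \<in> N" by (simp add: fs scale_right_diff_distrib sum_subtractf z)
  moreover have "(\<Sum>u\<in>F. scl (a u) u) \<in> U" using U FU by (intro V.subspace_sum V.subspace_scale)
  ultimately have "(\<Sum>u\<in>F. scl (a u) u) = 0" using inj by blast
  thus ?thesis using E(2) F u V.independentD by metis
 qed
 have "card F \<le> card B" if F: "finite F" "F \<subseteq> E" for F
 proof -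
  have inj_g: "inj_on g F"
  proof (rule inj_onI, rule ccontr)
   fix u w assume u: "u \<in> F" "w \<in> F" "g u = g w" "u ~= w"
   define a where "a v = (if v = u then 1 else if v = w then - 1 else 0 :: complex)" for v
   have "(\<Sum>v\<in>F. scale (a v) (g v)) = (\<Sum>v\<in>{u, w}. scale (a v) (g v))"
    using F u by (intro sum.mono_neutral_right) (auto simp: a_def)
   also have "... = 0" using u by (simp add: a_def)
   finally have "a u = 0" using indep[OF F _ u(1)] by blast
   thus False by (simp add: a_def)
  qed
  have "independent (g ` F)"
  proof (rule independent_if_scalars_zero)
   show "finite (g ` F)" using F by simp
   fix c w assume c: "(\<Sum>y\<in>g ` F. scale (c y) y) = 0" "w \<in> g ` F"
   hence "(\<Sum>u\<in>F. scale (c (g u)) (g u)) = 0" using inj_g by (simp add: sum.reindex)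
   thus "c w = 0" using indep[OF F, of "%u. c (g u)"] c(2) by auto
  qed
  moreover have "g ` F \<subseteq> span B" using g(1) F E by blast
  ultimately have "card (g ` F) \<le> card B" using independent_span_bound[OF B(1)] by blast
  thus ?thesis using card_image[OF inj_g] by simp
 qed
 hence "finite E" using finite_if_finite_subsets_card_bdd[of E "card B"] by blast
 thus ?thesis using E(3) by blast
qed

section \<open>The negative prefundamental representations\<close>

text \<open>For M = 3 the factors come from a primitive cube root of unity w, through 1 + w + w^2 =
  0.\<close>

lemma one_minus_power_factors:
 assumes "M \<in> {2, 3 :: nat}"
 shows "\<exists>cs. (1 - fps_X ^ M :: complex fps) = (\<Prod>c\<leftarrow>cs. 1 - fps_const c * fps_X)"
proof (cases "M = 2")
 case True
 have "fps_const (- 1) = (- 1 :: complex fps)" by (simp add: fps_const_neg[symmetric] del: fps_const_neg)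
 hence "(1 - fps_X ^ 2 :: complex fps) = (\<Prod>c\<leftarrow>[1, - 1]. 1 - fps_const c * fps_X)"
  by (simp add: algebra_simps power2_eq_square)
 thus ?thesis using True by blast
next
 case False
 hence M: "M = 3" using assms by simp
 define w where "w = cis (2 * pi / 3)"
 have "w ^ 3 = 1" using Complex.DeMoivre[of "2 * pi / 3" 3] by (simp add: w_def)
 moreover have "w ~= 1"
 proof
  assume "w = 1"
  hence "cos (2 * pi / 3) = 1" by (auto simp: w_def complex_eq_iff)
  thus False by (simp add: cos_120)
 qed
 moreover have "w ^ 3 - 1 = (w - 1) * (w * w + w + 1)" by algebra
 ultimately have "w * w + w + 1 = 0" by simp
 hence "fps_const (w * w + w + 1) = (0 :: complex fps)" by simp
 hence "fps_const w * fps_const w + fps_const w + 1 = (0 :: complex fps)"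
  by (simp only: fps_const_add[symmetric] fps_const_mult[symmetric] fps_const_1_eq_1)
 hence "(1 - fps_X) * ((1 - fps_const w * fps_X) * (1 - (fps_const w * fps_const w) * fps_X)) = (1 - fps_X ^ 3 :: complex fps)"
  by algebra
 hence "(1 - fps_X ^ 3 :: complex fps) = (\<Prod>c\<leftarrow>[1, w, w * w]. 1 - fps_const c * fps_X)"
  by (simp only: list.map prod_list.Cons prod_list.Nil fps_const_1_eq_1 mult_1_left mult_1_right fps_const_mult[symmetric])
 thus ?thesis using M by blast
qed

lemma complex_quotient_space: "quotient_space ((*) :: complex => complex => complex) {0}"
 by unfold_locales (auto simp: algebra_simps module.subspace_def[OF module.intro])

text \<open>Up to a shift of the index, multiplying \<open>f\<close> by 1 - c X applies S - c to its
  coefficients. After all factors the series 1 is left, whose coefficients are killed by the root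
  0.\<close>

lemma fps_product_torsion:
 assumes "f * (\<Prod>c\<leftarrow>cs. 1 - fps_const c * fps_X) = (1 :: complex fps)"
 shows "\<exists>zs. \<forall>l. quotient_space.steps (*) zs (fps_nth f) l = 0"
proof -
 interpret C: quotient_space "(*) :: complex => complex => complex" "{0}" by (rule complex_quotient_space)
 have "C.torsion (fps_nth f)" if "C.torsion (fps_nth g)" "f * (\<Prod>c\<leftarrow>cs. 1 - fps_const c * fps_X) = g" for f g
  using that(2)
 proof (induction cs arbitrary: f)
  case (Cons c cs)
  define f' where "f' = f * (1 - fps_const c * fps_X)"
  have tf: "C.torsion (fps_nth f')" using Cons by (simp add: f'_def mult.assoc)
  have st: "C.step c (fps_nth f) = (%l. fps_nth f' (1 + l))"
  proof
   fix l
   have "f' = f - fps_const c * (f * fps_X)" by (simp add: f'_def algebra_simps)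
   thus "C.step c (fps_nth f) l = fps_nth f' (1 + l)" by (simp add: C.step_def)
  qed
  show ?case by (rule C.torsion_step[of c], unfold st, rule C.torsion_shift[OF tf])
 qed (use that(1) in simp)
 moreover have "C.torsion (fps_nth 1)"
  unfolding C.torsion_def C.kills_def by (rule exI[of _ "[0]"]) (simp add: C.step_def)
 ultimately show ?thesis using assms by (simp add: C.torsion_def C.kills_def)
qed

locale prefundamental = twisted_datum X \<sigma> M q s
 for X \<sigma> M q s +
 fixes x h i0 and scl :: "complex => 'v => 'v::ab_group_add" and rho :: "ualg => 'v => 'v"
 assumes dgens: "drinfeld_generators x h" and i0: "i0 \<in> Isig" and isL: "is_L x h (neg_prefund i0) scl rho"
begin

lemma simple: "simple_module scl rho" using isL by (simp add: is_L_def)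
lemma bm: "borel_module scl rho" using simple by (simp add: simple_module_def)

sublocale VS: vector_space scl using bm by (simp add: borel_module_def)

lemma rho_linear: "a \<in> borel ==> rho a (v + w) = rho a v + rho a w" "a \<in> borel ==> rho a (scl c v) = scl c (rho a v)"
proof -
 have L: "Vector_Spaces.linear scl scl (rho a)" if "a \<in> borel" using bm that unfolding borel_module_def by blast
 show "a \<in> borel ==> rho a (v + w) = rho a v + rho a w"
  using L module_hom.add[of scl scl "rho a"] unfolding Vector_Spaces.linear_def by blast
 show "a \<in> borel ==> rho a (scl c v) = scl c (rho a v)"
  using L module_hom.scale[of scl scl "rho a"] unfolding Vector_Spaces.linear_def by blast
qed
lemma rho_sc: "rho (sc c) v = scl c v" using bm unfolding borel_module_def by blast
lemma rho_add: "a \<in> borel ==> b \<in> borel ==> rho (a + b) v = rho a v + rho b v" using bm unfolding borel_module_def by blast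
lemma rho_mult: "a \<in> borel ==> b \<in> borel ==> rho (a * b) v = rho a (rho b v)" using bm unfolding borel_module_def by blast
lemma rho_J: "a \<in> J ==> rho a v = 0" using bm unfolding borel_module_def by blast

lemma SB_borel: "b \<in> SB ==> b \<in> borel" unfolding borel_eq generated_def using eqU_refl by blast
lemma J_borel: "a \<in> J ==> a \<in> borel"
 unfolding borel_eq generated_def using subalgebra_0 by (auto simp: eqU_def intro!: bexI[of _ 0])
lemma borel_obtain: assumes "a \<in> borel" obtains b where "b \<in> SB" "(a :: ualg) \<approx> b"
 using assms unfolding borel_eq generated_def by blast
lemma rho_eqU: assumes "b \<in> borel" "(a :: ualg) \<approx> b" shows "rho a v = rho b v"
 using rho_add[OF assms(1) J_borel[of "a - b"], of v] rho_J[of "a - b" v] assms(2) by (simp add: eqU_def)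

lemma nontriv: "1 \<notin> J"
proof
 assume "1 \<in> J"
 hence "w = 0" for w :: 'v using rho_J[of 1 w] rho_sc[of 1 w] by simp
 thus False using simple by (auto simp: simple_module_def)
qed

sublocale drinfeld X \<sigma> M q s x h by unfold_locales (rule dgens, rule nontriv)

text \<open>The value 0 is a default for letters outside the Borel subalgebra, where
  \<open>rho\<close> is arbitrary.\<close>

definition opV :: "ugen => 'v => 'v" where "opV g v = (if gen g \<in> borel then rho (gen g) v else 0)"

sublocale V: lin_ops scl opV by unfold_locales (simp_all add: opV_def rho_linear)

lemma V_act: "b \<in> SB ==> V.act b v = rho b v"
proof (induction arbitrary: v rule: subalgebra.induct)
 case (gen b)
 then obtain g where g: "b = gen g" by (auto simp: borel_gens_def e_def k_def)
 have "b \<in> borel" using gen by (intro SB_borel subalgebra.gen)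
 hence "opV g v = rho b v" by (simp add: opV_def g)
 thus ?case by (simp add: g V.act_gen)
qed (simp_all add: V.act_sc V.act_add V.act_mult rho_sc rho_add rho_mult SB_borel)

text \<open>The relations hold exactly in the given module, so it is induced with \<open>V0\<close>
  equal to zero.\<close>

sublocale B: borel_rep X \<sigma> M q s scl opV "{0}"
proof
 fix r v assume r: "r \<in> borel_relators"
 have "r \<in> SB" using r unfolding borel_relators_def k_relators_def comm_def serre_def Let_def
  by (elim UnE CollectE exE conjE)
   (auto intro!: subalgebra_diff subalgebra.mult subalgebra_1 SB_k SB_e SB_central subalgebra_sum subalgebra.scalar subalgebra_power)
 moreover have "r \<in> J" using r borel_relators_subset unfolding J_def by (auto intro: two_sided_ideal_gen)
 ultimately show "V.act r v \<in> {0}" by (simp add: V_act rho_J)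
qed (auto simp: V.op_0)

text \<open>An element of the Borel subalgebra is a polynomial in the generators only modulo
  \<open>J\<close>, hence the congruence modulo \<open>NN\<close> in place of equality.\<close>

lemma act_delta: assumes "a \<in> borel" shows "B.M.act a (B.\<delta> w) - B.\<delta> (rho a w) \<in> B.NN"
proof -
 obtain b where b: "b \<in> SB" "a \<approx> b" by (rule borel_obtain[OF assms])
 have "B.M.act (a - b) (B.\<delta> w) \<in> B.NN" using b(2) by (intro B.J_act B.\<delta>_Mt) (simp add: eqU_def)
 thus ?thesis using rho_eqU[OF SB_borel[OF b(1)] b(2)] by (simp add: B.M.act_diff B.M_act_\<delta> b(1) V_act)
qed

definition vh :: 'v where
 "vh = (SOME v. {rho a v | a. a \<in> borel} = UNIV \<and> (\<forall>i\<in>nodes X. \<forall>r\<ge>0. rho (x Pos i r) v = 0)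
    \<and> (\<forall>i\<in>nodes X. \<forall>m. rho (phi h Pos i (int m)) v = scl (fps_nth (neg_prefund i0 i) m) v))"

lemma vh: "{rho a vh | a. a \<in> borel} = UNIV" "i \<in> nodes X ==> r \<ge> 0 ==> rho (x Pos i r) vh = 0"
 "i \<in> nodes X ==> rho (ph i m) vh = scl (fps_nth (neg_prefund i0 i) m) vh"
proof -
 have "\<exists>v. {rho a v | a. a \<in> borel} = UNIV \<and> (\<forall>i\<in>nodes X. \<forall>r\<ge>0. rho (x Pos i r) v = 0)
    \<and> (\<forall>i\<in>nodes X. \<forall>m. rho (phi h Pos i (int m)) v = scl (fps_nth (neg_prefund i0 i) m) v)"
  using isL unfolding is_L_def by (rule conjunct2)
 note w = someI_ex[OF this, folded vh_def]
 show "{rho a vh | a. a \<in> borel} = UNIV" by (rule w[THEN conjunct1])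
 show "i \<in> nodes X ==> r \<ge> 0 ==> rho (x Pos i r) vh = 0" using w[THEN conjunct2, THEN conjunct1] by simp
 show "i \<in> nodes X ==> rho (ph i m) vh = scl (fps_nth (neg_prefund i0 i) m) vh" using w[THEN conjunct2, THEN conjunct2] by simp
qed

lemma vh_obtain: obtains b where "b \<in> SB" "w = rho b vh"
proof -
 obtain a where a: "a \<in> borel" "w = rho a vh" using vh(1) by blast
 obtain b where b: "b \<in> SB" "a \<approx> b" by (rule borel_obtain[OF a(1)])
 show thesis using that[OF b(1)] rho_eqU[OF SB_borel[OF b(1)] b(2)] a(2) by simp
qed

lemma rho_0: "a \<in> borel ==> rho a 0 = 0" using rho_linear(2)[of a 0 0] by simp

lemma vh_nz: "vh ~= 0"
proof
 assume "vh = 0"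
 hence "w = 0" for w :: 'v using vh_obtain[of w] rho_0 SB_borel by metis
 thus False using simple by (auto simp: simple_module_def)
qed

lemma neg_prefund_torsion: "\<exists>zs. \<forall>l. quotient_space.steps (*) zs (fps_nth (neg_prefund i0 i)) l = 0"
proof -
 obtain cs where cs: "(1 - fps_X ^ M :: complex fps) = (\<Prod>c\<leftarrow>cs. 1 - fps_const c * fps_X)"
  using one_minus_power_factors[OF M] by blast
 have inv: "inverse f * f = 1" if "fps_nth f 0 ~= 0" for f :: "complex fps" using that by (rule inverse_mult_eq_1)
 have "\<exists>cs. neg_prefund i0 i * (\<Prod>c\<leftarrow>cs. 1 - fps_const c * fps_X) = 1"
 proof -
  consider "i \<notin> orbit i0" | "i \<in> orbit i0" "\<sigma> i0 = i0" | "i \<in> orbit i0" "\<sigma> i0 ~= i0" by blast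
  thus ?thesis
  proof cases
   case 1
   thus ?thesis by (intro exI[of _ "[]"]) (simp add: neg_prefund_def)
  next
   case 2
   have "fps_nth (1 - fps_X ^ M :: complex fps) 0 ~= 0" using M_pos by simp
   thus ?thesis using 2 inv cs by (intro exI[of _ cs]) (simp add: neg_prefund_def)
  next
   case 3
   thus ?thesis
    by (intro exI[of _ "[\<omega> ^ (LEAST t. (\<sigma> ^^ t) i0 = i)]"]) (simp add: neg_prefund_def inv)
  qed
 qed
 thus ?thesis using fps_product_torsion by blast
qed

sublocale Lm: loop_module X \<sigma> M q s x h B.sclM B.opM B.Mt B.NN "B.\<delta> vh" "%i. fps_nth (neg_prefund i0 i)"
proof
 show "B.M.subspace B.Mt" by (rule B.M.subspaceI) (auto simp: B.Mt_def intro: B.Fspan.zero B.Fspan.add B.Fspan_scl)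
 show sN: "B.M.subspace B.NN" by (rule B.M.subspaceI) (auto simp: B.NN_def intro: B.Fspan.zero B.Fspan.add B.Fspan_scl)
 show "B.NN \<subseteq> B.Mt"
 proof
  fix m assume "m \<in> B.NN"
  thus "m \<in> B.Mt" unfolding B.NN_def
  proof induction
   case (gen m c)
   hence "m \<in> B.Mt" using B.\<delta>_Mt B.Mt_act by auto
   thus ?case by (simp add: B.Mt_def B.Fspan_scl)
  qed (auto simp: B.Mt_def intro: B.Fspan.intros)
 qed
 show "B.\<delta> vh \<notin> B.NN"
 proof
  assume "B.\<delta> vh \<in> B.NN"
  hence "app (B.\<delta> vh) [] \<in> {0}" by (rule B.NN_low)
  thus False using vh_nz by (simp add: B.\<delta>_def)
 qed
 show "B.M.act (x Pos i (int r)) (B.\<delta> vh) \<in> B.NN" if "i \<in> Isig" for i r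
 proof -
  have "i \<in> nodes X" using that by (simp add: Isig_rep)
  moreover have "B.\<delta> 0 = 0" using B.\<delta>_scl[of 0 0] B.sclM_0 by simp
  ultimately show ?thesis using act_delta[OF in_borel(1)[of i "int r"], of vh] vh(2)[of i "int r"] by simp
 qed
 show "B.M.act (ph i m) (B.\<delta> vh) - B.sclM (fps_nth (neg_prefund i0 i) m) (B.\<delta> vh) \<in> B.NN" if "i \<in> Isig" for i m
 proof -
  have "i \<in> nodes X" using that by (simp add: Isig_rep)
  thus ?thesis using act_delta[OF in_borel(2)[of i "int m"], of vh] vh(3)[of i m] by (simp add: B.\<delta>_scl)
 qed
qed (use B.Mt_act B.NN_act B.J_act B.\<delta>_Mt neg_prefund_torsion in auto)

lemma delta_SB: "b \<in> SB ==> B.\<delta> (rho b w) = B.M.act b (B.\<delta> w)" by (simp add: B.M_act_\<delta> V_act)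


text \<open>Every vector is a Borel element applied to \<open>vh\<close>, and the Borel subalgebra
  lies in the nonnegative modes. Here the membership of the affine generator in \<open>Dplus\<close>
  pays off.\<close>

lemma delta_YA: "B.\<delta> w \<in> Lm.YA"
proof -
 obtain b where b: "b \<in> SB" "w = rho b vh" by (rule vh_obtain)
 have "B.\<delta> vh \<in> Lm.YA" by (rule Lm.Y_YA[OF Lm.Yb.top])
 thus ?thesis unfolding b(2) delta_SB[OF b(1)] by (rule Lm.YA_Dplus[OF SB_Dplus[OF b(1)]])
qed

text \<open>The vectors that fall into the radical form a Borel submodule without \<open>vh\<close>,
  so simplicity makes it zero.\<close>

lemma delta_Rad: assumes "B.\<delta> w \<in> Lm.Rad" shows "w = 0"
proof -
 define W where "W = {w. B.\<delta> w \<in> Lm.Rad}"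
 have "VS.subspace W"
 proof (rule VS.subspaceI)
  have "B.\<delta> 0 = 0" using B.\<delta>_scl[of 0 0] B.sclM_0 by simp
  thus "0 \<in> W" using Lm.QR.N_0 by (simp add: W_def)
 qed (auto simp: W_def B.\<delta>_add B.\<delta>_scl intro: Lm.QR.N_add Lm.QR.N_scale)
 moreover have "rho a w \<in> W" if aw: "a \<in> borel" "w \<in> W" for a w
 proof -
  obtain b where b: "b \<in> SB" "a \<approx> b" by (rule borel_obtain[OF aw(1)])
  have "B.\<delta> (rho b w) \<in> Lm.Rad" unfolding delta_SB[OF b(1)] using aw(2) by (intro Lm.Rad_Dplus SB_Dplus b) (simp add: W_def)
  thus ?thesis using rho_eqU[OF SB_borel[OF b(1)] b(2)] by (simp add: W_def)
 qed
 ultimately have "W = {0} \<or> W = UNIV" using simple unfolding simple_module_def by blast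
 moreover have "vh \<notin> W" using Lm.v0_Rad by (simp add: W_def)
 ultimately show ?thesis using assms by (auto simp: W_def)
qed

lemma k_SB: "i \<in> Isig ==> k p (Nd i) \<in> SB" by (rule SB_k) simp
lemma k_cartan: "i \<in> Isig ==> k p (Nd i) \<in> cartan_part"
 unfolding cartan_part_def generated_def using eqU_refl subalgebra.gen[of "k p (Nd i)" "{k p (Nd i) |p i. i \<in> Isig}"] by blast
lemma cartan_borel: "a \<in> cartan_part ==> a \<in> borel"
proof -
 assume "a \<in> cartan_part"
 then obtain b where b: "b \<in> subalgebra {k p (Nd i) |p i. i \<in> Isig}" "a \<approx> b" unfolding cartan_part_def generated_def by blast
 from b(1) have "b \<in> SB" by (induction rule: subalgebra.induct) (auto intro: subalgebra.intros k_SB)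
 thus ?thesis using b(2) unfolding borel_eq generated_def by blast
qed

lemma weight_graded:
 assumes w: "w \<in> weight_space scl rho n" "w ~= 0"
 obtains W y where "set_mset W \<subseteq> Isig" "!!i. i \<in> Isig ==> n (k Pos (Nd i)) = Lm.wtc i W" "Lm.Yb W y" "B.\<delta> w - y \<in> B.NN"
proof (rule Lm.weight_vector_graded[OF delta_YA])
 show "B.\<delta> w \<notin> B.NN" using delta_Rad w(2) Lm.NN_Rad by blast
 show "Lm.Kk Pos i (B.\<delta> w) - B.sclM (n (k Pos (Nd i))) (B.\<delta> w) \<in> B.NN" if "i \<in> Isig" for i
  using w(1) that k_cartan[OF that, of Pos]
  by (simp add: delta_SB[symmetric] k_SB weight_space_def B.\<delta>_scl Lm.QN.N_0)
qed (rule that)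

lemma weight_space_subspace: "VS.subspace (weight_space scl rho n)"
 by (rule VS.subspaceI) (auto simp: weight_space_def rho_linear rho_0 cartan_borel VS.scale_right_distrib mult.commute)

text \<open>All nonzero vectors of a given weight land, modulo \<open>NN\<close>, in the same graded
  piece. That piece is finite-dimensional modulo the radical, and \<delta> is injective modulo the
  radical.\<close>

lemma weight_space_fd: "\<exists>E. finite E \<and> weight_space scl rho n \<subseteq> VS.span E"
proof (cases "\<exists>w\<in>weight_space scl rho n. w ~= 0")
 case True
 then obtain w where w: "w \<in> weight_space scl rho n" "w ~= 0" by blast
 obtain W where W: "set_mset W \<subseteq> Isig" "!!i. i \<in> Isig ==> n (k Pos (Nd i)) = Lm.wtc i W"
  by (rule weight_graded[OF w], rule that)
 obtain C where C: "finite C" "Lm.Y W \<subseteq> Lm.QR.nspan C" using Lm.graded_pieces_fd[of W] unfolding Lm.fd_def by blast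
 note sub = Lm.QR.subspace_nspan[of C]
 show ?thesis
 proof (rule Lm.QR.embedded_finite_dim[OF VS.vector_space_axioms weight_space_subspace, where f = B.\<delta> and B = C])
  show "B.\<delta> u \<in> Lm.QR.nspan C" if u: "u \<in> weight_space scl rho n" for u
  proof (cases "u = 0")
   case True
   hence "B.\<delta> u = 0" using B.\<delta>_scl[of 0 0] B.sclM_0 by simp
   thus ?thesis using Lm.QR.N_nspan[OF Lm.QR.N_0] by simp
  next
   case False
   obtain W' y where W': "set_mset W' \<subseteq> Isig" "!!i. i \<in> Isig ==> n (k Pos (Nd i)) = Lm.wtc i W'" "Lm.Yb W' y"
    "B.\<delta> u - y \<in> B.NN" by (rule weight_graded[OF u False], rule that)
   have "W' = W" using W W' by (intro Lm.wtc_separates) auto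
   hence "y \<in> Lm.QR.nspan C" using W'(3) C(2) by blast
   moreover have "B.\<delta> u - y \<in> Lm.QR.nspan C" using W'(4) Lm.NN_Rad Lm.QR.N_nspan by blast
   ultimately show ?thesis using B.M.subspace_add[OF sub, of "B.\<delta> u - y" y] by simp
  qed
 qed (simp_all add: B.\<delta>_add B.\<delta>_scl delta_Rad C(1))
next
 case False
 thus ?thesis by (intro exI[of _ "{}"]) (auto simp: VS.span_empty)
qed

text \<open>Joint eigenvectors of the \<open>k\<close>'s with positive sign;
  \<open>kvec_cartan\<close> extends this to the whole Cartan part. Zero is included, which keeps
  the notion stable under the generators.\<close>

definition kvec :: "'v => bool" where
 "kvec w \<longleftrightarrow> (\<forall>i\<in>Isig. \<exists>c. rho (k Pos (Nd i)) w = scl c w)"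

lemma kvec_neg: assumes "kvec w" "i \<in> Isig" shows "\<exists>c. rho (k p (Nd i)) w = scl c w"
proof (cases p)
 case Neg
 obtain c where c: "rho (k Pos (Nd i)) w = scl c w" using assms by (auto simp: kvec_def)
 have b: "k p (Nd i) \<in> borel" for p using assms by (intro SB_borel k_SB)
 have "rho (k Neg (Nd i) * k Pos (Nd i)) w = rho (sc 1) w"
  using k_inv[of "Nd i" Neg] assms(2) by (intro rho_eqU SB_borel) (auto intro: subalgebra_1)
 hence "scl c (rho (k Neg (Nd i)) w) = w" by (simp only: rho_mult[OF b b] c rho_linear(2)[OF b] rho_sc VS.scale_one)
 hence "scl (1 / c) (scl c (rho (k Neg (Nd i)) w)) = scl (1 / c) w" by simp
 moreover have "c = 0 ==> w = 0" using \<open>scl c (rho (k Neg (Nd i)) w) = w\<close> by auto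
 ultimately show ?thesis using Neg rho_0[OF b] by (cases "c = 0") auto
qed (use assms in "auto simp: kvec_def")

lemma kvec_cartan: assumes w: "kvec w" and a: "a \<in> cartan_part" shows "\<exists>c. rho a w = scl c w"
proof -
 let ?S = "{k p (Nd i) |p i. i \<in> Isig}"
 obtain b where b: "b \<in> subalgebra ?S" "a \<approx> b" using a unfolding cartan_part_def generated_def by blast
 have bb: "b \<in> borel" if "b \<in> subalgebra ?S" for b
  using that eqU_refl by (intro cartan_borel) (auto simp: cartan_part_def generated_def)
 from b(1) have "\<exists>c. rho b w = scl c w"
 proof (induction rule: subalgebra.induct)
  case (scalar c)
  show ?case by (auto simp: rho_sc)
 next
  case (gen b)
  thus ?case using kvec_neg[OF w] by blast
 next
  case (add a b)
  thus ?case by (auto simp: rho_add bb VS.scale_left_distrib[symmetric])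
 next
  case (mult a b)
  thus ?case by (auto simp: rho_mult bb rho_linear)
 qed
 thus ?thesis using rho_eqU[OF bb[OF b(1)] b(2)] by simp
qed

text \<open>The weight of an eigenvector; it is determined only when the vector is nonzero.\<close>

definition chi :: "'v => ualg => complex" where "chi w a = (SOME c. rho a w = scl c w)"

lemma chi: "kvec w ==> a \<in> cartan_part ==> rho a w = scl (chi w a) w"
 using someI_ex[OF kvec_cartan] unfolding chi_def by blast

lemma chi_eq: assumes "w ~= 0" "rho a w = scl c w" shows "chi w a = c"
proof -
 have "rho a w = scl (chi w a) w" unfolding chi_def using assms(2) by (rule someI)
 thus ?thesis using assms by (metis VS.scale_right_imp_eq)
qed

lemma chi_tstar: assumes w: "kvec w" "w ~= 0" shows "chi w \<in> tstar"
proof -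
 have "chi w (a + b) = chi w a + chi w b \<and> chi w (a * b) = chi w a * chi w b"
  if ab: "a \<in> cartan_part" "b \<in> cartan_part" for a b
 proof
  have bo: "a \<in> borel" "b \<in> borel" using ab cartan_borel by auto
  show "chi w (a + b) = chi w a + chi w b"
   by (rule chi_eq[OF w(2)]) (simp add: rho_add bo chi[OF w(1)] ab VS.scale_left_distrib)
  show "chi w (a * b) = chi w a * chi w b"
   by (rule chi_eq[OF w(2)]) (simp add: rho_mult rho_linear bo chi[OF w(1)] ab mult.commute)
 qed
 moreover have "chi w (sc c) = c" for c by (rule chi_eq[OF w(2)]) (rule rho_sc)
 moreover have "chi w a = 0" if "a \<in> J" for a by (rule chi_eq[OF w(2)]) (simp add: rho_J that)
 ultimately show ?thesis by (simp add: tstar_def)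
qed

lemma kvec_weight: assumes "kvec w" shows "w \<in> VS.span (\<Union>n\<in>tstar. weight_space scl rho n)"
proof (cases "w = 0")
 case False
 have "w \<in> weight_space scl rho (chi w)" using chi[OF assms] by (simp add: weight_space_def)
 thus ?thesis using chi_tstar[OF assms False] by (intro VS.span_base) blast
qed (simp add: VS.span_zero)

lemma kvec_vh: "kvec vh" "i \<in> Isig ==> rho (k Pos (Nd i)) vh = scl (fps_nth (neg_prefund i0 i) 0) vh"
proof -
 show *: "rho (k Pos (Nd i)) vh = scl (fps_nth (neg_prefund i0 i) 0) vh" if "i \<in> Isig" for i
  using vh(3)[of i 0] ph_0[of i] that by (simp add: Isig_rep kI_def)
 show "kvec vh" using * by (auto simp: kvec_def)
qed

lemma kvec_SB_gen: assumes w: "kvec w" and b: "b \<in> borel_gens" shows "kvec (rho b w)"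
 unfolding kvec_def
proof
 fix i assume i: "i \<in> Isig"
 have I: "Nd i \<in> Ihat" using i by simp
 obtain c where c: "rho (k Pos (Nd i)) w = scl c w" using w i by (auto simp: kvec_def)
 have bo: "b \<in> borel" "k Pos (Nd i) \<in> borel" using b i by (auto intro: SB_borel k_SB subalgebra.gen)
 have "\<exists>u. k Pos (Nd i) * b \<approx> sc u * (b * k Pos (Nd i))"
 proof -
  consider j where "j \<in> Ihat" "b = e Pos j" | p j where "j \<in> Ihat" "b = k p j" using b by (auto simp: borel_gens_def)
  thus ?thesis
  proof cases
   case 1
   thus ?thesis using beq_eqU[OF k_e[OF I, of Pos Pos j]] by blast
  next
   case 2
   thus ?thesis using k_com[OF I 2(1), of Pos p] by (intro exI[of _ 1]) simp
  qed
 qed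
 then obtain u where u: "k Pos (Nd i) * b \<approx> sc u * (b * k Pos (Nd i))" by blast
 have S: "sc u \<in> borel" "b * k Pos (Nd i) \<in> borel" "sc u * (b * k Pos (Nd i)) \<in> borel"
  by (rule SB_borel, intro subalgebra.scalar subalgebra.mult k_SB i subalgebra.gen[OF b])+
 have "rho (k Pos (Nd i)) (rho b w) = rho (sc u * (b * k Pos (Nd i))) w"
  using rho_eqU[OF S(3) u, of w] by (simp only: rho_mult[OF bo(2,1)])
 also have "... = scl (u * c) (rho b w)"
  by (simp only: rho_mult[OF S(1,2)] rho_mult[OF bo] rho_sc c rho_linear(2)[OF bo(1)] VS.scale_scale)
 finally show "\<exists>c. rho (k Pos (Nd i)) (rho b w) = scl c (rho b w)" by blast
qed

text \<open>The generators of the Borel subalgebra send eigenvectors to eigenvectors, and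
  \<open>vh\<close> is one.\<close>

lemma span_kvec: "w \<in> VS.span (Collect kvec)"
proof -
 let ?T = "VS.span (Collect kvec)"
 have "rho b w \<in> ?T" if "b \<in> SB" "w \<in> ?T" for b w
  using that
 proof (induction arbitrary: w rule: subalgebra.induct)
  case (scalar c)
  thus ?case by (simp add: rho_sc VS.span_scale)
 next
  case (gen b)
  have bo: "b \<in> borel" using gen(1) by (intro SB_borel subalgebra.gen)
  have "VS.subspace {w. rho b w \<in> ?T}"
   by (rule VS.subspaceI) (auto simp: rho_linear[OF bo] rho_0[OF bo] intro: VS.span_zero VS.span_add VS.span_scale)
  hence "?T \<subseteq> {w. rho b w \<in> ?T}" using kvec_SB_gen[OF _ gen(1)] by (intro VS.span_minimal) (auto intro: VS.span_base)
  thus ?case using gen(2) by blast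
 next
  case (add a b)
  thus ?case by (simp add: rho_add SB_borel VS.span_add)
 next
  case (mult a b)
  thus ?case by (simp add: rho_mult SB_borel)
 qed
 moreover have "vh \<in> ?T" using kvec_vh(1) by (intro VS.span_base) simp
 ultimately show ?thesis using vh_obtain[of w] by metis
qed

text \<open>The multiset \<open>W\<close> of the graded piece supplies the coefficients of the
  simple roots, so the single cone below the weight of \<open>vh\<close> contains all
  weights.\<close>

lemma weight_below:
 assumes n: "n \<in> tstar" and w: "w \<in> weight_space scl rho n" "w ~= 0" shows "n \<in> Dcone (chi vh)"
proof -
 obtain W where W: "set_mset W \<subseteq> Isig" "!!i. i \<in> Isig ==> n (k Pos (Nd i)) = Lm.wtc i W"
  by (rule weight_graded[OF w], rule that)
 have "chi vh (k Pos (Nd j)) = n (k Pos (Nd j)) * (\<Prod>i\<in>Isig. qp (d i * of_int (Csig (Nd i) (Nd j))) ^ count W i)"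
  if j: "j \<in> Isig" for j
 proof -
  define g where "g = fps_nth (neg_prefund i0 j) 0"
  have 1: "chi vh (k Pos (Nd j)) = g" unfolding g_def by (rule chi_eq[OF vh_nz kvec_vh(2)[OF j]])
  have qq: "qp (d i * of_int (Csig (Nd i) (Nd j))) = q powi csum j i" if "i \<in> Isig" for i
  proof -
   have "d i * of_int (Csig (Nd i) (Nd j)) = of_int (csum j i)" using that j d_Csig[of i j] csum_sym[of i j] by (simp add: Isig_rep)
   hence "qp (d i * of_int (Csig (Nd i) (Nd j))) = s powi (2 * csum j i)" by (intro qp_int) simp
   thus ?thesis using s by (simp add: power_int_mult power_int_def[of s 2])
  qed
  have "(\<Prod>i\<in>Isig. qp (d i * of_int (Csig (Nd i) (Nd j))) ^ count W i) = (\<Prod>i\<in>Isig. (q powi csum j i) ^ count W i)"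
   by (intro prod.cong) (simp_all add: qq del: Csig.simps)
  also have "... = q powi (\<Sum>i\<in>Isig. int (count W i) * csum j i)"
  proof -
   have "(\<Prod>i\<in>F. (q powi csum j i) ^ count W i) = q powi (\<Sum>i\<in>F. int (count W i) * csum j i)" for F
    using q(1) by (induction F rule: infinite_finite_induct) (simp_all add: power_int_add power_int_power' mult.commute)
   thus ?thesis .
  qed
  also have "... = q powi (\<Sum>i\<in>#W. csum j i)" by (simp add: Lm.csum_mset[OF W(1)])
  finally have 2: "(\<Prod>i\<in>Isig. qp (d i * of_int (Csig (Nd i) (Nd j))) ^ count W i) = q powi (\<Sum>i\<in>#W. csum j i)" .
  have 3: "n (k Pos (Nd j)) = g * q powi (- (\<Sum>i\<in>#W. csum j i))" unfolding W(2)[OF j] Lm.wtc_eq g_def ..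
  show ?thesis unfolding 1 2 3 using q(1) by (simp add: power_int_minus)
 qed
 hence "wle n (chi vh)" unfolding wle_def by blast
 thus ?thesis using n by (simp add: Dcone_def)
qed

theorem category_O: "in_category_O scl rho"
 unfolding in_category_O_def
proof (intro conjI)
 show "borel_module scl rho" by (rule bm)
 have "Collect kvec \<subseteq> VS.span (\<Union>n\<in>tstar. weight_space scl rho n)" using kvec_weight by blast
 hence "VS.span (Collect kvec) \<subseteq> VS.span (\<Union>n\<in>tstar. weight_space scl rho n)"
  by (rule VS.span_minimal[OF _ VS.subspace_span])
 thus "VS.span (\<Union>n\<in>tstar. weight_space scl rho n) = UNIV" using span_kvec by blast
 show "\<forall>n\<in>tstar. \<exists>E. finite E \<and> weight_space scl rho n \<subseteq> VS.span E" using weight_space_fd by blast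
 show "\<exists>S\<subseteq>tstar. finite S \<and> (\<forall>n\<in>tstar. weight_space scl rho n ~= {0} --> (\<exists>\<mu>\<in>S. n \<in> Dcone \<mu>))"
 proof (intro exI[of _ "{chi vh}"] conjI ballI impI)
  show "{chi vh} \<subseteq> tstar" using chi_tstar[OF kvec_vh(1) vh_nz] by simp
  fix n assume n: "n \<in> tstar" "weight_space scl rho n ~= {0}"
  then obtain w where "w \<in> weight_space scl rho n" "w ~= 0"
   using VS.subspace_0[OF weight_space_subspace, of n] by blast
  thus "\<exists>\<mu>\<in>{chi vh}. n \<in> Dcone \<mu>" using weight_below[OF n(1)] by blast
 qed simp
qed

end

theorem lemma4p13:
  fixes X :: dynkin and \<sigma> :: "nat \<Rightarrow> nat" and M :: nat and q s :: complex
    and x :: "sign \<Rightarrow> nat \<Rightarrow> int \<Rightarrow> ualg" and h :: "nat \<Rightarrow> int \<Rightarrow> ualg"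
    and i :: nat
    and scl :: "complex \<Rightarrow> 'v \<Rightarrow> 'v::ab_group_add" and act :: "ualg \<Rightarrow> 'v \<Rightarrow> 'v"
  assumes "twisted_datum X \<sigma> M q s"
    and "twisted_datum.drinfeld_generators X \<sigma> M q s x h"
    and "i \<in> twisted_datum.Isig X \<sigma> M"
    and "twisted_datum.is_L X \<sigma> M s x h (twisted_datum.neg_prefund \<sigma> M i) scl act"
  shows "twisted_datum.in_category_O X \<sigma> M s scl act"
proof -
  interpret twisted_datum X \<sigma> M q s by (rule assms(1))
  interpret prefundamental X \<sigma> M q s x h i scl act
    by unfold_locales (use assms in auto)
  show ?thesis by (rule category_O)
qed

end
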